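(* Let $d\ge 1$, let $f$ satisfy Assumption (F0) with exponents $0<\alpha_1\le\alpha_2<\alpha_{\max}$, and assume $$\frac{\alpha_2}{2+\alpha_2}\le \alpha_1 .$$ Let $r_2=2+\alpha_2$ and let $r_0$ be any number satisfying $$\max\Big(1,\tfrac{d\alpha_1}{2}\Big)<r_0<2+\alpha_1,\qquad \frac12\le \frac{\alpha_1}{r_0}+\frac1{r_2},\qquad 1<\frac{\alpha_1+1}{r_0}+\frac1{r_2}.$$ Let $(\phi_j,\omega_j)_{j\in\mathbb N}$ be a sequence of bound states satisfying Assumption (T1) with this $r_0$. Then there exist constants $c_1>0$ and $v_\sharp\gg1$ such that for every infinite soliton train profile $R_\infty=\sum_{j\ge1}R_j$, $R_j=R_{\phi_j,\omega_j,0,v_j,\gamma_j}$, with arbitrary parameters $v_j\in\mathbb R^d$, $\gamma_j\in\mathbb R$ (and $x_j^0=0$) satisfying $$v_*:=\inf_{j,k\in\mathbb N,\ j\neq k}\sqrt{\omega_j}\,|v_k-v_j|\ \ge v_\sharp,$$ there exists a solution $u$ of (NLS) on $[0,\infty)$ such that $$\|(u-R_\infty)(t)\|_{L^{r_2}}+\|u-R_\infty\|_{S([t,\infty))}\le e^{-c_1v_*t}\qquad\forall t\ge0 .$$ Moreover $u$ is unique in the class of solutions satisfying this estimate.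
   Context: (NLS) is $i\partial_tu+\Delta u+f(u)=0$, $u:\mathbb R\times\mathbb R^d\to\mathbb C$. Let $\alpha_{\max}=+\infty$ if $d=1,2$ and $\alpha_{\max}=4/(d-2)$ if $d\ge3$. Assumption (F0): $f(u)=g(|u|^2)u$ with $g\in C^0([0,\infty),\mathbb R)\cap C^2((0,\infty),\mathbb R)$, $g(0)=0$, and $|sg'(s)|+|s^2g''(s)|\le C_0(s^{\alpha_1/2}+s^{\alpha_2/2})$ for all $s>0$, where $0<\alpha_1\le\alpha_2<\alpha_{\max}$, $C_0>0$. A bound state is a nontrivial $\phi\in H^1(\mathbb R^d)$ solving $\Delta\phi+f(\phi)=\omega\phi$ for some frequency $\omega>0$. For a bound state $(\phi,\omega)$ and parameters $x^0,v\in\mathbb R^d$, $\gamma\in\mathbb R$, the soliton is $R_{\phi,\omega,x^0,v,\gamma}(t,x)=e^{i(\omega t+\frac12 v\cdot x-\frac14|v|^2t+\gamma)}\phi(x-x^0-vt)$. Assumption (T1) (for given $\alpha_1$ and $r_0$): there are $0<a<1$ and $D_a>0$ independent of $j$ such that $|\phi_j(x)|+\omega_j^{-1/2}|\nabla\phi_j(x)|\le D_a\omega_j^{1/\alpha_1}e^{-a\omega_j^{1/2}|x|}$ for all $x\in\mathbb R^d$, $j\in\mathbb N$, and $r_0\ge1$, $\frac{d\alpha_1}{2}<r_0<2+\alpha_1$, with $A_1:=\sum_{j\in\mathbb N}\omega_j^{\frac1{\alpha_1}-\frac d{2r_0}}<\infty$. (Pairs $(\phi_j,\omega_j)=(0,0)$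 for $j$ large are allowed.) A pair $(q,r)$ is admissible if $\frac2q+\frac dr=\frac d2$, $2\le q,r\le\infty$, $(d,q,r)\ne(2,2,\infty)$. The Strichartz norm is $\|u\|_{S([t,\infty))}=\sup\{\|u\|_{L^q_tL^r_x([t,\infty)\times\mathbb R^d)}:(q,r)\text{ admissible},\ r\le r_{\rm Str}\}$, where $r_{\rm Str}=\infty$ if $d\ne2$ and $r_{\rm Str}$ is a fixed number in $(\alpha_2+2,\infty)$ if $d=2$. A solution $u$ with profile $W$ is understood as $u=W+\eta$ where $\eta(t)=-i\int_t^\infty e^{i(t-s)\Delta}[f(W+\eta)-f(W)+H](s)\,ds$ with $H=f(W)-\sum_j f(R_j)$. *)

theory Defs
  imports "HOL-Analysis.Analysis" "HOL-Probability.Essential_Supremum"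
begin

definition nonlin :: "(real \<Rightarrow> real) \<Rightarrow> complex \<Rightarrow> complex" where
  "nonlin g z = complex_of_real (g ((cmod z)\<^sup>2)) * z"

definition alpha_max_ok :: "nat \<Rightarrow> real \<Rightarrow> bool" where
  "alpha_max_ok d \<alpha> \<longleftrightarrow> (d \<ge> 3 \<longrightarrow> \<alpha> < 4 / (real d - 2))"

definition F0 :: "nat \<Rightarrow> (real \<Rightarrow> real) \<Rightarrow> real \<Rightarrow> real \<Rightarrow> real \<Rightarrow> bool" where
  "F0 d g \<alpha>1 \<alpha>2 C0 \<longleftrightarrow>
     0 < \<alpha>1 \<and> \<alpha>1 \<le> \<alpha>2 \<and> alpha_max_ok d \<alpha>2 \<and> C0 > 0 \<and>
     continuous_on {0..} g \<and> g 0 = 0 \<and>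
     (\<forall>s>0. g differentiable (at s) \<and> deriv g differentiable (at s)) \<and>
     continuous_on {0<..} (deriv (deriv g)) \<and>
     (\<forall>s>0. \<bar>s * deriv g s\<bar> + \<bar>s\<^sup>2 * deriv (deriv g) s\<bar>
              \<le> C0 * (s powr (\<alpha>1/2) + s powr (\<alpha>2/2)))"

definition pd :: "'n::finite \<Rightarrow> (real^'n \<Rightarrow> 'b::real_normed_vector) \<Rightarrow> real^'n \<Rightarrow> 'b" where
  "pd i f x = frechet_derivative f (at x) (axis i 1)"

fun pds :: "'n::finite list \<Rightarrow> (real^'n \<Rightarrow> 'b::real_normed_vector) \<Rightarrow> real^'n \<Rightarrow> 'b" where
  "pds [] f = f"
| "pds (i # is) f = pd i (pds is f)"

definition smooth_fun :: "(real^'n::finite \<Rightarrow> real) \<Rightarrow> bool" where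
  "smooth_fun \<psi> \<longleftrightarrow> (\<forall>is x. pds is \<psi> differentiable (at x))"

definition test_fun :: "(real^'n::finite \<Rightarrow> real) \<Rightarrow> bool" where
  "test_fun \<psi> \<longleftrightarrow> smooth_fun \<psi> \<and> bounded {x. \<psi> x \<noteq> 0}"

definition laplacian :: "(real^'n::finite \<Rightarrow> real) \<Rightarrow> real^'n \<Rightarrow> real" where
  "laplacian \<psi> x = (\<Sum>i\<in>UNIV. pd i (pd i \<psi>) x)"

definition L2 :: "(real^'n::finite \<Rightarrow> complex) \<Rightarrow> bool" where
  "L2 h \<longleftrightarrow> h \<in> borel_measurable lborel \<and> integrable lborel (\<lambda>x. (cmod (h x))\<^sup>2)"

definition H1 :: "(real^'n::finite \<Rightarrow> complex) \<Rightarrow> bool" where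
  "H1 \<phi> \<longleftrightarrow> L2 \<phi> \<and> (\<forall>i. \<exists>G. L2 G \<and> (\<forall>\<psi>. test_fun \<psi> \<longrightarrow>
      integrable lborel (\<lambda>x. \<phi> x * of_real (pd i \<psi> x)) \<and>
      integrable lborel (\<lambda>x. G x * of_real (\<psi> x)) \<and>
      (\<integral>x. \<phi> x * of_real (pd i \<psi> x) \<partial>lborel) = - (\<integral>x. G x * of_real (\<psi> x) \<partial>lborel)))"

definition bound_state :: "(real \<Rightarrow> real) \<Rightarrow> (real^'n::finite \<Rightarrow> complex) \<Rightarrow> real \<Rightarrow> bool" where
  "bound_state g \<phi> \<omega> \<longleftrightarrow> \<omega> > 0 \<and> H1 \<phi> \<and> \<not> (AE x in lborel. \<phi> x = 0) \<and>
     (\<forall>\<psi>. test_fun \<psi> \<longrightarrow>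
        integrable lborel (\<lambda>x. \<phi> x * of_real (laplacian \<psi> x)) \<and>
        integrable lborel (\<lambda>x. nonlin g (\<phi> x) * of_real (\<psi> x)) \<and>
        integrable lborel (\<lambda>x. \<phi> x * of_real (\<psi> x)) \<and>
        (\<integral>x. \<phi> x * of_real (laplacian \<psi> x) \<partial>lborel) + (\<integral>x. nonlin g (\<phi> x) * of_real (\<psi> x) \<partial>lborel)
          = of_real \<omega> * (\<integral>x. \<phi> x * of_real (\<psi> x) \<partial>lborel))"

definition grad_norm :: "(real^'n::finite \<Rightarrow> complex) \<Rightarrow> real^'n \<Rightarrow> real" where
  "grad_norm \<phi> x = sqrt (\<Sum>i\<in>UNIV. (cmod (pd i \<phi> x))\<^sup>2)"

text \<open>Assumption (T1) for given \<alpha>1, r0 (pairs (0,0) allowed).\<close>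
definition T1 :: "real \<Rightarrow> real \<Rightarrow> (nat \<Rightarrow> real^'n::finite \<Rightarrow> complex) \<Rightarrow> (nat \<Rightarrow> real) \<Rightarrow> bool" where
  "T1 \<alpha>1 r0 \<phi> \<omega> \<longleftrightarrow>
     (\<exists>a Da. 0 < a \<and> a < 1 \<and> Da > 0 \<and>
        (\<forall>j x. \<phi> j differentiable (at x) \<and>
           cmod (\<phi> j x) + \<omega> j powr (-1/2) * grad_norm (\<phi> j) x
             \<le> Da * \<omega> j powr (1/\<alpha>1) * exp (- a * sqrt (\<omega> j) * norm x))) \<and>
     r0 \<ge> 1 \<and> real CARD('n) * \<alpha>1 / 2 < r0 \<and> r0 < 2 + \<alpha>1 \<and>
     summable (\<lambda>j. \<omega> j powr (1/\<alpha>1 - real CARD('n) / (2 * r0)))"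

definition soliton :: "(real^'n::finite \<Rightarrow> complex) \<Rightarrow> real \<Rightarrow> real^'n \<Rightarrow> real^'n \<Rightarrow> real \<Rightarrow> real \<Rightarrow> real^'n \<Rightarrow> complex" where
  "soliton \<phi> \<omega> x0 v \<gamma> t x =
     exp (\<i> * of_real (\<omega> * t + (1/2) * (v \<bullet> x) - (1/4) * (norm v)\<^sup>2 * t + \<gamma>)) * \<phi> (x - x0 - t *\<^sub>R v)"

section \<open>Lebesgue and Strichartz norms (exponents given by reciprocals; 0 means \<infinity>)\<close>

definition enn_powr :: "ennreal \<Rightarrow> real \<Rightarrow> ennreal" where
  "enn_powr z p = (if z = top then top else ennreal (enn2real z powr p))"

definition Lnorm :: "'a measure \<Rightarrow> real \<Rightarrow> ('a \<Rightarrow> ennreal) \<Rightarrow> ennreal" where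
  "Lnorm M p F = (if p = 0 then esssup M F
                  else enn_powr (\<integral>\<^sup>+ x. enn_powr (F x) (1/p) \<partial>M) p)"

definition Lx :: "real \<Rightarrow> (real^'n::finite \<Rightarrow> complex) \<Rightarrow> ennreal" where
  "Lx p h = Lnorm lborel p (\<lambda>x. ennreal (cmod (h x)))"

definition Ltx :: "real \<Rightarrow> real \<Rightarrow> real \<Rightarrow> (real \<Rightarrow> real^'n::finite \<Rightarrow> complex) \<Rightarrow> ennreal" where
  "Ltx a b t0 u = Lnorm (restrict_space lborel {t0..}) a (\<lambda>s. Lx b (u s))"

text \<open>Admissible pair (q,r) in reciprocal form a = 1/q, b = 1/r.\<close>
definition admissible :: "nat \<Rightarrow> real \<Rightarrow> real \<Rightarrow> bool" where
  "admissible d a b \<longleftrightarrow> 0 \<le> a \<and> a \<le> 1/2 \<and> 0 \<le> b \<and> b \<le> 1/2 \<and>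
      2 * a + real d * b = real d / 2 \<and> \<not> (d = 2 \<and> a = 1/2 \<and> b = 0)"

text \<open>Strichartz norm on [t0,\<infinity>); bStr = 1/r_Str (bStr = 0 when d \<noteq> 2).\<close>
definition strichartz :: "real \<Rightarrow> real \<Rightarrow> (real \<Rightarrow> real^'n::finite \<Rightarrow> complex) \<Rightarrow> ennreal" where
  "strichartz bStr t0 u = (SUP ab \<in> {(a, b). admissible CARD('n) a b \<and> bStr \<le> b}. Ltx (fst ab) (snd ab) t0 u)"

text \<open>e^{i\<tau>\<Delta>}\<psi> via the explicit kernel (4\<pi>i\<tau>)^{-d/2} e^{i|x-y|^2/(4\<tau>)} (principal branch).\<close>
definition schr :: "real \<Rightarrow> (real^'n::finite \<Rightarrow> real) \<Rightarrow> real^'n \<Rightarrow> complex" where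
  "schr \<tau> \<psi> x = (if \<tau> = 0 then of_real (\<psi> x) else
     inverse (csqrt (Complex 0 (4 * pi * \<tau>)) ^ CARD('n)) *
       (\<integral>y. exp (\<i> * of_real ((norm (x - y))\<^sup>2 / (4 * \<tau>))) * of_real (\<psi> y) \<partial>lborel))"

definition train :: "(nat \<Rightarrow> real \<Rightarrow> real^'n::finite \<Rightarrow> complex) \<Rightarrow> real \<Rightarrow> real^'n \<Rightarrow> complex" where
  "train R t x = (\<Sum>j. R j t x)"

definition forcing :: "(real \<Rightarrow> real) \<Rightarrow> (nat \<Rightarrow> real \<Rightarrow> real^'n::finite \<Rightarrow> complex) \<Rightarrow> (real \<Rightarrow> real^'n \<Rightarrow> complex) \<Rightarrow> real \<Rightarrow> real^'n \<Rightarrow> complex" where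
  "forcing g R \<eta> s x =
     nonlin g (train R s x + \<eta> s x) - nonlin g (train R s x)
     + (nonlin g (train R s x) - (\<Sum>j. nonlin g (R j s x)))"

text \<open>u is a solution of (NLS) on [0,\<infinity>) with profile W = \<Sum> R_j: \<eta> = u - W satisfies
  \<eta>(t) = -i \<integral>_t^\<infinity> e^{i(t-s)\<Delta>} F(s) ds, tested against test functions \<psi>
  (using the adjoint e^{-i(t-s)\<Delta>} = e^{i(s-t)\<Delta>} on \<psi>; the s-integral as improper integral).\<close>
definition nls_solution :: "(real \<Rightarrow> real) \<Rightarrow> (nat \<Rightarrow> real \<Rightarrow> real^'n::finite \<Rightarrow> complex) \<Rightarrow> (real \<Rightarrow> real^'n \<Rightarrow> complex) \<Rightarrow> bool" where
  "nls_solution g R u \<longleftrightarrow>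
    (let \<eta> = (\<lambda>t x. u t x - train R t x); F = forcing g R \<eta> in
     (\<lambda>(t, x). u t x) \<in> borel_measurable (lborel \<Otimes>\<^sub>M lborel) \<and>
     (\<forall>t\<ge>0. \<forall>\<psi>. test_fun \<psi> \<longrightarrow>
        integrable lborel (\<lambda>x. \<eta> t x * of_real (\<psi> x)) \<and>
        (AE s in lborel. s \<ge> t \<longrightarrow> integrable lborel (\<lambda>x. F s x * cnj (schr (s - t) \<psi> x))) \<and>
        (\<forall>T\<ge>t. set_integrable lborel {t..T} (\<lambda>s. \<integral>x. F s x * cnj (schr (s - t) \<psi> x) \<partial>lborel)) \<and>
        ((\<lambda>T. - \<i> * (\<integral>s\<in>{t..T}. (\<integral>x. F s x * cnj (schr (s - t) \<psi> x) \<partial>lborel) \<partial>lborel))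
            \<longlongrightarrow> (\<integral>x. \<eta> t x * of_real (\<psi> x) \<partial>lborel)) at_top))"

text \<open>v_* = inf over j \<noteq> k (genuine solitons) of sqrt(\<omega>_j)|v_k - v_j|.\<close>
definition vstar :: "(nat \<Rightarrow> real) \<Rightarrow> (nat \<Rightarrow> real^'n::finite) \<Rightarrow> ereal" where
  "vstar \<omega> v = (INF jk \<in> {(j, k). j \<noteq> k \<and> \<omega> j \<noteq> 0 \<and> \<omega> k \<noteq> 0}.
                 ereal (sqrt (\<omega> (fst jk)) * norm (v (snd jk) - v (fst jk))))"

definition decay :: "real \<Rightarrow> ereal \<Rightarrow> real \<Rightarrow> ennreal" where
  "decay c vs t = (if vs = \<infinity> then (if t = 0 then 1 else 0)
                   else ennreal (exp (- c * real_of_ereal vs * t)))"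

definition train_estimate :: "real \<Rightarrow> real \<Rightarrow> real \<Rightarrow> ereal \<Rightarrow> (nat \<Rightarrow> real \<Rightarrow> real^'n::finite \<Rightarrow> complex) \<Rightarrow> (real \<Rightarrow> real^'n \<Rightarrow> complex) \<Rightarrow> bool" where
  "train_estimate bStr r2 c1 vs R u \<longleftrightarrow>
     (\<forall>t\<ge>0. Lx (1 / r2) (\<lambda>x. u t x - train R t x)
             + strichartz bStr t (\<lambda>s x. u s x - train R s x) \<le> decay c1 vs t)"

end

theory Submission
 imports Defs "HOL-Probability.Characteristic_Functions" "HOL-Computational_Algebra.Polynomial"
begin

text \<open>The free propagator enters only through the modulus of its kernel and through a Gaussian
regularisation of the composition \<open>U(t) U(s)*\<close>, whose kernel obeys the dispersive bound uniformly. This gives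
the \<open>L2\<close> bound, by Marcinkiewicz interpolation the decay from \<open>L(r')\<close> to \<open>L(r)\<close>, and by a \<open>T T*\<close> argument an
energy estimate. For a forcing of size \<open>exp (- \<mu> s)\<close> in \<open>L(r2')\<close> the Duhamel integral is split into dyadic time
lags and dyadic levels of the forcing; every piece satisfies a subcritical local Strichartz estimate and a supremum
bound, and interpolating the two with slack makes the pieces summable up to the Strichartz endpoint, with a gain
\<open>\<mu> powr (- \<sigma>)\<close>. At each \<open>(t, x)\<close> at most one of the exponential envelopes of the solitons exceeds
\<open>exp (- a v* t / 2)\<close>, so that the interaction term decays like \<open>exp (- a v* t / 4)\<close> in \<open>L(r2')\<close>; the
summability of \<open>A1\<close> controls the sum of the envelopes in \<open>L(r0)\<close> and in the supremum norm. For
\<open>\<mu> = a v* / 4\<close> large the Duhamel map is a contraction in the norm of \<open>L2\<close> and \<open>L(r2)\<close> weighted by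
\<open>exp (\<mu> t)\<close>. If \<open>v* = \<infinity>\<close> the interaction vanishes and the profile itself is the solution.\<close>

section \<open>Lebesgue norms\<close>

text \<open>\<open>U ta f\<close> is an absolutely convergent integral only for integrable
  \<open>f\<close>, so for a forcing that is merely in \<open>L(r2')\<close> neither the group law
  nor the Duhamel integral over all later times can be written down directly. Hence the detour: cut
  lags and levels, estimate uniformly, define the Duhamel term as an L2 limit, and identify this
  limit by duality, the form in which \<open>nls_solution\<close> states the equation. The fixed
  point is sought in \<open>NL\<close> alone; its Strichartz bound is read off the equation
  afterwards. Conversely, a competing solution is controlled in L2 only at almost every time, and
  uniqueness has to repair this first. The conditions on the exponents have one purpose each:
  \<open>1/2 \<le> \<alpha>1/r0 + 1/r2\<close> makes the power \<open>\<alpha>1\<close> of the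
  envelope sum a multiplier from L2 to \<open>L(r2')\<close>,
  \<open>1 < (\<alpha>1 + 1)/r0 + 1/r2\<close> puts the interaction itself in \<open>L(r2')\<close>,
  \<open>\<alpha>2/(2 + \<alpha>2) \<le> \<alpha>1\<close> places the powers of the error between L2
  and \<open>L(r2)\<close>, and \<open>\<alpha>2 < 4/(d - 2)\<close> makes the singularity of the
  dispersive decay integrable in time.\<close>

abbreviation bm :: "('a::topological_space \<Rightarrow> 'b::topological_space) set" where
  "bm \<equiv> borel_measurable borel"

abbreviation jm :: "('a::topological_space \<Rightarrow> 'b::topological_space \<Rightarrow> 'c::topological_space) \<Rightarrow> bool" where
  "jm F \<equiv> (\<lambda>(s, y). F s y) \<in> borel_measurable (borel \<Otimes>\<^sub>M borel)"

abbreviation nn_integral_lborel :: "('a::euclidean_space \<Rightarrow> ennreal) \<Rightarrow> ennreal" (binder "NN " 10) where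
  "nn_integral_lborel f \<equiv> nn_integral lborel f"

abbreviation gauss :: "real \<Rightarrow> 'a::real_normed_vector \<Rightarrow> real" where
 "gauss ep x \<equiv> exp (- ep * (norm x)\<^sup>2)"

abbreviation L1 :: "('a::euclidean_space \<Rightarrow> complex) \<Rightarrow> ennreal" where
 "L1 f \<equiv> NN x. ennreal (cmod (f x))"

type_synonym 'n wave = "(real, 'n) vec \<Rightarrow> complex"
type_synonym 'n evol = "real \<Rightarrow> (real, 'n) vec \<Rightarrow> complex"

lemma enn_powr_top [simp]: "enn_powr top p = top" by (simp add: enn_powr_def)

lemma enn_powr_ennreal: "0 \<le> x \<Longrightarrow> enn_powr (ennreal x) p = ennreal (x powr p)"
 by (simp add: enn_powr_def)

lemma enn_powr_0 [simp]: "enn_powr 0 p = 0" using enn_powr_ennreal[of 0 p] by simp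

lemma enn_powr_one [simp]: "enn_powr x 1 = x" by (cases x) (auto simp: enn_powr_ennreal)

lemma enn_powr_of_1 [simp]: "enn_powr 1 p = 1" using enn_powr_ennreal[of 1 p] by simp

lemma enn_powr_enn_powr: "enn_powr (enn_powr x p) q = enn_powr x (p * q)"
 by (cases x) (auto simp: enn_powr_ennreal powr_powr)

lemma enn_powr_add: "enn_powr x p * enn_powr x q = enn_powr x (p + q)"
 by (cases x) (auto simp: enn_powr_ennreal powr_add ennreal_mult)

lemma enn_powr_eq_0_iff [simp]: "enn_powr x p = 0 \<longleftrightarrow> x = 0"
 by (cases x) (auto simp: enn_powr_ennreal)

lemma enn_powr_eq_top_iff [simp]: "enn_powr x p = top \<longleftrightarrow> x = top"
 by (cases x) (auto simp: enn_powr_ennreal)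

lemma enn_powr_mult: "enn_powr (x * y) p = enn_powr x p * enn_powr y p"
proof (cases x)
 case (real a)
 note 1 = this
 show ?thesis
 proof (cases y)
  case (real b)
  with 1 show ?thesis by (simp add: enn_powr_ennreal powr_mult flip: ennreal_mult)
 next
  case top
  with 1 show ?thesis by (cases "a = 0") (auto simp: ennreal_mult_top enn_powr_ennreal)
 qed
next
 case top
 then show ?thesis by (cases "y = 0") (auto simp: ennreal_top_mult)
qed

lemma enn_powr_mono: "x \<le> y \<Longrightarrow> 0 \<le> p \<Longrightarrow> enn_powr x p \<le> enn_powr y p"
 by (cases x; cases y) (auto simp: enn_powr_ennreal powr_mono2 top_unique)

lemma enn_powr_le_iff: "0 < p \<Longrightarrow> enn_powr x p \<le> y \<longleftrightarrow> x \<le> enn_powr y (1/p)"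
 using enn_powr_mono[of "enn_powr x p" y "1/p"] enn_powr_mono[of x "enn_powr y (1/p)" p]
 by (auto simp: enn_powr_enn_powr)

text \<open>A monotone map of linear orders whose range is open is continuous; the range is
  everything because the power \<open>1/p\<close> inverts it.\<close>

lemma continuous_enn_powr:
 assumes "0 < p"
 shows "continuous_on UNIV (\<lambda>x. enn_powr x p)"
proof (rule continuous_onI_mono)
 have "range (\<lambda>x. enn_powr x p) = UNIV"
  using assms by (auto simp: surj_def enn_powr_enn_powr intro!: exI[of _ "enn_powr _ (1/p)"])
 then show "open (range (\<lambda>x. enn_powr x p))" by simp
qed (use assms in \<open>auto intro: enn_powr_mono\<close>)

lemma tendsto_enn_powr:
 assumes "0 < p" "(f \<longlongrightarrow> l) F"
 shows "((\<lambda>x. enn_powr (f x) p) \<longlongrightarrow> enn_powr l p) F"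
 using continuous_on_tendsto_compose[OF continuous_enn_powr[OF assms(1)] assms(2)] by simp

lemma borel_measurable_enn_powr [measurable]:
 assumes [measurable]: "f \<in> borel_measurable M"
 shows "(\<lambda>x. enn_powr (f x) p) \<in> borel_measurable M" unfolding enn_powr_def by measurable

lemma Young_enn_powr:
 assumes w: "0 < w" "w < 1"
 shows "enn_powr x w * enn_powr y (1 - w) \<le> ennreal w * x + ennreal (1 - w) * y"
proof (cases "x = top \<or> y = top")
 case True
 then show ?thesis using w by (auto simp: ennreal_mult_top)
next
 case False
 then obtain a b where ab: "x = ennreal a" "y = ennreal b" "0 \<le> a" "0 \<le> b" by (cases x; cases y) auto
 show ?thesis
 proof (cases "a = 0 \<or> b = 0")
  case False
  with ab have "0 < a" "0 < b" by auto
  then have "a powr w * b powr (1 - w) \<le> w * a + (1 - w) * b" using w by (intro Youngs_inequality_0) auto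
  with ab w show ?thesis by (simp add: enn_powr_ennreal ennreal_leI flip: ennreal_mult ennreal_plus)
 qed (use ab in auto)
qed

text \<open>Both integrals are normalised to 1 and the pointwise Young inequality is integrated. The
  values 0 and \<open>top\<close> of the integrals are settled beforehand.\<close>

lemma nn_integral_Hoelder:
 assumes [measurable]: "f \<in> borel_measurable M" "g \<in> borel_measurable M"
  and w: "0 < w" "w < 1"
 shows "(\<integral>\<^sup>+x. enn_powr (f x) w * enn_powr (g x) (1 - w) \<partial>M)
  \<le> enn_powr (\<integral>\<^sup>+x. f x \<partial>M) w * enn_powr (\<integral>\<^sup>+x. g x \<partial>M) (1 - w)"
  (is "?L \<le> enn_powr ?A w * enn_powr ?B (1 - w)")
proof (cases "?A = 0 \<or> ?B = 0")
 case True
 then have "(AE x in M. f x = 0) \<or> (AE x in M. g x = 0)" by (simp add: nn_integral_0_iff_AE)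
 then have "AE x in M. enn_powr (f x) w * enn_powr (g x) (1 - w) = 0" by (auto elim: eventually_mono)
 then have "?L = 0" by (subst nn_integral_0_iff_AE) auto
 then show ?thesis by simp
next
 case nz: False
 show ?thesis
 proof (cases "?A = top \<or> ?B = top")
  case True
  with nz show ?thesis by (auto simp: ennreal_mult_top ennreal_top_mult)
 next
  case False
  with nz obtain a b where ab: "?A = ennreal a" "?B = ennreal b" "0 < a" "0 < b"
   by (cases "?A"; cases "?B") (auto simp: zero_less_iff_neq_zero less_le)
  let ?c = "ennreal (a powr w * b powr (1 - w))"
  have "enn_powr (f x) w * enn_powr (g x) (1 - w)
   \<le> ?c * (ennreal (w/a) * f x + ennreal ((1 - w) / b) * g x)" for x
  proof -
   \<comment> \<open>The constant \<open>?c\<close> undoes the normalisation: the factors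
     \<open>1/a\<close> and \<open>1/b\<close> leave exactly the inverse of
     \<open>a powr w * b powr (1 - w)\<close>.\<close>
   have "enn_powr (f x) w * enn_powr (g x) (1 - w)
     = ?c * (enn_powr (ennreal (1/a) * f x) w * enn_powr (ennreal (1/b) * g x) (1 - w))"
   proof -
    have "?c * (ennreal ((1/a) powr w) * ennreal ((1/b) powr (1-w))) = 1"
     using ab w by (simp add: powr_divide flip: ennreal_mult)
    moreover have "?c * (enn_powr (ennreal (1/a) * f x) w * enn_powr (ennreal (1/b) * g x) (1 - w))
     = (?c * (ennreal ((1/a) powr w) * ennreal ((1/b) powr (1-w)))) * (enn_powr (f x) w * enn_powr (g x) (1 - w))"
     using ab by (simp add: enn_powr_mult enn_powr_ennreal mult_ac)
    ultimately show ?thesis by simp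
   qed
   also have "... \<le> ?c * (ennreal w * (ennreal (1/a) * f x) + ennreal (1 - w) * (ennreal (1/b) * g x))"
    by (intro mult_left_mono Young_enn_powr w) auto
   also have "... = ?c * (ennreal (w/a) * f x + ennreal ((1 - w) / b) * g x)"
    using w ab by (simp add: mult.assoc[symmetric] ennreal_mult[symmetric])
   finally show ?thesis .
  qed
  then have "?L \<le> (\<integral>\<^sup>+x. ?c * (ennreal (w/a) * f x + ennreal ((1 - w) / b) * g x) \<partial>M)"
   by (intro nn_integral_mono)
  also have "... = ?c * (ennreal (w/a) * ?A + ennreal ((1 - w) / b) * ?B)"
   by (simp add: nn_integral_cmult nn_integral_add)
  also have "ennreal (w/a) * ?A + ennreal ((1 - w) / b) * ?B = 1"
   using w ab by (simp add: field_simps flip: ennreal_mult ennreal_plus)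
  finally show ?thesis using ab by (simp add: enn_powr_ennreal ennreal_mult)
 qed
qed

lemma Lnorm_pos: "p \<noteq> 0 \<Longrightarrow> Lnorm M p F = enn_powr (\<integral>\<^sup>+ x. enn_powr (F x) (1/p) \<partial>M) p"
 by (simp add: Lnorm_def)

lemma Lnorm_mono_AE:
 assumes "0 < p" "AE x in M. F x \<le> G x"
 shows "Lnorm M p F \<le> Lnorm M p G" using assms unfolding Lnorm_pos[OF less_imp_neq[OF assms(1), symmetric]]
 by (intro enn_powr_mono nn_integral_mono_AE) (auto elim!: eventually_mono intro: enn_powr_mono)

lemma Lnorm_mono: "0 < p \<Longrightarrow> (\<And>x. F x \<le> G x) \<Longrightarrow> Lnorm M p F \<le> Lnorm M p G"
 by (intro Lnorm_mono_AE) auto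

lemma Lnorm_cong_AE: "0 < p \<Longrightarrow> AE x in M. F x = G x \<Longrightarrow> Lnorm M p F = Lnorm M p G"
 by (intro antisym Lnorm_mono_AE) auto

lemma Lnorm_le_iff:
 "0 < p \<Longrightarrow> Lnorm M p F \<le> A \<longleftrightarrow> (\<integral>\<^sup>+ x. enn_powr (F x) (1/p) \<partial>M) \<le> enn_powr A (1/p)"
 by (simp add: Lnorm_pos enn_powr_le_iff)

lemma Lnorm_zero_iff:
 assumes "0 < p" "F \<in> borel_measurable M"
 shows "Lnorm M p F = 0 \<longleftrightarrow> (AE x in M. F x = 0)"
 using assms by (simp add: Lnorm_pos nn_integral_0_iff_AE)

lemma Lnorm_0 [simp]: "0 < p \<Longrightarrow> Lnorm M p (\<lambda>_. 0) = 0" by (simp add: Lnorm_pos)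

lemma Lnorm_cmult:
 assumes "0 < p" "F \<in> borel_measurable M"
 shows "Lnorm M p (\<lambda>x. c * F x) = c * Lnorm M p F"
 using assms by (simp add: Lnorm_pos enn_powr_mult nn_integral_cmult enn_powr_enn_powr)

lemma Lnorm_enn_powr:
 assumes "0 < p" "0 < s"
 shows "Lnorm M p (\<lambda>x. enn_powr (F x) s) = enn_powr (Lnorm M (p/s) F) s"
 using assms by (simp add: Lnorm_pos enn_powr_enn_powr)

lemma Lnorm_one: "Lnorm M 1 F = (\<integral>\<^sup>+ x. F x \<partial>M)" by (simp add: Lnorm_pos)

lemma Lnorm_Hoelder:
 assumes [measurable]: "F \<in> borel_measurable M" "G \<in> borel_measurable M"
  and p: "0 < p" "0 < q"
 shows "Lnorm M (p + q) (\<lambda>x. F x * G x) \<le> Lnorm M p F * Lnorm M q G"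
proof -
 let ?w = "p / (p + q)"
 have w: "0 < ?w" "?w < 1" "1 - ?w = q / (p + q)" using p by (auto simp: field_simps)
 have "Lnorm M (p + q) (\<lambda>x. F x * G x) =
   enn_powr (\<integral>\<^sup>+x. enn_powr (enn_powr (F x) (1/p)) ?w * enn_powr (enn_powr (G x) (1/q)) (1 - ?w) \<partial>M) (p + q)"
  using p unfolding w(3) by (simp add: Lnorm_pos enn_powr_mult enn_powr_enn_powr)
 also have "... \<le> enn_powr (enn_powr (\<integral>\<^sup>+x. enn_powr (F x) (1/p) \<partial>M) ?w *
   enn_powr (\<integral>\<^sup>+x. enn_powr (G x) (1/q) \<partial>M) (1 - ?w)) (p + q)"
  using p by (intro enn_powr_mono nn_integral_Hoelder w) auto
 also have "... = Lnorm M p F * Lnorm M q G"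
  using p unfolding w(3) by (simp add: Lnorm_pos enn_powr_mult enn_powr_enn_powr)
 finally show ?thesis .
qed

text \<open>Hoelder for \<open>F\<close> written as the product of its powers \<open>1 - s\<close>
  and \<open>s\<close>. With reciprocal exponents the interpolated exponent is an affine
  combination.\<close>

lemma Lnorm_interpolate:
 assumes [measurable]: "F \<in> borel_measurable M" and p: "0 < p" "0 < q" "0 < s" "s < 1"
 shows "Lnorm M ((1 - s) * p + s * q) F \<le> enn_powr (Lnorm M p F) (1 - s) * enn_powr (Lnorm M q F) s"
proof -
 have "Lnorm M ((1 - s) * p + s * q) F
  = Lnorm M ((1 - s) * p + s * q) (\<lambda>x. enn_powr (F x) (1 - s) * enn_powr (F x) s)"
  by (simp add: enn_powr_add)
 also have "... \<le> Lnorm M ((1 - s) * p) (\<lambda>x. enn_powr (F x) (1 - s)) * Lnorm M (s * q) (\<lambda>x. enn_powr (F x) s)"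
  using p by (intro Lnorm_Hoelder) auto
 also have "... = enn_powr (Lnorm M p F) (1 - s) * enn_powr (Lnorm M q F) s" using p by (simp add: Lnorm_enn_powr)
 finally show ?thesis .
qed

text \<open>The partner exponent is infinity, with reciprocal 0, which
  \<open>Lnorm_interpolate\<close> excludes.\<close>

lemma Lnorm_interpolate_sup:
 assumes [measurable]: "F \<in> borel_measurable M" and p: "0 < p" "0 < s" "s < 1"
  and X: "AE x in M. F x \<le> X"
 shows "Lnorm M ((1 - s) * p) F \<le> enn_powr (Lnorm M p F) (1 - s) * enn_powr X s"
proof -
 have "Lnorm M ((1 - s) * p) F = Lnorm M ((1 - s) * p) (\<lambda>x. enn_powr (F x) s * enn_powr (F x) (1 - s))"
  by (simp add: enn_powr_add)
 also have "... \<le> Lnorm M ((1 - s) * p) (\<lambda>x. enn_powr X s * enn_powr (F x) (1 - s))"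
  using p X by (intro Lnorm_mono_AE) (auto elim!: eventually_mono intro!: mult_right_mono enn_powr_mono)
 also have "... = enn_powr X s * enn_powr (Lnorm M p F) (1 - s)" using p by (simp add: Lnorm_cmult Lnorm_enn_powr)
 finally show ?thesis by (simp add: mult.commute)
qed

text \<open>The majorant \<open>B\<close> is required to be positive so that the Jensen weight \<open>B powr (1 - 1/p)\<close> makes sense.\<close>

lemma Lnorm_nn_integral_le:
 assumes [measurable]: "(\<lambda>(x, s). F s x) \<in> borel_measurable (M \<Otimes>\<^sub>M N)" "B \<in> borel_measurable N"
  and "sigma_finite_measure M" "sigma_finite_measure N"
  and p: "0 < p" "p \<le> 1" and B: "\<And>s. 0 < B s"
  and le: "AE s in N. Lnorm M p (F s) \<le> ennreal (B s)"
 shows "Lnorm M p (\<lambda>x. \<integral>\<^sup>+s. F s x \<partial>N) \<le> (\<integral>\<^sup>+s. ennreal (B s) \<partial>N)"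
proof -
 interpret M: sigma_finite_measure M by fact
 interpret N: sigma_finite_measure N by fact
 interpret P: pair_sigma_finite M N ..
 have [measurable]: "(\<lambda>(s, x). F s x) \<in> borel_measurable (N \<Otimes>\<^sub>M M)"
  using measurable_compose[OF measurable_pair_swap'[of N M], of "\<lambda>(x, s). F s x" borel] by (simp add: split_beta')
 let ?B = "\<integral>\<^sup>+s. ennreal (B s) \<partial>N"
 let ?f = "\<lambda>s x. enn_powr (F s x) (1/p) * ennreal (B s powr (1 - 1/p))"
 show ?thesis
 proof (cases "p = 1")
  case True
  have "(\<integral>\<^sup>+x. \<integral>\<^sup>+s. F s x \<partial>N \<partial>M) = (\<integral>\<^sup>+s. \<integral>\<^sup>+x. F s x \<partial>M \<partial>N)"
   by (rule P.Fubini'[symmetric]) measurable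
  also have "... \<le> ?B" using le True by (intro nn_integral_mono_AE) (auto simp: Lnorm_one)
  finally show ?thesis using True by (simp add: Lnorm_one)
 next
  case False
  then have p1: "p < 1" using p by simp
  \<comment> \<open>Hoelder in \<open>s\<close> with weights \<open>p\<close> and
    \<open>1 - p\<close>: \<open>?f\<close> is the power \<open>1/p\<close> of \<open>F\<close>
    times a power of its bound, normalised so that its \<open>x\<close>-integral is at most
    \<open>B s\<close>.\<close>
  have pw: "F s x = enn_powr (?f s x) p * enn_powr (ennreal (B s)) (1 - p)" for s x
   using B[of s] p
   by (simp add: enn_powr_mult enn_powr_enn_powr enn_powr_ennreal powr_powr mult.assoc algebra_simps
     flip: ennreal_mult powr_add)
  have Fx: "(\<integral>\<^sup>+s. F s x \<partial>N) \<le> enn_powr (\<integral>\<^sup>+s. ?f s x \<partial>N) p * enn_powr ?B (1 - p)"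
   if [measurable]: "x \<in> space M" for x by (subst pw) (intro nn_integral_Hoelder p p1; measurable)
  have "(\<integral>\<^sup>+x. enn_powr (\<integral>\<^sup>+s. F s x \<partial>N) (1/p) \<partial>M)
    \<le> (\<integral>\<^sup>+x. (\<integral>\<^sup>+s. ?f s x \<partial>N) * enn_powr ?B ((1 - p) / p) \<partial>M)"
  proof (intro nn_integral_mono)
   fix x assume "x \<in> space M"
   from enn_powr_mono[OF Fx[OF this], of "1/p"] p
   show "enn_powr (\<integral>\<^sup>+s. F s x \<partial>N) (1/p)
     \<le> (\<integral>\<^sup>+s. ?f s x \<partial>N) * enn_powr ?B ((1 - p) / p)"
    by (simp add: enn_powr_mult enn_powr_enn_powr)
  qed
  also have "... = (\<integral>\<^sup>+s. (\<integral>\<^sup>+x. ?f s x \<partial>M) \<partial>N) * enn_powr ?B ((1 - p) / p)"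
   by (subst P.Fubini') (auto simp: nn_integral_multc)
  also have "(\<integral>\<^sup>+s. (\<integral>\<^sup>+x. ?f s x \<partial>M) \<partial>N) \<le> ?B"
  proof (intro nn_integral_mono_AE)
   show "AE s in N. (\<integral>\<^sup>+x. ?f s x \<partial>M) \<le> ennreal (B s)"
    using le AE_space
   proof (eventually_elim)
    case (elim s)
    have "(\<integral>\<^sup>+x. ?f s x \<partial>M)
      = (\<integral>\<^sup>+x. enn_powr (F s x) (1/p) \<partial>M) * ennreal (B s powr (1 - 1/p))"
      using elim by (intro nn_integral_multc) measurable
     also have "... \<le> enn_powr (ennreal (B s)) (1/p) * ennreal (B s powr (1 - 1/p))"
      using elim p by (intro mult_right_mono) (auto simp: Lnorm_le_iff)
     also have "... = ennreal (B s)" using B[of s] by (simp add: enn_powr_ennreal flip: ennreal_mult powr_add)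
     finally show ?case .
   qed
  qed
  then have "(\<integral>\<^sup>+s. (\<integral>\<^sup>+x. ?f s x \<partial>M) \<partial>N) * enn_powr ?B ((1 - p) / p)
    \<le> enn_powr ?B 1 * enn_powr ?B ((1 - p) / p)" by (intro mult_right_mono) auto
  also have "... = enn_powr ?B (1/p)" using p by (subst enn_powr_add) (simp add: field_simps)
  finally show ?thesis using p by (simp add: Lnorm_le_iff)
 qed
qed

text \<open>Minkowski's inequality as the integral version over the two-point space
  \<open>bool\<close>. That version wants positive finite majorants, so norms 0 and
  \<open>top\<close> are treated apart.\<close>

lemma Lnorm_add_le:
 assumes [measurable]: "F \<in> borel_measurable M" "G \<in> borel_measurable M"
  and M: "sigma_finite_measure M" and p: "0 < p" "p \<le> 1"
 shows "Lnorm M p (\<lambda>x. F x + G x) \<le> Lnorm M p F + Lnorm M p G"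
proof (cases "Lnorm M p F = 0 \<or> Lnorm M p G = 0 \<or> Lnorm M p F = top \<or> Lnorm M p G = top")
 case True
 moreover have "Lnorm M p (\<lambda>x. F x + G x) \<le> Lnorm M p F + Lnorm M p G" if "Lnorm M p F = 0"
 proof -
  from that p have "AE x in M. F x = 0" by (simp add: Lnorm_zero_iff)
  then have "Lnorm M p (\<lambda>x. F x + G x) = Lnorm M p G"
   using p by (intro Lnorm_cong_AE) (auto elim: eventually_mono)
  then show ?thesis by simp
 qed
 moreover have "Lnorm M p (\<lambda>x. F x + G x) \<le> Lnorm M p F + Lnorm M p G" if "Lnorm M p G = 0"
 proof -
  from that p have "AE x in M. G x = 0" by (simp add: Lnorm_zero_iff)
  then have "Lnorm M p (\<lambda>x. F x + G x) = Lnorm M p F"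
   using p by (intro Lnorm_cong_AE) (auto elim: eventually_mono)
  then show ?thesis by simp
 qed
 ultimately show ?thesis by auto
next
 case False
 then obtain a b where ab: "Lnorm M p F = ennreal a" "Lnorm M p G = ennreal b" "0 < a" "0 < b"
  by (cases "Lnorm M p F"; cases "Lnorm M p G") (auto simp: less_le)
 have "Lnorm M p (\<lambda>x. \<integral>\<^sup>+s. (if s then F x else G x) \<partial>count_space UNIV)
   \<le> (\<integral>\<^sup>+s. ennreal (if s then a else b) \<partial>count_space UNIV)"
  by (rule Lnorm_nn_integral_le)
   (use M p ab in \<open>auto intro: sigma_finite_measure_count_space_finite simp: AE_count_space\<close>)
 then show ?thesis using ab by (simp add: nn_integral_count_space_finite UNIV_bool add.commute)
qed

lemma Lnorm_suminf_le:
 assumes [measurable]: "\<And>n. F n \<in> borel_measurable M"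
  and M: "sigma_finite_measure M" and p: "0 < p" "p \<le> 1"
  and B: "\<And>n. 0 < B n" "\<And>n. Lnorm M p (F n) \<le> ennreal (B n)"
 shows "Lnorm M p (\<lambda>x. \<Sum>n. F n x) \<le> (\<Sum>n. ennreal (B n))"
proof -
 have [measurable]: "(\<lambda>(x, s). F s x) \<in> borel_measurable (M \<Otimes>\<^sub>M count_space (UNIV::nat set))"
  by (simp add: split_beta')
 have "Lnorm M p (\<lambda>x. \<integral>\<^sup>+n. F n x \<partial>count_space UNIV) \<le> (\<integral>\<^sup>+n. ennreal (B n) \<partial>count_space UNIV)"
  by (rule Lnorm_nn_integral_le)
   (use M p B in \<open>auto intro: sigma_finite_measure_count_space_countable\<close>)
 then show ?thesis by (simp add: nn_integral_count_space_nat)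
qed

lemma Lnorm_sum_le:
 assumes "finite I" and [measurable]: "\<And>n. n \<in> I \<Longrightarrow> F n \<in> borel_measurable M"
  and M: "sigma_finite_measure M" and p: "0 < p" "p \<le> 1"
 shows "Lnorm M p (\<lambda>x. \<Sum>n\<in>I. F n x) \<le> (\<Sum>n\<in>I. Lnorm M p (F n))" using assms(1,2)
proof (induction I)
 case (insert i I)
 have "Lnorm M p (\<lambda>x. F i x + (\<Sum>n\<in>I. F n x)) \<le> Lnorm M p (F i) + Lnorm M p (\<lambda>x. \<Sum>n\<in>I. F n x)"
  using insert M p by (intro Lnorm_add_le) auto
 also have "... \<le> Lnorm M p (F i) + (\<Sum>n\<in>I. Lnorm M p (F n))"
  using insert by (intro add_left_mono insert.IH) auto
 finally show ?case using insert by simp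
qed (use p in auto)

text \<open>The power is continuous and monotone, so it passes through \<open>liminf\<close> on both
  sides of the usual Fatou lemma.\<close>

lemma Lnorm_Fatou:
 assumes [measurable]: "\<And>n. F n \<in> borel_measurable M" and p: "0 < p"
  and lim: "AE x in M. G x \<le> liminf (\<lambda>n. F n x)"
 shows "Lnorm M p G \<le> liminf (\<lambda>n. Lnorm M p (F n))"
proof -
 have cont: "enn_powr (liminf X) q = liminf (\<lambda>n. enn_powr (X n) q)" if "0 < q" for X :: "nat \<Rightarrow> ennreal" and q
  using that by (intro Liminf_compose_continuous_mono[symmetric] continuous_enn_powr)
   (auto simp: mono_def intro: enn_powr_mono)
 have "(\<integral>\<^sup>+x. enn_powr (G x) (1/p) \<partial>M) \<le> (\<integral>\<^sup>+x. liminf (\<lambda>n. enn_powr (F n x) (1/p)) \<partial>M)"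
  using lim p by (intro nn_integral_mono_AE) (auto elim!: eventually_mono simp flip: cont intro: enn_powr_mono)
 also have "... \<le> liminf (\<lambda>n. \<integral>\<^sup>+x. enn_powr (F n x) (1/p) \<partial>M)"
  by (rule nn_integral_liminf) measurable
 finally show ?thesis using p by (simp add: Lnorm_pos cont[symmetric] enn_powr_mono)
qed

section \<open>Norms in space and their pairings\<close>

lemma Lx_pos: "0 < p \<Longrightarrow> Lx p h = enn_powr (NN x. enn_powr (ennreal (cmod (h x))) (1/p)) p"
 by (simp add: Lx_def Lnorm_pos)

lemma Lx_mono_AE: "0 < p \<Longrightarrow> AE x in lborel. cmod (f x) \<le> cmod (g x) \<Longrightarrow> Lx p f \<le> Lx p g"
 unfolding Lx_def by (intro Lnorm_mono_AE) (auto elim!: eventually_mono intro: ennreal_leI)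

lemma Lx_mono: "0 < p \<Longrightarrow> (\<And>x. cmod (f x) \<le> cmod (g x)) \<Longrightarrow> Lx p f \<le> Lx p g"
 by (intro Lx_mono_AE) auto

lemma Lx_cong_AE: "0 < p \<Longrightarrow> AE x in lborel. f x = g x \<Longrightarrow> Lx p f = Lx p g"
 by (intro antisym Lx_mono_AE) (auto elim!: eventually_mono)

lemma Lx_zero [simp]: "0 < p \<Longrightarrow> Lx p (\<lambda>_. 0) = 0" by (simp add: Lx_def)

lemma Lx_zero_iff: "0 < p \<Longrightarrow> f \<in> bm \<Longrightarrow> Lx p f = 0 \<longleftrightarrow> (AE x in lborel. f x = 0)"
 by (simp add: Lx_def Lnorm_zero_iff)

lemma Lx_cmult: "0 < p \<Longrightarrow> f \<in> bm \<Longrightarrow> Lx p (\<lambda>x. c * f x) = ennreal (cmod c) * Lx p f"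
 by (simp add: Lx_def norm_mult ennreal_mult Lnorm_cmult)

lemma Lx_minus [simp]: "Lx p (\<lambda>x. - f x) = Lx p f" by (simp add: Lx_def)

lemma Lx_commute: "Lx p (\<lambda>x. f x - g x) = Lx p (\<lambda>x. g x - f x)"
 by (simp add: Lx_def norm_minus_commute)

lemma Lx_add_le:
 assumes [measurable]: "f \<in> bm" "g \<in> bm" and p: "0 < p" "p \<le> 1"
 shows "Lx p (\<lambda>x. f x + g x) \<le> Lx p f + Lx p g"
proof -
 have "Lx p (\<lambda>x. f x + g x) \<le> Lnorm lborel p (\<lambda>x. ennreal (cmod (f x)) + ennreal (cmod (g x)))"
  unfolding Lx_def using p by (intro Lnorm_mono) (auto simp: norm_triangle_ineq simp flip: ennreal_plus)
 also have "... \<le> Lx p f + Lx p g"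
  unfolding Lx_def using p by (intro Lnorm_add_le) (auto intro: lborel.sigma_finite_measure_axioms)
 finally show ?thesis .
qed

lemma Lx_diff_triangle:
 assumes [measurable]: "f \<in> bm" "g \<in> bm" "h \<in> bm"
  and p: "0 < p" "p \<le> 1"
 shows "Lx p (\<lambda>x. f x - h x) \<le> Lx p (\<lambda>x. f x - g x) + Lx p (\<lambda>x. g x - h x)"
 using Lx_add_le[of "\<lambda>x. f x - g x" "\<lambda>x. g x - h x" p] p by simp

lemma Lx_sum_le:
 assumes "finite I" "\<And>n. n \<in> I \<Longrightarrow> f n \<in> bm" and p: "0 < p" "p \<le> 1"
 shows "Lx p (\<lambda>x. \<Sum>n\<in>I. f n x) \<le> (\<Sum>n\<in>I. Lx p (f n))" using assms(1,2)
proof (induction I)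
 case (insert i I)
 have "Lx p (\<lambda>x. f i x + (\<Sum>n\<in>I. f n x)) \<le> Lx p (f i) + Lx p (\<lambda>x. \<Sum>n\<in>I. f n x)"
  using insert p by (intro Lx_add_le) auto
 also have "... \<le> Lx p (f i) + (\<Sum>n\<in>I. Lx p (f n))" using insert by (intro add_left_mono insert.IH) auto
 finally show ?case using insert by simp
qed (use p in auto)

lemma nn_integral_mult_le_Lx:
 assumes [measurable]: "f \<in> bm" "g \<in> bm" and p: "0 < p" "p < 1"
 shows "(NN x. ennreal (cmod (f x * g x))) \<le> Lx p f * Lx (1 - p) g"
 using Lnorm_Hoelder[of "\<lambda>x. ennreal (cmod (f x))" lborel "\<lambda>x. ennreal (cmod (g x))" p "1 - p"] p
 by (simp add: Lx_def norm_mult ennreal_mult Lnorm_one)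

lemma integrable_mult_Lx:
 assumes [measurable]: "f \<in> bm" "g \<in> bm" and p: "0 < p" "p < 1"
  and fin: "Lx p f < top" "Lx (1 - p) g < top"
 shows "integrable lborel (\<lambda>x. f x * g x)"
proof (rule integrableI_bounded)
 have "Lx p f * Lx (1 - p) g < top" using fin by (simp add: ennreal_mult_less_top)
 then show "(NN x. ennreal (norm (f x * g x))) < \<infinity>"
  using nn_integral_mult_le_Lx[OF assms(1-4)] by (simp add: le_less_trans)
qed simp

text \<open>For a non-integrable product the integral has the default value 0, so the bound holds in
  every case.\<close>

lemma norm_integral_mult_le_Lx:
 assumes [measurable]: "f \<in> bm" "g \<in> bm" and p: "0 < p" "p < 1"
 shows "ennreal (cmod (LBINT x. f x * g x)) \<le> Lx p f * Lx (1 - p) g"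
proof (cases "integrable lborel (\<lambda>x. f x * g x)")
 case True
 then have "ennreal (cmod (LBINT x. f x * g x)) \<le> (NN x. ennreal (cmod (f x * g x)))"
  by (rule integral_norm_bound_ennreal)
 also have "... \<le> Lx p f * Lx (1 - p) g" by (rule nn_integral_mult_le_Lx[OF assms])
 finally show ?thesis .
qed (simp add: not_integrable_integral_eq)

lemma borel_measurable_Lx [measurable]:
 fixes u :: "'a \<Rightarrow> 'n::finite wave"
 assumes [measurable]: "(\<lambda>(s, x). u s x) \<in> borel_measurable (M \<Otimes>\<^sub>M borel)" and p: "0 < p"
 shows "(\<lambda>s. Lx p (u s)) \<in> borel_measurable M"
proof -
 have "(\<lambda>(s, x). enn_powr (ennreal (cmod (u s x))) (1/p)) \<in> borel_measurable (M \<Otimes>\<^sub>M lborel)"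
  by (simp add: split_beta')
 then show ?thesis unfolding Lx_pos[OF p] by measurable
qed

section \<open>Gaussian integrals\<close>

lemma norm_iexp [simp]: "cmod (iexp x) = 1" by simp

lemma borel_measurable_cnj' [measurable]:
 "f \<in> borel_measurable M \<Longrightarrow> (\<lambda>x. cnj (f x)) \<in> borel_measurable M"
 by (rule borel_measurable_continuous_on[where f=cnj]) (auto intro: continuous_intros)

lemma gauss_integrable:
 fixes a :: real assumes "0 < a"
 shows "integrable lborel (\<lambda>x::real. exp (- a * x\<^sup>2))"
  and "(LBINT x. exp (- a * x\<^sup>2)) = sqrt (pi/a)"
proof -
 have s: "0 < 1 / sqrt (2 * a)" using assms by simp
 have eq: "exp (- a * x\<^sup>2) = sqrt (pi/a) * normal_density 0 (1 / sqrt (2 * a)) x" for x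
  using assms by (simp add: normal_density_def real_sqrt_divide power_divide real_sqrt_mult field_simps)
 show "integrable lborel (\<lambda>x::real. exp (- a * x\<^sup>2))"
  unfolding eq using integrable_normal_density[OF s] by simp
 show "(LBINT x. exp (- a * x\<^sup>2)) = sqrt (pi/a)" unfolding eq using integral_normal_density[OF s] by simp
qed

text \<open>A rescaled characteristic function of the standard normal distribution.\<close>

lemma gauss_Fourier:
 fixes a \<xi> :: real assumes a: "0 < a"
 shows "(LBINT x. exp (- a * x\<^sup>2) * iexp (\<xi> * x))
  = complex_of_real (sqrt (pi/a) * exp (- \<xi>\<^sup>2 / (4 * a)))"
proof -
 define c where "c = sqrt (2 * a)"
 have c: "0 < c" "c\<^sup>2 = 2 * a" using a by (auto simp: c_def)
 have "complex_of_real (exp (- ((\<xi>/c)\<^sup>2) / 2)) = char std_normal_distribution (\<xi>/c)"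
  by (simp add: char_std_normal_distribution)
 also have "... = (LBINT x. std_normal_density x *\<^sub>R iexp (\<xi>/c * x))"
  unfolding char_def by (subst integral_density) auto
 also have "... = c *\<^sub>R (LBINT x. std_normal_density (c * x) *\<^sub>R iexp (\<xi>/c * (c * x)))"
  using c by (subst lborel_integral_real_affine[where c=c and t=0]) auto
 also have "... = (LBINT x. complex_of_real (c / sqrt (2 * pi)) * (exp (- a * x\<^sup>2) * iexp (\<xi> * x)))"
  using c by (subst integral_scaleR_right[symmetric])
   (auto intro!: Bochner_Integration.integral_cong simp: std_normal_density_def power_mult_distrib scaleR_conv_of_real exp_of_real)
 also have "... = complex_of_real (c / sqrt (2 * pi)) * (LBINT x. exp (- a * x\<^sup>2) * iexp (\<xi> * x))"
  by simp
 finally have eq: "complex_of_real (exp (- ((\<xi>/c)\<^sup>2) / 2)) = ..." .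
 have "c / sqrt (2 * pi) * sqrt (pi/a) = 1" using a by (simp add: c_def real_sqrt_mult real_sqrt_divide)
 then have PQ: "complex_of_real (sqrt (pi/a)) * complex_of_real (c / sqrt (2 * pi)) = 1"
  by (metis of_real_1 of_real_mult mult.commute)
 have e: "- ((\<xi>/c)\<^sup>2) / 2 = - \<xi>\<^sup>2 / (4 * a)" using c by (simp add: power_divide)
 have "(LBINT x. exp (- a * x\<^sup>2) * iexp (\<xi> * x))
  = complex_of_real (sqrt (pi/a)) * complex_of_real (exp (- ((\<xi>/c)\<^sup>2) / 2))"
  unfolding eq mult.assoc[symmetric] PQ mult_1_left ..
 then show ?thesis unfolding e of_real_mult .
qed

text \<open>The squared modulus of the integral is a double integral of
  \<open>w (y + u) * cnj (w y)\<close>. In this product the quadratic phase becomes linear in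
  \<open>y\<close>, so the \<open>y\<close>-integral is a Gaussian Fourier transform, and what
  remains in \<open>u\<close> is again a Gaussian. The bound is uniform in the regularisation
  \<open>ep\<close>.\<close>

lemma gauss_osc_bound:
 fixes ep b g :: real assumes e: "0 < ep" and b: "b \<noteq> 0"
 shows "cmod (LBINT x. exp (- ep * x\<^sup>2) * iexp (b * x\<^sup>2 + g * x)) \<le> sqrt (pi / \<bar>b\<bar>)"
proof -
 define w :: "real \<Rightarrow> complex" where "w x = exp (- ep * x\<^sup>2) * iexp (b * x\<^sup>2 + g * x)" for x
 have [measurable]: "w \<in> bm" unfolding w_def by measurable
 have nw: "cmod (w x) = exp (- ep * x\<^sup>2)" for x by (simp add: w_def norm_mult)
 have iw: "integrable lborel w"
  by (rule Bochner_Integration.integrable_bound[OF gauss_integrable(1)[OF e]]) (auto simp: nw)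
 let ?I = "\<integral>x. w x \<partial>lborel"
 have wsplit: "w (y + u) * cnj (w y) = (exp (- (ep/2) * u\<^sup>2) * iexp (g * u)) *
   (exp (- (2 * ep) * (u/2 + 1 * y)\<^sup>2) * iexp (2 * b * u * (u/2 + 1 * y)))" for y u
 proof -
  have 1: "exp (- ep * (y + u)\<^sup>2) * exp (- ep * y\<^sup>2) = exp (- (ep/2) * u\<^sup>2) * exp (- (2 * ep) * (u/2 + 1 * y)\<^sup>2)"
   unfolding exp_add[symmetric] by (simp add: power2_eq_square algebra_simps)
  have 2: "iexp (b * (y + u)\<^sup>2 + g * (y + u)) * cnj (iexp (b * y\<^sup>2 + g * y))
    = iexp (g * u) * iexp (2 * b * u * (u/2 + 1 * y))"
   unfolding exp_cnj exp_add[symmetric] by (simp add: power2_eq_square algebra_simps)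
  have "w (y + u) * cnj (w y) = complex_of_real (exp (- ep * (y + u)\<^sup>2) * exp (- ep * y\<^sup>2)) *
    (iexp (b * (y + u)\<^sup>2 + g * (y + u)) * cnj (iexp (b * y\<^sup>2 + g * y)))"
   by (simp add: w_def mult_ac)
  then show ?thesis unfolding 1 2 by (simp add: mult_ac)
 qed
 \<comment> \<open>\<open>ep/2\<close> comes from the Gaussian factor in \<open>u\<close>, the other
   summand from the Fourier transform at frequency \<open>2 * b * u\<close>.\<close>
 define A where "A = ep/2 + b\<^sup>2 / (2 * ep)"
 have A: "0 < A" using e by (auto simp: A_def add_pos_nonneg)
 have inner: "(LBINT y. w (y + u) * cnj (w y)) =
   iexp (g * u) * complex_of_real (sqrt (pi / (2 * ep)) * exp (- A * u\<^sup>2))" for u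
 proof -
  have "(LBINT y. w (y + u) * cnj (w y)) = (exp (- (ep/2) * u\<^sup>2) * iexp (g * u)) *
    (LBINT y. exp (- (2 * ep) * (u/2 + 1 * y)\<^sup>2) * iexp (2 * b * u * (u/2 + 1 * y)))"
   unfolding wsplit by simp
  also have "(LBINT y. exp (- (2 * ep) * (u/2 + 1 * y)\<^sup>2) * iexp (2 * b * u * (u/2 + 1 * y)))
   = (LBINT y. exp (- (2 * ep) * y\<^sup>2) * iexp (2 * b * u * y))"
   by (subst (2) lborel_integral_real_affine[where c=1 and t="u/2"]) auto
  also have "... = complex_of_real (sqrt (pi / (2 * ep)) * exp (- (2 * b * u)\<^sup>2 / (4 * (2 * ep))))"
   using e by (intro gauss_Fourier) auto
  also have "(exp (- (ep/2) * u\<^sup>2) * iexp (g * u)) * ... =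
   iexp (g * u) * complex_of_real (sqrt (pi / (2 * ep)) * (exp (- (ep/2) * u\<^sup>2) * exp (- (2 * b * u)\<^sup>2 / (4 * (2 * ep)))))"
   by (simp add: mult_ac)
  also have "exp (- (ep/2) * u\<^sup>2) * exp (- (2 * b * u)\<^sup>2 / (4 * (2 * ep))) = exp (- A * u\<^sup>2)"
   unfolding exp_add[symmetric] using e by (simp add: A_def power2_eq_square field_simps)
  finally show ?thesis .
 qed
 have int2: "integrable (lborel \<Otimes>\<^sub>M lborel) (\<lambda>(u, y). w (y + u) * cnj (w y))"
 proof (rule lborel_pair.Fubini_integrable)
  have "(LBINT y. cmod (w (y + u) * cnj (w y))) = exp (- (ep/2) * u\<^sup>2) * sqrt (pi / (2 * ep))" for u
  proof -
   have "(LBINT y. cmod (w (y + u) * cnj (w y))) = exp (- (ep/2) * u\<^sup>2) * (LBINT y. exp (- (2 * ep) * (u/2 + 1 * y)\<^sup>2))"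
    unfolding wsplit by (simp add: norm_mult)
   also have "(LBINT y. exp (- (2 * ep) * (u/2 + 1 * y)\<^sup>2)) = (LBINT y. exp (- (2 * ep) * y\<^sup>2))"
    by (subst (2) lborel_integral_real_affine[where c=1 and t="u/2"]) auto
   finally show ?thesis using gauss_integrable(2)[of "2 * ep"] e by simp
  qed
  then show "integrable lborel (\<lambda>u. \<integral>y. norm (case (u, y) of (u, y) \<Rightarrow> w (y + u) * cnj (w y)) \<partial>lborel)"
   using gauss_integrable(1)[of "ep/2"] e by simp
  show "AE u in lborel. integrable lborel (\<lambda>y. case (u, y) of (u, y) \<Rightarrow> w (y + u) * cnj (w y))"
  proof (intro AE_I2)
   fix u
   show "integrable lborel (\<lambda>y. case (u, y) of (u, y) \<Rightarrow> w (y + u) * cnj (w y))"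
   proof (rule Bochner_Integration.integrable_bound[OF gauss_integrable(1)[OF e]])
    show "(\<lambda>y. case (u, y) of (u, y) \<Rightarrow> w (y + u) * cnj (w y)) \<in> borel_measurable lborel"
     by simp measurable
   qed (use e in \<open>auto simp: nw norm_mult mult_le_cancel_right1\<close>)
  qed
 qed measurable
 have "?I * cnj ?I = (LBINT y. ?I * cnj (w y))"
  unfolding integral_mult_right_zero Bochner_Integration.integral_cnj ..
 also have "... = (\<integral>y. (\<integral>u. w (y + u) * cnj (w y) \<partial>lborel) \<partial>lborel)"
 proof (intro Bochner_Integration.integral_cong refl)
  fix y
  have "?I = (LBINT u. w (y + u))" by (subst lborel_integral_real_affine[where c=1 and t=y]) auto
  then show "?I * cnj (w y) = (LBINT u. w (y + u) * cnj (w y))" unfolding integral_mult_left_zero by (rule arg_cong)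
 qed
 also have "... = (\<integral>u. (\<integral>y. w (y + u) * cnj (w y) \<partial>lborel) \<partial>lborel)"
  by (rule lborel_pair.Fubini_integral[OF int2])
 finally have "cmod (?I * cnj ?I) = cmod (LBINT u. iexp (g * u) * complex_of_real (sqrt (pi / (2 * ep)) * exp (- A * u\<^sup>2)))"
  unfolding inner by simp
 also have "... \<le> (LBINT u. cmod (iexp (g * u) * complex_of_real (sqrt (pi / (2 * ep)) * exp (- A * u\<^sup>2))))"
  by (rule Bochner_Integration.integral_norm_bound)
 also have "... = (LBINT u. sqrt (pi / (2 * ep)) * exp (- A * u\<^sup>2))"
  using e by (simp only: norm_mult norm_of_real norm_iexp) (simp add: abs_mult)
 also have "... = sqrt (pi / (2 * ep)) * sqrt (pi/A)" using gauss_integrable(2)[OF A] by simp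
 \<comment> \<open>Here \<open>2 * ep * A\<close> equals \<open>ep^2 + b^2\<close>, so dropping
   \<open>ep\<close> leaves \<open>pi / \<bar>b\<bar>\<close>.\<close>
 also have "... = pi / sqrt (ep\<^sup>2 + b\<^sup>2)" using e unfolding real_sqrt_mult[symmetric]
  by (simp add: A_def field_simps power2_eq_square real_sqrt_divide)
 also have "... \<le> pi / \<bar>b\<bar>"
  using b e by (intro divide_left_mono) (auto simp: real_le_rsqrt intro!: mult_pos_pos add_pos_nonneg)
 finally have "(cmod ?I)\<^sup>2 \<le> pi / \<bar>b\<bar>" by (simp add: norm_mult power2_eq_square)
 then show ?thesis unfolding w_def by (rule real_le_rsqrt)
qed

lemma lborel_prod_integral:
 fixes f :: "'a::euclidean_space \<Rightarrow> real \<Rightarrow> complex"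
 assumes f: "\<And>b. b \<in> Basis \<Longrightarrow> integrable lborel (f b)"
 shows "(LBINT x. (\<Prod>b\<in>Basis. f b (x \<bullet> b))) = (\<Prod>b\<in>Basis. \<integral>x. f b x \<partial>lborel)"
proof -
 interpret product_sigma_finite "\<lambda>_::'a. lborel :: real measure"
  by (simp add: product_sigma_finite_def lborel.sigma_finite_measure_axioms)
 have [measurable]: "b \<in> Basis \<Longrightarrow> f b \<in> bm" for b using f[of b] by auto
 have "(LBINT x. (\<Prod>b\<in>Basis. f b (x \<bullet> b)))
   = (\<integral>x. (\<Prod>b\<in>Basis. f b ((\<Sum>b\<in>Basis. x b *\<^sub>R b) \<bullet> b)) \<partial>(\<Pi>\<^sub>M b\<in>(Basis::'a set). lborel))"
  by (subst lborel_eq, subst integral_distr) auto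
 also have "... = (\<integral>x. (\<Prod>b\<in>Basis. f b (x b)) \<partial>(\<Pi>\<^sub>M b\<in>(Basis::'a set). lborel))"
  by (intro Bochner_Integration.integral_cong refl prod.cong) (auto simp: inner_sum_left_Basis)
 also have "... = (\<Prod>b\<in>Basis. \<integral>x. f b x \<partial>lborel)"
  using f by (intro product_integral_prod) auto
 finally show ?thesis .
qed

lemma norm_sq_Basis: "(norm x)\<^sup>2 = (\<Sum>b\<in>Basis. (x \<bullet> b)\<^sup>2)" for x :: "'a::euclidean_space"
 by (simp add: norm_eq_sqrt_inner euclidean_inner[of x x] power2_eq_square sum_nonneg)

lemma gauss_osc_integrable:
 fixes ep b g :: real assumes e: "0 < ep"
 shows "integrable lborel (\<lambda>x. exp (- ep * x\<^sup>2) * iexp (b * x\<^sup>2 + g * x))"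
 by (rule Bochner_Integration.integrable_bound[OF gauss_integrable(1)[OF e]]) (auto simp: norm_mult)

lemma gauss_prod_form:
 fixes x ga :: "'a::euclidean_space"
 shows "gauss ep x * iexp (b * (norm x)\<^sup>2 + ga \<bullet> x)
  = (\<Prod>c\<in>Basis. exp (- ep * (x \<bullet> c)\<^sup>2) * iexp (b * (x \<bullet> c)\<^sup>2 + (ga \<bullet> c) * (x \<bullet> c)))"
 unfolding prod.distrib norm_sq_Basis euclidean_inner[of ga x]
proof -
 have "exp (- ep * (\<Sum>c\<in>Basis. (x \<bullet> c)\<^sup>2)) = (\<Prod>c\<in>Basis. exp (- ep * (x \<bullet> c)\<^sup>2))"
  by (simp only: sum_distrib_left exp_sum[OF finite_Basis])
 moreover have "\<i> * complex_of_real (b * (\<Sum>c\<in>Basis. (x \<bullet> c)\<^sup>2) + (\<Sum>c\<in>Basis. (ga \<bullet> c) * (x \<bullet> c)))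
   = (\<Sum>c\<in>Basis. \<i> * complex_of_real (b * (x \<bullet> c)\<^sup>2 + (ga \<bullet> c) * (x \<bullet> c)))"
  by (simp only: sum_distrib_left of_real_sum sum.distrib[symmetric] of_real_add)
 ultimately show "complex_of_real (exp (- ep * (\<Sum>c\<in>Basis. (x \<bullet> c)\<^sup>2))) *
  iexp (b * (\<Sum>c\<in>Basis. (x \<bullet> c)\<^sup>2) + (\<Sum>c\<in>Basis. (ga \<bullet> c) * (x \<bullet> c)))
  = (\<Prod>c\<in>Basis. complex_of_real (exp (- ep * (x \<bullet> c)\<^sup>2))) *
   (\<Prod>c\<in>Basis. iexp (b * (x \<bullet> c)\<^sup>2 + (ga \<bullet> c) * (x \<bullet> c)))"
  by (simp only: of_real_prod exp_sum[OF finite_Basis])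
qed

lemma gauss_nd_osc_bound:
 fixes ga :: "'a::euclidean_space" assumes e: "0 < ep" and b: "b \<noteq> 0"
 shows "cmod (LBINT x. gauss ep x * iexp (b * (norm x)\<^sup>2 + ga \<bullet> x)) \<le> sqrt (pi / \<bar>b\<bar>) ^ DIM('a)"
proof -
 have "cmod (\<Prod>c\<in>Basis. \<integral>x. exp (- ep * x\<^sup>2) * iexp (b * x\<^sup>2 + (ga \<bullet> c) * x) \<partial>lborel)
  \<le> (\<Prod>c\<in>(Basis::'a set). sqrt (pi / \<bar>b\<bar>))"
  unfolding prod_norm[symmetric] using assms by (intro prod_mono conjI norm_ge_zero gauss_osc_bound)
 then show ?thesis unfolding gauss_prod_form using e
  by (subst lborel_prod_integral) (rule gauss_osc_integrable | simp only: prod_constant)+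
qed

lemma gauss_nd_Fourier:
 fixes ga :: "'a::euclidean_space" assumes e: "0 < ep"
 shows "(LBINT x. gauss ep x * iexp (ga \<bullet> x))
  = complex_of_real (sqrt (pi/ep) ^ DIM('a) * exp (- (norm ga)\<^sup>2 / (4 * ep)))"
proof -
 have "(LBINT x. gauss ep x * iexp (ga \<bullet> x))
  = (\<Prod>c\<in>Basis. \<integral>x. exp (- ep * x\<^sup>2) * iexp (0 * x\<^sup>2 + (ga \<bullet> c) * x) \<partial>lborel)"
  using gauss_prod_form[of ep _ 0 ga] gauss_osc_integrable[OF e, of 0]
  by (simp only: mult_zero_left add_0_left) (subst lborel_prod_integral, auto)
 also have "... = (\<Prod>c\<in>Basis. complex_of_real (sqrt (pi/ep) * exp (- (ga \<bullet> c)\<^sup>2 / (4 * ep))))"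
  unfolding mult_zero_left add_0_left gauss_Fourier[OF e] ..
 also have "... = complex_of_real (sqrt (pi/ep) ^ DIM('a) * exp (- (norm ga)\<^sup>2 / (4 * ep)))"
  unfolding norm_sq_Basis by (simp add: prod.distrib exp_sum sum_divide_distrib sum_negf[symmetric])
 finally show ?thesis .
qed

lemma gauss_nd_nn_integral:
 assumes e: "0 < ep"
 shows "(NN (x::'a::euclidean_space). ennreal (gauss ep x)) = ennreal (sqrt (pi/ep) ^ DIM('a))"
proof -
 have "gauss ep x = (\<Prod>c\<in>Basis. exp (- ep * (x \<bullet> c)\<^sup>2))" for x :: 'a
  unfolding norm_sq_Basis by (simp add: exp_sum sum_distrib_left sum_negf[symmetric])
 then have "(NN (x::'a). ennreal (gauss ep x)) = (NN (x::'a). (\<Prod>c\<in>Basis. ennreal (exp (- ep * (x \<bullet> c)\<^sup>2))))"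
  by (simp only: prod_ennreal exp_ge_zero)
 also have "... = (\<Prod>c\<in>(Basis::'a set). NN x. ennreal (exp (- ep * x\<^sup>2)))"
  by (rule nn_integral_lborel_prod) auto
 also have "... = (\<Prod>c\<in>(Basis::'a set). ennreal (sqrt (pi/ep)))"
  using gauss_integrable[OF e] by (subst nn_integral_eq_integral) auto
 finally show ?thesis using e by (simp add: ennreal_power)
qed

section \<open>The Schroedinger kernel\<close>

text \<open>A bounded kernel between two integrable functions makes the triple product absolutely
  integrable. Cut to lags away from 0, the Schroedinger kernel is bounded, and this is how spatial
  and space-time integrals are exchanged below.\<close>

lemma Fubini_bounded_kernel:
 fixes h :: "'a \<Rightarrow> complex" and f :: "'b \<Rightarrow> complex" and k :: "'a \<Rightarrow> 'b \<Rightarrow> complex"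
 assumes M: "sigma_finite_measure M" and N: "sigma_finite_measure N"
  and h: "integrable M h" and f: "integrable N f"
  and k[measurable]: "(\<lambda>(x, y). k x y) \<in> borel_measurable (M \<Otimes>\<^sub>M N)"
  and bd: "\<And>x y. cmod (k x y) \<le> C"
 shows "(\<integral>x. h x * (\<integral>y. k x y * f y \<partial>N) \<partial>M) = (\<integral>y. (\<integral>x. h x * k x y \<partial>M) * f y \<partial>N)"
  and "integrable (M \<Otimes>\<^sub>M N) (\<lambda>(x, y). h x * k x y * f y)"
  and "integrable M (\<lambda>x. h x * (\<integral>y. k x y * f y \<partial>N))"
  and "integrable N (\<lambda>y. (\<integral>x. h x * k x y \<partial>M) * f y)"
proof -
 interpret M: sigma_finite_measure M by fact
 interpret N: sigma_finite_measure N by fact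
 interpret P: pair_sigma_finite M N ..
 have [measurable]: "h \<in> borel_measurable M" "f \<in> borel_measurable N" using h f by auto
 show int: "integrable (M \<Otimes>\<^sub>M N) (\<lambda>(x, y). h x * k x y * f y)"
 proof (rule integrableI_bounded)
  have "(\<integral>\<^sup>+p. ennreal (norm (case p of (x, y) \<Rightarrow> h x * k x y * f y)) \<partial>(M \<Otimes>\<^sub>M N))
   = (\<integral>\<^sup>+x. \<integral>\<^sup>+y. ennreal (norm (h x * k x y * f y)) \<partial>N \<partial>M)"
   by (subst N.nn_integral_fst[symmetric]) auto
  also have "... \<le> (\<integral>\<^sup>+x. \<integral>\<^sup>+y. ennreal C * ennreal (norm (h x)) * ennreal (norm (f y)) \<partial>N \<partial>M)"
  proof (intro nn_integral_mono)
   fix x y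
   have "norm (h x * k x y * f y) = norm (k x y) * (norm (h x) * norm (f y))" by (simp add: norm_mult)
   also have "... \<le> C * (norm (h x) * norm (f y))" by (intro mult_right_mono bd) auto
   finally show "ennreal (norm (h x * k x y * f y)) \<le> ennreal C * ennreal (norm (h x)) * ennreal (norm (f y))"
    using order_trans[OF norm_ge_zero bd] by (simp add: ennreal_leI mult.assoc flip: ennreal_mult)
  qed
  also have "... = ennreal C * (\<integral>\<^sup>+x. ennreal (norm (h x)) \<partial>M) * (\<integral>\<^sup>+y. ennreal (norm (f y)) \<partial>N)"
   by (simp add: nn_integral_cmult nn_integral_multc)
  also have "... < \<infinity>" using h f by (simp add: integrable_iff_bounded ennreal_mult_less_top)
  finally show "(\<integral>\<^sup>+p. ennreal (norm (case p of (x, y) \<Rightarrow> h x * k x y * f y)) \<partial>(M \<Otimes>\<^sub>M N)) < \<infinity>" .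
 qed measurable
 have 1: "(\<integral>y. h x * k x y * f y \<partial>N) = h x * (\<integral>y. k x y * f y \<partial>N)" for x
  unfolding mult.assoc integral_mult_right_zero ..
 have 2: "(\<integral>x. h x * k x y * f y \<partial>M) = (\<integral>x. h x * k x y \<partial>M) * f y" for y
  unfolding integral_mult_left_zero ..
 show "(\<integral>x. h x * (\<integral>y. k x y * f y \<partial>N) \<partial>M) = (\<integral>y. (\<integral>x. h x * k x y \<partial>M) * f y \<partial>N)"
  using P.Fubini_integral[OF int] unfolding 1 2 by simp
 show "integrable M (\<lambda>x. h x * (\<integral>y. k x y * f y \<partial>N))"
  using P.integrable_fst[OF int] unfolding 1 .
 show "integrable N (\<lambda>y. (\<integral>x. h x * k x y \<partial>M) * f y)"
  using P.integrable_snd[OF int] unfolding 2 .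
qed

section \<open>The propagator and its regularised composition\<close>

definition K :: "'n::finite evol" where
 "K ta z = inverse (csqrt (Complex 0 (4 * pi * ta)) ^ CARD('n)) * exp (\<i> * of_real ((norm z)\<^sup>2 / (4 * ta)))"

definition U :: "real \<Rightarrow> ('n::finite wave) \<Rightarrow> 'n wave" where
 "U ta f x = (LBINT y. K ta (x - y) * f y)"

lemma schr_eq_U: "ta \<noteq> 0 \<Longrightarrow> schr ta ps x = U ta (\<lambda>y. of_real (ps y)) x"
 unfolding schr_def U_def K_def by (simp add: mult.assoc)

definition disp :: "nat \<Rightarrow> real \<Rightarrow> real" where
 "disp d ta = (4 * pi * \<bar>ta\<bar>) powr (- real d / 2)"

lemma disp_pos: "ta \<noteq> 0 \<Longrightarrow> 0 < disp d ta" by (simp add: disp_def)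

lemma disp_nonneg [simp]: "0 \<le> disp d ta" by (simp add: disp_def)

lemma sqrt_power_disp: "0 < x \<Longrightarrow> inverse (sqrt x ^ d) = x powr (- real d / 2)"
 by (simp add: powr_half_sqrt[symmetric] powr_powr powr_minus[symmetric] flip: powr_realpow)

lemma norm_K:
 fixes z :: "real^'n::finite" assumes "ta \<noteq> 0" shows "cmod (K ta z) = disp CARD('n) ta"
proof -
 have "cmod (csqrt (Complex 0 (4 * pi * ta))) = sqrt (4 * pi * \<bar>ta\<bar>)"
  unfolding norm_csqrt by (simp add: cmod_def abs_mult)
 then show ?thesis using assms unfolding K_def disp_def
  by (simp add: norm_mult norm_inverse norm_power sqrt_power_disp)
qed

text \<open>At lag 0 the prefactor is the inverse of 0, hence 0: \<open>U 0\<close> is the zero map,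
  whereas \<open>schr 0\<close> is the identity.\<close>

lemma K_0 [simp]: "K 0 (z::real^'n::finite) = 0" by (simp add: K_def)

lemma norm_K_le: "cmod (K ta (z::real^'n::finite)) \<le> disp CARD('n) ta"
 using norm_K[of ta z] by (cases "ta = 0") auto

lemma K_minus: "K ta (- z) = K ta z" by (simp add: K_def)

text \<open>The principal root commutes with conjugation off the nonpositive reals, which
  \<open>Complex 0 (4 * pi * ta)\<close> meets only for \<open>ta = 0\<close>. So the adjoint of
  \<open>U ta\<close> is \<open>U (- ta)\<close>.\<close>

lemma cnj_K: "cnj (K ta z) = K (- ta) z"
proof (cases "ta = 0")
 case False
 have "cnj (csqrt (Complex 0 (4 * pi * ta))) = csqrt (cnj (Complex 0 (4 * pi * ta)))"
  using False by (intro cnj_csqrt) (auto simp: complex_nonpos_Reals_iff)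
 moreover have "cnj (Complex 0 (4 * pi * ta)) = Complex 0 (4 * pi * (- ta))" by (simp add: complex_eq_iff)
 moreover have "cnj (exp (\<i> * of_real ((norm z)\<^sup>2 / (4 * ta)))) = exp (\<i> * of_real ((norm z)\<^sup>2 / (4 * (- ta))))"
  unfolding exp_cnj by simp
 ultimately show ?thesis unfolding K_def complex_cnj_mult complex_cnj_inverse complex_cnj_power by (simp only:)
qed (simp add: K_def)

lemma csqrt_imag: "csqrt (Complex 0 y) = Complex (sqrt (\<bar>y\<bar> / 2)) ((if y < 0 then -1 else 1) * sqrt (\<bar>y\<bar> / 2))"
 by (simp add: csqrt.code norm_complex_def Complex_eq complex_eq_iff)

lemma borel_measurable_K [measurable]:
 assumes [measurable]: "f \<in> borel_measurable M" "g \<in> borel_measurable M"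
 shows "(\<lambda>x. K (f x) (g x :: real^'n::finite)) \<in> borel_measurable M"
proof -
 have "(\<lambda>x. csqrt (Complex 0 (4 * pi * f x))) \<in> borel_measurable M"
  unfolding csqrt_imag unfolding Complex_eq by measurable
 then show ?thesis unfolding K_def by measurable
qed

lemma borel_measurable_U [measurable]:
 fixes f :: "'a \<Rightarrow> 'n::finite wave"
 assumes [measurable]: "(\<lambda>(s, y). f s y) \<in> borel_measurable (M \<Otimes>\<^sub>M borel)"
  "ta \<in> borel_measurable M" "g \<in> borel_measurable M"
 shows "(\<lambda>s. U (ta s) (f s) (g s)) \<in> borel_measurable M"
proof -
 have "(\<lambda>(s, y). K (ta s) (g s - y) * f s y) \<in> borel_measurable (M \<Otimes>\<^sub>M lborel)"
  by (simp add: split_beta')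
 then show ?thesis unfolding U_def by (rule lborel.borel_measurable_lebesgue_integral)
qed

lemma integrable_K_mult:
 fixes f :: "'n::finite wave"
 assumes f: "integrable lborel f" shows "integrable lborel (\<lambda>y. K ta (x - y) * f y)"
proof (rule Bochner_Integration.integrable_bound)
 show "integrable lborel (\<lambda>y. disp CARD('n) ta * norm (f y))" using f by simp
 have [measurable]: "f \<in> bm" using f by auto
 show "(\<lambda>y. K ta (x - y) * f y) \<in> borel_measurable lborel" by simp
qed (auto simp: norm_mult intro!: mult_right_mono norm_K_le)

lemma U_bound:
 fixes f :: "'n::finite wave"
 assumes "integrable lborel f"
 shows "cmod (U ta f x) \<le> disp CARD('n) ta * (LBINT y. cmod (f y))"
proof -
 have "cmod (U ta f x) \<le> (LBINT y. cmod (K ta (x - y) * f y))" unfolding U_def by simp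
 also have "... \<le> (LBINT y. disp CARD('n) ta * cmod (f y))" using integrable_K_mult[OF assms] assms
  by (intro integral_mono integrable_norm) (auto simp: norm_mult intro!: mult_right_mono norm_K_le)
 finally show ?thesis using assms by simp
qed

lemma U_add:
 assumes "integrable lborel f" "integrable lborel g"
 shows "U ta (\<lambda>y. f y + g y) x = U ta f x + U ta g x" unfolding U_def using assms
 by (simp add: distrib_left integrable_K_mult)

lemma U_cmult: "U ta (\<lambda>y. c * f y) x = c * U ta f x" unfolding U_def by (simp add: mult.left_commute[of _ c])

lemma U_zero [simp]: "U ta (\<lambda>y. 0) x = 0" by (simp add: U_def)

lemma cnj_U: "cnj (U ta f x) = U (- ta) (\<lambda>y. cnj (f y)) x"
 unfolding U_def by (simp add: cnj_K flip: Bochner_Integration.integral_cnj)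

text \<open>The kernel is even in space, so \<open>U ta\<close> is symmetric for the bilinear
  pairing.\<close>

lemma U_pairing:
 fixes f g :: "'n::finite wave"
 assumes f: "integrable lborel f" and g: "integrable lborel g"
 shows "(LBINT x. g x * U ta f x) = (LBINT y. U ta g y * f y)"
proof -
 have "(\<integral>x. g x * (\<integral>y. K ta (x - y) * f y \<partial>lborel) \<partial>lborel) = (\<integral>y. (\<integral>x. g x * K ta (x - y) \<partial>lborel) * f y \<partial>lborel)"
  by (rule Fubini_bounded_kernel[OF lborel.sigma_finite_measure_axioms lborel.sigma_finite_measure_axioms g f _ norm_K_le]) measurable
 moreover have "K ta (x - y) = K ta (y - x)" for x y :: "real^'n" using K_minus[of ta "x - y"] by simp
 ultimately show ?thesis by (simp add: U_def mult.commute)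
qed

text \<open>The regularised composition of \<open>U ta\<close> with the adjoint of \<open>U ta'\<close>; its kernel obeys the dispersive
 bound of \<open>U (ta - ta')\<close> uniformly in \<open>ep\<close>, which replaces the group property.\<close>

definition S :: "real \<Rightarrow> real \<Rightarrow> real \<Rightarrow> ('n::finite wave) \<Rightarrow> 'n wave" where
 "S ep ta ta' f = U (- ta') (\<lambda>x. of_real (gauss ep x) * U ta f x)"

definition kS :: "real \<Rightarrow> real \<Rightarrow> real \<Rightarrow> real^'n::finite \<Rightarrow> 'n wave" where
 "kS ep ta ta' y y' = (LBINT x. of_real (gauss ep x) * cnj (K ta' (x - y')) * K ta (x - y))"

lemma integrable_gauss_mult_bounded:
 fixes u :: "'n::finite wave"
 assumes e: "0 < ep" and [measurable]: "u \<in> bm" and bd: "\<And>x. cmod (u x) \<le> C"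
 shows "integrable lborel (\<lambda>x. of_real (gauss ep x) * u x)"
proof -
 have int: "integrable lborel (\<lambda>x::real^'n. gauss ep x)"
 proof (rule integrableI_bounded)
  have "(NN (x::real^'n). ennreal (norm (gauss ep x))) = ennreal (sqrt (pi/ep) ^ DIM(real^'n))"
   unfolding real_norm_def abs_exp_cancel by (rule gauss_nd_nn_integral[OF e])
  then show "(NN (x::real^'n). ennreal (norm (gauss ep x))) < \<infinity>" by simp
 qed measurable
 show ?thesis
 proof (rule Bochner_Integration.integrable_bound)
  show "integrable lborel (\<lambda>x::real^'n. C * gauss ep x)"
   using int by (rule integrable_mult_right)
  show "AE x in lborel. cmod (complex_of_real (gauss ep x) * u x) \<le> norm (C * gauss ep x)"
  proof (intro AE_I2)
   fix x
   have "0 \<le> C" using order_trans[OF norm_ge_zero bd] .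
   then show "cmod (complex_of_real (gauss ep x) * u x) \<le> norm (C * gauss ep x)"
    using mult_left_mono[OF bd[of x], of "gauss ep x"] by (simp add: norm_mult mult.commute)
  qed
 qed measurable
qed

text \<open>The Gaussian weight makes the outer function integrable; this is what permits the
  exchange of the two integrals and gives the composition a kernel.\<close>

lemma S_eq_kS:
 fixes f :: "'n::finite wave"
 assumes e: "0 < ep" and f: "integrable lborel f"
 shows "S ep ta ta' f y' = (LBINT y. kS ep ta ta' y y' * f y)"
proof -
 let ?h = "\<lambda>x. of_real (gauss ep x) * cnj (K ta' (x - y'))"
 have "integrable lborel ?h"
  by (rule integrable_gauss_mult_bounded[OF e _, of _ "disp CARD('n) ta'"]) (auto simp: norm_K_le)
 then have "(\<integral>x. ?h x * (\<integral>y. K ta (x - y) * f y \<partial>lborel) \<partial>lborel) = (\<integral>y. (\<integral>x. ?h x * K ta (x - y) \<partial>lborel) * f y \<partial>lborel)"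
  by (intro Fubini_bounded_kernel[OF lborel.sigma_finite_measure_axioms lborel.sigma_finite_measure_axioms _ f _ norm_K_le]) measurable
 moreover have "K (- ta') (y' - x) = cnj (K ta' (x - y'))" for x
  using K_minus[of "- ta'" "x - y'"] by (simp add: cnj_K)
 ultimately show ?thesis by (simp add: S_def U_def kS_def mult_ac)
qed

text \<open>The product of the two kernels has a quadratic phase with coefficient \<open>b\<close>,
  the difference of the two curvatures. Its oscillation bound, the power \<open>d/2\<close> of
  \<open>pi / \<bar>b\<bar>\<close>, and the moduli of the two prefactors multiply to exactly
  \<open>disp\<close> of the time difference, since \<open>\<bar>b\<bar> = \<bar>ta - ta'\<bar> / (4
  * \<bar>ta\<bar> * \<bar>ta'\<bar>)\<close>; the regularisation leaves no trace.\<close>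

lemma norm_kS_le:
 fixes y y' :: "real^'n::finite"
 assumes e: "0 < ep" and ne: "ta \<noteq> 0" "ta' \<noteq> 0" "ta \<noteq> ta'"
 shows "cmod (kS ep ta ta' y y') \<le> disp CARD('n) (ta - ta')"
proof -
 define b where "b = 1 / (4 * ta) - 1 / (4 * ta')"
 have b: "b \<noteq> 0" "\<bar>b\<bar> = \<bar>ta - ta'\<bar> / (4 * \<bar>ta\<bar> * \<bar>ta'\<bar>)"
  using ne by (auto simp: b_def field_simps abs_mult abs_divide[symmetric] abs_minus_commute)
 define ga where "ga = (1 / (2 * ta')) *\<^sub>R y' - (1 / (2 * ta)) *\<^sub>R y"
 define c0 where "c0 = (norm y)\<^sup>2 / (4 * ta) - (norm y')\<^sup>2 / (4 * ta')"
 let ?a = "inverse (csqrt (Complex 0 (4 * pi * ta)) ^ CARD('n)) * cnj (inverse (csqrt (Complex 0 (4 * pi * ta')) ^ CARD('n)))"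
 have ph: "(norm (x - y))\<^sup>2 / (4 * ta) - (norm (x - y'))\<^sup>2 / (4 * ta') = c0 + (b * (norm x)\<^sup>2 + ga \<bullet> x)" for x
  using ne unfolding c0_def b_def ga_def power2_norm_eq_inner
  by (simp add: inner_diff_left inner_diff_right inner_commute field_simps)
 have "of_real (gauss ep x) * cnj (K ta' (x - y')) * K ta (x - y)
   = (?a * exp (\<i> * of_real c0)) * (of_real (gauss ep x) * exp (\<i> * of_real (b * (norm x)\<^sup>2 + ga \<bullet> x)))" for x
 proof -
  have "cnj (iexp ((norm (x - y'))\<^sup>2 / (4 * ta'))) * iexp ((norm (x - y))\<^sup>2 / (4 * ta))
   = exp (\<i> * of_real ((norm (x - y))\<^sup>2 / (4 * ta) - (norm (x - y'))\<^sup>2 / (4 * ta')))"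
   unfolding exp_cnj exp_add[symmetric] by (simp add: algebra_simps)
  also have "... = exp (\<i> * of_real c0) * exp (\<i> * of_real (b * (norm x)\<^sup>2 + ga \<bullet> x))"
   unfolding ph exp_add[symmetric] by (simp add: algebra_simps)
  finally have eq: "cnj (iexp ((norm (x - y'))\<^sup>2 / (4 * ta'))) * iexp ((norm (x - y))\<^sup>2 / (4 * ta)) = ..." .
  show ?thesis unfolding K_def complex_cnj_mult
   using arg_cong[OF eq, of "\<lambda>z. ?a * of_real (gauss ep x) * z"] by (simp only: mult_ac)
 qed
 then have "kS ep ta ta' y y' = (?a * exp (\<i> * of_real c0)) *
   (LBINT x. of_real (gauss ep x) * exp (\<i> * of_real (b * (norm x)\<^sup>2 + ga \<bullet> x)))"
  unfolding kS_def integral_mult_right_zero[symmetric] by (simp only:)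
 then have "cmod (kS ep ta ta' y y') \<le> cmod (?a * exp (\<i> * of_real c0)) * sqrt (pi / \<bar>b\<bar>) ^ CARD('n)"
  using gauss_nd_osc_bound[OF e b(1), of ga] by (simp add: norm_mult mult_left_mono)
 also have "cmod (?a * exp (\<i> * of_real c0)) = disp CARD('n) ta * disp CARD('n) ta'"
  using norm_K[OF ne(1), of "0 :: real^'n"] norm_K[OF ne(2), of "0 :: real^'n"]
  unfolding norm_mult complex_mod_cnj norm_iexp by (simp add: K_def)
 also have "sqrt (pi / \<bar>b\<bar>) ^ CARD('n) = (\<bar>b\<bar> / pi) powr (- real CARD('n) / 2)"
  using sqrt_power_disp[of "\<bar>b\<bar> / pi" "CARD('n)"] b(1) by (simp add: real_sqrt_divide power_divide field_simps)
 also have "disp CARD('n) ta * disp CARD('n) ta' * ... = (4 * pi * \<bar>ta\<bar> * (4 * pi * \<bar>ta'\<bar>) * (\<bar>b\<bar> / pi)) powr (- real CARD('n) / 2)"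
  unfolding disp_def by (subst powr_mult)+ auto
 also have "4 * pi * \<bar>ta\<bar> * (4 * pi * \<bar>ta'\<bar>) * (\<bar>b\<bar> / pi) = 4 * pi * \<bar>ta - ta'\<bar>"
  using ne unfolding b(2) by (simp add: field_simps)
 finally show ?thesis by (simp add: disp_def)
qed

lemma ennreal_norm_integral_le: "ennreal (norm (\<integral>x. f x \<partial>M)) \<le> (\<integral>\<^sup>+x. ennreal (norm (f x)) \<partial>M)"
 for f :: "'a \<Rightarrow> 'b::{banach, second_countable_topology}"
 by (cases "integrable M f") (auto simp: not_integrable_integral_eq intro: integral_norm_bound_ennreal)

lemma ennreal_half: "(x + x) / 2 = (x :: ennreal)"
proof (cases x)
 case (real r)
 then have "x + x = ennreal (r + r)" by (simp only: ennreal_plus)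
 with real show ?thesis using divide_ennreal[of "r + r" 2] by simp
next
 case top
 then show ?thesis by (simp add: ennreal_top_divide)
qed

lemma nn_integral_powr_from_0:
 assumes "-1 < a" "0 \<le> c"
 shows "(NN x. indicator {0..c} x * ennreal (x powr a)) = ennreal (c powr (a + 1) / (a + 1))"
 using nn_integral_has_integral_lebesgue[OF _ has_integral_powr_from_0[OF assms]]
 by (simp add: ennreal_mult'' ennreal_indicator)

text \<open>Fatou along \<open>ep = 1/(n + 1)\<close> removes the Gaussian weight from a bound that
  is uniform in \<open>ep\<close>.\<close>

lemma nn_integral_gauss_limit_le:
 fixes h :: "real^'n::finite \<Rightarrow> ennreal"
 assumes [measurable]: "h \<in> bm"
  and le: "\<And>ep. 0 < ep \<Longrightarrow> (NN x. ennreal (gauss ep x) * h x) \<le> A"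
 shows "(NN x. h x) \<le> A"
proof -
 let ?e = "\<lambda>n::nat. 1 / real (Suc n)"
 have "(\<lambda>n. ennreal (exp (- ?e n * (norm x)\<^sup>2)) * h x) \<longlonglongrightarrow> ennreal 1 * h x" for x
 proof (intro tendsto_mult_ennreal tendsto_ennrealI tendsto_const)
  have "(\<lambda>n. exp (- ?e n * (norm x)\<^sup>2)) \<longlonglongrightarrow> gauss 0 x"
   by (intro tendsto_intros LIMSEQ_Suc[OF lim_1_over_n])
  then show "(\<lambda>n. exp (- ?e n * (norm x)\<^sup>2)) \<longlonglongrightarrow> 1" by simp
 qed auto
 then have "h x = liminf (\<lambda>n. ennreal (exp (- ?e n * (norm x)\<^sup>2)) * h x)" for x
  by (intro lim_imp_Liminf[symmetric]) auto
 then have "(NN x. h x) = (NN x. liminf (\<lambda>n. ennreal (exp (- ?e n * (norm x)\<^sup>2)) * h x))"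
  by (simp only:)
 also have "... \<le> liminf (\<lambda>n. NN x. ennreal (exp (- ?e n * (norm x)\<^sup>2)) * h x)"
  by (rule nn_integral_liminf) measurable
 also have "... \<le> liminf (\<lambda>n::nat. A)" by (intro Liminf_mono always_eventually allI le) simp
 finally show ?thesis by (simp add: Liminf_const)
qed

lemma Lx_half_le_iff:
 fixes f :: "'n::finite wave"
 shows "Lx (1/2) f \<le> A \<longleftrightarrow> (NN x. ennreal ((cmod (f x))\<^sup>2)) \<le> enn_powr A 2"
proof -
 have "enn_powr (ennreal (cmod (f x))) 2 = ennreal ((cmod (f x))\<^sup>2)" for x by (simp add: enn_powr_ennreal)
 then show ?thesis by (simp add: Lx_def Lnorm_le_iff)
qed

lemma Lx_half_sq:
 fixes f :: "'n::finite wave"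
 shows "enn_powr (Lx (1/2) f) 2 = (NN x. ennreal ((cmod (f x))\<^sup>2))"
proof -
 have "enn_powr (ennreal (cmod (f x))) 2 = ennreal ((cmod (f x))\<^sup>2)" for x by (simp add: enn_powr_ennreal)
 then show ?thesis by (simp add: Lx_def Lnorm_pos enn_powr_enn_powr)
qed

lemma borel_measurable_U_const [measurable]:
 fixes f :: "'n::finite wave"
 assumes [measurable]: "f \<in> bm"
 shows "U ta f \<in> bm"
proof -
 have "(\<lambda>x. U ((\<lambda>_. ta) x) ((\<lambda>_. f) x) (id x)) \<in> bm"
  by (rule borel_measurable_U) measurable
 then show ?thesis by simp
qed

text \<open>The weighted inner product of two propagated functions is a pairing of one of the
  functions with \<open>S\<close> of the other; both the L2 bound and the energy estimate start from
  this form.\<close>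

lemma S_pairing:
 fixes f g :: "'n::finite wave"
 assumes e: "0 < ep" and f: "integrable lborel f" and g: "integrable lborel g"
 shows "(LBINT x. of_real (gauss ep x) * U ta f x * cnj (U ta' g x))
  = (LBINT y. S ep ta ta' f y * cnj (g y))" unfolding cnj_U S_def
proof (rule U_pairing)
 have [measurable]: "f \<in> bm" using f by auto
 show "integrable lborel (\<lambda>x. complex_of_real (gauss ep x) * U ta f x)"
  by (rule integrable_gauss_mult_bounded[OF e _ U_bound[OF f]]) measurable
qed (use g in simp)

text \<open>At equal times the quadratic phases cancel and the Fourier transform of the Gaussian
  remains: in modulus the kernel is itself a Gaussian in \<open>y - y'\<close>.\<close>

lemma norm_kS_same:
 fixes y y' :: "real^'n::finite"
 assumes e: "0 < ep" and t: "ta \<noteq> 0"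
 shows "cmod (kS ep ta ta y y') = (disp CARD('n) ta)\<^sup>2 * sqrt (pi/ep) ^ CARD('n) * exp (- (1 / (16 * ta\<^sup>2 * ep)) * (norm (y - y'))\<^sup>2)"
proof -
 define ga where "ga = (1 / (2 * ta)) *\<^sub>R (y' - y)"
 define c0 where "c0 = ((norm y)\<^sup>2 - (norm y')\<^sup>2) / (4 * ta)"
 let ?a = "cnj (inverse (csqrt (Complex 0 (4 * pi * ta)) ^ CARD('n))) * inverse (csqrt (Complex 0 (4 * pi * ta)) ^ CARD('n))"
 have ph: "(norm (x - y))\<^sup>2 / (4 * ta) - (norm (x - y'))\<^sup>2 / (4 * ta) = c0 + ga \<bullet> x" for x
  using t unfolding c0_def ga_def power2_norm_eq_inner
  by (simp add: inner_diff_left inner_diff_right inner_commute field_simps)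
 have "of_real (gauss ep x) * cnj (K ta (x - y')) * K ta (x - y)
   = (?a * exp (\<i> * of_real c0)) * (of_real (gauss ep x) * exp (\<i> * of_real (ga \<bullet> x)))" for x
 proof -
  have "cnj (iexp ((norm (x - y'))\<^sup>2 / (4 * ta))) * iexp ((norm (x - y))\<^sup>2 / (4 * ta))
   = exp (\<i> * of_real ((norm (x - y))\<^sup>2 / (4 * ta) - (norm (x - y'))\<^sup>2 / (4 * ta)))"
   unfolding exp_cnj exp_add[symmetric] by (simp add: algebra_simps)
  also have "... = exp (\<i> * of_real c0) * exp (\<i> * of_real (ga \<bullet> x))"
   unfolding ph exp_add[symmetric] by (simp add: algebra_simps)
  finally have eq: "cnj (iexp ((norm (x - y'))\<^sup>2 / (4 * ta))) * iexp ((norm (x - y))\<^sup>2 / (4 * ta)) = ..." .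
  show ?thesis unfolding K_def complex_cnj_mult
   using arg_cong[OF eq, of "\<lambda>z. ?a * of_real (gauss ep x) * z"] by (simp only: mult_ac)
 qed
 then have "kS ep ta ta y y' = (?a * exp (\<i> * of_real c0)) *
   (LBINT x. of_real (gauss ep x) * exp (\<i> * of_real (ga \<bullet> x)))"
  unfolding kS_def integral_mult_right_zero[symmetric] by (simp only:)
 also have "cmod ... = cmod (?a * exp (\<i> * of_real c0)) * (sqrt (pi/ep) ^ CARD('n) * exp (- (norm ga)\<^sup>2 / (4 * ep)))"
  unfolding gauss_nd_Fourier[OF e] norm_mult[of _ "complex_of_real _"] norm_of_real using e by (simp add: abs_mult)
 also have "cmod (?a * exp (\<i> * of_real c0)) = (disp CARD('n) ta)\<^sup>2" using norm_K[OF t, of "0 :: real^'n"]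
  unfolding norm_mult complex_mod_cnj norm_iexp by (simp add: K_def power2_eq_square)
 also have "(norm ga)\<^sup>2 = (norm (y - y'))\<^sup>2 / (4 * ta\<^sup>2)"
  by (simp add: ga_def power_mult_distrib norm_minus_commute power_divide)
 finally show ?thesis by (simp add: field_simps)
qed

text \<open>The Gaussian of \<open>norm_kS_same\<close> has mass exactly 1 whatever
  \<open>ep\<close> is, so that Schur's test will give the constant 1.\<close>

lemma nn_integral_kS_same:
 fixes y y' :: "real^'n::finite"
 assumes e: "0 < ep" and t: "ta \<noteq> 0"
 shows "(NN y. ennreal (cmod (kS ep ta ta y y'))) = 1" "L1 (kS ep ta ta y) = 1"
proof -
 let ?A = "1 / (16 * ta\<^sup>2 * ep)"
 let ?c = "(disp CARD('n) ta)\<^sup>2 * sqrt (pi/ep) ^ CARD('n)"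
 have A: "0 < ?A" using assms by simp
 have shift: "(NN y. ennreal (exp (- ?A * (norm (y - z))\<^sup>2))) = ennreal (sqrt (pi/?A) ^ CARD('n))" for z :: "real^'n"
 proof -
  have "(NN (y::real^'n). ennreal (gauss ?A y)) = (\<integral>\<^sup>+y. ennreal (gauss ?A y) \<partial>distr lborel borel ((+) (- z)))"
   by (simp add: lborel_distr_plus)
  also have "... = (NN y. ennreal (exp (- ?A * (norm (y - z))\<^sup>2)))" by (subst nn_integral_distr) auto
  finally show ?thesis using gauss_nd_nn_integral[OF A, where 'a="real^'n"] by simp
 qed
 \<comment> \<open>The widths of the two Gaussians are dual: the product of their normalisations
   does not depend on \<open>ep\<close>.\<close>
 have "sqrt (pi/ep) * sqrt (pi/?A) = 4 * pi * \<bar>ta\<bar>" unfolding real_sqrt_mult[symmetric] using e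
  by (intro real_sqrt_unique) (auto simp: power2_eq_square field_simps)
 then have r1: "sqrt (pi/ep) ^ CARD('n) * sqrt (pi/?A) ^ CARD('n) = (4 * pi * \<bar>ta\<bar>) ^ CARD('n)"
  by (metis power_mult_distrib)
 have r2: "(disp CARD('n) ta)\<^sup>2 = inverse ((4 * pi * \<bar>ta\<bar>) ^ CARD('n))" using t unfolding disp_def
  by (simp add: power2_eq_square powr_minus powr_realpow flip: inverse_mult_distrib powr_add)
 have 1: "?c * sqrt (pi/?A) ^ CARD('n) = 1"
 proof -
  have "?c * sqrt (pi/?A) ^ CARD('n) = (disp CARD('n) ta)\<^sup>2 * (sqrt (pi/ep) ^ CARD('n) * sqrt (pi/?A) ^ CARD('n))"
   by (rule mult.assoc)
  also have "... = 1" unfolding r1 r2 by (rule left_inverse) (use t in simp)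
  finally show ?thesis .
 qed
 have eq: "ennreal (cmod (kS ep ta ta y y')) = ennreal ?c * ennreal (exp (- ?A * (norm (y - y'))\<^sup>2))" for y y' :: "real^'n"
  unfolding norm_kS_same[OF e t] using e by (subst ennreal_mult) auto
 have N: "(NN y. ennreal (cmod (kS ep ta ta y y'))) = 1" for y' :: "real^'n"
 proof -
  have "(NN y. ennreal (cmod (kS ep ta ta y y'))) = ennreal ?c * (NN y. ennreal (exp (- ?A * (norm (y - y'))\<^sup>2)))"
   unfolding eq by (rule nn_integral_cmult) measurable
  also have "... = ennreal (?c * sqrt (pi/?A) ^ CARD('n))"
   unfolding shift by (rule ennreal_mult[symmetric]) (use e in auto)
  finally show ?thesis unfolding 1 by simp
 qed
 then show "(NN y. ennreal (cmod (kS ep ta ta y y'))) = 1" .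
 have "cmod (kS ep ta ta y y') = cmod (kS ep ta ta y' y)" for y' :: "real^'n"
  unfolding norm_kS_same[OF e t] norm_minus_commute[of y y'] ..
 then show "L1 (kS ep ta ta y) = 1" using N[of y] by simp
qed

lemma borel_measurable_kS [measurable]:
 fixes y y' :: "'a \<Rightarrow> real^'n::finite"
 assumes [measurable]: "ta \<in> borel_measurable M" "ta' \<in> borel_measurable M" "y \<in> borel_measurable M" "y' \<in> borel_measurable M"
 shows "(\<lambda>z. kS ep (ta z) (ta' z) (y z) (y' z)) \<in> borel_measurable M"
proof -
 have "(\<lambda>(z, x). complex_of_real (exp (- ep * (norm (x::real^'n))\<^sup>2)) * cnj (K (ta' z) (x - y' z)) * K (ta z) (x - y z))
  \<in> borel_measurable (M \<Otimes>\<^sub>M lborel)" by (simp add: split_beta')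
 from lborel.borel_measurable_lebesgue_integral[OF this]
 show ?thesis unfolding kS_def by (simp add: split_beta')
qed

text \<open>Plancherel's inequality by Schur's test: the weighted square norm of
  \<open>U ta f\<close> is the pairing of \<open>S ep ta ta f\<close> with \<open>f\<close>, and
  both marginals of the kernel are 1. Letting the weight tend to 1 gives a contraction on
  L2.\<close>

lemma U_L2:
 fixes f :: "'n::finite wave"
 assumes f: "integrable lborel f"
 shows "Lx (1/2) (U ta f) \<le> Lx (1/2) f"
proof (cases "ta = 0")
 case True
 then have "U ta f = (\<lambda>_. 0)" by (auto simp: U_def)
 then show ?thesis by simp
next
 case t: False
 have [measurable]: "f \<in> bm" using f by auto
 let ?B = "NN x. ennreal ((cmod (f x))\<^sup>2)"
 have "(NN x. ennreal (gauss ep x) * ennreal ((cmod (U ta f x))\<^sup>2)) \<le> ?B" if e: "0 < ep" for ep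
 proof -
  let ?k = "\<lambda>y y'. ennreal (cmod (kS ep ta ta y y'))"
  have int: "integrable lborel (\<lambda>x. of_real (gauss ep x) * (U ta f x * cnj (U ta f x)))"
   by (rule integrable_gauss_mult_bounded[OF e _, of _ "(disp CARD('n) ta * (LBINT y. cmod (f y)))^2"])
    (auto simp: norm_mult power2_eq_square intro!: mult_mono U_bound[OF f])
  have re: "of_real (gauss ep x) * U ta f x * cnj (U ta f x) = complex_of_real (gauss ep x * (cmod (U ta f x))\<^sup>2)" for x
   by (simp only: mult.assoc complex_norm_square[symmetric] of_real_mult)
  have "(NN x. ennreal (gauss ep x) * ennreal ((cmod (U ta f x))\<^sup>2))
   = (NN x. ennreal (gauss ep x * (cmod (U ta f x))\<^sup>2))" by (simp add: ennreal_mult)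
  also have "... = ennreal (LBINT x. gauss ep x * (cmod (U ta f x))\<^sup>2)"
  proof (intro nn_integral_eq_integral)
   show "integrable lborel (\<lambda>x. gauss ep x * (cmod (U ta f x))\<^sup>2)"
    using int unfolding mult.assoc[symmetric] re by (simp only: complex_of_real_integrable_eq)
  qed auto
  also have "... = ennreal (cmod (LBINT x. of_real (gauss ep x) * U ta f x * cnj (U ta f x)))"
   unfolding re integral_complex_of_real norm_of_real
   by (subst abs_of_nonneg) (auto intro!: Bochner_Integration.integral_nonneg)
  also have "... = ennreal (cmod (LBINT y. S ep ta ta f y * cnj (f y)))" by (simp only: S_pairing[OF e f f])
  also have "... \<le> (NN y'. ennreal (cmod (S ep ta ta f y' * cnj (f y'))))" by (rule ennreal_norm_integral_le)
  also have "... \<le> (NN y'. (NN y. ?k y y' * (ennreal ((cmod (f y))\<^sup>2) + ennreal ((cmod (f y'))\<^sup>2)) / 2))"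
  proof (intro nn_integral_mono)
   fix y'
   have "ennreal (cmod (S ep ta ta f y' * cnj (f y'))) = ennreal (cmod (LBINT y. kS ep ta ta y y' * f y * cnj (f y')))"
    by (simp add: S_eq_kS[OF e f])
   also have "... \<le> (NN y. ennreal (cmod (kS ep ta ta y y' * f y * cnj (f y'))))"
    by (rule ennreal_norm_integral_le)
   also have "... \<le> (NN y. ?k y y' * (ennreal ((cmod (f y))\<^sup>2) + ennreal ((cmod (f y'))\<^sup>2)) / 2)"
   proof (intro nn_integral_mono)
    fix y
    \<comment> \<open>Schur's test: the mean of the squares separates the two arguments, and each
      half is integrated with the marginal 1.\<close>
    have "cmod (f y) * cmod (f y') \<le> ((cmod (f y))\<^sup>2 + (cmod (f y'))\<^sup>2) / 2"
     using sum_squares_bound[of "cmod (f y)" "cmod (f y')"] by simp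
    then have "cmod (kS ep ta ta y y' * f y * cnj (f y')) \<le> cmod (kS ep ta ta y y') * (((cmod (f y))\<^sup>2 + (cmod (f y'))\<^sup>2) / 2)"
     by (simp add: norm_mult mult.assoc mult_left_mono del: times_divide_eq_right)
    then show "ennreal (cmod (kS ep ta ta y y' * f y * cnj (f y'))) \<le> ?k y y' * (ennreal ((cmod (f y))\<^sup>2) + ennreal ((cmod (f y'))\<^sup>2)) / 2"
     by (simp add: ennreal_leI divide_ennreal flip: ennreal_mult ennreal_plus ennreal_numeral)
   qed
   finally show "ennreal (cmod (S ep ta ta f y' * cnj (f y'))) \<le> (NN y. ?k y y' * (ennreal ((cmod (f y))\<^sup>2) + ennreal ((cmod (f y'))\<^sup>2)) / 2)" .
  qed
  also have "... = ((NN y'. NN y. ?k y y' * ennreal ((cmod (f y))\<^sup>2)) + (NN y'. NN y. ?k y y' * ennreal ((cmod (f y'))\<^sup>2))) / 2"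
   by (simp add: distrib_left nn_integral_divide nn_integral_add)
  also have "(NN y'. NN y. ?k y y' * ennreal ((cmod (f y'))\<^sup>2)) = ?B"
   by (simp add: nn_integral_multc nn_integral_kS_same[OF e t])
  also have "(NN y'. NN y. ?k y y' * ennreal ((cmod (f y))\<^sup>2)) = (NN y. NN y'. ?k y y' * ennreal ((cmod (f y))\<^sup>2))"
   by (rule lborel_pair.Fubini') measurable
  also have "... = ?B" by (simp add: nn_integral_multc nn_integral_kS_same[OF e t])
  also have "(?B + ?B) / 2 = ?B" by (rule ennreal_half)
  finally show ?thesis .
 qed
 then have "(NN x. ennreal ((cmod (U ta f x))\<^sup>2)) \<le> ?B"
  by (rule nn_integral_gauss_limit_le[rotated]) measurable
 then show ?thesis unfolding Lx_half_le_iff Lx_half_sq .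
qed

lemma S_measurable [measurable]:
 fixes f :: "'n::finite wave"
 assumes [measurable]: "f \<in> bm"
 shows "S ep ta ta' f \<in> bm" unfolding S_def by measurable

lemma S_L2:
 fixes f :: "'n::finite wave"
 assumes e: "0 < ep" and f: "integrable lborel f"
 shows "Lx (1/2) (S ep ta ta' f) \<le> Lx (1/2) f"
proof -
 have [measurable]: "f \<in> bm" using f by auto
 have "Lx (1/2) (S ep ta ta' f) \<le> Lx (1/2) (\<lambda>x. complex_of_real (gauss ep x) * U ta f x)"
  unfolding S_def by (rule U_L2) (rule integrable_gauss_mult_bounded[OF e _ U_bound[OF f]], measurable)
 also have "... \<le> Lx (1/2) (U ta f)"
 proof (intro Lx_mono)
  show "cmod (complex_of_real (gauss ep x) * U ta f x) \<le> cmod (U ta f x)" for x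
   using e mult_right_mono[of "gauss ep x" 1 "cmod (U ta f x)"] by (simp add: norm_mult)
 qed simp
 also have "... \<le> Lx (1/2) f" by (rule U_L2[OF f])
 finally show ?thesis .
qed

lemma S_bound:
 fixes f :: "'n::finite wave"
 assumes e: "0 < ep" and f: "integrable lborel f" and ne: "ta \<noteq> 0" "ta' \<noteq> 0" "ta \<noteq> ta'"
 shows "cmod (S ep ta ta' f x) \<le> disp CARD('n) (ta - ta') * (LBINT y. cmod (f y))"
proof -
 have [measurable]: "f \<in> bm" using f by auto
 have "cmod (S ep ta ta' f x) \<le> (LBINT y. cmod (kS ep ta ta' y x * f y))" unfolding S_eq_kS[OF e f] by simp
 also have "... \<le> (LBINT y. disp CARD('n) (ta - ta') * cmod (f y))"
  using f by (intro integral_mono' integrable_norm) (auto simp: norm_mult intro!: mult_right_mono norm_kS_le e ne)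
 finally show ?thesis using f by simp
qed

lemma S_add:
 fixes f g :: "'n::finite wave"
 assumes e: "0 < ep" and f: "integrable lborel f" "integrable lborel g"
 shows "S ep ta ta' (\<lambda>y. f y + g y) x = S ep ta ta' f x + S ep ta ta' g x"
proof -
 have [measurable]: "f \<in> bm" "g \<in> bm" using f by auto
 have "integrable lborel (\<lambda>x. complex_of_real (gauss ep x) * U ta f x)"
  "integrable lborel (\<lambda>x. complex_of_real (gauss ep x) * U ta g x)"
  by (rule integrable_gauss_mult_bounded[OF e _ U_bound[OF f(1)]], measurable)
    (rule integrable_gauss_mult_bounded[OF e _ U_bound[OF f(2)]], measurable)
 then show ?thesis unfolding S_def using f by (simp add: U_add distrib_left)
qed

section \<open>Dispersive decay and the energy estimate\<close>

lemma powr_sq: "0 \<le> x \<Longrightarrow> x powr 2 = x\<^sup>2" for x :: real by (simp add: powr_numeral)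

lemma integrable_indicator_mult:
 fixes f :: "'a \<Rightarrow> complex"
 assumes "integrable M f" "A \<in> sets M"
 shows "integrable M (\<lambda>x. indicator A x * f x)"
proof -
 have "(\<lambda>x. indicator A x *\<^sub>R f x) = (\<lambda>x. indicator A x * f x)" by (auto simp: indicator_def)
 then show ?thesis using integrable_mult_indicator[OF assms(2,1)] by simp
qed

text \<open>Real interpolation by hand: at level \<open>\<lambda>\<close> the function is cut at the height for which the large part
 contributes at most \<open>\<lambda>/2\<close> in the supremum norm.\<close>

lemma Marcinkiewicz_L1_L2:
 fixes f :: "'n::finite wave" and T :: "('n wave) \<Rightarrow> 'n wave"
 assumes f: "integrable lborel f"
  and meas: "\<And>g. integrable lborel g \<Longrightarrow> T g \<in> bm"
  and add: "\<And>g h x. integrable lborel g \<Longrightarrow> integrable lborel h \<Longrightarrow> T (\<lambda>y. g y + h y) x = T g x + T h x"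
  and inf: "\<And>g x. integrable lborel g \<Longrightarrow> cmod (T g x) \<le> M * (LBINT y. cmod (g y))"
  and L2: "\<And>g. integrable lborel g \<Longrightarrow> Lx (1/2) (T g) \<le> Lx (1/2) g"
  and M: "0 < M" and be: "0 < be" "be < 1/2"
 shows "Lx be (T f) \<le> ennreal (8 / (1 - 2 * be) * M powr (1 - 2 * be)) * Lx (1 - be) f"
proof -
 have [measurable]: "f \<in> bm" using f by auto
 have [measurable]: "T f \<in> bm" by (rule meas[OF f])
 define r where "r = 1/be"
 define r' where "r' = 1 / (1 - be)"
 have r: "2 < r" "1 < r'" "r' < 2" using be by (auto simp: r_def r'_def field_simps)
 have rr: "(r - 1) * (1 - r') = -1" "2 - (r - 2) / (r - 1) = r'" "1/(r-1) = r' - 1"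
  using be by (auto simp: r_def r'_def field_simps)
 let ?J = "NN x. ennreal (cmod (f x) powr r')"
 have LJ: "Lx (1 - be) f = enn_powr ?J (1 - be)" using be by (simp add: Lx_pos enn_powr_ennreal r'_def)
 consider "?J = top" | "?J = 0" | n where "?J = ennreal n" "0 < n" by (cases ?J) (auto simp: less_le)
 then show ?thesis
 proof cases
  case 1
  have "0 < 8 / (1 - 2 * be) * M powr (1 - 2 * be)" using be M by auto
  then show ?thesis unfolding LJ 1 using M be by (simp add: ennreal_mult_top)
 next
  case 2
  then have "AE x in lborel. f x = 0" by (subst (asm) nn_integral_0_iff_AE) auto
  then have "(LBINT y. cmod (f y)) = (\<integral>(y::real^'n). 0 \<partial>lborel)" by (intro integral_cong_AE) auto
  then have "T f = (\<lambda>x. 0)" using inf[OF f] by (auto simp: fun_eq_iff)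
  then show ?thesis using be by simp
 next
  case (3 n)
  \<comment> \<open>The cut height. Where \<open>cmod (f y)\<close> exceeds \<open>h l\<close>, it
    is at most \<open>h l powr (1 - r')\<close> times its own power \<open>r'\<close>, and
    \<open>(r - 1) * (1 - r') = -1\<close> makes the L1 norm of the large part at most
    \<open>l / (2 * M)\<close>.\<close>
  define h where "h l = (2 * M * n/l) powr (r - 1)" for l
  let ?m = "\<lambda>l y. ennreal ((cmod (f y))\<^sup>2) * indicator {y. cmod (f y) \<le> h l} y"
  let ?k = "\<lambda>l y. (if 0 < l then ennreal (r * l powr (r - 1) * (4/l\<^sup>2)) * (?m l y) else 0)"
  let ?c = "\<lambda>l x. (if 0 \<le> l \<and> l \<le> cmod (T f x) then ennreal (r * l powr (r - 1)) else 0)"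
  have level: "(NN x. indicator {x. l \<le> cmod (T f x)} x)
    \<le> ennreal (4/l\<^sup>2) * (NN y. ?m l y)" if l: "0 < l" for l
  proof -
   let ?A = "{y. h l < cmod (f y)}"
   let ?g1 = "\<lambda>y. indicator ?A y * f y" and ?g2 = "\<lambda>y. indicator (- ?A) y * f y"
   have A: "?A \<in> sets lborel" "- ?A \<in> sets lborel" by measurable
   have i: "integrable lborel ?g1" "integrable lborel ?g2" by (rule integrable_indicator_mult[OF f]; fact A)+
   have h: "0 < h l" using l M 3 by (auto simp: h_def)
   have "ennreal (LBINT y. cmod (?g1 y)) = (NN y. ennreal (cmod (?g1 y)))"
    using i by (intro nn_integral_eq_integral[symmetric]) auto
   also have "... \<le> (NN y. ennreal (h l powr (1 - r')) * ennreal (cmod (f y) powr r'))"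
   proof (intro nn_integral_mono)
    fix y
    show "ennreal (cmod (?g1 y)) \<le> ennreal (h l powr (1 - r')) * ennreal (cmod (f y) powr r')"
    proof (cases "y \<in> ?A")
     case True
     then have fy: "h l < cmod (f y)" by simp
     then have "cmod (f y) = cmod (f y) powr (1 - r') * cmod (f y) powr r'" using h by (simp flip: powr_add)
     also have "... \<le> h l powr (1 - r') * cmod (f y) powr r'"
      using fy h r by (intro mult_right_mono powr_mono2') auto
     finally show ?thesis using True by (simp add: norm_mult ennreal_leI flip: ennreal_mult)
    qed simp
   qed
   also have "... = ennreal (h l powr (1 - r')) * ?J" by (rule nn_integral_cmult) measurable
   also have "... = ennreal (h l powr (1 - r') * n)" using 3 by (simp add: ennreal_mult)
   also have "h l powr (1 - r') = (2 * M * n/l) powr (-1)" unfolding h_def powr_powr rr(1) ..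
   also have "(2 * M * n/l) powr (-1) * n = l / (2 * M)" using l M 3 by (simp add: powr_minus field_simps)
   finally have "(LBINT y. cmod (?g1 y)) \<le> l / (2 * M)" using l M by (subst (asm) ennreal_le_iff) auto
   then have "M * (LBINT y. cmod (?g1 y)) \<le> l/2" using M by (simp add: field_simps)
   then have g1: "cmod (T ?g1 x) \<le> l/2" for x using inf[OF i(1), of x] by simp
   have split: "T f x = T ?g1 x + T ?g2 x" for x
   proof -
    have "f = (\<lambda>y. ?g1 y + ?g2 y)" by (auto simp: fun_eq_iff indicator_def)
    then have "T f x = T (\<lambda>y. ?g1 y + ?g2 y) x" by (rule arg_cong)
    also have "... = T ?g1 x + T ?g2 x" by (rule add[OF i])
    finally show ?thesis .
   qed
   have [measurable]: "T ?g2 \<in> bm" by (rule meas[OF i(2)])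
   have "(NN x. indicator {x. l \<le> cmod (T f x)} x) \<le> (NN x. ennreal (4/l\<^sup>2) * ennreal ((cmod (T ?g2 x))\<^sup>2))"
   proof (intro nn_integral_mono)
    fix x
    show "indicator {x. l \<le> cmod (T f x)} x \<le> ennreal (4/l\<^sup>2) * ennreal ((cmod (T ?g2 x))\<^sup>2)"
    proof (cases "l \<le> cmod (T f x)")
     case True
     then have "l/2 \<le> cmod (T ?g2 x)"
      using g1[of x] norm_triangle_ineq[of "T ?g1 x" "T ?g2 x"] unfolding split[of x] by linarith
     then have "(l/2)\<^sup>2 \<le> (cmod (T ?g2 x))\<^sup>2" using l by (intro power_mono) auto
     then have "1 \<le> 4/l\<^sup>2 * (cmod (T ?g2 x))\<^sup>2" using l by (simp add: power_divide field_simps)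
     then show ?thesis using True by (simp add: ennreal_leI flip: ennreal_mult ennreal_1)
    qed simp
   qed
   also have "... = ennreal (4/l\<^sup>2) * (NN x. ennreal ((cmod (T ?g2 x))\<^sup>2))"
    by (rule nn_integral_cmult) measurable
   also have "... \<le> ennreal (4/l\<^sup>2) * (NN x. ennreal ((cmod (?g2 x))\<^sup>2))"
    using L2[OF i(2)] unfolding Lx_half_le_iff Lx_half_sq by (intro mult_left_mono) auto
   also have "(NN x. ennreal ((cmod (?g2 x))\<^sup>2)) = (NN y. ?m l y)"
    by (intro nn_integral_cong) (auto simp: indicator_def norm_mult)
   finally show ?thesis .
  qed
  \<comment> \<open>Layer cake: the power \<open>r\<close> as an integral over levels.\<close>
  have cake: "ennreal (c powr r) = (NN l. (if 0 \<le> l \<and> l \<le> c then ennreal (r * l powr (r - 1)) else 0))" if "0 \<le> c" for c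
  proof -
   have "(NN l. (if 0 \<le> l \<and> l \<le> c then ennreal (r * l powr (r - 1)) else 0))
     = (NN l. ennreal r * (indicator {0..c} l * ennreal (l powr (r - 1))))"
    using r by (intro nn_integral_cong) (auto simp: ennreal_mult indicator_def)
   also have "... = ennreal r * ennreal (c powr (r - 1 + 1) / (r - 1 + 1))"
    using r that by (simp add: nn_integral_cmult nn_integral_powr_from_0)
   also have "... = ennreal (c powr r)" using r by (simp flip: ennreal_mult)
   finally show ?thesis ..
  qed
  define A where "A = 4 * r / (r - 2) * (2 * M * n) powr (r - 2)"
  have A0: "0 \<le> A" using r by (auto simp: A_def)
  \<comment> \<open>After the exchange of integrals a point \<open>y\<close> only sees levels with
    \<open>cmod (f y) \<le> h l\<close>, that is \<open>l \<le> c\<close>; the weight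
    \<open>l powr (r - 3)\<close> is integrable at 0 because \<open>2 < r\<close>.\<close>
  have inner: "(NN l. ?k l y)
    \<le> ennreal A * ennreal (cmod (f y) powr r')" for y
  proof (cases "f y = 0")
   case False
   define F where "F = cmod (f y)"
   define c where "c = 2 * M * n * F powr (- (1 / (r - 1)))"
   have F: "0 < F" and c: "0 < c" using False M 3 by (auto simp: F_def c_def)
   have hc: "l \<le> c" if "0 < l" "F \<le> h l" for l
   proof -
    have "F powr (1 / (r - 1)) \<le> h l powr (1 / (r - 1))" using that F r by (intro powr_mono2) auto
    also have "... = 2 * M * n/l" using r M 3 that by (simp add: h_def powr_powr)
    finally show ?thesis using that F by (simp add: c_def powr_minus field_simps)
   qed
   have "(NN l. ?k l y)
     \<le> (NN l. ennreal (4 * r * F\<^sup>2) * (indicator {0..c} l * ennreal (l powr (r - 3))))"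
   proof (intro nn_integral_mono)
    fix l :: real
    show "?k l y
     \<le> ennreal (4 * r * F\<^sup>2) * (indicator {0..c} l * ennreal (l powr (r - 3)))"
    proof (cases "0 < l \<and> F \<le> h l")
     case True
     then have l: "0 < l" "l \<le> c" using hc by auto
     have E: "l powr (r - 1) / l\<^sup>2 = l powr (r - 3)"
      using l powr_add[of l "r - 3" 2] by (simp add: powr_sq field_simps)
     have "r * l powr (r - 1) * (4/l\<^sup>2) * F\<^sup>2 = 4 * r * F\<^sup>2 * l powr (r - 3)"
      unfolding E[symmetric] by (simp add: field_simps)
     then have "ennreal (r * l powr (r - 1) * (4/l\<^sup>2)) * ennreal (F\<^sup>2) = ennreal (4 * r * F\<^sup>2) * ennreal (l powr (r - 3))"
      using r by (subst (1 2) ennreal_mult[symmetric]) auto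
     then show ?thesis using l True by (simp add: F_def)
    qed (auto simp: F_def indicator_def)
   qed
   also have "... = ennreal (4 * r * F\<^sup>2) * ennreal (c powr (r - 2) / (r - 2))"
    using nn_integral_powr_from_0[of "r - 3" c] r c by (subst nn_integral_cmult) auto
   also have "... = ennreal (A * (F\<^sup>2 * F powr (- (1 / (r - 1)) * (r - 2))))"
   proof -
    have "4 * r * F\<^sup>2 * (c powr (r - 2) / (r - 2)) = A * (F\<^sup>2 * F powr (- (1 / (r - 1)) * (r - 2)))"
     using M 3 F by (simp add: c_def A_def powr_mult powr_powr)
    then show ?thesis using r by (subst ennreal_mult[symmetric]) auto
   qed
   also have "F\<^sup>2 * F powr (- (1 / (r - 1)) * (r - 2)) = F powr r'"
    using F rr(2) by (simp flip: powr_numeral powr_add)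
   finally show ?thesis unfolding F_def by (subst (asm) ennreal_mult[OF A0]) auto
  qed (simp add: if_distrib cong: if_cong)
  have "(NN x. ennreal (cmod (T f x) powr r)) = (NN x l. ?c l x)"
   by (intro nn_integral_cong cake) auto
  also have "... = (NN l x. ?c l x)"
   by (rule lborel_pair.Fubini') measurable
  also have "... \<le> (NN l y. ?k l y)"
  proof (rule nn_integral_mono)
   fix l :: real
   show "(NN x. ?c l x)
    \<le> (NN y. ?k l y)"
   proof (cases "0 < l")
    case True
    have "(NN x. ?c l x)
     = (NN x. ennreal (r * l powr (r - 1)) * indicator {x. l \<le> cmod (T f x)} x)"
     using True by (intro nn_integral_cong) (auto simp: indicator_def)
    also have "... = ennreal (r * l powr (r - 1)) * (NN x. indicator {x. l \<le> cmod (T f x)} x)"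
     by (rule nn_integral_cmult) measurable
    also have "... \<le> ennreal (r * l powr (r - 1)) * (ennreal (4/l\<^sup>2) * (NN y. ?m l y))"
     by (intro mult_left_mono level True) auto
    also have "... = ennreal (r * l powr (r - 1) * (4/l\<^sup>2)) * (NN y. ?m l y)"
     using r by (subst (2) ennreal_mult) (auto simp: mult.assoc)
    also have "... = (NN y. ennreal (r * l powr (r - 1) * (4/l\<^sup>2)) * (?m l y))"
     by (rule nn_integral_cmult[symmetric]) measurable
    finally show ?thesis using True by simp
   qed (auto simp: indicator_def nn_integral_0_iff_AE)
  qed
  also have "... = (NN y l. ?k l y)"
  proof (rule lborel_pair.Fubini')
   show "(\<lambda>(y, l). if 0 < l then ennreal (r * l powr (r - 1) * (4/l\<^sup>2)) * (?m l y) else 0) \<in> borel_measurable (lborel \<Otimes>\<^sub>M lborel)"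
    unfolding h_def indicator_def mem_Collect_eq by measurable
  qed
  also have "... \<le> (NN y. ennreal A * ennreal (cmod (f y) powr r'))" by (intro nn_integral_mono inner)
  also have "... = ennreal A * ?J" by (rule nn_integral_cmult) measurable
  also have "... = ennreal (A * n)" using 3 A0 by (simp add: ennreal_mult)
  finally have main: "(NN x. ennreal (cmod (T f x) powr r)) \<le> ..." .
  \<comment> \<open>The constant is made explicit:
    \<open>4 * r / (r - 2) = 4 / (1 - 2 * be)\<close>, and this number and 2 are at least 1, so
    their powers \<open>be\<close> and \<open>1 - 2 * be\<close> are bounded by the numbers
    themselves.\<close>
  have "(A * n) powr be = (4 * r / (r - 2)) powr be * 2 powr (1 - 2 * be) * M powr (1 - 2 * be) * n powr (1 - be)"
  proof -
   have e: "(r - 2) * be = 1 - 2 * be" using be by (simp add: r_def field_simps)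
   have "(A * n) powr be = (4 * r / (r - 2)) powr be * (2 * M * n) powr (1 - 2 * be) * n powr be"
    unfolding A_def powr_mult powr_powr e ..
   also have "... = (4 * r / (r - 2)) powr be * 2 powr (1 - 2 * be) * M powr (1 - 2 * be) * (n powr (1 - 2 * be) * n powr be)"
    unfolding powr_mult by (simp only: mult_ac)
   also have "n powr (1 - 2 * be) * n powr be = n powr (1 - be)" by (simp flip: powr_add)
   finally show ?thesis .
  qed
  also have "... \<le> 4 / (1 - 2 * be) * 2 * M powr (1 - 2 * be) * n powr (1 - be)"
  proof (intro mult_right_mono mult_mono)
   have "4 * r / (r - 2) = 4 / (1 - 2 * be)" using be by (simp add: r_def field_simps)
   moreover have "(4 / (1 - 2 * be)) powr be \<le> (4 / (1 - 2 * be)) powr 1"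
    using be by (intro powr_mono) (auto simp: field_simps)
   ultimately show "(4 * r / (r - 2)) powr be \<le> 4 / (1 - 2 * be)" using be by simp
   have "2 powr (1 - 2 * be) \<le> 2 powr (1::real)" using be by (intro powr_mono) auto
   then show "2 powr (1 - 2 * be) \<le> (2::real)" by simp
  qed (use be in auto)
  also have "... = 8 / (1 - 2 * be) * M powr (1 - 2 * be) * n powr (1 - be)" by simp
  finally have num: "(A * n) powr be \<le> 8 / (1 - 2 * be) * M powr (1 - 2 * be) * n powr (1 - be)" .
  have "Lx be (T f) = enn_powr (NN x. ennreal (cmod (T f x) powr r)) be"
   using be by (simp add: Lx_pos enn_powr_ennreal r_def)
  also have "... \<le> enn_powr (ennreal (A * n)) be" using be by (intro enn_powr_mono[OF main]) auto
  also have "... = ennreal ((A * n) powr be)" using A0 3 by (intro enn_powr_ennreal) auto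
  also have "... \<le> ennreal (8 / (1 - 2 * be) * M powr (1 - 2 * be) * n powr (1 - be))"
   by (rule ennreal_leI[OF num])
  also have "... = ennreal (8 / (1 - 2 * be) * M powr (1 - 2 * be)) * Lx (1 - be) f"
   unfolding LJ 3(1) enn_powr_ennreal[OF less_imp_le[OF 3(2)]] by (rule ennreal_mult) (use be in auto)
  finally show ?thesis .
 qed
qed

section \<open>Decay from \<open>L(r')\<close> to \<open>L(r)\<close> and the energy
  estimate\<close>

definition delta :: "nat \<Rightarrow> real \<Rightarrow> real" where
 "delta d be = real d * (1/2 - be)"

definition Cdisp :: "real \<Rightarrow> real" where
 "Cdisp be = 8 / (1 - 2 * be)"

lemma Cdisp_pos: "be < 1/2 \<Longrightarrow> 0 < Cdisp be" by (simp add: Cdisp_def)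

lemma disp_powr_le:
 assumes "ta \<noteq> 0" "be < 1/2"
 shows "disp d ta powr (1 - 2 * be) \<le> \<bar>ta\<bar> powr (- delta d be)"
proof -
 have "disp d ta powr (1 - 2 * be) = (4 * pi * \<bar>ta\<bar>) powr (- delta d be)"
  by (simp add: disp_def powr_powr delta_def algebra_simps)
 also have "... = (4 * pi) powr (- delta d be) * \<bar>ta\<bar> powr (- delta d be)" by (simp add: powr_mult)
 also have "(4 * pi) powr (- delta d be) \<le> 1 powr (- delta d be)"
  using assms pi_ge_two by (intro powr_mono2') (auto simp: delta_def)
 finally show ?thesis by (simp add: mult_right_mono)
qed

text \<open>With \<open>be = 1/r\<close> the exponent \<open>delta\<close> is dictated by scaling:
  from L1 to the supremum norm the decay is the power \<open>d/2\<close> of the lag, and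
  interpolation with L2 keeps the fraction \<open>1 - 2 * be\<close> of it.\<close>

lemma U_dispersive:
 fixes f :: "'n::finite wave"
 assumes f: "integrable lborel f" and t: "ta \<noteq> 0" and be: "0 < be" "be < 1/2"
 shows "Lx be (U ta f) \<le> ennreal (Cdisp be * \<bar>ta\<bar> powr (- delta CARD('n) be)) * Lx (1 - be) f"
proof -
 have "Lx be (U ta f) \<le> ennreal (8 / (1 - 2 * be) * disp CARD('n) ta powr (1 - 2 * be)) * Lx (1 - be) f"
 proof (rule Marcinkiewicz_L1_L2[OF f])
  show "U ta g \<in> bm" if "integrable lborel g" for g :: "'n wave"
   using that by (intro borel_measurable_U_const) auto
 qed (use t be in \<open>simp_all add: U_add U_bound U_L2 disp_pos\<close>)
 also have "... \<le> ennreal (Cdisp be * \<bar>ta\<bar> powr (- delta CARD('n) be)) * Lx (1 - be) f"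
  using be t unfolding Cdisp_def by (intro mult_right_mono ennreal_leI mult_left_mono disp_powr_le) auto
 finally show ?thesis .
qed

lemma S_dispersive:
 fixes f :: "'n::finite wave"
 assumes e: "0 < ep" and f: "integrable lborel f" and t: "ta \<noteq> 0" "ta' \<noteq> 0" "ta \<noteq> ta'" and be: "0 < be" "be < 1/2"
 shows "Lx be (S ep ta ta' f) \<le> ennreal (Cdisp be * \<bar>ta - ta'\<bar> powr (- delta CARD('n) be)) * Lx (1 - be) f"
proof -
 have "Lx be (S ep ta ta' f) \<le> ennreal (8 / (1 - 2 * be) * disp CARD('n) (ta - ta') powr (1 - 2 * be)) * Lx (1 - be) f"
 proof (rule Marcinkiewicz_L1_L2[OF f])
  show "S ep ta ta' g \<in> bm" if "integrable lborel g" for g :: "'n wave"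
   using that by (intro S_measurable) auto
 qed (use t be in \<open>simp_all add: S_add[OF e] S_bound[OF e] S_L2[OF e] disp_pos\<close>)
 also have "... \<le> ennreal (Cdisp be * \<bar>ta - ta'\<bar> powr (- delta CARD('n) be)) * Lx (1 - be) f"
  using be t unfolding Cdisp_def by (intro mult_right_mono ennreal_leI mult_left_mono disp_powr_le) auto
 finally show ?thesis .
qed

lemma integrable_pair_lborel:
 fixes G :: "'n::finite evol"
 assumes [measurable]: "jm G"
  and int: "(NN s y. ennreal (cmod (G s y))) < \<infinity>"
 shows "integrable (lborel \<Otimes>\<^sub>M lborel) (\<lambda>p. G (fst p) (snd p))"
proof (rule integrableI_bounded)
 show "(\<lambda>p. G (fst p) (snd p)) \<in> borel_measurable (lborel \<Otimes>\<^sub>M lborel)" by measurable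
 have "(\<integral>\<^sup>+p. ennreal (cmod (G (fst p) (snd p))) \<partial>(lborel \<Otimes>\<^sub>M lborel)) = (NN s y. ennreal (cmod (G s y)))"
  by (subst lborel.nn_integral_fst[symmetric]) auto
 then show "(\<integral>\<^sup>+p. ennreal (norm (G (fst p) (snd p))) \<partial>(lborel \<Otimes>\<^sub>M lborel)) < \<infinity>"
  using int by simp
qed

lemma integrable_bounded_mult:
 fixes f k :: "'a \<Rightarrow> complex"
 assumes f: "integrable M f" and [measurable]: "k \<in> borel_measurable M" and k: "\<And>x. cmod (k x) \<le> D"
 shows "integrable M (\<lambda>x. k x * f x)"
proof (rule Bochner_Integration.integrable_bound)
 show "integrable M (\<lambda>x. D * cmod (f x))" using f by simp
 have [measurable]: "f \<in> borel_measurable M" using f by simp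
 show "(\<lambda>x. k x * f x) \<in> borel_measurable M" by measurable
 have "0 \<le> D" using order_trans[OF norm_ge_zero k] .
 then show "AE x in M. norm (k x * f x) \<le> norm (D * cmod (f x))"
  using k by (intro AE_I2) (simp add: norm_mult mult_right_mono)
qed

text \<open>The square of the L2 norm unfolds to a double time integral of pairings of
  \<open>S ep (ta s') (ta s) (G s')\<close> with \<open>G s\<close>, each bounded by the dispersive
  decay at lag \<open>\<bar>s - s'\<bar>\<close>. The isometry \<open>ta\<close> covers the map from
  \<open>s\<close> to \<open>t - s\<close> as well as the transposed situation, where the earlier
  time is integrated. The gap \<open>c\<close> keeps the kernel bounded, as Fubini requires.\<close>

lemma energy:
 fixes G :: "'n::finite evol"
 assumes meas[measurable]: "jm G"
  and int: "(NN s y. ennreal (cmod (G s y))) < \<infinity>"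
  and [measurable]: "ta \<in> bm" and iso: "\<And>s s'. \<bar>ta s - ta s'\<bar> = \<bar>s - s'\<bar>"
  and c: "0 < c" and G0: "\<And>s y. \<bar>ta s\<bar> < c \<Longrightarrow> G s y = 0"
  and be: "0 < be" "be < 1/2"
 shows "enn_powr (Lx (1/2) (\<lambda>x. \<integral>s. U (ta s) (G s) x \<partial>lborel)) 2
  \<le> (NN s. NN s'. ennreal (Cdisp be * \<bar>s - s'\<bar> powr (- delta CARD('n) be)) * (Lx (1 - be) (G s) * Lx (1 - be) (G s')))"
  (is "_ \<le> ?R")
proof -
 let ?P = "lborel \<Otimes>\<^sub>M lborel :: (real \<times> (real^'n)) measure"
 have P: "sigma_finite_measure ?P" by (rule sigma_finite_pair_measure; rule lborel.sigma_finite_measure_axioms)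
 define Gam where "Gam p = G (fst p) (snd p)" for p
 define D where "D = disp CARD('n) c"
 \<comment> \<open>The kernel is replaced by 0 at times where \<open>G\<close> vanishes, which
   changes no product with \<open>Gam\<close> and makes it bounded by \<open>D\<close>.\<close>
 define k where "k x p = (if c \<le> \<bar>ta (fst p)\<bar> then K (ta (fst p)) (x - snd p) else 0)" for x :: "real^'n" and p :: "real \<times> (real^'n)"
 have [measurable]: "(\<lambda>z. k (f z) (g z)) \<in> borel_measurable M"
  if [measurable]: "f \<in> borel_measurable M" "g \<in> M \<rightarrow>\<^sub>M borel \<Otimes>\<^sub>M borel" for f g and M :: "'z measure"
  unfolding k_def by measurable
 have [measurable]: "Gam \<in> borel_measurable (borel \<Otimes>\<^sub>M borel)" unfolding Gam_def by measurable
 have Gam: "integrable ?P Gam" using integrable_pair_lborel[OF meas int] by (simp add: Gam_def[abs_def])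
 have kD: "cmod (k x p) \<le> D" for x p
 proof (cases "c \<le> \<bar>ta (fst p)\<bar>")
  case True
  then have "disp CARD('n) (ta (fst p)) \<le> D" unfolding D_def disp_def using c by (intro powr_mono2') auto
  then show ?thesis using True norm_K_le[of "ta (fst p)" "x - snd p"] by (simp add: k_def)
 qed (simp add: k_def D_def)
 have kGam: "k x p * Gam p = K (ta (fst p)) (x - snd p) * Gam p" for x p
  using G0[of "fst p" "snd p"] by (auto simp: k_def Gam_def)
 define V where "V x = (\<integral>p. k x p * Gam p \<partial>?P)" for x
 have ikGam: "integrable ?P (\<lambda>p. k x p * Gam p)" for x
  by (rule integrable_bounded_mult[OF Gam _ kD]) measurable
 have V_eq: "(LBINT s. U (ta s) (G s) x) = V x" for x
 proof -
  have "V x = (\<integral>s. \<integral>y. k x (s, y) * Gam (s, y) \<partial>lborel \<partial>lborel)"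
   unfolding V_def by (rule lborel_pair.integral_fst'[OF ikGam, symmetric])
  then show ?thesis unfolding kGam U_def by (simp add: Gam_def)
 qed
 have [measurable]: "V \<in> bm"
 proof -
  have "(\<lambda>(x, p). k x p * Gam p) \<in> borel_measurable (borel \<Otimes>\<^sub>M ?P)" by measurable
  then show ?thesis unfolding V_def by (rule sigma_finite_measure.borel_measurable_lebesgue_integral[OF P])
 qed
 define B where "B = D * (\<integral>p. cmod (Gam p) \<partial>?P)"
 have VB: "cmod (V x) \<le> B" for x
 proof -
  have "cmod (V x) \<le> (\<integral>p. cmod (k x p * Gam p) \<partial>?P)"
   unfolding V_def by (rule Bochner_Integration.integral_norm_bound)
  also have "... \<le> (\<integral>p. D * cmod (Gam p) \<partial>?P)"
   using ikGam Gam kD by (intro integral_mono integrable_norm) (auto simp: norm_mult intro!: mult_right_mono)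
  finally show ?thesis by (simp add: B_def)
 qed
 have AEint: "AE s in lborel. integrable lborel (G s)"
  using lborel_pair.AE_integrable_fst'[OF Gam] by (simp add: Gam_def)
 have main: "(NN x. ennreal (gauss ep x) * ennreal ((cmod (V x))\<^sup>2)) \<le> ?R" if e: "0 < ep" for ep
 proof -
  define ee where "ee x = complex_of_real (gauss ep x)" for x :: "real^'n"
  have [measurable]: "ee \<in> bm" unfolding ee_def by measurable
  have iee: "integrable lborel (\<lambda>x. ee x * u x)" if "u \<in> bm" "\<And>x. cmod (u x) \<le> C" for u C
   unfolding ee_def by (rule integrable_gauss_mult_bounded[OF e that])
  define W where "W p = (LBINT x. ee x * cnj (V x) * k x p)" for p
  have 1: "(LBINT x. ee x * cnj (V x) * V x) = (\<integral>p. W p * Gam p \<partial>?P)" "integrable ?P (\<lambda>p. W p * Gam p)"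
  proof -
   have h: "integrable lborel (\<lambda>x. ee x * cnj (V x))" by (rule iee[of _ B]) (auto simp: VB)
   have m: "(\<lambda>(x, p). k x p) \<in> borel_measurable (lborel \<Otimes>\<^sub>M ?P)" by measurable
   show "(LBINT x. ee x * cnj (V x) * V x) = (\<integral>p. W p * Gam p \<partial>?P)"
    unfolding V_def[of "_"] W_def
    using Fubini_bounded_kernel(1)[OF lborel.sigma_finite_measure_axioms P h Gam m kD] unfolding V_def by simp
   show "integrable ?P (\<lambda>p. W p * Gam p)"
    using Fubini_bounded_kernel(4)[OF lborel.sigma_finite_measure_axioms P h Gam m kD] unfolding W_def .
  qed
  define kk where "kk p p' = (LBINT x. ee x * k x p * cnj (k x p'))" for p p'
  have [measurable]: "(\<lambda>z. kk (f z) (g z)) \<in> borel_measurable M"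
   if [measurable]: "f \<in> M \<rightarrow>\<^sub>M borel \<Otimes>\<^sub>M borel" "g \<in> M \<rightarrow>\<^sub>M borel \<Otimes>\<^sub>M borel" for f g and M :: "'z measure"
  proof -
   have "(\<lambda>(z, x). ee x * k x (f z) * cnj (k x (g z))) \<in> borel_measurable (M \<Otimes>\<^sub>M lborel)"
    by measurable
   then show ?thesis unfolding kk_def by (rule lborel.borel_measurable_lebesgue_integral)
  qed
  have 2: "W p = (\<integral>p'. kk p p' * cnj (Gam p') \<partial>?P)" "integrable ?P (\<lambda>p'. kk p p' * cnj (Gam p'))" for p
  proof -
   have h: "integrable lborel (\<lambda>x. ee x * k x p)"
   proof (rule iee[of _ D])
    show "(\<lambda>x. k x p) \<in> bm" by measurable (simp add: space_pair_measure)
   qed (rule kD)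
   have m: "(\<lambda>(x, p). cnj (k x p)) \<in> borel_measurable (lborel \<Otimes>\<^sub>M ?P)" by measurable
   have bd: "cmod (cnj (k x p')) \<le> D" for x p' using kD by simp
   have cGam: "integrable ?P (\<lambda>p'. cnj (Gam p'))" using Gam by simp
   note F = Fubini_bounded_kernel[OF lborel.sigma_finite_measure_axioms P h cGam m bd]
   have "cnj (V x) = (\<integral>p'. cnj (k x p') * cnj (Gam p') \<partial>?P)" for x
    unfolding V_def complex_cnj_mult[symmetric] by (rule Bochner_Integration.integral_cnj[symmetric])
   then have "W p = (\<integral>x. ee x * k x p * (\<integral>p'. cnj (k x p') * cnj (Gam p') \<partial>?P) \<partial>lborel)"
    unfolding W_def by (simp add: mult_ac)
   then show "W p = (\<integral>p'. kk p p' * cnj (Gam p') \<partial>?P)" using F(1) unfolding kk_def by simp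
   show "integrable ?P (\<lambda>p'. kk p p' * cnj (Gam p'))" using F(4) unfolding kk_def .
  qed
  define q where "q s s' y = (\<integral>y'. kk (s, y) (s', y') * cnj (G s' y') \<partial>lborel)" for s s' y
  have [measurable]: "(\<lambda>z. q (f z) (g z) (h z)) \<in> borel_measurable M"
   if [measurable]: "f \<in> borel_measurable M" "g \<in> borel_measurable M" "h \<in> borel_measurable M" for f g h and M :: "'z measure"
  proof -
   have "(\<lambda>(z, y'). kk (f z, h z) (g z, y') * cnj (G (g z) y')) \<in> borel_measurable (M \<Otimes>\<^sub>M lborel)"
    by measurable
   then show ?thesis unfolding q_def by (rule lborel.borel_measurable_lebesgue_integral)
  qed
  have W_le: "ennreal (cmod (W (s, y))) \<le> (NN s'. ennreal (cmod (q s s' y)))" for s y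
  proof -
   have "W (s, y) = (\<integral>s'. q s s' y \<partial>lborel)"
    unfolding 2(1) q_def using lborel_pair.integral_fst'[OF 2(2)[of "(s, y)"], symmetric] by (simp add: Gam_def)
   then show ?thesis by (simp add: ennreal_norm_integral_le)
  qed
  have q_eq: "q s s' y = cnj (S ep (ta s') (ta s) (G s') y)"
   if "c \<le> \<bar>ta s\<bar>" "c \<le> \<bar>ta s'\<bar>" "integrable lborel (G s')" for s s' y
  proof -
   have "kk (s, y) (s', y') = cnj (kS ep (ta s') (ta s) y' y)" for y'
    using that(1,2) unfolding kk_def kS_def ee_def k_def
    by (simp add: mult_ac flip: Bochner_Integration.integral_cnj)
   then have "q s s' y = (\<integral>y'. cnj (kS ep (ta s') (ta s) y' y * G s' y') \<partial>lborel)"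
    unfolding q_def by simp
   also have "... = cnj (S ep (ta s') (ta s) (G s') y)"
    unfolding S_eq_kS[OF e that(3)] by (rule Bochner_Integration.integral_cnj)
   finally show ?thesis .
  qed
  have real: "ee x * cnj (V x) * V x = complex_of_real (gauss ep x * (cmod (V x))\<^sup>2)" for x
   unfolding ee_def by (simp only: mult.assoc mult.commute[of "cnj (V x)"] complex_norm_square[symmetric] of_real_mult)
  have iV: "integrable lborel (\<lambda>x. gauss ep x * (cmod (V x))\<^sup>2)"
  proof -
   have "integrable lborel (\<lambda>x. ee x * (cnj (V x) * V x))"
    by (rule iee[of _ "B * B"]) (auto simp: norm_mult intro!: mult_mono VB order_trans[OF norm_ge_zero VB])
   then show ?thesis unfolding mult.assoc[symmetric] real by (simp only: complex_of_real_integrable_eq)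
  qed
  have "(NN x. ennreal (gauss ep x) * ennreal ((cmod (V x))\<^sup>2))
    = (NN x. ennreal (gauss ep x * (cmod (V x))\<^sup>2))" by (simp add: ennreal_mult)
  also have "... = ennreal (LBINT x. gauss ep x * (cmod (V x))\<^sup>2)"
   by (rule nn_integral_eq_integral[OF iV]) auto
  also have "... = ennreal (cmod (\<integral>p. W p * Gam p \<partial>?P))"
   unfolding 1(1)[symmetric] real integral_complex_of_real norm_of_real
   by (subst abs_of_nonneg) (auto intro!: Bochner_Integration.integral_nonneg)
  also have "... \<le> (\<integral>\<^sup>+p. ennreal (cmod (W p * Gam p)) \<partial>?P)"
   by (rule ennreal_norm_integral_le)
  also have "... = (NN s y. ennreal (cmod (W (s, y) * Gam (s, y))))"
  proof -
   have [measurable]: "(\<lambda>p. W p * Gam p) \<in> borel_measurable ?P" using 1(2) by simp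
   show ?thesis by (rule lborel.nn_integral_fst[symmetric]) measurable
  qed
  also have "... \<le> (NN s y. (NN s'. ennreal (cmod (q s s' y))) * ennreal (cmod (G s y)))"
   by (intro nn_integral_mono) (auto simp: norm_mult ennreal_mult Gam_def intro!: mult_right_mono W_le)
  also have "... = (NN s y. (NN s'. ennreal (cmod (q s s' y * G s y))))"
   by (simp add: nn_integral_multc norm_mult ennreal_mult)
  also have "... = (NN s. NN s'. (NN y. ennreal (cmod (q s s' y * G s y))))"
  proof (rule nn_integral_cong)
   fix s :: real
   show "(NN y. NN s'. ennreal (cmod (q s s' y * G s y))) = (NN s'. NN y. ennreal (cmod (q s s' y * G s y)))"
    by (rule lborel_pair.Fubini') measurable
  qed
  also have "... \<le> ?R"
  proof (rule nn_integral_mono, rule nn_integral_mono_AE)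
   fix s :: real
   \<comment> \<open>The diagonal is a null set; off it the two times are distinct and
     \<open>S_dispersive\<close> applies.\<close>
   have "AE s' in lborel. s' \<noteq> s" by (rule AE_lborel_singleton)
   then show "AE s' in lborel. (NN y. ennreal (cmod (q s s' y * G s y)))
    \<le> ennreal (Cdisp be * \<bar>s - s'\<bar> powr (- delta CARD('n) be)) * (Lx (1 - be) (G s) * Lx (1 - be) (G s'))"
    using AEint
   proof eventually_elim
    case (elim s')
    show ?case
    proof (cases "c \<le> \<bar>ta s\<bar> \<and> c \<le> \<bar>ta s'\<bar>")
     case True
     have ne: "ta s' \<noteq> 0" "ta s \<noteq> 0" "ta s' \<noteq> ta s"
      using True c iso[of s' s] elim(1) by auto
     have [measurable]: "G s \<in> bm" "G s' \<in> bm" by measurable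
     have "(NN y. ennreal (cmod (q s s' y * G s y))) = (NN y. ennreal (cmod (S ep (ta s') (ta s) (G s') y * G s y)))"
      using True elim(2) by (simp add: q_eq norm_mult)
     also have "... \<le> Lx be (S ep (ta s') (ta s) (G s')) * Lx (1 - be) (G s)"
      using be by (intro nn_integral_mult_le_Lx) auto
     also have "... \<le> (ennreal (Cdisp be * \<bar>ta s' - ta s\<bar> powr (- delta CARD('n) be)) * Lx (1 - be) (G s')) * Lx (1 - be) (G s)"
      by (intro mult_right_mono S_dispersive[OF e elim(2) ne be]) auto
     finally show ?thesis by (simp add: iso abs_minus_commute mult_ac)
    next
     case False
     have "ennreal (cmod (q s s' y * G s y)) = 0" for y
     proof (cases "c \<le> \<bar>ta s\<bar>")
      case True
      with False have "G s' y' = 0" for y' using G0 by auto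
      then show ?thesis by (simp add: q_def)
     next
      case False
      then have "G s y = 0" using G0 by auto
      then show ?thesis by simp
     qed
     then show ?thesis by (simp only:) simp
    qed
   qed
  qed
  finally show ?thesis .
 qed
 have "enn_powr (Lx (1/2) V) 2 \<le> ?R"
  unfolding Lx_half_sq by (rule nn_integral_gauss_limit_le[OF _ main]) measurable
 then show ?thesis unfolding V_eq .
qed

section \<open>Mixed norms of the dyadic pieces\<close>

text \<open>To meet the positivity asked for by \<open>Lnorm_nn_integral_le\<close>, a small
  multiple of a strictly positive integrable function is added to the majorant; such a function
  exists by sigma-finiteness.\<close>

lemma Lnorm_Minkowski_integral:
 assumes [measurable]: "(\<lambda>(x, s). F s x) \<in> borel_measurable (M \<Otimes>\<^sub>M N)"
  and M: "sigma_finite_measure M" and N: "sigma_finite_measure N"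
  and p: "0 < p" "p \<le> 1"
  and le: "AE s in N. Lnorm M p (F s) \<le> B s" and [measurable]: "B \<in> borel_measurable N"
 shows "Lnorm M p (\<lambda>x. \<integral>\<^sup>+s. F s x \<partial>N) \<le> (\<integral>\<^sup>+s. B s \<partial>N)"
proof (cases "(\<integral>\<^sup>+s. B s \<partial>N) = top")
 case fin: False
 obtain h where h[measurable]: "h \<in> borel_measurable N" and hi: "integral\<^sup>N N h \<noteq> \<infinity>" and hp: "\<forall>x\<in>space N. 0 < h x \<and> h x < \<infinity>"
  using sigma_finite_measure.Ex_finite_integrable_function[OF N] by auto
 define g where "g s = (if enn2real (h s) = 0 then 1 else enn2real (h s))" for s
 have gp: "0 < g s" for s by (auto simp: g_def less_le)
 have [measurable]: "g \<in> borel_measurable N" unfolding g_def by measurable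
 have gh: "ennreal (g s) = h s" if "s \<in> space N" for s using hp that by (cases "h s") (auto simp: g_def)
 have "(\<integral>\<^sup>+s. ennreal (g s) \<partial>N) = integral\<^sup>N N h" by (rule nn_integral_cong) (rule gh)
 then obtain I where I: "(\<integral>\<^sup>+s. ennreal (g s) \<partial>N) = ennreal I" "0 \<le> I"
  using hi by (cases "integral\<^sup>N N h") auto
 have fAE: "AE s in N. B s \<noteq> top" using fin nn_integral_PInf_AE[of B N] by simp
 have "Lnorm M p (\<lambda>x. \<integral>\<^sup>+s. F s x \<partial>N) \<le> (\<integral>\<^sup>+s. B s \<partial>N) + ennreal ep" if e: "0 < ep" for ep
 proof -
  define e' where "e' = ep / (I + 1)"
  have e': "0 < e'" using e I by (simp add: e'_def)
  have "Lnorm M p (\<lambda>x. \<integral>\<^sup>+s. F s x \<partial>N) \<le> (\<integral>\<^sup>+s. ennreal (enn2real (B s) + e' * g s) \<partial>N)"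
  proof (rule Lnorm_nn_integral_le[OF _ _ M N p])
   show "AE s in N. Lnorm M p (F s) \<le> ennreal (enn2real (B s) + e' * g s)" using le fAE
   proof eventually_elim
    case (elim s)
    then have "B s = ennreal (enn2real (B s))" by (cases "B s") auto
    also have "... \<le> ennreal (enn2real (B s) + e' * g s)" using e' gp[of s] by (intro ennreal_leI) auto
    finally show ?case using elim by auto
   qed
   show "0 < enn2real (B s) + e' * g s" for s using e' gp[of s] by (intro add_nonneg_pos) auto
  qed measurable
  also have "... = (\<integral>\<^sup>+s. ennreal (enn2real (B s)) + ennreal e' * ennreal (g s) \<partial>N)"
   using e' gp by (intro nn_integral_cong) (auto simp: ennreal_mult less_imp_le)
  also have "... = (\<integral>\<^sup>+s. ennreal (enn2real (B s)) \<partial>N) + ennreal e' * ennreal I"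
   using I by (simp add: nn_integral_add nn_integral_cmult)
  also have "(\<integral>\<^sup>+s. ennreal (enn2real (B s)) \<partial>N) = (\<integral>\<^sup>+s. B s \<partial>N)"
   using fAE by (intro nn_integral_cong_AE) (auto elim!: eventually_mono simp: less_top)
  also have "ennreal e' * ennreal I \<le> ennreal ep"
   using e' I e by (simp add: e'_def field_simps flip: ennreal_mult)
  finally show ?thesis by (simp add: add_left_mono)
 qed
 then show ?thesis by (rule ennreal_le_epsilon)
qed simp

lemma nn_integral_powr_ball:
 assumes e: "e < 1" and l: "0 \<le> l"
 shows "(NN t'. (if \<bar>t - t'\<bar> \<le> l then ennreal (\<bar>t - t'\<bar> powr (- e)) else 0)) = ennreal (2 * l powr (1 - e) / (1 - e))"
proof -
 define f where "f z = (if \<bar>z\<bar> \<le> l then ennreal (\<bar>z\<bar> powr (- e)) else 0)" for z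
 have [measurable]: "f \<in> bm" unfolding f_def by measurable
 have f_minus: "f (- z) = f z" for z by (simp add: f_def)
 have half: "(NN z. indicator {0..} z * f z) = ennreal (l powr (1 - e) / (1 - e))"
 proof -
  have "(NN z. indicator {0..} z * f z) = (NN z. indicator {0..l} z * ennreal (z powr (- e)))"
   by (intro nn_integral_cong) (auto simp: indicator_def f_def)
  then show ?thesis using nn_integral_powr_from_0[of "- e" l] e l by simp
 qed
 have neg: "(NN z. indicator {..<0} z * f z) = (NN z. indicator {0..} z * f z)"
 proof -
  have "(NN z. indicator {..<0} z * f z) = ennreal \<bar>-1\<bar> * (NN z. indicator {..<0} (0 + (-1) * z) * f (0 + (-1) * z))"
   by (rule nn_integral_real_affine) measurable
  also have "... = (NN z. indicator {..<0} (- z) * f z)" by (simp add: f_minus)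
  also have "... = (NN z. indicator {0..} z * f z)"
   by (intro nn_integral_cong_AE eventually_mono[OF AE_lborel_singleton[of 0]]) (auto simp: indicator_def)
  finally show ?thesis .
 qed
 have "(NN t'. (if \<bar>t - t'\<bar> \<le> l then ennreal (\<bar>t - t'\<bar> powr (- e)) else 0)) = (NN z. f z)"
  unfolding f_def[symmetric] by (subst (2) nn_integral_real_affine[where c="-1" and t=t]) auto
 also have "... = (NN z. indicator {..<0} z * f z + indicator {0..} z * f z)"
  by (intro nn_integral_cong) (auto simp: indicator_def)
 also have "... = (NN z. indicator {..<0} z * f z) + (NN z. indicator {0..} z * f z)"
  by (rule nn_integral_add) measurable
 also have "... = ennreal (2 * l powr (1 - e) / (1 - e))" unfolding neg half using e by (simp flip: ennreal_plus)
 finally show ?thesis .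
qed

text \<open>Young's inequality below the critical exponent: \<open>de < 2 * rh\<close> makes the
  power \<open>1/(2 * rh)\<close> of the cut kernel integrable. Hoelder with weights
  \<open>1 - 2 * rh\<close> and \<open>2 * rh\<close> splits off \<open>n t * n t'\<close>; the
  other factor, the kernel times the root of \<open>n t * n t'\<close>, is integrated by means of
  the arithmetic-geometric mean.\<close>

lemma Young_time:
 fixes n :: "real \<Rightarrow> ennreal"
 assumes [measurable]: "n \<in> bm"
  and rh: "0 < rh" "rh < 1/2" and de: "0 \<le> de" "de < 2 * rh" and l: "0 < l"
 shows "(NN t. NN t'. (if \<bar>t - t'\<bar> \<le> l then ennreal (\<bar>t - t'\<bar> powr (- de)) else 0) * (enn_powr (n t) (1 - rh) * enn_powr (n t') (1 - rh)))
  \<le> ennreal ((2 * l powr (1 - de / (2 * rh)) / (1 - de / (2 * rh))) powr (2 * rh)) * enn_powr (NN t. n t) (2 * (1 - rh))"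
proof -
 define e where "e = de / (2 * rh)"
 have e: "0 \<le> e" "e < 1" using rh de by (auto simp: e_def)
 define k where "k t t' = (if \<bar>t - t'\<bar> \<le> l then ennreal (\<bar>t - t'\<bar> powr (- e)) else 0)" for t t'
 have [measurable]: "jm k" unfolding k_def split_beta' by measurable
 define f where "f p = n (fst p) * n (snd p)" for p
 define g where "g p = k (fst p) (snd p) * (enn_powr (n (fst p)) (1/2) * enn_powr (n (snd p)) (1/2))" for p
 have [measurable]: "f \<in> borel_measurable (lborel \<Otimes>\<^sub>M lborel)" "g \<in> borel_measurable (lborel \<Otimes>\<^sub>M lborel)"
  unfolding f_def g_def by measurable
 let ?w = "1 - 2 * rh"
 let ?I = "NN t. n t"
 let ?M = "2 * l powr (1 - e) / (1 - e)"
 have k_int: "(NN t'. k t t') = ennreal ?M" for t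
  unfolding k_def using nn_integral_powr_ball[OF e(2), of l t] l by simp
 have k_sym: "k t t' = k t' t" for t t' unfolding k_def abs_minus_commute[of t t'] ..
 have "(NN t. NN t'. (if \<bar>t - t'\<bar> \<le> l then ennreal (\<bar>t - t'\<bar> powr (- de)) else 0) * (enn_powr (n t) (1 - rh) * enn_powr (n t') (1 - rh)))
  = (NN t. NN t'. enn_powr (f (t, t')) ?w * enn_powr (g (t, t')) (1 - ?w))"
 proof (intro nn_integral_cong)
  fix t t' :: real
  have 1: "(if \<bar>t - t'\<bar> \<le> l then ennreal (\<bar>t - t'\<bar> powr (- de)) else 0) = enn_powr (k t t') (2 * rh)"
   using rh by (auto simp: k_def enn_powr_ennreal powr_powr e_def)
  have 2: "enn_powr (n t) (1 - rh) = enn_powr (n t) ?w * enn_powr (enn_powr (n t) (1/2)) (2 * rh)" for t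
   unfolding enn_powr_enn_powr enn_powr_add using rh by simp
  show "(if \<bar>t - t'\<bar> \<le> l then ennreal (\<bar>t - t'\<bar> powr (- de)) else 0) * (enn_powr (n t) (1 - rh) * enn_powr (n t') (1 - rh))
   = enn_powr (f (t, t')) ?w * enn_powr (g (t, t')) (1 - ?w)"
   unfolding 1 2[of t] 2[of t'] f_def g_def by (simp add: enn_powr_mult mult_ac)
 qed
 also have "... = (\<integral>\<^sup>+p. enn_powr (f p) ?w * enn_powr (g p) (1 - ?w) \<partial>(lborel \<Otimes>\<^sub>M lborel))"
  by (rule lborel.nn_integral_fst) measurable
 also have "... \<le> enn_powr (\<integral>\<^sup>+p. f p \<partial>(lborel \<Otimes>\<^sub>M lborel)) ?w * enn_powr (\<integral>\<^sup>+p. g p \<partial>(lborel \<Otimes>\<^sub>M lborel)) (1 - ?w)"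
  using rh by (intro nn_integral_Hoelder) auto
 also have "(\<integral>\<^sup>+p. f p \<partial>(lborel \<Otimes>\<^sub>M lborel)) = enn_powr ?I 2"
 proof -
  have "(\<integral>\<^sup>+p. f p \<partial>(lborel \<Otimes>\<^sub>M lborel)) = (NN t. NN t'. n t * n t')"
   by (subst lborel.nn_integral_fst[symmetric]) (auto simp: f_def)
  also have "... = ?I * ?I" by (simp add: nn_integral_cmult nn_integral_multc)
  also have "... = enn_powr ?I 2" using enn_powr_add[of ?I 1 1] by simp
  finally show ?thesis .
 qed
 also have "enn_powr (\<integral>\<^sup>+p. g p \<partial>(lborel \<Otimes>\<^sub>M lborel)) (1 - ?w) \<le> enn_powr (ennreal ?M * ?I) (2 * rh)"
 proof -
  have "(\<integral>\<^sup>+p. g p \<partial>(lborel \<Otimes>\<^sub>M lborel)) \<le> ennreal ?M * ?I"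
  proof -
   have "(\<integral>\<^sup>+p. g p \<partial>(lborel \<Otimes>\<^sub>M lborel)) = (NN t. NN t'. k t t' * (enn_powr (n t) (1/2) * enn_powr (n t') (1/2)))"
    by (subst lborel.nn_integral_fst[symmetric]) (auto simp: g_def)
   also have "... \<le> (NN t. NN t'. ennreal (1/2) * (k t t' * n t) + ennreal (1/2) * (k t t' * n t'))"
   proof (rule nn_integral_mono, rule nn_integral_mono)
    fix t t' :: real
    have "k t t' * (enn_powr (n t) (1/2) * enn_powr (n t') (1/2)) \<le> k t t' * (ennreal (1/2) * n t + ennreal (1/2) * n t')"
     using Young_enn_powr[of "1/2" "n t" "n t'"] by (intro mult_left_mono) auto
    then show "k t t' * (enn_powr (n t) (1/2) * enn_powr (n t') (1/2)) \<le> ennreal (1/2) * (k t t' * n t) + ennreal (1/2) * (k t t' * n t')"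
     by (simp add: distrib_left mult_ac)
   qed
   also have "... = ennreal (1/2) * (NN t. NN t'. k t t' * n t) + ennreal (1/2) * (NN t. NN t'. k t t' * n t')"
    by (simp add: nn_integral_add nn_integral_cmult)
   also have "(NN t. NN t'. k t t' * n t') = (NN t'. NN t. k t t' * n t')" by (rule lborel_pair.Fubini') measurable
   also have "... = (NN t. NN t'. k t t' * n t)" by (subst k_sym) simp
   also have "(NN t. NN t'. k t t' * n t) = ennreal ?M * ?I"
    by (simp add: nn_integral_multc k_int nn_integral_cmult)
   also have "ennreal (1/2) * (ennreal ?M * ?I) + ennreal (1/2) * (ennreal ?M * ?I) = ennreal ?M * ?I"
   proof -
    have "ennreal (1/2) + ennreal (1/2) = ennreal (1/2 + 1/2)" by (rule ennreal_plus[symmetric]) auto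
    also have "... = 1" by (simp only: field_sum_of_halves ennreal_1)
    finally show ?thesis unfolding distrib_right[symmetric] by simp
   qed
   finally show ?thesis .
  qed
  then show ?thesis using rh by (simp add: enn_powr_mono)
 qed
 also have "enn_powr (enn_powr ?I 2) ?w * enn_powr (ennreal ?M * ?I) (2 * rh) = ennreal (?M powr (2 * rh)) * (enn_powr ?I (2 * ?w) * enn_powr ?I (2 * rh))"
  using e by (simp add: enn_powr_mult enn_powr_enn_powr enn_powr_ennreal mult_ac)
 also have "enn_powr ?I (2 * ?w) * enn_powr ?I (2 * rh) = enn_powr ?I (2 * (1 - rh))"
  unfolding enn_powr_add by (simp add: algebra_simps)
 finally show ?thesis unfolding e_def by (simp add: mult_left_mono)
qed

section \<open>Duhamel pieces with lags in a bounded range\<close>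

definition lagcut :: "real \<Rightarrow> real \<Rightarrow> (real \<Rightarrow> 'a \<Rightarrow> complex) \<Rightarrow> real \<Rightarrow> real \<Rightarrow> 'a \<Rightarrow> complex" where
 "lagcut c c' G t s y = (if c < s - t \<and> s - t \<le> c' then G s y else 0)"

definition Duh :: "real \<Rightarrow> real \<Rightarrow> ('n::finite evol) \<Rightarrow> 'n evol" where
 "Duh c c' G t x = (LBINT s. U (t - s) (lagcut c c' G t s) x)"

lemma borel_measurable_lagcut [measurable]:
 fixes G :: "'n::finite evol"
 assumes [measurable]: "jm G"
  "t \<in> borel_measurable M" "s \<in> borel_measurable M" "y \<in> borel_measurable M"
 shows "(\<lambda>z. lagcut c c' G (t z) (s z) (y z)) \<in> borel_measurable M" unfolding lagcut_def by measurable

lemma borel_measurable_Duh [measurable]: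
 fixes G :: "'n::finite evol"
 assumes [measurable]: "jm G"
  "t \<in> borel_measurable M" "x \<in> borel_measurable M"
 shows "(\<lambda>z. Duh c c' G (t z) (x z)) \<in> borel_measurable M"
proof -
 have "(\<lambda>(z, s). U (t z - s) (lagcut c c' G (t z) s) (x z)) \<in> borel_measurable (M \<Otimes>\<^sub>M lborel)"
  by measurable
 then show ?thesis unfolding Duh_def by (rule lborel.borel_measurable_lebesgue_integral)
qed

lemma disp_antimono: "0 < a \<Longrightarrow> a \<le> \<bar>b\<bar> \<Longrightarrow> disp d b \<le> disp d a"
 unfolding disp_def by (intro powr_mono2') auto

lemma nn_integral_norm_U_le:
 fixes f :: "'n::finite wave"
 assumes [measurable]: "f \<in> bm"
 shows "ennreal (cmod (U ta f x)) \<le> ennreal (disp CARD('n) ta) * L1 f"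
proof -
 have "ennreal (cmod (U ta f x)) \<le> (NN y. ennreal (cmod (K ta (x - y) * f y)))"
  unfolding U_def by (rule ennreal_norm_integral_le)
 also have "... \<le> (NN y. ennreal (disp CARD('n) ta) * ennreal (cmod (f y)))"
  by (intro nn_integral_mono) (auto simp: norm_mult simp flip: ennreal_mult intro!: ennreal_leI mult_right_mono norm_K_le)
 also have "... = ennreal (disp CARD('n) ta) * L1 f" by (rule nn_integral_cmult) measurable
 finally show ?thesis .
qed

text \<open>The kernel is largest at the shortest lag \<open>c\<close>, the forcing at the earliest
  time \<open>t + c\<close>, and the lags fill a range of length \<open>c' - c\<close>.\<close>

lemma nn_integral_Duh_le:
 fixes G :: "'n::finite evol"
 assumes [measurable]: "jm G"
  and L1: "\<And>s. L1 (G s) \<le> ennreal (B1 * exp (- mu * s))"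
  and c: "0 < c" "c \<le> c'" and mu: "0 \<le> mu" and B1: "0 \<le> B1"
 shows "(NN s. ennreal (cmod (U (t - s) (lagcut c c' G t s) x))) \<le> ennreal (disp CARD('n) c * (c' - c) * B1 * exp (- mu * (t + c)))"
proof -
 have [measurable]: "G s \<in> bm" for s by measurable
 have "(NN s. ennreal (cmod (U (t - s) (lagcut c c' G t s) x))) \<le> (NN s. ennreal (disp CARD('n) c * B1 * exp (- mu * (t + c))) * indicator {t + c<..t + c'} s)"
 proof (rule nn_integral_mono)
  fix s
  show "ennreal (cmod (U (t - s) (lagcut c c' G t s) x)) \<le> ennreal (disp CARD('n) c * B1 * exp (- mu * (t + c))) * indicator {t + c<..t + c'} s"
  proof (cases "c < s - t \<and> s - t \<le> c'")
   case True
   then have "lagcut c c' G t s = G s" by (auto simp: lagcut_def fun_eq_iff)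
   then have "ennreal (cmod (U (t - s) (lagcut c c' G t s) x)) \<le> ennreal (disp CARD('n) (t - s)) * L1 (G s)"
    using nn_integral_norm_U_le[of "G s" "t - s" x] by simp
   also have "... \<le> ennreal (disp CARD('n) c) * ennreal (B1 * exp (- mu * s))"
    using True c by (intro mult_mono ennreal_leI disp_antimono L1) auto
   also have "... \<le> ennreal (disp CARD('n) c) * ennreal (B1 * exp (- mu * (t + c)))"
    using True mu B1 by (intro mult_left_mono ennreal_leI) (auto intro!: mult_left_mono)
   finally show ?thesis using True B1 by (simp add: indicator_def mult.assoc flip: ennreal_mult)
  next
   case False
   then have "lagcut c c' G t s = (\<lambda>_. 0)" by (auto simp: lagcut_def fun_eq_iff)
   then show ?thesis by simp
  qed
 qed
 also have "... = ennreal (disp CARD('n) c * B1 * exp (- mu * (t + c))) * ennreal (c' - c)"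
  using c by (subst nn_integral_cmult_indicator) auto
 also have "... = ennreal (disp CARD('n) c * (c' - c) * B1 * exp (- mu * (t + c)))"
  using c B1 by (simp add: mult_ac flip: ennreal_mult)
 finally show ?thesis .
qed

lemma Duh_sup:
 fixes G :: "'n::finite evol"
 assumes meas: "jm G"
  and L1: "\<And>s. L1 (G s) \<le> ennreal (B1 * exp (- mu * s))"
  and c: "0 < c" "c \<le> c'" and mu: "0 \<le> mu" and B1: "0 \<le> B1"
 shows "cmod (Duh c c' G t x) \<le> disp CARD('n) c * (c' - c) * B1 * exp (- mu * (t + c))"
proof -
 have "ennreal (cmod (Duh c c' G t x)) \<le> (NN s. ennreal (cmod (U (t - s) (lagcut c c' G t s) x)))"
  unfolding Duh_def by (rule ennreal_norm_integral_le)
 also have "... \<le> ennreal (disp CARD('n) c * (c' - c) * B1 * exp (- mu * (t + c)))"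
  by (rule nn_integral_Duh_le[OF meas L1 c mu B1])
 finally show ?thesis using B1 c by (subst (asm) ennreal_le_iff) auto
qed

lemma nn_integral_exp_tail:
 assumes "0 < b"
 shows "(NN s. ennreal (exp (- b * s)) * indicator {a..} s) = ennreal (exp (- b * a) / b)"
proof -
 have "(NN s. ennreal (exp (- b * s)) * indicator {a..} s) = ennreal (0 - (- exp (- b * a) / b))"
 proof (rule nn_integral_FTC_atLeast)
  show "((\<lambda>s. - exp (- b * s) / b) has_real_derivative exp (- b * x)) (at x)" for x
   using assms by (auto intro!: derivative_eq_intros)
  have "((\<lambda>s. exp (- b * s)) \<longlongrightarrow> 0) at_top"
   using assms by (intro filterlim_compose[OF exp_at_bot] filterlim_tendsto_neg_mult_at_bot[of _ "- b"] filterlim_ident tendsto_const) auto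
  then have "((\<lambda>s. - (exp (- b * s)) / b) \<longlongrightarrow> - 0/b) at_top"
   using assms by (intro tendsto_intros) auto
  then show "((\<lambda>s. - exp (- b * s) / b) \<longlongrightarrow> 0) at_top" by simp
 qed auto
 then show ?thesis by simp
qed

text \<open>Duality with the extremal test function \<open>W\<close>. Its pairing with the truncated
  piece is \<open>Z\<close>, the integral of the power \<open>1/rh\<close> of the spatial norms.
  Transposed, the same number pairs \<open>G\<close> with a propagated \<open>W\<close>, which
  \<open>energy\<close> and \<open>Young_time\<close> bound in L2 at each \<open>s\<close>. The
  outcome \<open>Z \<le> H * Z powr (1 - rh)\<close> may be divided by the power on the right
  because the cut to bounded \<open>t\<close> and \<open>x\<close> makes \<open>Z\<close>
  finite.\<close>

lemma piece_mixed_truncated: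
 fixes G :: "'n::finite evol" and R :: real
 assumes meas[measurable]: "jm G"
  and L1: "\<And>s. L1 (G s) \<le> ennreal (B1 * exp (- mu * s))"
  and L2: "\<And>s. Lx (1/2) (G s) \<le> ennreal (B2 * exp (- mu * s))"
  and c: "0 < c" "c < c'" and mu: "0 < mu" and B: "0 \<le> B1" "0 \<le> B2"
  and al: "0 < al" "al < 1/2" and rh: "0 < rh" "rh < 1/2" and de: "de = delta CARD('n) al" "de < 2 * rh"
  and TR: "t0 \<le> T"
 defines "uc \<equiv> \<lambda>t x. if t0 \<le> t \<and> t \<le> T \<and> norm x \<le> R then Duh c c' G t x else 0"
 shows "Lnorm lborel rh (\<lambda>t. Lx al (uc t))
  \<le> ennreal (sqrt (Cdisp al) * (2 / (1 - de / (2 * rh))) powr rh * (c' - c) powr (1 - de/2) * B2 * (rh/mu) powr rh * exp (- mu * (t0 + c)))"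
proof -
 define A where "A = 1/al"
 define q where "q = 1/rh"
 have A: "2 < A" and q: "2 < q" using al rh by (auto simp: A_def q_def field_simps)
 have de0: "0 < de" using al by (simp add: de delta_def)
 have e: "0 < 1 - de / (2 * rh)" using de rh by (simp add: field_simps)
 have [measurable]: "jm uc" unfolding uc_def split_beta' by measurable
 define X where "X = disp CARD('n) c * (c' - c) * B1 * exp (- mu * (t0 + c))"
 have X0: "0 \<le> X" using c B by (auto simp: X_def)
 have uX: "cmod (uc t x) \<le> X * indicator (cball 0 R) x" for t x
 proof (cases "t0 \<le> t \<and> t \<le> T \<and> norm x \<le> R")
  case True
  have "cmod (Duh c c' G t x) \<le> disp CARD('n) c * (c' - c) * B1 * exp (- mu * (t + c))"
   using c mu B by (intro Duh_sup[OF meas L1]) auto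
  also have "... \<le> X" unfolding X_def using True c mu B by (intro mult_left_mono) auto
  finally show ?thesis using True by (simp add: uc_def)
 qed (use X0 in \<open>auto simp: uc_def\<close>)
 have im: "(indicator (cball 0 R) :: 'n wave) \<in> bm"
  by (intro borel_measurable_indicator) auto
 define bR where "bR = Lx al (\<lambda>x::real^'n. indicator (cball 0 R) x)"
 have bR: "bR < top"
 proof -
  have "(NN (x::real^'n). enn_powr (ennreal (cmod (indicator (cball 0 R) x))) (1/al)) = (NN (x::real^'n). indicator (cball 0 R) x)"
   by (intro nn_integral_cong) (auto simp: indicator_def)
  also have "... < top" using emeasure_lborel_cball_finite[of "0::real^'n" R] by simp
  finally show ?thesis unfolding bR_def Lx_pos[OF al(1)] by (simp add: less_top[symmetric])
 qed
 have ubR: "Lx al (uc t) \<le> ennreal X * bR" for t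
 proof -
  have "Lx al (uc t) \<le> Lx al (\<lambda>x::real^'n. complex_of_real X * indicator (cball 0 R) x)"
  proof (rule Lx_mono[OF al(1)])
   show "cmod (uc t x) \<le> cmod (complex_of_real X * indicator (cball 0 R) x)" for x
    using uX[of t x] X0 by (cases "norm x \<le> R") (auto simp: norm_mult)
  qed
  also have "... = ennreal X * bR"
  proof -
   have "(indicator (cball 0 R) :: 'n wave) \<in> bm"
    by (intro borel_measurable_indicator) auto
   then show ?thesis using al X0 unfolding bR_def by (subst Lx_cmult) auto
  qed
  finally show ?thesis .
 qed
 \<comment> \<open>A real-valued norm: it is finite and bounded by \<open>Nm\<close>, since the
   truncated piece is bounded with support in a ball.\<close>
 define N where "N t = enn2real (Lx al (uc t))" for t
 define Nm where "Nm = enn2real (ennreal X * bR)"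
 have XbR: "ennreal X * bR < top" using bR by (simp add: ennreal_mult_less_top)
 have N_eq: "Lx al (uc t) = ennreal (N t)" for t using le_less_trans[OF ubR XbR, of t] by (simp add: N_def)
 have N0: "0 \<le> N t" for t by (simp add: N_def)
 have Nm: "N t \<le> Nm" for t unfolding N_def Nm_def using XbR by (intro enn2real_mono ubR) auto
 have N_out: "N t = 0" if "\<not> (t0 \<le> t \<and> t \<le> T)" for t
 proof -
  have "uc t = (\<lambda>_. 0)" using that by (auto simp: uc_def)
  then show ?thesis using al by (simp add: N_def)
 qed
 have [measurable]: "N \<in> bm" unfolding N_def using al by measurable
 \<comment> \<open>The extremiser of the mixed norm: in the dual Lebesgue space its norm at time
   \<open>t\<close> is \<open>N t powr (q - 1)\<close>, and its product with \<open>uc\<close>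
   integrates to \<open>N t powr q\<close>.\<close>
 define W where "W t x = complex_of_real (N t powr (q - A) * cmod (uc t x) powr (A - 2)) * cnj (uc t x)" for t x
 have [measurable]: "jm W" unfolding W_def split_beta' by measurable
 have pw: "v powr (A - 2) * v = v powr (A - 1)" if "0 \<le> v" for v :: real
  using that powr_add[of v "A - 2" 1] by (cases "v = 0") auto
 have pw2: "v powr (A - 2) * v\<^sup>2 = v powr A" if "0 \<le> v" for v :: real
  using that powr_add[of v "A - 2" 2] by (cases "v = 0") (auto simp: powr_sq)
 have pwN: "N t powr (q - A) * N t powr (A - 1) = N t powr (q - 1)" for t by (simp flip: powr_add)
 have LW: "Lx (1 - al) (W t) = ennreal (N t powr (q - 1))" for t
 proof -
  have "cmod (W t x) = N t powr (q - A) * cmod (uc t x) powr (A - 1)" for x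
   using pw[of "cmod (uc t x)"] by (simp add: W_def norm_mult mult.assoc)
  then have "Lx (1 - al) (W t) = Lnorm lborel (1 - al) (\<lambda>x. ennreal (N t powr (q - A)) * enn_powr (ennreal (cmod (uc t x))) (A - 1))"
   by (simp add: Lx_def enn_powr_ennreal ennreal_mult)
  also have "... = ennreal (N t powr (q - A)) * enn_powr (Lnorm lborel ((1 - al) / (A - 1)) (\<lambda>x. ennreal (cmod (uc t x)))) (A - 1)"
   using al A by (subst Lnorm_cmult) (auto simp: Lnorm_enn_powr)
  also have "(1 - al) / (A - 1) = al" using al by (simp add: A_def field_simps)
  also have "Lnorm lborel al (\<lambda>x. ennreal (cmod (uc t x))) = ennreal (N t)"
   using N_eq[of t] by (simp add: Lx_def)
  finally show ?thesis using N0[of t] pwN[of t] by (simp add: enn_powr_ennreal flip: ennreal_mult)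
 qed
 have W_out: "W t x = 0" if "\<not> (t0 \<le> t \<and> t \<le> T \<and> norm x \<le> R)" for t x
  using that by (auto simp: W_def uc_def)
 have W1: "L1 (W t) \<le> ennreal (Nm powr (q - 1)) * bR" for t
 proof -
  have "L1 (W t) = (NN x. ennreal (cmod (W t x * indicator (cball 0 R) x)))"
   by (intro nn_integral_cong) (auto simp: indicator_def W_out)
  also have "... \<le> Lx (1 - al) (W t) * Lx (1 - (1 - al)) (\<lambda>x::real^'n. indicator (cball 0 R) x)"
   using al by (intro nn_integral_mult_le_Lx im) auto
  also have "... \<le> ennreal (Nm powr (q - 1)) * bR"
   unfolding LW bR_def using q N0 Nm by (intro mult_mono ennreal_leI powr_mono2) auto
  finally show ?thesis .
 qed
 have W2: "(NN t x. ennreal (cmod (W t x))) < \<infinity>"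
 proof -
  have "(NN t x. ennreal (cmod (W t x))) \<le> (NN t. ennreal (Nm powr (q - 1)) * bR * indicator {t0..T} t)"
   using W1 by (intro nn_integral_mono) (auto simp: indicator_def W_out)
  also have "... = ennreal (Nm powr (q - 1)) * bR * ennreal (T - t0)"
   using TR by (subst nn_integral_cmult_indicator) auto
  also have "... < \<infinity>" using bR by (simp add: ennreal_mult_less_top)
  finally show ?thesis .
 qed
 let ?P = "lborel \<Otimes>\<^sub>M lborel :: (real \<times> (real^'n)) measure"
 have P: "sigma_finite_measure ?P" by (rule sigma_finite_pair_measure; rule lborel.sigma_finite_measure_axioms)
 have iW: "integrable ?P (\<lambda>z. W (fst z) (snd z))" by (rule integrable_pair_lborel[OF _ W2]) measurable
 \<comment> \<open>Only the forcing at times within reach of \<open>t0\<close> to \<open>T\<close>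
   enters; cutting off the rest makes \<open>G'\<close> integrable in space-time.\<close>
 define G' where "G' s y = (if t0 + c < s \<and> s \<le> T + c' then G s y else 0)" for s y
 have [measurable]: "jm G'" unfolding G'_def split_beta' by measurable
 have iG': "integrable ?P (\<lambda>p. G' (fst p) (snd p))"
 proof (rule integrable_pair_lborel)
  have "(NN s y. ennreal (cmod (G' s y))) \<le> (NN s. ennreal (B1 * exp (- mu * (t0 + c))) * indicator {t0 + c<..T + c'} s)"
  proof (rule nn_integral_mono)
   fix s
   show "L1 (G' s) \<le> ennreal (B1 * exp (- mu * (t0 + c))) * indicator {t0 + c<..T + c'} s"
   proof (cases "t0 + c < s \<and> s \<le> T + c'")
    case True
    then have "L1 (G' s) \<le> ennreal (B1 * exp (- mu * s))"
     using L1[of s] by (simp add: G'_def)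
    also have "... \<le> ennreal (B1 * exp (- mu * (t0 + c)))"
     using True mu B by (intro ennreal_leI mult_left_mono) auto
    finally show ?thesis using True by simp
   next
    case False
    then have "G' s = (\<lambda>_. 0)" by (auto simp: G'_def fun_eq_iff)
    then show ?thesis by simp
   qed
  qed
  also have "... = ennreal (B1 * exp (- mu * (t0 + c))) * ennreal (T + c' - (t0 + c))"
   using TR c by (subst nn_integral_cmult_indicator) auto
  also have "... < \<infinity>" by (simp add: ennreal_mult_less_top)
  finally show "(NN s y. ennreal (cmod (G' s y))) < \<infinity>" .
 qed measurable
 define k where "k z p = (if c < fst p - fst z \<and> fst p - fst z \<le> c' then K (fst z - fst p) (snd z - snd p) else 0)"
  for z p :: "real \<times> (real^'n)"
 have [measurable]: "(\<lambda>z. k (f z) (g z)) \<in> borel_measurable M"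
  if [measurable]: "f \<in> M \<rightarrow>\<^sub>M borel \<Otimes>\<^sub>M borel" "g \<in> M \<rightarrow>\<^sub>M borel \<Otimes>\<^sub>M borel" for f g and M :: "'z measure"
  unfolding k_def by measurable
 have kD: "cmod (k z p) \<le> disp CARD('n) c" for z p
 proof (cases "c < fst p - fst z \<and> fst p - fst z \<le> c'")
  case True
  then have "disp CARD('n) (fst z - fst p) \<le> disp CARD('n) c" using c by (intro disp_antimono) auto
  then show ?thesis using True norm_K_le[of "fst z - fst p" "snd z - snd p"] by (simp add: k_def)
 qed (auto simp: k_def)
 have km: "(\<lambda>(z, p). k z p) \<in> borel_measurable (?P \<Otimes>\<^sub>M ?P)" by measurable
 note F = Fubini_bounded_kernel[OF P P iW iG' km kD]
 have u_eq: "(\<integral>p. k z p * G' (fst p) (snd p) \<partial>?P) = Duh c c' G (fst z) (snd z)" if "t0 \<le> fst z" "fst z \<le> T" for z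
 proof -
  have "integrable ?P (\<lambda>p. k z p * G' (fst p) (snd p))"
  proof (rule integrable_bounded_mult[OF iG' _ kD])
   show "k z \<in> borel_measurable ?P" unfolding k_def by measurable
  qed
  then have "(\<integral>p. k z p * G' (fst p) (snd p) \<partial>?P) = (\<integral>s. \<integral>y. k z (s, y) * G' s y \<partial>lborel \<partial>lborel)"
   by (subst lborel_pair.integral_fst'[symmetric]) auto
  moreover have "k z (s, y) * G' s y = K (fst z - s) (snd z - y) * lagcut c c' G (fst z) s y" for s y
   using that by (auto simp: k_def G'_def lagcut_def)
  ultimately show ?thesis by (simp add: Duh_def U_def)
 qed
 define w where "w t x = N t powr (q - A) * cmod (uc t x) powr A" for t x
 have Wu: "W (fst z) (snd z) * (\<integral>p. k z p * G' (fst p) (snd p) \<partial>?P) = complex_of_real (w (fst z) (snd z))" for z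
 proof (cases "t0 \<le> fst z \<and> fst z \<le> T \<and> norm (snd z) \<le> R")
  case True
  let ?v = "uc (fst z) (snd z)"
  have v: "Duh c c' G (fst z) (snd z) = ?v" using True by (simp add: uc_def)
  have "W (fst z) (snd z) * ?v = complex_of_real (N (fst z) powr (q - A) * cmod ?v powr (A - 2)) * (?v * cnj ?v)"
   by (simp add: W_def)
  also have "... = complex_of_real (N (fst z) powr (q - A) * (cmod ?v powr (A - 2) * (cmod ?v)\<^sup>2))"
   by (simp only: complex_norm_square[symmetric] of_real_mult mult.assoc)
  finally show ?thesis using True by (simp add: u_eq v w_def pw2)
 next
  case False
  then have "uc (fst z) (snd z) = 0" by (auto simp: uc_def)
  then show ?thesis by (simp add: W_def w_def)
 qed
 define Z where "Z = (NN t. ennreal (N t powr q))"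
 have wN: "(NN x. ennreal (w t x)) = ennreal (N t powr q)" for t
 proof -
  have "(NN x. ennreal (w t x)) = ennreal (N t powr (q - A)) * (NN x. ennreal (cmod (uc t x) powr A))"
   unfolding w_def by (subst ennreal_mult) (auto simp: nn_integral_cmult)
  also have "(NN x. ennreal (cmod (uc t x) powr A)) = enn_powr (Lx al (uc t)) A"
   using al by (simp add: Lx_pos enn_powr_enn_powr A_def enn_powr_ennreal)
  finally show ?thesis unfolding N_eq using N0 by (simp add: enn_powr_ennreal flip: ennreal_mult powr_add)
 qed
 have Zfin: "Z < top"
 proof -
  have "Z \<le> (NN t. ennreal (Nm powr q) * indicator {t0..T} t)" unfolding Z_def using q N0 Nm N_out
   by (intro nn_integral_mono) (auto simp: indicator_def intro!: ennreal_leI powr_mono2)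
  also have "... < top" using TR by (subst nn_integral_cmult_indicator) (auto simp: ennreal_mult_less_top)
  finally show ?thesis .
 qed
 \<comment> \<open>The transposed Duhamel operator applied to \<open>W\<close>: at time
   \<open>s\<close> it collects the earlier times \<open>t\<close> whose lag lies in the
   range.\<close>
 define V where "V s y = (\<integral>z. W (fst z) (snd z) * k z (s, y) \<partial>?P)" for s y
 have V_eq: "V s y = (LBINT t. U (t - s) (\<lambda>x. if c < s - t \<and> s - t \<le> c' then W t x else 0) y)" for s y
 proof -
  have "integrable ?P (\<lambda>z. k z (s, y) * W (fst z) (snd z))"
   by (rule integrable_bounded_mult[OF iW _ kD]) measurable
  then have "V s y = (\<integral>t. \<integral>x. W t x * k (t, x) (s, y) \<partial>lborel \<partial>lborel)"
   unfolding V_def by (subst lborel_pair.integral_fst'[symmetric]) (auto simp: mult.commute)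
  moreover have "W t x * k (t, x) (s, y) = K (t - s) (y - x) * (if c < s - t \<and> s - t \<le> c' then W t x else 0)" for t x
   using K_minus[of "t - s" "y - x"] by (simp add: k_def)
  ultimately show ?thesis by (simp add: U_def)
 qed
 \<comment> \<open>The mass of \<open>N powr q\<close> that reaches time \<open>s\<close>; the
   energy bound is a power of it.\<close>
 define Ms where "Ms s = (NN t. (if c < s - t \<and> s - t \<le> c' then ennreal (N t powr q) else 0))" for s
 define Y where "Y = (2 * (c' - c) powr (1 - de / (2 * rh)) / (1 - de / (2 * rh))) powr (2 * rh)"
 have VL2: "Lx (1/2) (V s) \<le> ennreal (sqrt (Cdisp al * Y)) * enn_powr (Ms s) (1 - rh)" for s
 proof -
  define Ws where "Ws t x = (if c < s - t \<and> s - t \<le> c' then W t x else 0)" for t x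
  define n where "n t = (if c < s - t \<and> s - t \<le> c' then ennreal (N t powr q) else 0)" for t
  have [measurable]: "n \<in> bm" unfolding n_def by measurable
  have LWs: "Lx (1 - al) (Ws t) = enn_powr (n t) (1 - rh)" for t
  proof (cases "c < s - t \<and> s - t \<le> c'")
   case True
   then have "Ws t = W t" by (auto simp: Ws_def fun_eq_iff)
   then show ?thesis using True rh N0[of t] by (simp add: LW n_def enn_powr_ennreal powr_powr q_def field_simps)
  next
   case False
   then have "Ws t = (\<lambda>_. 0)" by (auto simp: Ws_def fun_eq_iff)
   then show ?thesis using False al by (auto simp: n_def)
  qed
  have "enn_powr (Lx (1/2) (\<lambda>x. \<integral>t. U (t - s) (Ws t) x \<partial>lborel)) 2
   \<le> (NN t. NN t'. ennreal (Cdisp al * \<bar>t - t'\<bar> powr (- delta CARD('n) al)) * (Lx (1 - al) (Ws t) * Lx (1 - al) (Ws t')))"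
  proof (rule energy[where c=c])
   show "jm Ws" unfolding Ws_def by measurable
   have "(NN t x. ennreal (cmod (Ws t x))) \<le> (NN t x. ennreal (cmod (W t x)))"
    by (rule nn_integral_mono, rule nn_integral_mono) (simp add: Ws_def)
   then show "(NN t x. ennreal (cmod (Ws t x))) < \<infinity>" using W2 by (rule le_less_trans)
  qed (use c al in \<open>auto simp: Ws_def\<close>)
  \<comment> \<open>Two times that both have their lag to \<open>s\<close> between \<open>c\<close>
    and \<open>c'\<close> differ by at most \<open>c' - c\<close>; this is the cut of the kernel
    that \<open>Young_time\<close> wants.\<close>
  also have "... \<le> (NN t. NN t'. ennreal (Cdisp al) * ((if \<bar>t - t'\<bar> \<le> c' - c then ennreal (\<bar>t - t'\<bar> powr (- de)) else 0) * (enn_powr (n t) (1 - rh) * enn_powr (n t') (1 - rh))))"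
  proof (rule nn_integral_mono, rule nn_integral_mono)
   fix t t' :: real
   show "ennreal (Cdisp al * \<bar>t - t'\<bar> powr (- delta CARD('n) al)) * (Lx (1 - al) (Ws t) * Lx (1 - al) (Ws t'))
    \<le> ennreal (Cdisp al) * ((if \<bar>t - t'\<bar> \<le> c' - c then ennreal (\<bar>t - t'\<bar> powr (- de)) else 0) * (enn_powr (n t) (1 - rh) * enn_powr (n t') (1 - rh)))"
    unfolding LWs using Cdisp_pos[OF al(2)]
    by (cases "(c < s - t \<and> s - t \<le> c') \<and> (c < s - t' \<and> s - t' \<le> c')") (auto simp: n_def de ennreal_mult mult.assoc)
  qed
  also have "... = ennreal (Cdisp al) * (NN t. NN t'. (if \<bar>t - t'\<bar> \<le> c' - c then ennreal (\<bar>t - t'\<bar> powr (- de)) else 0) * (enn_powr (n t) (1 - rh) * enn_powr (n t') (1 - rh)))"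
   by (simp add: nn_integral_cmult)
  also have "... \<le> ennreal (Cdisp al) * (ennreal Y * enn_powr (NN t. n t) (2 * (1 - rh)))"
   unfolding Y_def using rh de de0 c by (intro mult_left_mono Young_time) auto
  also have "(NN t. n t) = Ms s" by (simp add: Ms_def n_def)
  finally have "enn_powr (Lx (1/2) (V s)) 2 \<le> ennreal (Cdisp al * Y) * enn_powr (Ms s) (2 * (1 - rh))"
   using Cdisp_pos[OF al(2)] by (simp add: V_eq[abs_def] Ws_def Y_def ennreal_mult mult.assoc)
  then have "Lx (1/2) (V s) \<le> enn_powr (ennreal (Cdisp al * Y) * enn_powr (Ms s) (2 * (1 - rh))) (1/2)"
   by (subst (asm) enn_powr_le_iff) auto
  also have "... = ennreal (sqrt (Cdisp al * Y)) * enn_powr (Ms s) (1 - rh)"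
  proof -
   have "2 * (1 - rh) * (1/2) = 1 - rh" by simp
   moreover have "enn_powr (ennreal (Cdisp al * Y)) (1/2) = ennreal (sqrt (Cdisp al * Y))"
    using Cdisp_pos[OF al(2)] by (subst enn_powr_ennreal) (auto simp: powr_half_sqrt Y_def)
   ultimately show ?thesis unfolding enn_powr_mult enn_powr_enn_powr by (simp only:)
  qed
  finally show ?thesis .
 qed
 define D where "D = sqrt (Cdisp al * Y) * B2"
 have D0: "0 \<le> D" using B Cdisp_pos[OF al(2)] by (auto simp: D_def Y_def)
 \<comment> \<open>\<open>E\<close> is the power \<open>1/rh\<close> of the decay of
   \<open>G\<close>, so that Hoelder in \<open>s\<close> with weights \<open>rh\<close> and
   \<open>1 - rh\<close> applies to \<open>E\<close> and \<open>Ms\<close>.\<close>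
 define E where "E s = ennreal (exp (- (mu/rh) * s)) * indicator {t0 + c..} s" for s
 have [measurable]: "E \<in> bm" "Ms \<in> bm" unfolding E_def Ms_def by measurable
 have [measurable]: "(\<lambda>z. V (f z) (g z)) \<in> borel_measurable M"
  if [measurable]: "f \<in> borel_measurable M" "g \<in> borel_measurable M" for f g and M :: "'z measure"
 proof -
  have "(\<lambda>(m, z). W (fst z) (snd z) * k z (f m, g m)) \<in> borel_measurable (M \<Otimes>\<^sub>M ?P)"
   by measurable
  then show ?thesis unfolding V_def by (rule sigma_finite_measure.borel_measurable_lebesgue_integral[OF P])
 qed
 have "Z = (NN t x. ennreal (w t x))" unfolding Z_def wN ..
 also have "... = (\<integral>\<^sup>+z. ennreal (w (fst z) (snd z)) \<partial>?P)"
 proof -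
  have [measurable]: "(\<lambda>z. w (fst z) (snd z)) \<in> borel_measurable ?P" unfolding w_def by measurable
  show ?thesis by (subst lborel.nn_integral_fst[symmetric]) auto
 qed
 also have "... = ennreal (\<integral>z. w (fst z) (snd z) \<partial>?P)"
 proof (rule nn_integral_eq_integral)
  show "integrable ?P (\<lambda>z. w (fst z) (snd z))"
   using F(3) unfolding Wu by (simp only: complex_of_real_integrable_eq)
 qed (simp add: w_def)
 also have "... = ennreal (cmod (\<integral>p. V (fst p) (snd p) * G' (fst p) (snd p) \<partial>?P))"
 proof -
  have "(\<integral>p. V (fst p) (snd p) * G' (fst p) (snd p) \<partial>?P) = complex_of_real (\<integral>z. w (fst z) (snd z) \<partial>?P)"
   using F(1) unfolding Wu integral_complex_of_real V_def by simp
  moreover have "0 \<le> (\<integral>z. w (fst z) (snd z) \<partial>?P)"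
   by (intro Bochner_Integration.integral_nonneg) (simp add: w_def)
  ultimately show ?thesis by simp
 qed
 also have "... \<le> (\<integral>\<^sup>+p. ennreal (cmod (V (fst p) (snd p) * G' (fst p) (snd p))) \<partial>?P)"
  by (rule ennreal_norm_integral_le)
 also have "... = (NN s y. ennreal (cmod (V s y * G' s y)))" by (subst lborel.nn_integral_fst[symmetric]) auto
 also have "... \<le> (NN s. ennreal D * (enn_powr (E s) rh * enn_powr (Ms s) (1 - rh)))"
 proof (rule nn_integral_mono)
  fix s
  show "(NN y. ennreal (cmod (V s y * G' s y))) \<le> ennreal D * (enn_powr (E s) rh * enn_powr (Ms s) (1 - rh))"
  proof (cases "t0 + c < s \<and> s \<le> T + c'")
   case True
   then have G's: "G' s = G s" by (auto simp: G'_def)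
   have "(NN y. ennreal (cmod (V s y * G' s y))) \<le> Lx (1/2) (V s) * Lx (1 - 1/2) (G s)"
    unfolding G's by (intro nn_integral_mult_le_Lx) auto
   also have "... \<le> (ennreal (sqrt (Cdisp al * Y)) * enn_powr (Ms s) (1 - rh)) * ennreal (B2 * exp (- mu * s))"
    using L2[of s] by (intro mult_mono VL2) auto
   also have "... = ennreal D * (ennreal (exp (- mu * s)) * enn_powr (Ms s) (1 - rh))"
    using B Cdisp_pos[OF al(2)] by (simp add: D_def Y_def ennreal_mult mult_ac)
   also have "ennreal (exp (- mu * s)) = enn_powr (E s) rh"
    using True rh by (simp add: E_def enn_powr_ennreal exp_powr_real)
   finally show ?thesis .
  qed (auto simp: G'_def)
 qed
 also have "... = ennreal D * (NN s. enn_powr (E s) rh * enn_powr (Ms s) (1 - rh))"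
  by (rule nn_integral_cmult) measurable
 also have "... \<le> ennreal D * (enn_powr (NN s. E s) rh * enn_powr (NN s. Ms s) (1 - rh))"
  using rh by (intro mult_left_mono nn_integral_Hoelder) auto
 also have "(NN s. E s) = ennreal (exp (- (mu/rh) * (t0 + c)) / (mu/rh))"
  unfolding E_def using mu rh by (intro nn_integral_exp_tail) auto
 \<comment> \<open>By Fubini each \<open>t\<close> is counted for a set of times \<open>s\<close> of
   length \<open>c' - c\<close>.\<close>
 also have "(NN s. Ms s) = ennreal (c' - c) * Z"
 proof -
  have "(NN s. Ms s) = (NN t s. (if c < s - t \<and> s - t \<le> c' then ennreal (N t powr q) else 0))"
   unfolding Ms_def by (rule lborel_pair.Fubini') measurable
  also have "... = (NN t s. ennreal (N t powr q) * indicator {t + c<..t + c'} s)"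
   by (intro nn_integral_cong) (auto simp: indicator_def)
  also have "... = (NN t. ennreal (N t powr q) * ennreal (c' - c))"
   using c by (intro nn_integral_cong) (subst nn_integral_cmult_indicator, auto)
  also have "... = ennreal (c' - c) * Z" unfolding Z_def by (subst nn_integral_multc) (auto simp: mult.commute)
  finally show ?thesis .
 qed
 finally have Zle: "Z \<le> ennreal D * (enn_powr (ennreal (exp (- (mu/rh) * (t0 + c)) / (mu/rh))) rh * enn_powr (ennreal (c' - c) * Z) (1 - rh))" .
 define H where "H = D * (c' - c) powr (1 - rh) * (rh/mu) powr rh * exp (- mu * (t0 + c))"
 have "exp (- (mu/rh) * (t0 + c)) / (mu/rh) = (rh/mu) * exp (- (mu/rh) * (t0 + c))" by simp
 then have "(exp (- (mu/rh) * (t0 + c)) / (mu/rh)) powr rh = (rh/mu) powr rh * exp (- mu * (t0 + c))"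
  using rh by (simp only: powr_mult exp_powr_real) simp
 then have "Z \<le> ennreal H * enn_powr Z (1 - rh)"
  using Zle c rh mu D0 by (simp add: enn_powr_mult enn_powr_ennreal H_def ennreal_mult mult_ac)
 moreover obtain z where z: "Z = ennreal z" "0 \<le> z" using Zfin by (cases Z) auto
 moreover have H0: "0 \<le> H" using D0 by (simp add: H_def)
 ultimately have "z \<le> H * z powr (1 - rh)" by (simp add: enn_powr_ennreal flip: ennreal_mult)
 \<comment> \<open>This is where the finiteness of \<open>Z\<close> is used: a positive finite
   \<open>z\<close> may be cancelled.\<close>
 have zH: "z powr rh \<le> H"
 proof (cases "z = 0")
  case False
  then have "0 < z" using z by simp
  have "z powr rh * z powr (1 - rh) = z" using \<open>0 < z\<close> by (simp flip: powr_add)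
  with \<open>z \<le> H * z powr (1 - rh)\<close> have "z powr rh * z powr (1 - rh) \<le> H * z powr (1 - rh)" by simp
  then show ?thesis using \<open>0 < z\<close> by (simp add: mult_le_cancel_right)
 qed (use H0 in simp)
 have "Lnorm lborel rh (\<lambda>t. Lx al (uc t)) = enn_powr Z rh"
  unfolding N_eq Z_def using rh N0 by (simp add: Lnorm_pos enn_powr_ennreal q_def)
 also have "... \<le> ennreal H" unfolding z(1) enn_powr_ennreal[OF z(2)] by (rule ennreal_leI[OF zH])
 \<comment> \<open>Powers of the lag length: \<open>rh - de/2\<close> from the root of
   \<open>Y\<close> and \<open>1 - rh\<close> from \<open>Ms\<close> add up to
   \<open>1 - de/2\<close>.\<close>
 also have "H = sqrt (Cdisp al) * (2 / (1 - de / (2 * rh))) powr rh * (c' - c) powr (1 - de/2) * B2 * (rh/mu) powr rh * exp (- mu * (t0 + c))"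
 proof -
  define l where "l = c' - c"
  define b where "b = 1 - de / (2 * rh)"
  have l: "0 < l" and b: "0 < b" using c e by (auto simp: l_def b_def)
  have "Y = ((2 * l powr b / b) powr rh)\<^sup>2"
   unfolding Y_def l_def[symmetric] b_def[symmetric] by (simp add: power2_eq_square flip: powr_add)
  then have "sqrt Y = (2 * l powr b / b) powr rh" by simp
  also have "... = (2/b) powr rh * l powr (b * rh)" using powr_mult[of "2/b" "l powr b" rh] by (simp add: powr_powr)
  also have "b * rh = rh - de/2" using rh by (simp add: b_def field_simps)
  finally have "sqrt Y = (2/b) powr rh * l powr (rh - de/2)" .
  moreover have "l powr (rh - de/2) * l powr (1 - rh) = l powr (1 - de/2)" by (simp flip: powr_add)
  ultimately have "sqrt Y * l powr (1 - rh) = (2/b) powr rh * l powr (1 - de/2)" by (simp add: mult.assoc)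
  moreover have "H = sqrt (Cdisp al) * (sqrt Y * l powr (1 - rh)) * B2 * (rh/mu) powr rh * exp (- mu * (t0 + c))"
   by (simp add: H_def D_def real_sqrt_mult l_def mult_ac)
  ultimately show ?thesis by (simp add: l_def b_def mult_ac)
 qed
 finally show ?thesis .
qed

lemma Lnorm_restrict:
 assumes "0 < p" "A \<in> sets lborel"
 shows "Lnorm (restrict_space lborel A) p F = Lnorm lborel p (\<lambda>s. F s * indicator A s)"
proof -
 have "(\<integral>\<^sup>+ x. enn_powr (F x) (1/p) \<partial>restrict_space lborel A) = (\<integral>\<^sup>+ x. enn_powr (F x) (1/p) * indicator A x \<partial>lborel)"
  using assms by (intro nn_integral_restrict_space) auto
 also have "... = (\<integral>\<^sup>+ x. enn_powr (F x * indicator A x) (1/p) \<partial>lborel)"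
  by (intro nn_integral_cong) (auto simp: indicator_def)
 finally show ?thesis using assms by (simp add: Lnorm_pos)
qed

lemma sigma_finite_restrict_lborel: "A \<in> sets lborel \<Longrightarrow> sigma_finite_measure (restrict_space lborel (A :: real set))"
 using sigma_finite_measure_restrict_space[OF lborel.sigma_finite_measure_axioms] .

text \<open>The truncations exhaust time and space; Fatou is used once in \<open>x\<close> and once
  in \<open>t\<close>.\<close>

lemma piece_mixed:
 fixes G :: "'n::finite evol"
 assumes meas[measurable]: "jm G"
  and L1: "\<And>s. L1 (G s) \<le> ennreal (B1 * exp (- mu * s))"
  and L2: "\<And>s. Lx (1/2) (G s) \<le> ennreal (B2 * exp (- mu * s))"
  and c: "0 < c" "c < c'" and mu: "0 < mu" and B: "0 \<le> B1" "0 \<le> B2"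
  and al: "0 < al" "al < 1/2" and rh: "0 < rh" "rh < 1/2" and de: "de = delta CARD('n) al" "de < 2 * rh"
 shows "Lnorm (restrict_space lborel {t0..}) rh (\<lambda>t. Lx al (Duh c c' G t))
  \<le> ennreal (sqrt (Cdisp al) * (2 / (1 - de / (2 * rh))) powr rh * (c' - c) powr (1 - de/2) * B2 * (rh/mu) powr rh * exp (- mu * (t0 + c)))"
  (is "_ \<le> ?X")
proof -
 define uc where "uc n t x = (if t0 \<le> t \<and> t \<le> t0 + real n \<and> norm x \<le> real n then Duh c c' G t x else 0)" for n t and x :: "real^'n"
 have [measurable]: "(\<lambda>z. uc n (f z) (g z)) \<in> borel_measurable M"
  if [measurable]: "f \<in> borel_measurable M" "g \<in> borel_measurable M" for f g n and M :: "'z measure"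
  unfolding uc_def by measurable
 have le: "Lnorm lborel rh (\<lambda>t. Lx al (uc n t)) \<le> ?X" for n
  unfolding uc_def[abs_def] by (rule piece_mixed_truncated[OF meas L1 L2 c mu B al rh de]) simp
 have "Lnorm (restrict_space lborel {t0..}) rh (\<lambda>t. Lx al (Duh c c' G t)) = Lnorm lborel rh (\<lambda>t. Lx al (Duh c c' G t) * indicator {t0..} t)"
  using rh by (intro Lnorm_restrict) auto
 also have "... \<le> liminf (\<lambda>n. Lnorm lborel rh (\<lambda>t. Lx al (uc n t)))"
 proof (rule Lnorm_Fatou[OF _ rh(1)])
  show "AE t in lborel. Lx al (Duh c c' G t) * indicator {t0..} t \<le> liminf (\<lambda>n. Lx al (uc n t))"
  proof (intro AE_I2)
   fix t
   show "Lx al (Duh c c' G t) * indicator {t0..} t \<le> liminf (\<lambda>n. Lx al (uc n t))"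
   proof (cases "t0 \<le> t")
    case True
    have "Lx al (Duh c c' G t) \<le> liminf (\<lambda>n. Lx al (uc n t))" unfolding Lx_def
    proof (rule Lnorm_Fatou[OF _ al(1)])
     show "AE x in lborel. ennreal (cmod (Duh c c' G t x)) \<le> liminf (\<lambda>n. ennreal (cmod (uc n t x)))"
     proof (intro AE_I2)
      fix x :: "real^'n"
      obtain m :: nat where m: "max (t - t0) (norm x) \<le> real m" using real_arch_simple by blast
      have "\<forall>\<^sub>F n in sequentially. ennreal (cmod (Duh c c' G t x)) \<le> ennreal (cmod (uc n t x))"
       using eventually_ge_at_top[of m]
      proof eventually_elim
       case (elim n)
       then have "real m \<le> real n" by simp
       then show ?case using m True by (simp add: uc_def)
      qed
      then show "ennreal (cmod (Duh c c' G t x)) \<le> liminf (\<lambda>n. ennreal (cmod (uc n t x)))"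
       by (rule Liminf_bounded)
     qed
    qed measurable
    then show ?thesis using True by simp
   qed simp
  qed
 qed (use al in measurable)
 also have "... \<le> liminf (\<lambda>n::nat. ?X)" by (intro Liminf_mono always_eventually allI le)
 finally show ?thesis by (simp add: Liminf_const)
qed

text \<open>In space the mixed bound is interpolated with the supremum bound. In time the supremum
  bound is an exponential, which on a half-line lies in every Lebesgue space: Hoelder raises the
  reciprocal time exponent by a free amount \<open>nu\<close>, and the norm of the exponential
  yields the factor \<open>mu powr (- nu)\<close>.\<close>

lemma piece_strichartz:
 fixes G :: "'n::finite evol"
 assumes meas[measurable]: "jm G"
  and L1: "\<And>s. L1 (G s) \<le> ennreal (B1 * exp (- mu * s))"
  and L2: "\<And>s. Lx (1/2) (G s) \<le> ennreal (B2 * exp (- mu * s))"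
  and c: "0 < c" and mu: "1 \<le> mu" and B: "0 \<le> B1" "0 \<le> B2"
  and th: "0 < th" "th < 1" and et: "0 < et" "et \<le> 1"
  and al: "0 < al" "et \<le> 1 - 2 * al" and rh: "0 < rh" "rh < 1/2" and de: "de = delta CARD('n) al" "et \<le> 1 - de / (2 * rh)"
  and nu: "et \<le> nu" "nu \<le> 1"
 shows "Ltx ((1 - th) * rh + nu) ((1 - th) * al) t0 (Duh c (2 * c) G)
  \<le> ennreal (16 / (et\<^sup>2 * th) * (B1 powr th * B2 powr (1 - th)) * c powr ((1 - th) * (1 - de/2) + th * (1 - real CARD('n) / 2))
    * exp (- mu * (t0 + c)) * mu powr (- et))"
proof -
 let ?d = "disp CARD('n) c * c" and ?E = "exp (- mu * (t0 + c))" and ?N = "(nu / (mu * th)) powr nu" and ?r = "de / (2 * rh)" and ?n = "real CARD('n)"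
 let ?u = "Duh c (2 * c) G"
 let ?M = "restrict_space lborel {t0..} :: real measure"
 have al2: "al < 1/2" using al et by simp
 have nu0: "0 < nu" using nu et by simp
 have de2: "de < 2 * rh"
 proof -
  have "?r < 1" using de(2) et by linarith
  then show ?thesis using rh by (simp add: field_simps)
 qed
 have de0: "0 \<le> de" using al2 by (simp add: de delta_def)
 define X where "X t = ?d * B1 * exp (- mu * (t + c))" for t
 have X0: "0 \<le> X t" for t using c B by (simp add: X_def)
 have uX: "cmod (?u t x) \<le> X t" for t x using Duh_sup[OF meas L1, of c "2 * c" t x] c mu B by (simp add: X_def)
 define Cp where "Cp = sqrt (Cdisp al) * (2 / (1 - ?r)) powr rh"
 let ?b = "Cp * c powr (1 - de/2) * B2"
 have D0: "0 < 1 - ?r" using de(2) et by linarith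
 have Cp0: "0 < Cp" unfolding Cp_def
 proof (intro mult_pos_pos)
  have "0 < 2 / (1 - ?r)" using D0 by (rule divide_pos_pos[rotated]) simp
  then show "0 < (2 / (1 - ?r)) powr rh" by (metis less_irrefl powr_gt_zero)
 qed (use Cdisp_pos[OF al2] in simp)
 have [measurable]: "(\<lambda>t. Lx al (?u t)) \<in> bm" using al by measurable
 have [measurable]: "(\<lambda>t. Lx al (?u t)) \<in> borel_measurable ?M" "X \<in> borel_measurable ?M"
  by (intro measurable_restrict_space1; simp add: X_def[abs_def])+
 have "Ltx ((1 - th) * rh + nu) ((1 - th) * al) t0 ?u = Lnorm ?M ((1 - th) * rh + nu) (\<lambda>t. Lx ((1 - th) * al) (?u t))"
  by (simp add: Ltx_def)
 also have "... \<le> Lnorm ?M ((1 - th) * rh + nu) (\<lambda>t. enn_powr (Lx al (?u t)) (1 - th) * enn_powr (ennreal (X t)) th)"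
 proof (rule Lnorm_mono)
  show "0 < (1 - th) * rh + nu" using th rh nu0 by (simp add: add_pos_pos)
  show "Lx ((1 - th) * al) (?u t) \<le> enn_powr (Lx al (?u t)) (1 - th) * enn_powr (ennreal (X t)) th" for t
   unfolding Lx_def using al th uX[of t] by (intro Lnorm_interpolate_sup AE_I2 ennreal_leI) auto
 qed
 also have "... \<le> Lnorm ?M ((1 - th) * rh) (\<lambda>t. enn_powr (Lx al (?u t)) (1 - th)) * Lnorm ?M nu (\<lambda>t. enn_powr (ennreal (X t)) th)"
  using th rh nu0 by (intro Lnorm_Hoelder) auto
 also have "Lnorm ?M ((1 - th) * rh) (\<lambda>t. enn_powr (Lx al (?u t)) (1 - th)) = enn_powr (Lnorm ?M rh (\<lambda>t. Lx al (?u t))) (1 - th)"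
  using th rh by (subst Lnorm_enn_powr) auto
 also have "Lnorm ?M rh (\<lambda>t. Lx al (?u t)) \<le> ennreal (?b * ?E)"
 proof -
  have "Lnorm ?M rh (\<lambda>t. Lx al (?u t)) \<le> ennreal (Cp * (2 * c - c) powr (1 - de/2) * B2 * (rh/mu) powr rh * ?E)"
   unfolding Cp_def using c mu B al al2 rh de de2 by (intro piece_mixed[OF meas L1 L2]) auto
  also have "... \<le> ennreal (?b * ?E)"
  proof (rule ennreal_leI)
   have "rh/mu \<le> 1" using rh mu by simp
   then have "(rh/mu) powr rh \<le> 1" using rh mu by (intro powr_le1) auto
   then have "?b * ?E * (rh/mu) powr rh \<le> ?b * ?E * 1"
    using Cp0 B by (intro mult_left_mono) auto
   then show "Cp * (2 * c - c) powr (1 - de/2) * B2 * (rh/mu) powr rh * ?E \<le> ?b * ?E"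
    by (simp add: mult_ac)
  qed
  finally show ?thesis .
 qed
 also have "Lnorm ?M nu (\<lambda>t. enn_powr (ennreal (X t)) th) = ennreal ((?d * B1 * ?E) powr th * ?N)"
 proof -
  define b where "b = mu * th/nu"
  define Y where "Y = ?d * B1 * exp (- mu * c)"
  have b: "0 < b" using mu th nu0 by (simp add: b_def)
  have Y: "0 \<le> Y" using c B by (simp add: Y_def)
  have XY: "X t = Y * exp (- mu * t)" for t
  proof -
   have "exp (- mu * (t + c)) = exp (- mu * c) * exp (- mu * t)" by (simp add: algebra_simps flip: exp_add)
   then show ?thesis by (simp add: X_def Y_def)
  qed
  have "Lnorm ?M nu (\<lambda>t. enn_powr (ennreal (X t)) th) = enn_powr (NN t. ennreal (X t powr (th/nu)) * indicator {t0..} t) nu"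
   using nu0 X0 by (subst Lnorm_pos) (auto simp: enn_powr_enn_powr enn_powr_ennreal nn_integral_restrict_space powr_powr)
  also have "(NN t. ennreal (X t powr (th/nu)) * indicator {t0..} t) = (NN t. ennreal (Y powr (th/nu)) * (ennreal (exp (- b * t)) * indicator {t0..} t))"
  proof (rule nn_integral_cong)
   fix t
   have "X t powr (th/nu) = Y powr (th/nu) * exp (- b * t)" by (simp add: XY powr_mult exp_powr_real b_def)
   then show "ennreal (X t powr (th/nu)) * indicator {t0..} t = ennreal (Y powr (th/nu)) * (ennreal (exp (- b * t)) * indicator {t0..} t)"
    by (simp add: ennreal_mult mult.assoc)
  qed
  also have "... = ennreal (Y powr (th/nu)) * ennreal (exp (- b * t0) / b)"
   using nn_integral_exp_tail[OF b, of t0] by (subst nn_integral_cmult) auto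
  also have "enn_powr ... nu = ennreal ((Y powr (th/nu) * (exp (- b * t0) / b)) powr nu)"
   using b by (subst ennreal_mult[symmetric]) (auto simp: enn_powr_ennreal)
  also have "(Y powr (th/nu) * (exp (- b * t0) / b)) powr nu = (Y * exp (- mu * t0)) powr th * ?N"
  proof -
   have "(Y powr (th/nu) * (exp (- b * t0) / b)) powr nu = Y powr th * (exp (- b * t0) powr nu * (1/b) powr nu)"
    using nu0 b powr_mult[of "exp (- b * t0)" "1/b" nu] powr_mult[of "Y powr (th/nu)" "exp (- b * t0) / b" nu]
    by (simp add: powr_powr)
   also have "exp (- b * t0) powr nu = exp (- mu * t0) powr th" using nu0 by (simp add: exp_powr_real b_def)
   also have "1/b = nu / (mu * th)" by (simp add: b_def)
   finally show ?thesis by (simp add: powr_mult mult.assoc)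
  qed
  also have "Y * exp (- mu * t0) = ?d * B1 * ?E"
  proof -
   have "?E = exp (- mu * c) * exp (- mu * t0)" by (simp add: algebra_simps flip: exp_add)
   then show ?thesis by (simp add: Y_def)
  qed
  finally show ?thesis .
 qed
 finally have "Ltx ((1 - th) * rh + nu) ((1 - th) * al) t0 ?u
  \<le> enn_powr (ennreal (?b * ?E)) (1 - th)
   * ennreal ((?d * B1 * ?E) powr th * ?N)"
  using th by (simp add: mult_right_mono enn_powr_mono)
 also have "... = ennreal ((?b * ?E) powr (1 - th)
   * ((?d * B1 * ?E) powr th * ?N))"
  using Cp0 B by (subst enn_powr_ennreal) (auto simp: ennreal_mult[symmetric])
 also have "... \<le> ennreal (16 / (et\<^sup>2 * th) * (B1 powr th * B2 powr (1 - th)) * c powr ((1 - th) * (1 - de/2) + th * (1 - ?n / 2))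
    * ?E * mu powr (- et))"
 proof (rule ennreal_leI)
  have E: "?E powr (1 - th) * ?E powr th = ?E" by (simp flip: powr_add)
  \<comment> \<open>\<open>et\<close> bounds the distances to all degenerate parameters from below,
    so the constant depends on \<open>et\<close> but on none of the individual exponents.\<close>
  have Cp_le: "Cp powr (1 - th) \<le> 16/et\<^sup>2"
  proof -
   have "Cdisp al \<le> 8/et" using al et al2 unfolding Cdisp_def by (intro divide_left_mono) auto
   moreover have "1 \<le> 8/et" using et by (simp add: field_simps)
   ultimately have 1: "sqrt (Cdisp al) \<le> 8/et"
    by (smt (verit) real_sqrt_le_mono real_sqrt_le_iff sqrt_le_D real_le_lsqrt power2_eq_square mult_le_cancel_right1 mult_left_le)
   have "2 / (1 - ?r) \<le> 2/et" using de et by (intro divide_left_mono) auto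
   then have "(2 / (1 - ?r)) powr rh \<le> (2/et) powr rh" using rh D0 by (intro powr_mono2) auto
   also have "... \<le> (2/et) powr 1" using rh et by (intro powr_mono) (auto simp: field_simps)
   finally have 2: "(2 / (1 - ?r)) powr rh \<le> 2/et" using et by simp
   have "Cp \<le> 8/et * (2/et)" unfolding Cp_def using 1 2 et by (intro mult_mono) auto
   also have "... = 16/et\<^sup>2" by (simp add: power2_eq_square)
   finally have "Cp powr (1 - th) \<le> (16/et\<^sup>2) powr (1 - th)" using th Cp0 by (intro powr_mono2) auto
   also have "... \<le> (16/et\<^sup>2) powr 1"
   proof (rule powr_mono)
    have "et\<^sup>2 \<le> 1" using et by (simp add: power_le_one)
    then show "1 \<le> 16/et\<^sup>2" using et by (simp add: field_simps)
   qed (use th in auto)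
   finally show ?thesis using et by simp
  qed
  have nu_le: "?N \<le> 1/th * mu powr (- et)"
  proof -
   have "?N = (nu/th) powr nu * mu powr (- nu)"
    using powr_divide[of "nu/th" mu nu] mu th nu0 by (simp add: powr_minus_divide mult.commute)
   also have "... \<le> 1/th * mu powr (- et)"
   proof (rule mult_mono)
    have "(nu/th) powr nu \<le> (1/th) powr nu" using nu nu0 th by (intro powr_mono2 divide_right_mono) auto
    also have "... \<le> (1/th) powr 1" using nu th by (intro powr_mono) auto
    finally show "(nu/th) powr nu \<le> 1/th" using th by simp
    show "mu powr (- nu) \<le> mu powr (- et)" using mu nu by (intro powr_mono) auto
   qed (use th in auto)
   finally show ?thesis .
  qed
  have d_le: "(?d) powr th \<le> c powr (th * (1 - ?n / 2))"
  proof -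
   have "disp CARD('n) c \<le> c powr (- ?n / 2)"
    unfolding disp_def using c pi_ge_two by (intro powr_mono2') auto
   then have "?d \<le> c powr (- ?n / 2) * c powr 1"
    using c by (simp add: mult_right_mono)
   also have "... = c powr (1 - ?n / 2)" unfolding powr_add[symmetric] by simp
   finally have "(?d) powr th \<le> (c powr (1 - ?n / 2)) powr th"
    using th c by (intro powr_mono2) auto
   then show ?thesis by (simp add: powr_powr mult.commute)
  qed
  have "(?b * ?E) powr (1 - th) * ((?d * B1 * ?E) powr th * ?N)
   = (B1 powr th * B2 powr (1 - th)) * (?E powr (1 - th) * ?E powr th) * c powr ((1 - de/2) * (1 - th))
     * (Cp powr (1 - th) * ((?d) powr th * ?N))"
   by (simp add: powr_mult powr_powr mult_ac)
  also have "... \<le> (B1 powr th * B2 powr (1 - th)) * (?E powr (1 - th) * ?E powr th) * c powr ((1 - de/2) * (1 - th))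
     * (16/et\<^sup>2 * (c powr (th * (1 - ?n / 2)) * (1/th * mu powr (- et))))"
   using Cp_le nu_le d_le et by (intro mult_left_mono mult_mono) auto
  also have "... = 16 / (et\<^sup>2 * th) * (B1 powr th * B2 powr (1 - th)) * (c powr ((1 - de/2) * (1 - th)) * c powr (th * (1 - ?n / 2)))
    * ?E * mu powr (- et)" unfolding E using th et by (simp add: field_simps)
  also have "c powr ((1 - de/2) * (1 - th)) * c powr (th * (1 - ?n / 2)) = c powr ((1 - th) * (1 - de/2) + th * (1 - ?n / 2))"
   unfolding powr_add[symmetric] by (simp add: mult.commute)
  finally show "(?b * ?E) powr (1 - th)
   * ((?d * B1 * ?E) powr th * ?N)
   \<le> 16 / (et\<^sup>2 * th) * (B1 powr th * B2 powr (1 - th)) * c powr ((1 - th) * (1 - de/2) + th * (1 - ?n / 2))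
    * ?E * mu powr (- et)" .
 qed
 finally show ?thesis .
qed

section \<open>Dyadic levels of the forcing\<close>

definition levcut :: "real \<Rightarrow> real \<Rightarrow> real \<Rightarrow> real \<Rightarrow> (real \<Rightarrow> 'a \<Rightarrow> complex) \<Rightarrow> real \<Rightarrow> 'a \<Rightarrow> complex" where
 "levcut ka mu h h' F s y = (if h * (ka * exp (- mu * s)) \<le> cmod (F s y) \<and> cmod (F s y) < h' * (ka * exp (- mu * s)) then F s y else 0)"

lemma borel_measurable_levcut [measurable]:
 fixes F :: "'n::finite evol"
 assumes [measurable]: "jm F"
  "s \<in> borel_measurable M" "y \<in> borel_measurable M"
 shows "(\<lambda>z. levcut ka mu h h' F (s z) (y z)) \<in> borel_measurable M" unfolding levcut_def by measurable

lemma norm_levcut_le: "cmod (levcut ka mu h h' F s y) \<le> cmod (F s y)" by (simp add: levcut_def)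

lemma nn_integral_powr_Lx:
 fixes f :: "'n::finite wave"
 assumes "0 < p" "Lx p f \<le> ennreal A" "0 \<le> A"
 shows "(NN y. ennreal (cmod (f y) powr (1/p))) \<le> ennreal (A powr (1/p))"
 using assms by (simp add: Lx_def Lnorm_le_iff enn_powr_ennreal)

text \<open>Levels are measured in units of \<open>ka * exp (- mu * s)\<close>, so that heights are
  pure numbers and every bound keeps the decay in \<open>s\<close>. The L1 norm is controlled by the
  lower cut, the L2 norm in \<open>levcut_L2\<close> by the upper one.\<close>

lemma levcut_L1:
 fixes F :: "'n::finite evol"
 assumes [measurable]: "jm F"
  and F: "Lx (1 - be) (F s) \<le> ennreal (ka * exp (- mu * s))" and ka: "0 < ka" and be: "0 < be" "be < 1/2" and h: "0 < h"
 shows "L1 (levcut ka mu h h' F s) \<le> ennreal (ka * h powr (1 - 1 / (1 - be)) * exp (- mu * s))"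
proof -
 define A where "A = ka * exp (- mu * s)"
 define r where "r = 1 / (1 - be)"
 have A: "0 < A" using ka by (simp add: A_def)
 have r: "1 < r" using be by (simp add: r_def field_simps)
 have "L1 (levcut ka mu h h' F s) \<le> (NN y. ennreal ((h * A) powr (1 - r)) * ennreal (cmod (F s y) powr r))"
 proof (rule nn_integral_mono)
  fix y
  show "ennreal (cmod (levcut ka mu h h' F s y)) \<le> ennreal ((h * A) powr (1 - r)) * ennreal (cmod (F s y) powr r)"
  proof (cases "h * A \<le> cmod (F s y)")
   case True
   have hA: "0 < h * A" using h A by simp
   have pos: "0 < cmod (F s y)" using True hA by linarith
   have "cmod (levcut ka mu h h' F s y) \<le> cmod (F s y)" by (rule norm_levcut_le)
   also have "... = cmod (F s y) powr (1 - r) * cmod (F s y) powr r" using pos by (simp flip: powr_add)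
   also have "... \<le> (h * A) powr (1 - r) * cmod (F s y) powr r"
    using True hA r by (intro mult_right_mono powr_mono2') auto
   finally show ?thesis by (simp add: ennreal_leI flip: ennreal_mult)
  next
   case False
   then have "levcut ka mu h h' F s y = 0" by (simp add: levcut_def A_def)
   then show ?thesis by simp
  qed
 qed
 also have "... = ennreal ((h * A) powr (1 - r)) * (NN y. ennreal (cmod (F s y) powr r))"
  by (rule nn_integral_cmult) measurable
 also have "... \<le> ennreal ((h * A) powr (1 - r)) * ennreal (A powr r)"
  unfolding r_def using nn_integral_powr_Lx[OF _ F] be ka by (intro mult_left_mono) (auto simp: A_def)
 also have "... = ennreal (h powr (1 - r) * (A powr (1 - r) * A powr r))"
  by (simp add: powr_mult mult.assoc flip: ennreal_mult)
 also have "A powr (1 - r) * A powr r = A" using A by (simp flip: powr_add)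
 finally show ?thesis by (simp add: A_def r_def mult_ac)
qed

lemma levcut_L2:
 fixes F :: "'n::finite evol"
 assumes [measurable]: "jm F"
  and F: "Lx (1 - be) (F s) \<le> ennreal (ka * exp (- mu * s))" and ka: "0 < ka" and be: "0 < be" "be < 1/2" and h: "0 < h'"
 shows "Lx (1/2) (levcut ka mu h h' F s) \<le> ennreal (ka * h' powr (1 - 1 / (1 - be) / 2) * exp (- mu * s))"
proof -
 define A where "A = ka * exp (- mu * s)"
 define r where "r = 1 / (1 - be)"
 have A: "0 < A" using ka by (simp add: A_def)
 have r: "1 < r" "r < 2" using be by (auto simp: r_def field_simps)
 have "(NN y. ennreal ((cmod (levcut ka mu h h' F s y))\<^sup>2)) \<le> (NN y. ennreal ((h' * A) powr (2 - r)) * ennreal (cmod (F s y) powr r))"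
 proof (rule nn_integral_mono)
  fix y
  show "ennreal ((cmod (levcut ka mu h h' F s y))\<^sup>2) \<le> ennreal ((h' * A) powr (2 - r)) * ennreal (cmod (F s y) powr r)"
  proof (cases "cmod (F s y) < h' * A")
   case True
   have "(cmod (levcut ka mu h h' F s y))\<^sup>2 \<le> (cmod (F s y))\<^sup>2" by (intro power_mono norm_levcut_le) auto
   also have "... = cmod (F s y) powr (2 - r) * cmod (F s y) powr r" by (simp add: powr_sq flip: powr_add)
   also have "... \<le> (h' * A) powr (2 - r) * cmod (F s y) powr r"
    using True r by (intro mult_right_mono powr_mono2) auto
   finally show ?thesis by (simp add: ennreal_leI flip: ennreal_mult)
  next
   case False
   then have "levcut ka mu h h' F s y = 0" by (simp add: levcut_def A_def)
   then show ?thesis by simp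
  qed
 qed
 also have "... = ennreal ((h' * A) powr (2 - r)) * (NN y. ennreal (cmod (F s y) powr r))"
  by (rule nn_integral_cmult) measurable
 also have "... \<le> ennreal ((h' * A) powr (2 - r)) * ennreal (A powr r)"
  unfolding r_def using nn_integral_powr_Lx[OF _ F] be ka by (intro mult_left_mono) (auto simp: A_def)
 also have "... = ennreal (h' powr (2 - r) * (A powr (2 - r) * A powr r))"
  by (simp add: powr_mult mult.assoc flip: ennreal_mult)
 also have "A powr (2 - r) * A powr r = A powr 2" by (simp flip: powr_add)
 also have "h' powr (2 - r) * A powr 2 = (A * h' powr (1 - r/2)) powr 2" by (simp add: powr_mult powr_powr)
 also have "ennreal ... = enn_powr (ennreal (A * h' powr (1 - r/2))) 2" using A by (subst enn_powr_ennreal) auto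
 finally show ?thesis unfolding Lx_half_le_iff by (simp add: A_def r_def mult_ac)
qed

section \<open>Summation over lags and levels\<close>

abbreviation p2 :: "int \<Rightarrow> real" where "p2 j \<equiv> 2 powr (real_of_int j)"

lemma p2_Suc: "p2 (j + 1) = 2 * p2 j" by (simp add: powr_add)

lemma two_powr_less_one: "e < 0 \<Longrightarrow> 2 powr e < (1::real)" using powr_less_mono[of e 0 2] by simp

lemma sum_int_partition:
 fixes z :: "'a::comm_monoid_add"
 assumes "a \<le> b"
 shows "(\<Sum>k\<in>{a..<b}. if p2 k \<le> v \<and> v < p2 (k + 1) then z else 0) = (if p2 a \<le> v \<and> v < p2 b then z else 0)"
 using assms
proof (induction b rule: int_ge_induct)
 case (step b)
 have "{a..<b + 1} = insert b {a..<b}" using step.hyps by auto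
 moreover have "p2 a \<le> p2 b" "p2 b \<le> p2 (b + 1)" using step.hyps by auto
 ultimately show ?case using step.IH by (auto simp del: powr_le_cancel_iff powr_less_cancel_iff)
qed auto

lemma sum_int_partition':
 fixes z :: "'a::comm_monoid_add"
 assumes "a \<le> b"
 shows "(\<Sum>k\<in>{a..<b}. if p2 k < v \<and> v \<le> p2 (k + 1) then z else 0) = (if p2 a < v \<and> v \<le> p2 b then z else 0)"
 using assms
proof (induction b rule: int_ge_induct)
 case (step b)
 have "{a..<b + 1} = insert b {a..<b}" using step.hyps by auto
 moreover have "p2 a \<le> p2 b" "p2 b \<le> p2 (b + 1)" using step.hyps by auto
 ultimately show ?case using step.IH by (auto simp del: powr_le_cancel_iff powr_less_cancel_iff)
qed auto

lemma Duh_integrable: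
 fixes G :: "'n::finite evol"
 assumes [measurable]: "jm G"
  and L1: "\<And>s. L1 (G s) \<le> ennreal (B1 * exp (- mu * s))"
  and c: "0 < c" "c \<le> c'" and mu: "0 \<le> mu" and B1: "0 \<le> B1"
 shows "integrable lborel (\<lambda>s. U (t - s) (lagcut c c' G t s) x)" "integrable lborel (lagcut c c' G t s)"
proof -
 show "integrable lborel (\<lambda>s. U (t - s) (lagcut c c' G t s) x)"
 proof (rule integrableI_bounded)
  show "(NN s. ennreal (norm (U (t - s) (lagcut c c' G t s) x))) < \<infinity>"
   using nn_integral_Duh_le[OF assms, of t x] by (simp add: le_less_trans)
 qed measurable
 have [measurable]: "lagcut c c' G t s \<in> bm" unfolding lagcut_def[abs_def] by measurable
 show "integrable lborel (lagcut c c' G t s)"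
 proof (rule integrableI_bounded)
  have "(NN y. ennreal (norm (lagcut c c' G t s y))) \<le> L1 (G s)"
   by (intro nn_integral_mono) (simp add: lagcut_def)
  also have "... < \<infinity>" using L1[of s] by (simp add: le_less_trans)
  finally show "(NN y. ennreal (norm (lagcut c c' G t s y))) < \<infinity>" .
 qed measurable
qed

lemma U_sum:
 assumes "finite I" "\<And>i. i \<in> I \<Longrightarrow> integrable lborel (f i)"
 shows "U ta (\<lambda>y. \<Sum>i\<in>I. f i y) x = (\<Sum>i\<in>I. U ta (f i) x)"
 using assms by (induction I) (simp_all add: U_add)

lemma Duh_sum:
 fixes G :: "'n::finite evol"
 assumes I: "finite I"
  and H[measurable]: "\<And>i. i \<in> I \<Longrightarrow> jm (H i)"
  and L1: "\<And>i s. i \<in> I \<Longrightarrow> L1 (H i s) \<le> ennreal (Bd i * exp (- mu * s))"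
  and c: "\<And>i. i \<in> I \<Longrightarrow> 0 < a i \<and> a i \<le> b i \<and> 0 \<le> Bd i" and mu: "0 \<le> mu"
  and split: "\<And>s y. lagcut c c' G t s y = (\<Sum>i\<in>I. lagcut (a i) (b i) (H i) t s y)"
 shows "Duh c c' G t x = (\<Sum>i\<in>I. Duh (a i) (b i) (H i) t x)"
proof -
 note int = Duh_integrable[OF H L1 _ _ mu]
 have "lagcut c c' G t s = (\<lambda>y. \<Sum>i\<in>I. lagcut (a i) (b i) (H i) t s y)" for s using split by auto
 then have "Duh c c' G t x = (LBINT s. (\<Sum>i\<in>I. U (t - s) (lagcut (a i) (b i) (H i) t s) x))"
  unfolding Duh_def using I c int(2) by (simp add: U_sum)
 also have "... = (\<Sum>i\<in>I. Duh (a i) (b i) (H i) t x)"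
  unfolding Duh_def using c int(1) by (intro Bochner_Integration.integral_sum) auto
 finally show ?thesis .
qed

definition DuhN :: "real \<Rightarrow> real \<Rightarrow> ('n::finite evol) \<Rightarrow> nat \<Rightarrow> 'n evol" where
 "DuhN ka mu F n = Duh (p2 (- int n)) (p2 (int n)) (levcut ka mu (p2 (- int n)) (p2 (int n)) F)"

text \<open>Lags and levels are cut by half-open dyadic intervals, closed on the right for lags and
  on the left for levels, so that neighbouring pieces neither overlap nor leave a gap.\<close>

lemma DuhN_eq_sum:
 fixes F :: "'n::finite evol"
 assumes [measurable]: "jm F"
  and F: "\<And>s. Lx (1 - be) (F s) \<le> ennreal (ka * exp (- mu * s))" and ka: "0 < ka" and be: "0 < be" "be < 1/2" and mu: "0 \<le> mu"
 shows "DuhN ka mu F n t x =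
  (\<Sum>(j, k)\<in>{- int n..<int n} \<times> {- int n..<int n}. Duh (p2 j) (2 * p2 j) (levcut ka mu (p2 k) (2 * p2 k) F) t x)"
proof -
 let ?I = "{- int n..<int n}"
 have "Duh (p2 (- int n)) (p2 (int n)) (levcut ka mu (p2 (- int n)) (p2 (int n)) F) t x =
  (\<Sum>i\<in>?I \<times> ?I. Duh (p2 (fst i)) (2 * p2 (fst i)) (levcut ka mu (p2 (snd i)) (2 * p2 (snd i)) F) t x)"
 proof (rule Duh_sum[where Bd="\<lambda>i. ka * p2 (snd i) powr (1 - 1 / (1 - be))" and mu=mu])
  show "(NN y. ennreal (cmod (levcut ka mu (p2 (snd i)) (2 * p2 (snd i)) F s y))) \<le> ennreal (ka * p2 (snd i) powr (1 - 1 / (1 - be)) * exp (- mu * s))"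
   for i :: "int \<times> int" and s by (rule levcut_L1[OF _ F ka be]) auto
  fix s y
  define v where "v = cmod (F s y) / (ka * exp (- mu * s))"
  have pos: "0 < ka * exp (- mu * s)" using ka by simp
  have lev: "levcut ka mu h h' F s y = (if h \<le> v \<and> v < h' then F s y else 0)" for h h'
   using pos by (simp add: levcut_def v_def field_simps)
  have "(\<Sum>i\<in>?I \<times> ?I. lagcut (p2 (fst i)) (2 * p2 (fst i)) (levcut ka mu (p2 (snd i)) (2 * p2 (snd i)) F) t s y)
   = (\<Sum>j\<in>?I. \<Sum>k\<in>?I. lagcut (p2 j) (2 * p2 j) (levcut ka mu (p2 k) (2 * p2 k) F) t s y)"
   by (simp add: sum.cartesian_product split_beta')
  also have "... = (\<Sum>j\<in>?I. if p2 j < s - t \<and> s - t \<le> p2 (j + 1) then (\<Sum>k\<in>?I. if p2 k \<le> v \<and> v < p2 (k + 1) then F s y else 0) else 0)"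
  proof (rule sum.cong[OF refl])
   fix j
   show "(\<Sum>k\<in>?I. lagcut (p2 j) (2 * p2 j) (levcut ka mu (p2 k) (2 * p2 k) F) t s y)
    = (if p2 j < s - t \<and> s - t \<le> p2 (j + 1) then (\<Sum>k\<in>?I. if p2 k \<le> v \<and> v < p2 (k + 1) then F s y else 0) else 0)"
   proof (cases "p2 j < s - t \<and> s - t \<le> p2 (j + 1)")
    case True
    then have "p2 j < s - t" "s - t \<le> 2 * p2 j" by (simp_all only: p2_Suc)
    then show ?thesis by (simp only: lagcut_def lev p2_Suc simp_thms if_True cong: sum.cong)
   next
    case False
    then have "(p2 j < s - t \<and> s - t \<le> 2 * p2 j) = False" by (simp only: p2_Suc simp_thms)
    with False show ?thesis by (simp only: lagcut_def lev if_False sum.neutral_const cong: sum.cong)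
   qed
  qed
  also have "... = lagcut (p2 (- int n)) (p2 (int n)) (levcut ka mu (p2 (- int n)) (p2 (int n)) F) t s y"
   by (subst sum_int_partition, simp, subst sum_int_partition', simp) (simp add: lagcut_def lev)
  finally show "lagcut (p2 (- int n)) (p2 (int n)) (levcut ka mu (p2 (- int n)) (p2 (int n)) F) t s y =
   (\<Sum>i\<in>?I \<times> ?I. lagcut (p2 (fst i)) (2 * p2 (fst i)) (levcut ka mu (p2 (snd i)) (2 * p2 (snd i)) F) t s y)" ..
  show "jm (levcut ka mu (p2 (snd i)) (2 * p2 (snd i)) F)" for i :: "int \<times> int" by measurable
 qed (use ka mu in auto)
 then show ?thesis by (simp add: DuhN_def split_beta')
qed

lemma sum_geometric_le:
 fixes q :: real
 assumes "0 \<le> q" "q < 1"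
 shows "(\<Sum>i<n. q ^ i) \<le> 1 / (1 - q)"
 using assms sum_le_suminf[OF summable_geometric, of q "{..<n}"] suminf_geometric[of q] by simp

lemma sum_int_nonneg_eq: "(\<Sum>k\<in>{0..<int n}. f k) = (\<Sum>i<n. f (int i))"
 by (rule sum.reindex_bij_witness[of _ int nat]) auto

lemma sum_int_neg_eq: "(\<Sum>k\<in>{- int n..<0}. f k) = (\<Sum>i<n. f (- int i - 1))"
 by (rule sum.reindex_bij_witness[of _ "\<lambda>i. - int i - 1" "\<lambda>k. nat (- k - 1)"]) auto

lemma sum_int_split: "(\<Sum>k\<in>{- int n..<int n}. f k) = (\<Sum>k\<in>{- int n..<0}. f k) + (\<Sum>k\<in>{0..<int n}. f k)"
proof -
 have "{- int n..<int n} = {- int n..<0} \<union> {0..<int n}" by auto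
 then show ?thesis by (simp add: sum.union_disjoint ivl_disj_int)
qed

lemma sum_p2_neg_le:
 assumes "0 < e" shows "(\<Sum>k\<in>{- int n..<0}. p2 k powr e) \<le> 1 / (1 - 2 powr (- e))"
proof -
 have "(\<Sum>k\<in>{- int n..<0}. p2 k powr e) \<le> (\<Sum>i<n. (2 powr (- e)) ^ i)"
  unfolding sum_int_neg_eq using assms
  by (intro sum_mono) (auto simp: powr_powr powr_power algebra_simps intro!: powr_mono)
 also have "... \<le> 1 / (1 - 2 powr (- e))" using assms by (intro sum_geometric_le two_powr_less_one) auto
 finally show ?thesis .
qed

lemma sum_p2_nonneg_le:
 assumes "e < 0" shows "(\<Sum>k\<in>{0..<int n}. p2 k powr e) \<le> 1 / (1 - 2 powr e)"
proof -
 have "(\<Sum>k\<in>{0..<int n}. p2 k powr e) = (\<Sum>i<n. (2 powr e) ^ i)"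
  unfolding sum_int_nonneg_eq by (intro sum.cong refl) (simp add: powr_powr powr_power mult.commute)
 also have "... \<le> 1 / (1 - 2 powr e)" using assms by (intro sum_geometric_le two_powr_less_one) auto
 finally show ?thesis .
qed

text \<open>Short lags are summed by the positive power \<open>et\<close>, long ones by the
  exponential; the 8 is \<open>4 / (1 - 1/2)\<close>.\<close>

lemma sum_lags_le:
 assumes et: "0 < et" "et \<le> 1"
 shows "(\<Sum>j\<in>{- int n..<int n}. (p2 j powr et + p2 j) * exp (- p2 j)) \<le> 2 / (1 - 2 powr (- et)) + 8"
proof -
 have "(\<Sum>j\<in>{- int n..<0}. (p2 j powr et + p2 j) * exp (- p2 j)) \<le> (\<Sum>j\<in>{- int n..<0}. 2 * p2 j powr et)"
 proof (rule sum_mono)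
  fix j assume "j \<in> {- int n..<0}"
  then have "p2 j \<le> 1" using powr_mono[of "real_of_int j" 0 2] by simp
  then have "p2 j powr 1 \<le> p2 j powr et" using et by (intro powr_mono') auto
  then have "p2 j \<le> p2 j powr et" by simp
  then have "(p2 j powr et + p2 j) * exp (- p2 j) \<le> (2 * p2 j powr et) * 1" by (intro mult_mono) auto
  then show "(p2 j powr et + p2 j) * exp (- p2 j) \<le> 2 * p2 j powr et" by simp
 qed
 also have "... \<le> 2 * (1 / (1 - 2 powr (- et)))"
  unfolding sum_distrib_left[symmetric] using et by (intro mult_left_mono sum_p2_neg_le) auto
 finally have 1: "(\<Sum>j\<in>{- int n..<0}. (p2 j powr et + p2 j) * exp (- p2 j)) \<le> 2 / (1 - 2 powr (- et))" by simp
 have "(\<Sum>j\<in>{0..<int n}. (p2 j powr et + p2 j) * exp (- p2 j)) \<le> (\<Sum>j\<in>{0..<int n}. 4 * p2 j powr (- 1))"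
 proof (rule sum_mono)
  fix j assume "j \<in> {0..<int n}"
  define x where "x = p2 j"
  have x: "1 \<le> x" using \<open>j \<in> _\<close> powr_mono[of 0 "real_of_int j" 2] by (simp add: x_def)
  have "x powr et \<le> x powr 1" using et x by (intro powr_mono) auto
  then have "x powr et + x \<le> 2 * x" using x by simp
  moreover have "exp (- x) \<le> 2/x\<^sup>2"
  proof -
   have "x\<^sup>2/2 \<le> exp x" using exp_lower_Taylor_quadratic[of x] x by simp
   then show ?thesis using x by (simp add: exp_minus field_simps)
  qed
  ultimately have "(x powr et + x) * exp (- x) \<le> (2 * x) * (2/x\<^sup>2)" using x by (intro mult_mono) auto
  also have "... = 4 * x powr (- 1)" using x by (simp add: powr_minus power2_eq_square field_simps)
  finally show "(p2 j powr et + p2 j) * exp (- p2 j) \<le> 4 * p2 j powr (- 1)" by (simp add: x_def)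
 qed
 also have "... \<le> 4 * (1 / (1 - 2 powr (- 1)))"
  unfolding sum_distrib_left[symmetric] by (intro mult_left_mono sum_p2_nonneg_le) auto
 also have "... = 8" by (simp add: powr_minus)
 finally show ?thesis using 1 unfolding sum_int_split by simp
qed

text \<open>The pair \<open>(a, b)\<close> of reciprocal exponents is reached, with slack \<open>et\<close>, by interpolating with parameter \<open>th\<close>
 between a subcritical local Strichartz estimate and the supremum bound.\<close>

definition admissible_split :: "nat \<Rightarrow> real \<Rightarrow> real \<Rightarrow> real \<Rightarrow> real \<Rightarrow> bool" where
 "admissible_split d et th a b \<longleftrightarrow> 0 < et \<and> et \<le> 1 \<and> 0 < th \<and> th < 1 \<and>
  (\<exists>al rh nu. 0 < al \<and> et \<le> 1 - 2 * al \<and> 0 < rh \<and> rh < 1/2 \<and> et \<le> 1 - delta d al / (2 * rh) \<and> et \<le> nu \<and> nu \<le> 1 \<and>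
   a = (1 - th) * rh + nu \<and> b = (1 - th) * al \<and>
   et \<le> (1 - th) * (1 - delta d al / 2) + th * (1 - real d / 2) \<and> (1 - th) * (1 - delta d al / 2) + th * (1 - real d / 2) \<le> 1)"

text \<open>Interpolation between the L1 and L2 bounds of one level leaves the power
  \<open>1 - (1 + th) / (2 * (1 - be))\<close> of its height; the sign of this power changes at
  \<open>th = 1 - 2 * be\<close>.\<close>

lemma strichartz_term:
 fixes F :: "'n::finite evol"
 assumes meas[measurable]: "jm F"
  and F: "\<And>s. Lx (1 - be) (F s) \<le> ennreal (ka * exp (- mu * s))" and ka: "0 < ka" and be: "0 < be" "be < 1/2" and mu: "1 \<le> mu"
  and ok: "admissible_split CARD('n) et th a b"
 shows "Ltx a b t0 (Duh (p2 j) (2 * p2 j) (levcut ka mu (p2 k) (2 * p2 k) F))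
  \<le> ennreal (32 / (et\<^sup>2 * th) * ka * p2 k powr (1 - (1 + th) / (2 * (1 - be))) * ((p2 j powr et + p2 j) * exp (- p2 j)) * exp (- mu * t0) * mu powr (- et))"
proof -
 from ok obtain al rh nu where et: "0 < et" "et \<le> 1" and th: "0 < th" "th < 1"
  and p: "0 < al" "et \<le> 1 - 2 * al" "0 < rh" "rh < 1/2" "et \<le> 1 - delta CARD('n) al / (2 * rh)" "et \<le> nu" "nu \<le> 1"
  and ab: "a = (1 - th) * rh + nu" "b = (1 - th) * al"
  and e: "et \<le> (1 - th) * (1 - delta CARD('n) al / 2) + th * (1 - real CARD('n) / 2)"
   "(1 - th) * (1 - delta CARD('n) al / 2) + th * (1 - real CARD('n) / 2) \<le> 1"
  unfolding admissible_split_def by auto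
 define ex where "ex = (1 - th) * (1 - delta CARD('n) al / 2) + th * (1 - real CARD('n) / 2)"
 define r where "r = 1 / (1 - be)"
 have r: "1 < r" "r < 2" using be by (auto simp: r_def field_simps)
 define B1 where "B1 = ka * p2 k powr (1 - r)"
 define B2 where "B2 = ka * (2 * p2 k) powr (1 - r/2)"
 have B: "0 \<le> B1" "0 \<le> B2" using ka by (auto simp: B1_def B2_def)
 have "Ltx a b t0 (Duh (p2 j) (2 * p2 j) (levcut ka mu (p2 k) (2 * p2 k) F))
  \<le> ennreal (16 / (et\<^sup>2 * th) * (B1 powr th * B2 powr (1 - th)) * p2 j powr ex * exp (- mu * (t0 + p2 j)) * mu powr (- et))"
  unfolding ab ex_def
 proof (rule piece_strichartz[OF _ _ _ _ mu B th et p(1-4) refl p(5-7)])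
  show "(NN y. ennreal (cmod (levcut ka mu (p2 k) (2 * p2 k) F s y))) \<le> ennreal (B1 * exp (- mu * s))" for s
   unfolding B1_def r_def by (rule levcut_L1[OF meas F ka be]) simp
  show "Lx (1/2) (levcut ka mu (p2 k) (2 * p2 k) F s) \<le> ennreal (B2 * exp (- mu * s))" for s
   unfolding B2_def r_def by (rule levcut_L2[OF meas F ka be]) simp
 qed simp_all
 also have "... \<le> ennreal (32 / (et\<^sup>2 * th) * ka * p2 k powr (1 - (1 + th) / (2 * (1 - be))) * ((p2 j powr et + p2 j) * exp (- p2 j)) * exp (- mu * t0) * mu powr (- et))"
 proof (rule ennreal_leI)
  have 1: "B1 powr th * B2 powr (1 - th) \<le> 2 * ka * p2 k powr (1 - (1 + th) / (2 * (1 - be)))"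
  proof -
   have "B1 powr th * B2 powr (1 - th) = (ka powr th * ka powr (1 - th)) * 2 powr ((1 - r/2) * (1 - th)) * (p2 k powr ((1 - r) * th) * p2 k powr ((1 - r/2) * (1 - th)))"
    by (simp add: B1_def B2_def powr_mult powr_powr mult_ac)
   also have "ka powr th * ka powr (1 - th) = ka" using ka by (simp flip: powr_add)
   also have "p2 k powr ((1 - r) * th) * p2 k powr ((1 - r/2) * (1 - th)) = p2 k powr (1 - (1 + th) / (2 * (1 - be)))"
   proof -
    have "(1 - r) * th + (1 - r/2) * (1 - th) = 1 - (1 + th) * r/2" by (simp add: field_simps)
    also have "... = 1 - (1 + th) / (2 * (1 - be))" by (simp add: r_def mult.commute)
    finally show ?thesis unfolding powr_add[symmetric] by (simp only:)
   qed
   also have "ka * 2 powr ((1 - r/2) * (1 - th)) \<le> ka * 2"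
   proof (rule mult_left_mono)
    have "(1 - r/2) * (1 - th) \<le> 1 * 1" using r th by (intro mult_mono) auto
    then have "2 powr ((1 - r/2) * (1 - th)) \<le> 2 powr (1::real)" by (intro powr_mono) auto
    then show "2 powr ((1 - r/2) * (1 - th)) \<le> (2::real)" by simp
   qed (use ka in simp)
   finally show ?thesis by (simp add: mult_right_mono mult.commute)
  qed
  \<comment> \<open>\<open>ex\<close> lies between \<open>et\<close> and 1; which end dominates
    depends on whether the lag is below or above 1.\<close>
  have 2: "p2 j powr ex \<le> p2 j powr et + p2 j"
  proof (cases "1 \<le> p2 j")
   case True
   have "p2 j powr ex \<le> p2 j powr 1" using True e by (intro powr_mono) (auto simp: ex_def)
   then show ?thesis by (simp add: add_increasing)
  next
   case False
   have "p2 j powr ex \<le> p2 j powr et" using False e by (intro powr_mono') (auto simp: ex_def)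
   then show ?thesis by (simp add: add_increasing2)
  qed
  \<comment> \<open>Since \<open>mu \<ge> 1\<close>, a factor \<open>exp (- p2 j)\<close>
    independent of \<open>mu\<close> can be kept for the sum over lags.\<close>
  have 3: "exp (- mu * (t0 + p2 j)) \<le> exp (- p2 j) * exp (- mu * t0)"
  proof -
   have "1 * p2 j \<le> mu * p2 j" using mu by (intro mult_right_mono) auto
   then show ?thesis unfolding exp_add[symmetric] by (simp add: algebra_simps)
  qed
  have "16 / (et\<^sup>2 * th) * (B1 powr th * B2 powr (1 - th)) * p2 j powr ex * exp (- mu * (t0 + p2 j)) * mu powr (- et)
   \<le> 16 / (et\<^sup>2 * th) * (2 * ka * p2 k powr (1 - (1 + th) / (2 * (1 - be)))) * (p2 j powr et + p2 j) * (exp (- p2 j) * exp (- mu * t0)) * mu powr (- et)"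
   using th ka by (intro mult_right_mono mult_mono 1 2 3 mult_left_mono) auto
  also have "... = 32 / (et\<^sup>2 * th) * ka * p2 k powr (1 - (1 + th) / (2 * (1 - be))) * ((p2 j powr et + p2 j) * exp (- p2 j)) * exp (- mu * t0) * mu powr (- et)"
   by simp
  finally show "16 / (et\<^sup>2 * th) * (B1 powr th * B2 powr (1 - th)) * p2 j powr ex * exp (- mu * (t0 + p2 j)) * mu powr (- et) \<le> ..." .
 qed
 finally show ?thesis .
qed

lemma Ltx_sum_le:
 fixes u :: "'i \<Rightarrow> 'n::finite evol"
 assumes I: "finite I" and meas[measurable]: "\<And>i. i \<in> I \<Longrightarrow> jm (u i)"
  and ab: "0 < a" "a \<le> 1" "0 < b" "b \<le> 1"
 shows "Ltx a b t0 (\<lambda>t x. \<Sum>i\<in>I. u i t x) \<le> (\<Sum>i\<in>I. Ltx a b t0 (u i))"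
proof -
 let ?M = "restrict_space lborel {t0..} :: real measure"
 have [measurable]: "i \<in> I \<Longrightarrow> (\<lambda>t. Lx b (u i t)) \<in> borel_measurable ?M" for i
  using ab by (intro measurable_restrict_space1) measurable
 have [measurable]: "i \<in> I \<Longrightarrow> u i t \<in> bm" for i t
 proof -
  assume i[measurable]: "i \<in> I"
  have "(\<lambda>x. (\<lambda>(t, x). u i t x) (t, x)) \<in> bm" by measurable
  then show "u i t \<in> bm" by simp
 qed
 have "Ltx a b t0 (\<lambda>t x. \<Sum>i\<in>I. u i t x) \<le> Lnorm ?M a (\<lambda>t. \<Sum>i\<in>I. Lx b (u i t))"
  unfolding Ltx_def using ab I by (intro Lnorm_mono Lx_sum_le) auto
 also have "... \<le> (\<Sum>i\<in>I. Ltx a b t0 (u i))"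
  unfolding Ltx_def using ab I by (intro Lnorm_sum_le sigma_finite_restrict_lborel) auto
 finally show ?thesis .
qed

text \<open>The same pair of exponents is reached with two parameters on either side of
  \<open>1 - 2 * be\<close>: \<open>th1\<close> sums the low levels and \<open>th2\<close> the high
  ones, each as a geometric series.\<close>

lemma strichartz_DuhN:
 assumes be: "0 < be" "be < 1/2" and et: "0 < et" "et \<le> 1"
  and th: "0 < th1" "th1 < 1 - 2 * be" "1 - 2 * be < th2" "th2 < 1"
 shows "\<exists>C>0. \<forall>a b (F :: 'n::finite evol) ka mu t0 n.
  admissible_split CARD('n) et th1 a b \<and> admissible_split CARD('n) et th2 a b \<and> a \<le> 1 \<and> b \<le> 1 \<and>
  jm F \<and>
  (\<forall>s. Lx (1 - be) (F s) \<le> ennreal (ka * exp (- mu * s))) \<and> 0 < ka \<and> 1 \<le> mu \<longrightarrow>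
  Ltx a b t0 (DuhN ka mu F n) \<le> ennreal (C * ka * mu powr (- et) * exp (- mu * t0))"
proof -
 define e where "e th = 1 - (1 + th) / (2 * (1 - be))" for th
 have e: "0 < e th1" "e th2 < 0" using th be by (auto simp: e_def field_simps)
 define Sk where "Sk = 1 / (1 - 2 powr (- e th1)) + 1 / (1 - 2 powr e th2)"
 define Sj where "Sj = 2 / (1 - 2 powr (- et)) + 8"
 define c0 where "c0 = 32 / (et\<^sup>2 * th1)"
 have c0: "0 < c0" using et th by (simp add: c0_def)
 have Sk0: "0 < Sk" unfolding Sk_def using e two_powr_less_one[of "- e th1"] two_powr_less_one[of "e th2"] by (intro add_pos_pos divide_pos_pos) auto
 have Sj0: "0 < Sj" unfolding Sj_def using et two_powr_less_one[of "- et"] by (intro add_nonneg_pos divide_nonneg_nonneg) auto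
 show ?thesis
 proof (intro exI[of _ "c0 * Sj * Sk"] conjI allI impI)
  show "0 < c0 * Sj * Sk" using c0 Sk0 Sj0 by simp
  fix a b and F :: "'n evol" and ka mu t0 :: real and n :: nat
  assume "admissible_split CARD('n) et th1 a b \<and> admissible_split CARD('n) et th2 a b \<and> a \<le> 1 \<and> b \<le> 1 \<and>
   jm F \<and> (\<forall>s. Lx (1 - be) (F s) \<le> ennreal (ka * exp (- mu * s))) \<and> 0 < ka \<and> 1 \<le> mu"
  then have ok: "admissible_split CARD('n) et th1 a b" "admissible_split CARD('n) et th2 a b" and ab: "a \<le> 1" "b \<le> 1"
   and meas[measurable]: "jm F"
   and F: "\<And>s. Lx (1 - be) (F s) \<le> ennreal (ka * exp (- mu * s))" and ka: "0 < ka" and mu: "1 \<le> mu"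
   by auto
  have ab0: "0 < a" "0 < b" using ok(1) unfolding admissible_split_def by (auto intro!: add_nonneg_pos mult_pos_pos)
  let ?I = "{- int n..<int n}"
  define u where "u i = Duh (p2 (fst i)) (2 * p2 (fst i)) (levcut ka mu (p2 (snd i)) (2 * p2 (snd i)) F)" for i :: "int \<times> int"
  define W where "W = ka * exp (- mu * t0) * mu powr (- et)"
  have W0: "0 < W" using ka mu by (simp add: W_def)
  define g where "g j = (p2 j powr et + p2 j) * exp (- p2 j)" for j
  define f where "f k = p2 k powr (if k < 0 then e th1 else e th2)" for k
  have g0: "0 \<le> g j" and f0: "0 \<le> f k" for j k by (auto simp: g_def f_def)
  have u_le: "Ltx a b t0 (u (j, k)) \<le> ennreal (c0 * W * (g j * f k))" for j k
  proof (cases "k < 0")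
   case True
   have "Ltx a b t0 (u (j, k)) \<le> ennreal (32 / (et\<^sup>2 * th1) * ka * p2 k powr (1 - (1 + th1) / (2 * (1 - be))) * ((p2 j powr et + p2 j) * exp (- p2 j)) * exp (- mu * t0) * mu powr (- et))"
    unfolding u_def fst_conv snd_conv by (rule strichartz_term[OF meas F ka be mu ok(1)])
   then show ?thesis using True by (simp add: c0_def W_def g_def f_def e_def mult_ac)
  next
   case False
   have "Ltx a b t0 (u (j, k)) \<le> ennreal (32 / (et\<^sup>2 * th2) * ka * p2 k powr (1 - (1 + th2) / (2 * (1 - be))) * ((p2 j powr et + p2 j) * exp (- p2 j)) * exp (- mu * t0) * mu powr (- et))"
    unfolding u_def fst_conv snd_conv by (rule strichartz_term[OF meas F ka be mu ok(2)])
   also have "... = ennreal (32 / (et\<^sup>2 * th2) * (W * (g j * f k)))"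
    using False by (simp add: W_def g_def f_def e_def mult_ac)
   \<comment> \<open>The constant decreases in the parameter and \<open>th1 < th2\<close>, so that
     of \<open>th1\<close> serves for both.\<close>
   also have "... \<le> ennreal (c0 * (W * (g j * f k)))"
    unfolding c0_def using th et W0 g0 f0 by (intro ennreal_leI mult_right_mono divide_left_mono mult_left_mono) auto
   finally show ?thesis by (simp add: mult_ac)
  qed
  have "DuhN ka mu F n = (\<lambda>t x. \<Sum>i\<in>?I \<times> ?I. u i t x)"
   using DuhN_eq_sum[OF meas F ka be] mu by (auto simp: u_def split_beta' fun_eq_iff)
  then have "Ltx a b t0 (DuhN ka mu F n) \<le> (\<Sum>i\<in>?I \<times> ?I. Ltx a b t0 (u i))"
  proof (simp only:, intro Ltx_sum_le ab0 ab)
   show "jm (u i)" for i unfolding u_def by measurable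
  qed simp
  also have "... \<le> (\<Sum>i\<in>?I \<times> ?I. ennreal (c0 * W * (g (fst i) * f (snd i))))"
   using u_le by (intro sum_mono) (auto simp: split_beta')
  also have "... = ennreal (\<Sum>i\<in>?I \<times> ?I. c0 * W * (g (fst i) * f (snd i)))"
   using c0 W0 g0 f0 by (intro sum_ennreal) auto
  also have "(\<Sum>i\<in>?I \<times> ?I. c0 * W * (g (fst i) * f (snd i))) = c0 * W * ((\<Sum>j\<in>?I. g j) * (\<Sum>k\<in>?I. f k))"
   unfolding sum_distrib_left[symmetric] unfolding sum_product sum.cartesian_product by (simp only: split_beta')
  also have "ennreal ... \<le> ennreal (c0 * W * (Sj * Sk))"
  proof (intro ennreal_leI mult_left_mono mult_mono)
   show "(\<Sum>j\<in>?I. g j) \<le> Sj" unfolding g_def Sj_def by (rule sum_lags_le[OF et])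
   have "(\<Sum>k\<in>?I. f k) = (\<Sum>k\<in>{- int n..<0}. p2 k powr e th1) + (\<Sum>k\<in>{0..<int n}. p2 k powr e th2)"
    unfolding sum_int_split f_def by (intro arg_cong2[where f="(+)"] sum.cong) auto
   also have "... \<le> Sk" unfolding Sk_def using e by (intro add_mono sum_p2_neg_le sum_p2_nonneg_le)
   finally show "(\<Sum>k\<in>?I. f k) \<le> Sk" .
  qed (use c0 W0 Sj0 g0 f0 in \<open>auto intro: sum_nonneg\<close>)
  also have "c0 * W * (Sj * Sk) = c0 * Sj * Sk * ka * mu powr (- et) * exp (- mu * t0)" by (simp add: W_def mult_ac)
  finally show "Ltx a b t0 (DuhN ka mu F n) \<le> ennreal (c0 * Sj * Sk * ka * mu powr (- et) * exp (- mu * t0))" .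
 qed
qed

lemma admissible_splitI:
 assumes "0 < et" "et \<le> 1" "0 < th" "th < 1" "0 < al" "et \<le> 1 - 2 * al" "0 < rh" "rh < 1/2"
  "et \<le> 1 - delta d al / (2 * rh)" "et \<le> nu" "nu \<le> 1" "a = (1 - th) * rh + nu" "b = (1 - th) * al"
  "et \<le> (1 - th) * (1 - delta d al / 2) + th * (1 - real d / 2)"
  "(1 - th) * (1 - delta d al / 2) + th * (1 - real d / 2) \<le> 1"
 shows "admissible_split d et th a b" unfolding admissible_split_def using assms by blast

lemma admissible_split_mono:
 assumes "admissible_split d et th a b" "0 < et'" "et' \<le> et"
 shows "admissible_split d et' th a b"
proof -
 from assms(1) obtain al rh nu where "et \<le> 1" "0 < th" "th < 1"
  "0 < al" "et \<le> 1 - 2 * al" "0 < rh" "rh < 1/2" "et \<le> 1 - delta d al / (2 * rh)" "et \<le> nu" "nu \<le> 1"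
  "a = (1 - th) * rh + nu" "b = (1 - th) * al"
  "et \<le> (1 - th) * (1 - delta d al / 2) + th * (1 - real d / 2)" "(1 - th) * (1 - delta d al / 2) + th * (1 - real d / 2) \<le> 1"
  unfolding admissible_split_def by blast
 then show ?thesis using assms(2,3) by (intro admissible_splitI[where al=al and rh=rh and nu=nu]) auto
qed

text \<open>\<open>rh\<close> has to lie strictly above \<open>L\<close>, half of
  \<open>delta\<close>, for subcriticality, and strictly below both 1/2 and
  \<open>a / (1 - th)\<close>, the latter for a positive \<open>nu\<close>; the midpoint of this
  interval is taken. The two inequalities \<open>e\<close> say that the exponent of the lag is
  positive and that \<open>L < 1/2\<close>.\<close>

lemma admissible_split_scaling:
 assumes b: "0 < b" "th < 1 - 2 * b" and th: "0 < th" and a: "a = real d / 4 - real d * b/2" "0 < a" "a \<le> 1/2"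
  and e: "real d * th/4 < 1 - a" "2 * a < 1 + th * (real d - 2) / 2"
 shows "\<exists>et>0. admissible_split d et th a b"
proof -
 have th1: "th < 1" using b by simp
 define al where "al = b / (1 - th)"
 define L where "L = (a - real d * th/4) / (1 - th)"
 define H where "H = min (1/2) (a / (1 - th))"
 define rh where "rh = (max 0 L + H) / 2"
 define nu where "nu = a - (1 - th) * rh"
 have d: "0 < real d" using a b by (cases "d = 0") auto
 have L: "delta d al = 2 * L" using th1 by (simp add: delta_def al_def L_def a field_simps)
 have "L < 1/2" using e(2) th1 by (simp add: L_def field_simps)
 moreover have "L < a / (1 - th)" unfolding L_def using th th1 d by (intro divide_strict_right_mono) auto
 moreover have "0 < H" using a th1 by (simp add: H_def)
 ultimately have LH: "max 0 L < H" by (simp add: H_def)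
 then have rh: "0 < rh" "L < rh" "rh < H" by (auto simp: rh_def)
 have al: "0 < al" "0 < 1 - 2 * al" using b th1 by (auto simp: al_def field_simps)
 have nu: "0 < nu" "nu \<le> 1"
 proof -
  have "rh < a / (1 - th)" using rh by (simp add: H_def)
  then show "0 < nu" using th1 by (simp add: nu_def field_simps)
  have "0 \<le> (1 - th) * rh" using rh th1 by simp
  then show "nu \<le> 1" using a by (simp add: nu_def)
 qed
 have l: "0 < 1 - delta d al / (2 * rh)" using rh by (simp add: L)
 have ee: "(1 - th) * (1 - delta d al / 2) + th * (1 - real d / 2) = 1 - a - real d * th/4"
 proof -
  have "(1 - th) * (1 - delta d al / 2) = (1 - th) - (1 - th) * L" by (simp add: L algebra_simps)
  also have "(1 - th) * L = a - real d * th/4" using th1 by (simp add: L_def)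
  finally show ?thesis by (simp add: algebra_simps)
 qed
 define et where "et = Min {1, 1 - 2 * al, 1 - delta d al / (2 * rh), nu, 1 - a - real d * th / 4}"
 have et0: "0 < et" using al l nu e(1) by (auto simp: et_def)
 have et: "et \<le> 1" "et \<le> 1 - 2 * al" "et \<le> 1 - delta d al / (2 * rh)" "et \<le> nu" "et \<le> 1 - a - real d * th/4"
  unfolding et_def by (intro Min_le; simp)+
 have rh2: "rh < 1/2" using rh by (simp add: H_def)
 have "0 \<le> real d * th" using th by simp
 then have e1: "1 - a - real d * th/4 \<le> 1" using a by simp
 have ab: "a = (1 - th) * rh + nu" "b = (1 - th) * al" using th1 by (auto simp: al_def nu_def)
 have "admissible_split d et th a b"
  by (rule admissible_splitI[OF et0 et(1) th th1 al(1) et(2) rh(1) rh2 et(3,4) nu(2) ab]) (use et(5) e1 ee in auto)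
 with et0 show ?thesis by blast
qed

text \<open>In dimension one the endpoint \<open>(1/4, 0)\<close> is approached through pairs \<open>(1/4, b)\<close>, which are not admissible.\<close>

lemma admissible_split_1:
 assumes th: "0 < th" "th < 1" and b: "0 < b" "b \<le> (1 - th) / 8"
 shows "admissible_split 1 (th/16) th (1/4) b"
proof -
 define al where "al = b / (1 - th)"
 \<comment> \<open>Half of \<open>delta 1 al\<close> is below 1/4; the excess \<open>th/8\<close> is
   the slack, and \<open>nu\<close> stays positive because
   \<open>(1 - th) * rh < 1/4\<close>.\<close>
 define rh where "rh = 1/4 + th/8"
 define nu where "nu = 1/4 - (1 - th) * rh"
 have al: "0 < al" "al \<le> 1/8" using b th by (auto simp: al_def field_simps)
 have nu: "nu = th/8 + th * th/8" by (simp add: nu_def rh_def field_simps)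
 have tt: "0 \<le> th * th" "th * th \<le> 1" using th by (auto intro: mult_le_one)
 have "th/16 \<le> 1 - (1/4) / (1/4 + th/8)" using th tt by (simp add: field_simps)
 also have "... \<le> 1 - delta 1 al / (2 * rh)"
 proof -
  have "delta 1 al / (2 * rh) = (1/4 - al/2) / rh" by (simp add: delta_def field_simps)
  also have "... \<le> (1/4) / rh" using al th by (intro divide_right_mono) (auto simp: rh_def)
  finally show ?thesis by (simp add: rh_def)
 qed
 finally have 1: "th/16 \<le> 1 - delta 1 al / (2 * rh)" .
 have e: "(1 - th) * (1 - delta 1 al / 2) + th * (1 - real 1 / 2) = 3/4 - th/4 + (1 - th) * al/2"
  by (simp add: delta_def field_simps)
 have 2: "0 \<le> (1 - th) * al" "(1 - th) * al \<le> 1 * (1/8)"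
  using th al by simp (rule mult_mono, use th al in auto)
 show ?thesis
 proof (rule admissible_splitI)
  show "b = (1 - th) * al" using th by (simp add: al_def)
  show "1/4 = (1 - th) * rh + nu" by (simp add: nu_def)
  show "th/16 \<le> 1 - delta 1 al / (2 * rh)" by (rule 1)
  show "th/16 \<le> (1 - th) * (1 - delta 1 al / 2) + th * (1 - real 1 / 2)"
   "(1 - th) * (1 - delta 1 al / 2) + th * (1 - real 1 / 2) \<le> 1" unfolding e using th 2 by linarith+
  show "th/16 \<le> nu" "nu \<le> 1" unfolding nu using th tt by auto
 qed (use th al in \<open>auto simp: rh_def\<close>)
qed

section \<open>Limits in L2 and lower semicontinuity of the norms\<close>

lemma AE_summable_L2:
 fixes d :: "nat \<Rightarrow> 'n::finite wave"
 assumes [measurable]: "\<And>k. d k \<in> bm"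
  and le: "\<And>k. Lx (1/2) (d k) \<le> ennreal ((1/4) ^ k)"
 shows "AE x in lborel. summable (\<lambda>k. cmod (d k x))"
proof -
 have "Lnorm lborel (1/2) (\<lambda>x. \<Sum>k. ennreal (cmod (d k x))) \<le> (\<Sum>k. ennreal ((1/4) ^ k))"
  using le by (intro Lnorm_suminf_le) (auto simp: Lx_def sigma_finite_lborel)
 also have "... = ennreal (\<Sum>k. (1/4) ^ k)" by (intro suminf_ennreal2) (auto intro: summable_geometric)
 also have "... < top" by simp
 finally have "(NN x. enn_powr (\<Sum>k. ennreal (cmod (d k x))) 2) \<noteq> \<infinity>" by (auto simp: Lnorm_pos)
 then have "AE x in lborel. enn_powr (\<Sum>k. ennreal (cmod (d k x))) 2 \<noteq> \<infinity>"
  by (intro nn_integral_PInf_AE) auto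
 then show ?thesis by eventually_elim (auto intro!: summable_suminf_not_top)
qed

lemma Lx_half_AE_subseq:
 fixes f :: "nat \<Rightarrow> 'n::finite wave"
 assumes [measurable]: "\<And>n. f n \<in> bm" "g \<in> bm"
  and lim: "(\<lambda>n. Lx (1/2) (\<lambda>x. f n x - g x)) \<longlonglongrightarrow> 0"
 shows "\<exists>r. filterlim r sequentially sequentially \<and> (AE x in lborel. (\<lambda>k. f (r k) x) \<longlonglongrightarrow> g x)"
proof -
 have "\<exists>n\<ge>k. Lx (1/2) (\<lambda>x. f n x - g x) \<le> ennreal ((1/4) ^ k)" for k
 proof -
  have "\<forall>\<^sub>F n in sequentially. Lx (1/2) (\<lambda>x. f n x - g x) < ennreal ((1/4) ^ k)"
   using lim by (rule order_tendstoD) simp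
  then obtain N where "\<And>n. n \<ge> N \<Longrightarrow> Lx (1/2) (\<lambda>x. f n x - g x) < ennreal ((1/4) ^ k)"
   unfolding eventually_sequentially by blast
  from this[of "max N k"] show ?thesis by (intro exI[of _ "max N k"]) auto
 qed
 then obtain r where r: "\<And>k. r k \<ge> k" "\<And>k. Lx (1/2) (\<lambda>x. f (r k) x - g x) \<le> ennreal ((1/4) ^ k)"
  by metis
 have "AE x in lborel. summable (\<lambda>k. cmod (f (r k) x - g x))" by (rule AE_summable_L2) (use r in auto)
 then have "AE x in lborel. (\<lambda>k. f (r k) x) \<longlonglongrightarrow> g x"
 proof eventually_elim
  case (elim x)
  then have "(\<lambda>k. f (r k) x - g x) \<longlonglongrightarrow> 0"
   using summable_LIMSEQ_zero tendsto_norm_zero_iff by blast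
  then show ?case by (simp add: LIM_zero_iff)
 qed
 moreover have "filterlim r sequentially sequentially"
  using r(1) by (intro filterlim_at_top_mono[OF filterlim_ident]) auto
 ultimately show ?thesis by blast
qed

text \<open>A subsequence realising the \<open>liminf\<close> is thinned out to one that converges
  almost everywhere, and Fatou applies.\<close>

lemma Lx_lower_semicontinuous:
 fixes f :: "nat \<Rightarrow> 'n::finite wave"
 assumes [measurable]: "\<And>n. f n \<in> bm" "g \<in> bm"
  and lim: "(\<lambda>n. Lx (1/2) (\<lambda>x. f n x - g x)) \<longlonglongrightarrow> 0" and b: "0 < b"
 shows "Lx b g \<le> liminf (\<lambda>n. Lx b (f n))"
proof -
 obtain r :: "nat \<Rightarrow> nat" where r: "strict_mono r" "((\<lambda>n. Lx b (f n)) \<circ> r) \<longlonglongrightarrow> liminf (\<lambda>n. Lx b (f n))"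
  using liminf_subseq_lim by blast
 have "(\<lambda>n. Lx (1/2) (\<lambda>x. f (r n) x - g x)) \<longlonglongrightarrow> 0"
  using LIMSEQ_subseq_LIMSEQ[OF lim r(1)] by (simp add: o_def)
 from Lx_half_AE_subseq[OF _ _ this] obtain q where q: "filterlim q sequentially sequentially"
  and ae: "AE x in lborel. (\<lambda>k. f (r (q k)) x) \<longlonglongrightarrow> g x" by auto
 have "Lx b g \<le> liminf (\<lambda>k. Lx b (f (r (q k))))" unfolding Lx_def
 proof (rule Lnorm_Fatou[OF _ b])
  show "AE x in lborel. ennreal (cmod (g x)) \<le> liminf (\<lambda>k. ennreal (cmod (f (r (q k)) x)))" using ae
  proof eventually_elim
   case (elim x)
   then have "(\<lambda>k. ennreal (cmod (f (r (q k)) x))) \<longlonglongrightarrow> ennreal (cmod (g x))"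
    by (intro tendsto_ennrealI tendsto_norm)
   then show ?case by (simp add: lim_imp_Liminf del: tendsto_ennreal_iff)
  qed
 qed measurable
 also have "(\<lambda>k. Lx b (f (r (q k)))) \<longlonglongrightarrow> liminf (\<lambda>n. Lx b (f n))"
  using filterlim_compose[OF r(2) q] by (simp add: o_def)
 then have "liminf (\<lambda>k. Lx b (f (r (q k)))) = liminf (\<lambda>n. Lx b (f n))" by (simp add: lim_imp_Liminf)
 finally show ?thesis .
qed

text \<open>At each time the limit is only a class of functions. To select representatives jointly
  measurable in \<open>t\<close> and \<open>x\<close>, the subsequence runs along
  \<open>N k t\<close>, the least index with Cauchy error \<open>(1/4) ^ k\<close>, which depends
  measurably on \<open>t\<close>.\<close>

lemma L2_limit_measurable:
 fixes u :: "nat \<Rightarrow> 'n::finite evol"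
 assumes meas[measurable]: "\<And>n. jm (u n)"
  and Cauchy: "\<And>t ep. 0 < ep \<Longrightarrow> \<exists>N. \<forall>m\<ge>N. \<forall>n\<ge>N. Lx (1/2) (\<lambda>x. u m t x - u n t x) \<le> ennreal ep"
 shows "\<exists>V. jm V \<and> (\<forall>t. (\<lambda>n. Lx (1/2) (\<lambda>x. u n t x - V t x)) \<longlonglongrightarrow> 0)"
proof -
 define P where "P k t N \<longleftrightarrow> (\<forall>m\<ge>N. \<forall>n\<ge>N. Lx (1/2) (\<lambda>x. u m t x - u n t x) \<le> ennreal ((1/4) ^ k))" for k t N
 define N where "N k t = (LEAST N. P k t N)" for k t
 have [measurable]: "(\<lambda>t. Lx (1/2) (\<lambda>x. u m t x - u n t x)) \<in> bm" for m n
  by (rule borel_measurable_Lx) auto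
 have [measurable]: "(\<lambda>t. P k t M) \<in> measurable borel (count_space UNIV)" for k M
  unfolding P_def by measurable
 have [measurable]: "N k \<in> measurable borel (count_space UNIV)" for k unfolding N_def by measurable
 have P: "P k t (N k t)" for k t
 proof -
  have "\<exists>N. P k t N" unfolding P_def by (rule Cauchy) simp
  then show ?thesis unfolding N_def by (rule LeastI_ex)
 qed
 have Nmono: "N k t \<le> N (Suc k) t" for k t
 proof -
  have "ennreal ((1/4) ^ Suc k) \<le> ennreal ((1/4) ^ k)" by (intro ennreal_leI) simp
  then have "P k t (N (Suc k) t)" using P[of "Suc k" t] unfolding P_def by (meson order_trans)
  then show ?thesis unfolding N_def by (intro Least_le)
 qed
 have Nmono': "j \<le> k \<Longrightarrow> N j t \<le> N k t" for j k t by (rule lift_Suc_mono_le[of "\<lambda>k. N k t"]) (rule Nmono)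
 define v where "v k t x = u (N k t) t x" for k t x
 have vm[measurable]: "jm (v k)" for k unfolding v_def split_beta'
  by (rule measurable_compose_countable[where f="\<lambda>i z. u i (fst z) (snd z)"]) (use meas in \<open>auto simp: split_beta'\<close>)
 \<comment> \<open>Where the sequence diverges, \<open>lim\<close> is a fixed default value; for
   every \<open>t\<close> this concerns a null set of \<open>x\<close>.\<close>
 define V where "V t x = lim (\<lambda>k. v k t x)" for t x
 have Vm[measurable]: "jm V"
  unfolding V_def split_beta' by (rule borel_measurable_lim_metric) (use vm in \<open>auto simp: split_beta'\<close>)
 have um1[measurable]: "u n t \<in> bm" for n t
  using measurable_compose[OF measurable_Pair1'[of t borel] meas[of n]] by simp
 have [measurable]: "V t \<in> bm" for t using measurable_compose[OF measurable_Pair1'[of t borel] Vm] by simp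
 have [measurable]: "v k t \<in> bm" for k t using measurable_compose[OF measurable_Pair1'[of t borel] vm] by simp
 have ae: "AE x in lborel. (\<lambda>k. v k t x) \<longlonglongrightarrow> V t x" for t
 proof -
  have "AE x in lborel. summable (\<lambda>k. cmod (v (Suc k) t x - v k t x))"
  proof (rule AE_summable_L2)
   show "Lx (1/2) (\<lambda>x. v (Suc k) t x - v k t x) \<le> ennreal ((1/4) ^ k)" for k
    using P[of k t] Nmono[of k t] by (auto simp: P_def v_def)
  qed measurable
  then show ?thesis
  proof eventually_elim
   case (elim x)
   then have "convergent (\<lambda>n. \<Sum>k<n. v (Suc k) t x - v k t x)"
    by (simp add: summable_norm_cancel flip: summable_iff_convergent)
   then have "convergent (\<lambda>n. v n t x - v 0 t x)"
    by (simp only: sum_lessThan_telescope[of "\<lambda>n. v n t x"])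
   then have "convergent (\<lambda>k. v k t x)"
    using convergent_add[OF _ convergent_const[of "v 0 t x"], of "\<lambda>n. v n t x - v 0 t x"] by simp
   then show ?case by (simp add: V_def convergent_LIMSEQ_iff)
  qed
 qed
 have le: "Lx (1/2) (\<lambda>x. u n t x - V t x) \<le> ennreal ((1/4) ^ j)" if "N j t \<le> n" for n t j
 proof -
  have "Lx (1/2) (\<lambda>x. u n t x - V t x) \<le> liminf (\<lambda>k. Lx (1/2) (\<lambda>x. u n t x - v k t x))"
   unfolding Lx_def
  proof (rule Lnorm_Fatou)
   show "AE x in lborel. ennreal (cmod (u n t x - V t x)) \<le> liminf (\<lambda>k. ennreal (cmod (u n t x - v k t x)))"
    using ae[of t]
   proof eventually_elim
    case (elim x)
    then have "(\<lambda>k. ennreal (cmod (u n t x - v k t x))) \<longlonglongrightarrow> ennreal (cmod (u n t x - V t x))"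
     by (intro tendsto_ennrealI tendsto_norm tendsto_diff tendsto_const)
    then show ?case by (simp add: lim_imp_Liminf del: tendsto_ennreal_iff)
   qed
  qed auto
  also have "... \<le> liminf (\<lambda>k. ennreal ((1/4) ^ j))"
  proof (rule Liminf_mono)
   show "\<forall>\<^sub>F k in sequentially. Lx (1/2) (\<lambda>x. u n t x - v k t x) \<le> ennreal ((1/4) ^ j)"
    using eventually_ge_at_top[of j]
   proof eventually_elim
    case (elim k)
    then show ?case using P[of j t] Nmono'[OF elim, of t] that by (auto simp: P_def v_def)
   qed
  qed
  finally show ?thesis by (simp add: Liminf_const)
 qed
 have "(\<lambda>n. Lx (1/2) (\<lambda>x. u n t x - V t x)) \<longlonglongrightarrow> 0" for t
 proof (rule order_tendstoI)
  fix a :: ennreal assume a: "0 < a"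
  have "(\<lambda>j. ennreal ((1/4) ^ j)) \<longlonglongrightarrow> ennreal 0"
   by (intro tendsto_ennrealI LIMSEQ_realpow_zero) auto
  then have "\<forall>\<^sub>F j in sequentially. ennreal ((1/4) ^ j) < a" using a by (auto dest: order_tendstoD(2))
  then obtain j where j: "ennreal ((1/4) ^ j) < a" by (auto simp: eventually_sequentially)
  show "\<forall>\<^sub>F n in sequentially. Lx (1/2) (\<lambda>x. u n t x - V t x) < a"
   using eventually_ge_at_top[of "N j t"] by eventually_elim (use le j in \<open>auto intro: le_less_trans\<close>)
 qed auto
 with Vm show ?thesis by blast
qed

text \<open>For \<open>z\<close> below the essential supremum the set \<open>A\<close> where
  \<open>f\<close> exceeds \<open>z\<close> has positive measure, and the norms are at least
  \<open>c * m powr b n\<close>, which tends to \<open>c\<close>. The measure is capped at 1 because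
  it may be infinite.\<close>

lemma Lx_0_le_liminf:
 fixes f :: "'n::finite wave"
 assumes [measurable]: "f \<in> bm" and b: "\<And>n. 0 < b n" "b \<longlonglongrightarrow> 0"
 shows "Lx 0 f \<le> liminf (\<lambda>n. Lx (b n) f)"
proof (rule dense_le)
 fix z assume "z < Lx 0 f"
 then have z: "z < esssup lborel (\<lambda>x. ennreal (cmod (f x)))" by (simp add: Lx_def Lnorm_def)
 define c where "c = enn2real z"
 have zt: "z < top" using z by (rule less_le_trans) simp
 then have zc: "z = ennreal c" "0 \<le> c" by (auto simp: c_def)
 define A where "A = {x. c < cmod (f x)}"
 have [measurable]: "A \<in> sets borel" unfolding A_def by measurable
 have "0 < emeasure lborel {x \<in> space lborel. z < ennreal (cmod (f x))}"
  using z by (intro esssup_pos_measure) auto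
 then have A: "0 < emeasure lborel A" by (simp add: A_def zc ennreal_less_iff)
 define m where "m = enn2real (min 1 (emeasure lborel A))"
 have m: "ennreal m = min 1 (emeasure lborel A)" unfolding m_def by (intro ennreal_enn2real) (simp add: min_less_iff_disj)
 have "0 < ennreal m" unfolding m using A by simp
 then have m0: "0 < m" by simp
 have le: "ennreal (c * m powr b n) \<le> Lx (b n) f" for n
 proof -
  have "ennreal (c * m powr b n) = ennreal c * enn_powr (min 1 (emeasure lborel A)) (b n)"
   using zc m0 by (simp add: ennreal_mult enn_powr_ennreal flip: m)
  also have "... \<le> ennreal c * enn_powr (emeasure lborel A) (b n)"
   using b(1)[of n] by (intro mult_left_mono enn_powr_mono) auto
  also have "enn_powr (emeasure lborel A) (b n) = Lnorm lborel (b n) (indicator A :: _ \<Rightarrow> ennreal)"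
  proof -
   have "enn_powr (indicator A x) (1 / b n) = indicator A x" for x :: "real^'n" by (simp split: split_indicator)
   then show ?thesis using b(1)[of n] by (simp add: Lnorm_pos)
  qed
  also have "ennreal c * ... = Lnorm lborel (b n) (\<lambda>x. ennreal c * indicator A x)"
   using b(1)[of n] by (subst Lnorm_cmult) auto
  also have "... \<le> Lx (b n) f"
   unfolding Lx_def using b(1)[of n] by (intro Lnorm_mono) (auto simp: A_def zc intro!: ennreal_leI split: split_indicator)
  finally show ?thesis .
 qed
 have "(\<lambda>n. ennreal (c * m powr b n)) \<longlonglongrightarrow> ennreal (c * m powr 0)"
  using m0 b(2) by (intro tendsto_ennrealI tendsto_intros) auto
 then have "z = liminf (\<lambda>n. ennreal (c * m powr b n))"
  using m0 by (simp add: zc lim_imp_Liminf del: tendsto_ennreal_iff)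
 also have "... \<le> liminf (\<lambda>n. Lx (b n) f)" by (intro Liminf_mono always_eventually allI le)
 finally show "z \<le> liminf (\<lambda>n. Lx (b n) f)" .
qed

section \<open>The Duhamel integral\<close>

lemma nn_integral_exp_tail':
 "0 < b \<Longrightarrow> (\<integral>\<^sup>+s\<in>{a..}. ennreal (exp (- (b * s))) \<partial>lborel) = ennreal (exp (- (b * a)) / b)"
 using nn_integral_exp_tail[of b a] by simp

text \<open>The integral is split at lag \<open>1/mu\<close>: nearer, the singularity is integrable
  and contributes \<open>mu powr (e - 1)\<close>; farther, the kernel is at most
  \<open>mu powr e\<close> and the exponential integrates to a multiple of \<open>1/mu\<close>. This
  is the source of the gain in the L2 and \<open>L(r2)\<close> bounds.\<close>

lemma nn_integral_kernel_exp:
 assumes e: "0 \<le> e" "e < 1" and mu: "1 \<le> mu" and ka: "0 \<le> ka"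
 shows "(NN s'. ennreal (\<bar>s - s'\<bar> powr (- e)) * (ennreal (ka * exp (- mu * s')) * indicator {t..} s'))
  \<le> ennreal (3 / (1 - e) * ka * mu powr (e - 1) * exp (- mu * t))"
proof -
 let ?f = "\<lambda>s'. ennreal (\<bar>s - s'\<bar> powr (- e)) * (ennreal (ka * exp (- mu * s')) * indicator {t..} s')"
 let ?k = "\<lambda>s'. if \<bar>s - s'\<bar> \<le> 1 / mu then ennreal (\<bar>s - s'\<bar> powr (- e)) else 0"
 have "(NN s'. ?f s')
  \<le> (NN s'. ennreal (ka * exp (- mu * t)) * ?k s' + ennreal (mu powr e * ka) * (ennreal (exp (- mu * s')) * indicator {t..} s'))"
 proof (rule nn_integral_mono)
  fix s'
  show "?f s'
   \<le> ennreal (ka * exp (- mu * t)) * ?k s' + ennreal (mu powr e * ka) * (ennreal (exp (- mu * s')) * indicator {t..} s')"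
  proof (cases "t \<le> s'")
   case False then show ?thesis by simp
  next
   case t: True
   show ?thesis
   proof (cases "\<bar>s - s'\<bar> \<le> 1/mu")
    case True
    have "?f s' \<le> ennreal (\<bar>s - s'\<bar> powr (- e)) * ennreal (ka * exp (- mu * t))"
     using t mu ka by (intro mult_left_mono) (auto intro!: ennreal_leI mult_left_mono)
    then show ?thesis using True by (simp add: mult.commute add_increasing2)
   next
    case False
    then have "\<bar>s - s'\<bar> powr (- e) \<le> (1/mu) powr (- e)" using mu e by (intro powr_mono2') auto
    also have "... = mu powr e" using mu by (simp add: powr_minus_divide powr_divide)
    finally have "ennreal (\<bar>s - s'\<bar> powr (- e)) * ennreal (ka * exp (- mu * s')) \<le> ennreal (mu powr e) * ennreal (ka * exp (- mu * s'))"
     by (intro mult_right_mono ennreal_leI) auto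
    then show ?thesis using False t ka by (simp add: mult.assoc ennreal_mult)
   qed
  qed
 qed
 also have "... = ennreal (ka * exp (- mu * t)) * ennreal (2 * (1/mu) powr (1 - e) / (1 - e)) + ennreal (mu powr e * ka) * ennreal (exp (- mu * t) / mu)"
  using mu e by (subst nn_integral_add) (auto simp: nn_integral_cmult nn_integral_powr_ball nn_integral_exp_tail')
 also have "... = ennreal (ka * exp (- mu * t) * (2 * (1/mu) powr (1 - e) / (1 - e)) + mu powr e * ka * (exp (- mu * t) / mu))"
  using ka mu e by (simp flip: ennreal_mult)
 also have "... \<le> ennreal (3 / (1 - e) * ka * mu powr (e - 1) * exp (- mu * t))"
 proof (rule ennreal_leI)
  have 1: "(1/mu) powr (1 - e) = mu powr (e - 1)" using mu powr_minus_divide[of mu "1 - e"] by (simp add: powr_divide)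
  have 2: "mu powr e / mu = mu powr (e - 1)" using mu by (simp add: powr_diff)
  have "ka * exp (- mu * t) * (2 * (1/mu) powr (1 - e) / (1 - e)) + mu powr e * ka * (exp (- mu * t) / mu)
   = (2 / (1 - e) + 1) * (ka * mu powr (e - 1) * exp (- mu * t))"
   unfolding 1 by (simp add: 2[symmetric] distrib_left add_divide_distrib mult_ac)
  also have "... \<le> 3 / (1 - e) * (ka * mu powr (e - 1) * exp (- mu * t))"
  proof (rule mult_right_mono)
   have "1 \<le> 1 / (1 - e)" using e by simp
   then show "2 / (1 - e) + 1 \<le> 3 / (1 - e)" by simp
  qed (use ka in simp)
  finally show "ka * exp (- mu * t) * (2 * (1/mu) powr (1 - e) / (1 - e)) + mu powr e * ka * (exp (- mu * t) / mu)
   \<le> 3 / (1 - e) * ka * mu powr (e - 1) * exp (- mu * t)" by (simp add: mult.assoc)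
 qed
 finally show ?thesis .
qed

text \<open>In the double time integral one factor is used up by the exponential bound, while the
  other keeps its own majorant \<open>A\<close>: the exponential again for the L2 bound, a vanishing
  tail for the Cauchy property.\<close>

lemma energy_weighted:
 fixes G :: "'n::finite evol"
 assumes meas[measurable]: "jm G"
  and int: "(NN s y. ennreal (cmod (G s y))) < \<infinity>"
  and c: "0 < c" "\<And>s y. \<bar>t - s\<bar> < c \<Longrightarrow> G s y = 0"
  and be: "0 < be" "be < 1/2" "delta CARD('n) be < 1" and mu: "1 \<le> mu" and ka: "0 \<le> ka"
  and G: "\<And>s. Lx (1 - be) (G s) \<le> ennreal (ka * exp (- mu * s)) * indicator {t..} s"
  and A: "\<And>s. Lx (1 - be) (G s) \<le> A s" and [measurable]: "A \<in> bm"
 shows "enn_powr (Lx (1/2) (\<lambda>x. \<integral>s. U (t - s) (G s) x \<partial>lborel)) 2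
  \<le> ennreal (Cdisp be * (3 / (1 - delta CARD('n) be) * ka * mu powr (delta CARD('n) be - 1) * exp (- mu * t))) * (NN s. A s)"
proof -
 let ?de = "delta CARD('n) be" and ?N = "\<lambda>s. Lx (1 - be) (G s)"
 have de: "0 \<le> ?de" using be by (simp add: delta_def)
 have C: "0 \<le> Cdisp be" using Cdisp_pos[of be] be by simp
 let ?M = "3 / (1 - ?de) * ka * mu powr (?de - 1) * exp (- mu * t)"
 let ?k = "\<lambda>s s'. ennreal (\<bar>s - s'\<bar> powr (- ?de)) * (ennreal (ka * exp (- mu * s')) * indicator {t..} s')"
 have "enn_powr (Lx (1/2) (\<lambda>x. \<integral>s. U (t - s) (G s) x \<partial>lborel)) 2
  \<le> (NN s. NN s'. ennreal (Cdisp be * \<bar>s - s'\<bar> powr (- ?de)) * (?N s * ?N s'))"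
  by (rule energy[OF meas int _ _ c(1) _ be(1,2)]) (use c(2) in auto)
 also have "... \<le> (NN s. NN s'. (ennreal (Cdisp be) * A s) * ?k s s')"
 proof (rule nn_integral_mono, rule nn_integral_mono)
  fix s s'
  have "ennreal (Cdisp be * \<bar>s - s'\<bar> powr (- ?de)) * (?N s * ?N s') = (ennreal (Cdisp be) * ?N s) * (ennreal (\<bar>s - s'\<bar> powr (- ?de)) * ?N s')"
   using C by (simp add: ennreal_mult mult_ac)
  also have "... \<le> (ennreal (Cdisp be) * A s) * ?k s s'"
   by (intro mult_mono G A mult_left_mono) auto
  finally show "ennreal (Cdisp be * \<bar>s - s'\<bar> powr (- ?de)) * (?N s * ?N s') \<le> ..." .
 qed
 also have "... = (NN s. (ennreal (Cdisp be) * A s) * (NN s'. ?k s s'))"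
  by (intro nn_integral_cong nn_integral_cmult) measurable
 also have "... \<le> (NN s. ennreal (Cdisp be * ?M) * A s)"
 proof (rule nn_integral_mono)
  fix s
  have "(ennreal (Cdisp be) * A s) * (NN s'. ?k s s')
   \<le> (ennreal (Cdisp be) * A s) * ennreal ?M" by (intro mult_left_mono nn_integral_kernel_exp de be mu ka) simp
  also have "... = ennreal (Cdisp be * ?M) * A s" unfolding ennreal_mult'[OF C] by (simp only: mult_ac)
  finally show "(ennreal (Cdisp be) * A s) * (NN s'. ?k s s')
   \<le> ennreal (Cdisp be * ?M) * A s" .
 qed
 also have "... \<le> ennreal (Cdisp be * ?M) * (NN s. A s)" by (simp add: nn_integral_cmult)
 finally show ?thesis .
qed

locale duhamel =
 fixes F :: "'n::finite evol" and be ka mu :: real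
 assumes meas [measurable]: "jm F"
  and F_le: "Lx (1 - be) (F s) \<le> ennreal (ka * exp (- mu * s))"
  and ka: "0 < ka" and mu: "1 \<le> mu" and be: "0 < be" "be < 1/2" and de1: "delta CARD('n) be < 1"
begin

definition H :: "nat \<Rightarrow> real \<Rightarrow> 'n evol" where
 "H n t s = lagcut (p2 (- int n)) (p2 (int n)) (levcut ka mu (p2 (- int n)) (p2 (int n)) F) t s"

lemma de_nonneg: "0 \<le> delta CARD('n) be" using be by (simp add: delta_def)

lemma measurable_H [measurable]: "jm (H n t)" unfolding H_def by measurable

lemma H_eq: "H n t s y = (if (p2 (- int n) < s - t \<and> s - t \<le> p2 (int n)) \<and>
  (p2 (- int n) * (ka * exp (- mu * s)) \<le> cmod (F s y) \<and> cmod (F s y) < p2 (int n) * (ka * exp (- mu * s))) then F s y else 0)"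
 by (simp add: H_def lagcut_def levcut_def)

lemma H_cases: "H n t s y = 0 \<or> H n t s y = F s y" by (simp add: H_eq)

lemma H_zero: "s \<le> t + p2 (- int n) \<Longrightarrow> H n t s = (\<lambda>_. 0)" by (auto simp: H_eq fun_eq_iff)

lemma H_zero': "s \<le> t \<Longrightarrow> H n t s = (\<lambda>_. 0)" by (rule H_zero) (simp add: add_increasing2)

lemma H_mono:
 assumes "n \<le> m" "H n t s y \<noteq> 0" shows "H m t s y = F s y"
proof -
 have 1: "p2 (- int m) \<le> p2 (- int n)" "p2 (int n) \<le> p2 (int m)" using assms by auto
 have pos: "0 < ka * exp (- mu * s)" using ka by simp
 have 2: "p2 (- int m) * (ka * exp (- mu * s)) \<le> p2 (- int n) * (ka * exp (- mu * s))" "p2 (int n) * (ka * exp (- mu * s)) \<le> p2 (int m) * (ka * exp (- mu * s))"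
  using 1 pos by (auto intro!: mult_right_mono simp del: powr_le_cancel_iff)
 from assms(2) have 3: "p2 (- int n) < s - t" "s - t \<le> p2 (int n)"
  "p2 (- int n) * (ka * exp (- mu * s)) \<le> cmod (F s y)" "cmod (F s y) < p2 (int n) * (ka * exp (- mu * s))"
  unfolding H_eq by (auto split: if_splits)
 have "p2 (- int m) < s - t" "s - t \<le> p2 (int m)"
  "p2 (- int m) * (ka * exp (- mu * s)) \<le> cmod (F s y)" "cmod (F s y) < p2 (int m) * (ka * exp (- mu * s))"
  using 1 2 3 by linarith+
 then show ?thesis by (simp add: H_eq)
qed

lemma H_eventually:
 assumes "t < s" shows "\<exists>N. \<forall>n\<ge>N. H n t s y = F s y"
proof (cases "F s y = 0")
 case True then show ?thesis using H_cases by metis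
next
 case False
 define w where "w = ka * exp (- mu * s)"
 have w: "0 < w" using ka by (simp add: w_def)
 have p: "p2 (int n) = 2 ^ n" "p2 (- int n) = (1/2) ^ n" for n
  by (simp_all add: powr_minus powr_realpow power_one_over inverse_eq_divide)
 have "\<forall>\<^sub>F n in sequentially. (1/2) ^ n < min (s - t) (cmod (F s y) / w)"
  using assms False w by (intro order_tendstoD[OF LIMSEQ_realpow_zero]) auto
 then obtain n1 where n1: "(1/2) ^ n1 < min (s - t) (cmod (F s y) / w)" by (auto simp: eventually_sequentially)
 obtain n2 where n2: "max (s - t) (cmod (F s y) / w) < 2 ^ n2"
  using real_arch_pow[of 2 "max (s - t) (cmod (F s y) / w)"] by auto
 have "H (max n1 n2) t s y = F s y"
 proof -
  let ?n = "max n1 n2"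
  have "(1/2) ^ ?n \<le> (1/2 :: real) ^ n1" "(2::real) ^ n2 \<le> 2 ^ ?n" by (auto intro: power_decreasing power_increasing)
  moreover have "(1/2) ^ n1 < s - t" "(1/2) ^ n1 < cmod (F s y) / w" "s - t < 2 ^ n2" "cmod (F s y) / w < 2 ^ n2"
   using n1 n2 by auto
  ultimately have "(1/2) ^ ?n < s - t" "s - t \<le> 2 ^ ?n" "(1/2) ^ ?n \<le> cmod (F s y) / w" "cmod (F s y) / w < 2 ^ ?n"
   by linarith+
  then show ?thesis unfolding H_eq p w_def[symmetric] using w by (simp add: field_simps)
 qed
 then show ?thesis using H_mono[of "max n1 n2" _ t s y] False by (intro exI[of _ "max n1 n2"]) auto
qed

lemma H_L1: "(NN y. ennreal (cmod (levcut ka mu (p2 (- int n)) (p2 (int n)) F s y)))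
  \<le> ennreal (ka * p2 (- int n) powr (1 - 1 / (1 - be)) * exp (- mu * s))"
 by (rule levcut_L1[OF meas F_le ka be]) simp

lemma H_integrable: "integrable lborel (\<lambda>s. U (t - s) (H n t s) x)" "integrable lborel (H n t s)"
proof -
 have m: "jm (levcut ka mu (p2 (- int n)) (p2 (int n)) F)" by measurable
 have 1: "p2 (- int n) \<le> p2 (int n)" "0 \<le> ka * p2 (- int n) powr (1 - 1 / (1 - be))" "0 \<le> mu" "0 < p2 (- int n)" using ka mu by auto
 show "integrable lborel (\<lambda>s. U (t - s) (H n t s) x)" "integrable lborel (H n t s)"
  unfolding H_def by (rule Duh_integrable[OF m H_L1 1(4,1,3,2)])+
qed

lemma DuhN_eq: "DuhN ka mu F n t x = (LBINT s. U (t - s) (H n t s) x)" by (simp add: DuhN_def Duh_def H_def)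

lemma measurable_DuhN: "jm (DuhN ka mu F n)" unfolding DuhN_def by measurable

lemma measurable_DuhN1 [measurable]: "DuhN ka mu F n t \<in> bm"
 using measurable_compose[OF measurable_Pair1'[of t borel] measurable_DuhN] by simp

lemma H_L1_time: "(NN s y. ennreal (cmod (H n t s y))) < \<infinity>"
proof -
 let ?B = "ka * p2 (- int n) powr (1 - 1 / (1 - be))"
 have "(NN s y. ennreal (cmod (H n t s y))) \<le> (NN s. ennreal ?B * (ennreal (exp (- mu * s)) * indicator {t..} s))"
 proof (rule nn_integral_mono)
  fix s
  show "L1 (H n t s) \<le> ennreal ?B * (ennreal (exp (- mu * s)) * indicator {t..} s)"
  proof (cases "t \<le> s")
   case True
   have "L1 (H n t s) \<le> (NN y. ennreal (cmod (levcut ka mu (p2 (- int n)) (p2 (int n)) F s y)))"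
    by (intro nn_integral_mono) (simp add: H_def lagcut_def)
   also note H_L1
   finally show ?thesis using True ka by (simp add: ennreal_mult)
  next
   case False
   then show ?thesis by (simp add: H_zero')
  qed
 qed
 also have "... = ennreal ?B * ennreal (exp (- mu * t) / mu)"
  using mu by (simp add: nn_integral_cmult nn_integral_exp_tail')
 also have "... < \<infinity>" by (simp add: ennreal_mult_less_top)
 finally show ?thesis .
qed

lemma H_le: "Lx (1 - be) (H n t s) \<le> ennreal (ka * exp (- mu * s)) * indicator {t..} s"
proof (cases "t \<le> s")
 case True
 have "Lx (1 - be) (H n t s) \<le> Lx (1 - be) (F s)" using be H_cases[of n t s] by (intro Lx_mono) (auto simp: H_eq)
 then show ?thesis using True F_le[of s] by simp
next
 case False
 then show ?thesis using be by (simp add: H_zero')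
qed

text \<open>The forcing after time \<open>t\<close> that the cut omits. It dominates every
  difference of later cuts, as \<open>norm_H_diff_le\<close> shows, and so turns pointwise
  convergence of the cuts into a Cauchy estimate.\<close>

definition rest :: "nat \<Rightarrow> real \<Rightarrow> 'n evol" where
 "rest n t s y = (if t < s then F s y - H n t s y else 0)"

lemma measurable_rest [measurable]: "jm (rest n t)"
 using meas measurable_H[of n t] unfolding rest_def split_beta' by measurable

lemma norm_rest_le: "cmod (rest n t s y) \<le> cmod (F s y)" using H_cases[of n t s y] by (auto simp: rest_def)

lemma rest_le: "Lx (1 - be) (rest n t s) \<le> ennreal (ka * exp (- mu * s)) * indicator {t..} s"
proof (cases "t < s")
 case True
 have "Lx (1 - be) (rest n t s) \<le> Lx (1 - be) (F s)" using be by (intro Lx_mono norm_rest_le) auto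
 then show ?thesis using True F_le[of s] by simp
next
 case False
 then have "rest n t s = (\<lambda>_. 0)" by (simp add: rest_def fun_eq_iff)
 then show ?thesis using be by simp
qed

lemma norm_H_diff_le:
 assumes "N \<le> n" "N \<le> m" shows "cmod (H n t s y - H m t s y) \<le> cmod (rest N t s y)"
proof (cases "t < s")
 case True
 then show ?thesis
  using H_mono[OF assms(1), of t s y] H_mono[OF assms(2), of t s y] H_cases[of n t s y] H_cases[of m t s y] H_cases[of N t s y]
  by (cases "H N t s y = 0") (auto simp: rest_def)
next
 case False
 then show ?thesis by (simp add: H_zero')
qed

lemma rest_tendsto: "(\<lambda>n. Lx (1 - be) (rest n t s)) \<longlonglongrightarrow> 0"
proof -
 define r where "r = 1 / (1 - be)"
 have r: "0 < r" using be by (simp add: r_def)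
 have "(\<lambda>n. NN y. enn_powr (ennreal (cmod (rest n t s y))) r) \<longlonglongrightarrow> (NN (y::real^'n). 0)"
 proof (rule nn_integral_dominated_convergence[where w="\<lambda>y. enn_powr (ennreal (cmod (F s y))) r"])
  show "AE y in lborel. enn_powr (ennreal (cmod (rest n t s y))) r \<le> enn_powr (ennreal (cmod (F s y))) r" for n
   using r by (intro AE_I2 enn_powr_mono ennreal_leI norm_rest_le) auto
  have "Lx (1 - be) (F s) < \<infinity>" using F_le[of s] by (simp add: le_less_trans)
  then show "(NN y. enn_powr (ennreal (cmod (F s y))) r) < \<infinity>"
   using be by (auto simp: Lx_pos r_def less_top[symmetric])
  show "AE y in lborel. (\<lambda>n. enn_powr (ennreal (cmod (rest n t s y))) r) \<longlonglongrightarrow> 0"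
  proof (rule AE_I2)
   fix y
   have "\<exists>N. \<forall>n\<ge>N. rest n t s y = 0"
    using H_eventually[of t s y] unfolding rest_def by (metis cancel_comm_monoid_add_class.diff_cancel)
   then have "\<forall>\<^sub>F n in sequentially. rest n t s y = 0" by (simp add: eventually_sequentially)
   then have "\<forall>\<^sub>F n in sequentially. enn_powr (ennreal (cmod (rest n t s y))) r = 0"
    by eventually_elim simp
   then show "(\<lambda>n. enn_powr (ennreal (cmod (rest n t s y))) r) \<longlonglongrightarrow> 0"
    by (rule tendsto_eventually)
  qed
 qed (use r in auto)
 then have "(\<lambda>n. enn_powr (NN y. enn_powr (ennreal (cmod (rest n t s y))) r) (1 - be)) \<longlonglongrightarrow> enn_powr 0 (1 - be)"
  using be by (intro tendsto_enn_powr) auto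
 then show ?thesis using be by (simp add: Lx_pos r_def)
qed

lemma rest_integral_tendsto: "(\<lambda>n. NN s. Lx (1 - be) (rest n t s)) \<longlonglongrightarrow> 0"
proof -
 have [measurable]: "(\<lambda>s. Lx (1 - be) (rest n t s)) \<in> bm" for n
  using be by (intro borel_measurable_Lx) auto
 have "(\<lambda>n. NN s. Lx (1 - be) (rest n t s)) \<longlonglongrightarrow> (NN (s::real). 0)"
 proof (rule nn_integral_dominated_convergence[where w="\<lambda>s. ennreal ka * (ennreal (exp (- mu * s)) * indicator {t..} s)"])
  show "AE s in lborel. Lx (1 - be) (rest n t s) \<le> ennreal ka * (ennreal (exp (- mu * s)) * indicator {t..} s)" for n
   using rest_le[of n t] ka by (simp add: ennreal_mult mult.assoc)
  show "(NN s. ennreal ka * (ennreal (exp (- mu * s)) * indicator {t..} s)) < \<infinity>"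
   using mu by (simp add: nn_integral_cmult nn_integral_exp_tail' ennreal_mult_less_top)
 qed (use rest_tendsto in auto)
 then show ?thesis by simp
qed

lemma DuhN_L2: "Lx (1/2) (DuhN ka mu F n t) \<le> ennreal (sqrt (Cdisp be * 3 / (1 - delta CARD('n) be)) * ka * mu powr (delta CARD('n) be - 1) * exp (- mu * t))"
proof -
 let ?c = "Cdisp be * 3 / (1 - delta CARD('n) be)" and ?m = "mu powr (delta CARD('n) be - 1)" and ?E = "exp (- mu * t)" and ?d = "3 / (1 - delta CARD('n) be)"
 let ?A = "\<lambda>s. ennreal ka * (ennreal (exp (- mu * s)) * indicator {t..} s)"
 have C: "0 < ?c" using Cdisp_pos[OF be(2)] de1 by simp
 have "enn_powr (Lx (1/2) (DuhN ka mu F n t)) 2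
  \<le> ennreal (Cdisp be * (?d * ka * ?m * ?E)) * (NN s. ?A s)"
  unfolding DuhN_eq[abs_def]
 proof (rule energy_weighted[OF measurable_H H_L1_time, where c="p2 (- int n)"])
  show "H n t s y = 0" if "\<bar>t - s\<bar> < p2 (- int n)" for s y using that H_zero[of s t n] by simp
  show "Lx (1 - be) (H n t s) \<le> ?A s" for s using H_le[of n t s] ka by (simp add: ennreal_mult mult.assoc)
 qed (use be de1 mu ka H_le in auto)
 also have "(NN s. ?A s) = ennreal (ka * (?E / mu))"
  using mu ka by (subst ennreal_mult) (simp_all add: nn_integral_cmult nn_integral_exp_tail')
 also have "ennreal (Cdisp be * (?d * ka * ?m * ?E)) * ...
   = ennreal (Cdisp be * (?d * ka * ?m * ?E) * (ka * (?E / mu)))"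
  using mu ka by (intro ennreal_mult''[symmetric]) auto
 also have "... \<le> ennreal ((sqrt (?c) * ka * ?m * ?E)\<^sup>2)"
 proof (rule ennreal_leI)
  define c0 where "c0 = ?c"
  define P where "P = ?m"
  define E where "E = ?E"
  \<comment> \<open>Replacing \<open>1/mu\<close> by the larger \<open>mu powr (delta - 1)\<close>
    turns the bound into a perfect square.\<close>
  have "1/mu = mu powr (- 1)" using mu by (simp add: powr_minus_divide)
  also have "... \<le> P" unfolding P_def using mu de_nonneg by (intro powr_mono) auto
  finally have P: "1/mu \<le> P" .
  have c0: "0 < c0" unfolding c0_def by (rule C)
  have "Cdisp be * (?d * ka * P * E) * (ka * (E/mu)) = (c0 * ka\<^sup>2 * P * E\<^sup>2) * (1/mu)"
   by (simp add: c0_def power2_eq_square)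
  also have "... \<le> (c0 * ka\<^sup>2 * P * E\<^sup>2) * P"
   using c0 by (intro mult_left_mono P) (auto simp: P_def)
  also have "... = (sqrt c0 * ka * P * E)\<^sup>2" using c0 by (simp add: power_mult_distrib power2_eq_square)
  finally show "Cdisp be * (?d * ka * ?m * ?E) * (ka * (?E / mu))
   \<le> (sqrt (?c) * ka * ?m * ?E)\<^sup>2"
   unfolding c0_def P_def E_def .
 qed
 also have "... = enn_powr (ennreal (sqrt (?c) * ka * ?m * ?E)) 2"
  using C ka by (simp add: enn_powr_ennreal powr_sq del: real_sqrt_divide)
 finally show ?thesis by (subst (asm) enn_powr_le_iff) (simp_all add: enn_powr_enn_powr)
qed

text \<open>The difference of two cuts is itself a forcing dominated by \<open>rest N\<close>, and
  \<open>energy_weighted\<close> applies with the norm of \<open>rest N\<close> as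
  \<open>A\<close>.\<close>

lemma DuhN_Cauchy:
 assumes ep: "0 < ep"
 shows "\<exists>N. \<forall>m\<ge>N. \<forall>n\<ge>N. Lx (1/2) (\<lambda>x. DuhN ka mu F m t x - DuhN ka mu F n t x) \<le> ennreal ep"
proof -
 define D where "D = Cdisp be * (3 / (1 - delta CARD('n) be) * ka * mu powr (delta CARD('n) be - 1) * exp (- mu * t))"
 have "(\<lambda>N. ennreal D * (NN s. Lx (1 - be) (rest N t s))) \<longlonglongrightarrow> ennreal D * 0"
  by (intro tendsto_mult_ennreal tendsto_const rest_integral_tendsto) auto
 then have "\<forall>\<^sub>F N in sequentially. ennreal D * (NN s. Lx (1 - be) (rest N t s)) < ennreal (ep\<^sup>2)"
  using ep by (intro order_tendstoD) auto
 then obtain N where N: "ennreal D * (NN s. Lx (1 - be) (rest N t s)) < ennreal (ep\<^sup>2)"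
  by (auto simp: eventually_sequentially)
 have "Lx (1/2) (\<lambda>x. DuhN ka mu F m t x - DuhN ka mu F n t x) \<le> ennreal ep" if nm: "N \<le> m" "N \<le> n" for m n
 proof -
  define G where "G s y = H m t s y - H n t s y" for s y
  have Gm[measurable]: "jm G"
   using measurable_H[of m t] measurable_H[of n t] unfolding G_def split_beta' by measurable
  have "DuhN ka mu F m t x - DuhN ka mu F n t x = (LBINT s. U (t - s) (G s) x)" for x
  proof -
   have "U (t - s) (G s) x = U (t - s) (H m t s) x - U (t - s) (H n t s) x" for s
    using U_add[OF H_integrable(2)[of m t s] integrable_mult_right[OF H_integrable(2)[of n t s], of "- 1"]] U_cmult[of "t - s" "-1" "H n t s" x]
    by (simp add: G_def[abs_def])
   then show ?thesis unfolding DuhN_eq by (simp add: H_integrable)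
  qed
  then have "enn_powr (Lx (1/2) (\<lambda>x. DuhN ka mu F m t x - DuhN ka mu F n t x)) 2 \<le> ennreal D * (NN s. Lx (1 - be) (rest N t s))"
   unfolding D_def
  proof (simp only:, intro energy_weighted[OF Gm, where c="p2 (- int (max m n))"])
   have "(NN s y. ennreal (cmod (G s y))) \<le> (NN s y. ennreal (cmod (H m t s y)) + ennreal (cmod (H n t s y)))"
    unfolding G_def by (rule nn_integral_mono, rule nn_integral_mono) (simp add: norm_triangle_ineq4 flip: ennreal_plus)
   also have "... = (NN s y. ennreal (cmod (H m t s y))) + (NN s y. ennreal (cmod (H n t s y)))"
    by (simp add: nn_integral_add)
   also have "... < \<infinity>" using H_L1_time[of m t] H_L1_time[of n t] by simp
   finally show "(NN s y. ennreal (cmod (G s y))) < \<infinity>" .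
   show "G s y = 0" if "\<bar>t - s\<bar> < p2 (- int (max m n))" for s y
   proof -
    have "p2 (- int (max m n)) \<le> p2 (- int m)" "p2 (- int (max m n)) \<le> p2 (- int n)" by auto
    then have "s \<le> t + p2 (- int m)" "s \<le> t + p2 (- int n)" using that by linarith+
    then show ?thesis by (simp add: G_def H_zero)
   qed
   show le: "Lx (1 - be) (G s) \<le> Lx (1 - be) (rest N t s)" for s
    unfolding G_def using be nm by (intro Lx_mono norm_H_diff_le) auto
   show "Lx (1 - be) (G s) \<le> ennreal (ka * exp (- mu * s)) * indicator {t..} s" for s
    using order_trans[OF le rest_le] .
  qed (use be de1 mu ka in auto)
  also have "... \<le> ennreal (ep\<^sup>2)" using N by simp
  also have "... = enn_powr (ennreal ep) 2" using ep by (simp add: enn_powr_ennreal powr_sq)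
  finally show ?thesis by (subst (asm) enn_powr_le_iff) (simp_all add: enn_powr_enn_powr)
 qed
 then show ?thesis by blast
qed

text \<open>Minkowski in time with the dispersive decay at each lag; \<open>delta < 1\<close> makes
  the singularity at lag 0 integrable.\<close>

lemma DuhN_Lbe: "Lx be (DuhN ka mu F n t) \<le> ennreal (Cdisp be * 3 / (1 - delta CARD('n) be) * ka * mu powr (delta CARD('n) be - 1) * exp (- mu * t))"
proof -
 let ?k = "\<lambda>s. ennreal (\<bar>t - s\<bar> powr (- delta CARD('n) be)) * (ennreal (ka * exp (- mu * s)) * indicator {t..} s)"
 have C: "0 \<le> Cdisp be" using Cdisp_pos[of be] be by simp
 have "Lx be (DuhN ka mu F n t) \<le> Lnorm lborel be (\<lambda>x. NN s. ennreal (cmod (U (t - s) (H n t s) x)))"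
  unfolding Lx_def DuhN_eq using be by (intro Lnorm_mono ennreal_norm_integral_le)
 also have "... \<le> (NN s. ennreal (Cdisp be) * ?k s)"
 proof (rule Lnorm_Minkowski_integral)
  show "AE s in lborel. Lnorm lborel be (\<lambda>x. ennreal (cmod (U (t - s) (H n t s) x)))
   \<le> ennreal (Cdisp be) * ?k s"
  proof (rule AE_I2)
   fix s
   show "Lnorm lborel be (\<lambda>x. ennreal (cmod (U (t - s) (H n t s) x)))
    \<le> ennreal (Cdisp be) * ?k s"
   proof (cases "s \<le> t")
    case True
    then show ?thesis using be by (simp add: H_zero')
   next
    case False
    have "Lx be (U (t - s) (H n t s)) \<le> ennreal (Cdisp be * \<bar>t - s\<bar> powr (- delta CARD('n) be)) * Lx (1 - be) (H n t s)"
     using False by (intro U_dispersive H_integrable be) auto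
    also have "... \<le> ennreal (Cdisp be * \<bar>t - s\<bar> powr (- delta CARD('n) be)) * (ennreal (ka * exp (- mu * s)) * indicator {t..} s)"
     by (intro mult_left_mono H_le) auto
    finally show ?thesis using C by (simp add: Lx_def ennreal_mult mult.assoc)
   qed
  qed
  show "(\<lambda>(x, s). ennreal (cmod (U (t - s) (H n t s) x))) \<in> borel_measurable (lborel \<Otimes>\<^sub>M lborel)"
   unfolding H_def by measurable
 qed (use be in \<open>auto simp: sigma_finite_lborel\<close>)
 also have "... = ennreal (Cdisp be) * (NN s. ?k s)"
  by (rule nn_integral_cmult) measurable
 also have "... \<le> ennreal (Cdisp be) * ennreal (3 / (1 - delta CARD('n) be) * ka * mu powr (delta CARD('n) be - 1) * exp (- mu * t))"
  using ka by (intro mult_left_mono nn_integral_kernel_exp de_nonneg de1 mu) auto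
 also have "... = ennreal (Cdisp be * 3 / (1 - delta CARD('n) be) * ka * mu powr (delta CARD('n) be - 1) * exp (- mu * t))"
  using C by (simp add: mult_ac flip: ennreal_mult')
 finally show ?thesis .
qed

end

lemma Lx_less_top_bounded:
 fixes ps :: "'n::finite wave"
 assumes ps: "integrable lborel ps" and bd: "\<And>x. cmod (ps x) \<le> B" and p: "0 < p" "p \<le> 1"
 shows "Lx p ps < top"
proof -
 have [measurable]: "ps \<in> bm" using ps by auto
 have B: "0 \<le> B" using bd[of 0] norm_ge_zero order_trans by blast
 have "(NN x. enn_powr (ennreal (cmod (ps x))) (1/p)) \<le> (NN x. ennreal (B powr (1/p - 1)) * ennreal (cmod (ps x)))"
 proof (rule nn_integral_mono)
  fix x
  have "cmod (ps x) powr (1/p) = cmod (ps x) powr (1/p - 1) * cmod (ps x)"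
   by (cases "ps x = 0") (auto simp: powr_diff)
  also have "... \<le> B powr (1/p - 1) * cmod (ps x)" using p bd by (intro mult_right_mono powr_mono2) auto
  finally show "enn_powr (ennreal (cmod (ps x))) (1/p) \<le> ennreal (B powr (1/p - 1)) * ennreal (cmod (ps x))"
   by (simp add: enn_powr_ennreal flip: ennreal_mult)
 qed
 also have "... = ennreal (B powr (1/p - 1)) * L1 ps" by (rule nn_integral_cmult) measurable
 also have "... < top" using ps by (auto simp: ennreal_mult_less_top integrable_iff_bounded)
 finally show ?thesis using p by (simp add: Lx_pos less_top[symmetric])
qed

lemma ennreal_norm_squeeze:
 fixes z :: "nat \<Rightarrow> complex"
 assumes le: "\<And>n. ennreal (cmod (z n)) \<le> e n" and e: "e \<longlonglongrightarrow> 0"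
 shows "z \<longlonglongrightarrow> 0"
proof -
 have "(\<lambda>n. ennreal (cmod (z n))) \<longlonglongrightarrow> ennreal 0"
 proof (rule tendsto_sandwich[OF _ _ tendsto_const])
  show "e \<longlonglongrightarrow> ennreal 0" using e by simp
 qed (use le in \<open>auto intro!: always_eventually\<close>)
 then have "(\<lambda>n. cmod (z n)) \<longlonglongrightarrow> 0" by (subst (asm) tendsto_ennreal_iff) auto
 then show ?thesis by (simp only: tendsto_norm_zero_iff)
qed

context duhamel
begin

text \<open>For the cut forcing all integrals converge absolutely, so the propagator can be moved to
  the test function.\<close>

lemma DuhN_pairing:
 assumes ps: "integrable lborel ps"
 shows "(LBINT x. DuhN ka mu F n t x * ps x) = (\<integral>s. \<integral>x. H n t s x * U (t - s) ps x \<partial>lborel \<partial>lborel)"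
proof -
 have [measurable]: "ps \<in> bm" using ps by auto
 have m1: "jm (levcut ka mu (p2 (- int n)) (p2 (int n)) F)" by measurable
 define B where "B = disp CARD('n) (p2 (- int n)) * (p2 (int n) - p2 (- int n)) * (ka * p2 (- int n) powr (1 - 1 / (1 - be))) * exp (- mu * (t + p2 (- int n)))"
 have Bd: "(NN s. ennreal (cmod (U (t - s) (H n t s) x))) \<le> ennreal B" for x
  unfolding H_def B_def by (rule nn_integral_Duh_le[OF m1 H_L1]) (use ka mu in auto)
 have [measurable]: "(\<lambda>(x, s). U (t - s) (H n t s) x * ps x) \<in> borel_measurable (lborel \<Otimes>\<^sub>M lborel)"
  unfolding H_def by measurable
 have int: "integrable (lborel \<Otimes>\<^sub>M lborel) (\<lambda>(x, s). U (t - s) (H n t s) x * ps x)"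
 proof (rule integrableI_bounded)
  have "(\<integral>\<^sup>+z. ennreal (norm (case z of (x, s) \<Rightarrow> U (t - s) (H n t s) x * ps x)) \<partial>(lborel \<Otimes>\<^sub>M lborel))
   = (NN x s. ennreal (cmod (U (t - s) (H n t s) x * ps x)))" by (subst lborel.nn_integral_fst[symmetric]) auto
  also have "... \<le> (NN x. ennreal B * ennreal (cmod (ps x)))"
  proof (rule nn_integral_mono)
   fix x
   have [measurable]: "(\<lambda>s. U (t - s) (H n t s) x) \<in> borel_measurable lborel"
    unfolding H_def by measurable
   show "(NN s. ennreal (cmod (U (t - s) (H n t s) x * ps x))) \<le> ennreal B * ennreal (cmod (ps x))"
    using mult_right_mono[OF Bd, of "ennreal (cmod (ps x))"]
    by (simp add: norm_mult ennreal_mult nn_integral_multc)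
  qed
  also have "... = ennreal B * L1 ps" by (rule nn_integral_cmult) measurable
  also have "... < \<infinity>" using ps by (auto simp: ennreal_mult_less_top integrable_iff_bounded)
  finally show "(\<integral>\<^sup>+z. ennreal (norm (case z of (x, s) \<Rightarrow> U (t - s) (H n t s) x * ps x)) \<partial>(lborel \<Otimes>\<^sub>M lborel)) < \<infinity>" .
 qed measurable
 have "(LBINT x. DuhN ka mu F n t x * ps x) = (\<integral>x. \<integral>s. U (t - s) (H n t s) x * ps x \<partial>lborel \<partial>lborel)"
  by (simp add: DuhN_eq)
 also have "... = (\<integral>s. \<integral>x. U (t - s) (H n t s) x * ps x \<partial>lborel \<partial>lborel)"
  by (rule lborel_pair.Fubini_integral[OF int, symmetric])
 also have "... = (\<integral>s. \<integral>x. H n t s x * U (t - s) ps x \<partial>lborel \<partial>lborel)"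
  using U_pairing[OF ps H_integrable(2)] by (simp add: mult.commute)
 finally show ?thesis .
qed

lemma ex_limit: "\<exists>V. jm V \<and> (\<forall>t. (\<lambda>n. Lx (1/2) (\<lambda>x. DuhN ka mu F n t x - V t x)) \<longlonglongrightarrow> 0)"
 by (intro L2_limit_measurable measurable_DuhN DuhN_Cauchy)

text \<open>The limit is determined only up to null sets at each time, hence the choice; later
  comparisons of two such functions go through the weak formulation.\<close>

definition V :: "'n evol" where
 "V = (SOME V. jm V \<and> (\<forall>t. (\<lambda>n. Lx (1/2) (\<lambda>x. DuhN ka mu F n t x - V t x)) \<longlonglongrightarrow> 0))"

lemma measurable_V: "jm V"
 and V_limit: "(\<lambda>n. Lx (1/2) (\<lambda>x. DuhN ka mu F n t x - V t x)) \<longlonglongrightarrow> 0"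
 using someI_ex[OF ex_limit] unfolding V_def by blast+

lemma measurable_V1 [measurable]: "V t \<in> bm"
 using measurable_compose[OF measurable_Pair1'[of t borel] measurable_V] by simp

lemma V_Lx_le:
 assumes "0 < b" "\<And>n. Lx b (DuhN ka mu F n t) \<le> B" shows "Lx b (V t) \<le> B"
proof -
 have "Lx b (V t) \<le> liminf (\<lambda>n. Lx b (DuhN ka mu F n t))"
  by (rule Lx_lower_semicontinuous[OF _ _ V_limit assms(1)]) measurable
 also have "... \<le> liminf (\<lambda>n. B)" by (intro Liminf_mono always_eventually allI assms(2))
 finally show ?thesis by (simp add: Liminf_const)
qed

lemmas V_L2 = V_Lx_le[OF _ DuhN_L2] and V_Lbe = V_Lx_le[OF _ DuhN_Lbe]

lemma V_Ltx_le:
 assumes "0 < a" "0 < b" "\<And>n. Ltx a b t0 (DuhN ka mu F n) \<le> B" shows "Ltx a b t0 V \<le> B"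
proof -
 have "Ltx a b t0 V \<le> liminf (\<lambda>n. Ltx a b t0 (DuhN ka mu F n))" unfolding Ltx_def
 proof (rule Lnorm_Fatou)
  show "AE t in restrict_space lborel {t0..}. Lx b (V t) \<le> liminf (\<lambda>n. Lx b (DuhN ka mu F n t))"
   by (intro AE_I2 Lx_lower_semicontinuous[OF _ _ V_limit assms(2)]) measurable
  show "(\<lambda>t. Lx b (DuhN ka mu F n t)) \<in> borel_measurable (restrict_space lborel {t0..})" for n
   using borel_measurable_Lx[OF measurable_DuhN assms(2)] by (intro measurable_restrict_space1) simp
 qed (fact assms(1))
 also have "... \<le> liminf (\<lambda>n. B)" by (intro Liminf_mono always_eventually allI assms(3))
 finally show ?thesis by (simp add: Liminf_const)
qed

text \<open>The limit of \<open>DuhN_pairing\<close>. The integrands in \<open>s\<close> are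
  dominated by the power \<open>- delta\<close> of the lag times the exponential, and they converge
  for each \<open>s > t\<close> because \<open>rest\<close> tends to 0. Thus the improper integral
  in \<open>nls_solution\<close> is absolutely convergent for this forcing.\<close>

lemma V_pairing:
 assumes ps: "integrable lborel ps" and bd: "\<And>x. cmod (ps x) \<le> B"
 shows "integrable lborel (\<lambda>x. V t x * ps x)"
  and "t < s \<Longrightarrow> integrable lborel (\<lambda>x. F s x * U (t - s) ps x)"
  and "integrable lborel (\<lambda>s. indicator {t<..} s * (LBINT x. F s x * U (t - s) ps x))"
  and "(LBINT x. V t x * ps x) = (\<integral>s. indicator {t<..} s * (\<integral>x. F s x * U (t - s) ps x \<partial>lborel) \<partial>lborel)"
proof -
 have [measurable]: "ps \<in> bm" using ps by auto
 have C: "0 < Cdisp be" using Cdisp_pos[of be] be by simp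
 have ps2: "Lx (1/2) ps < top" and psbe: "Lx (1 - be) ps < top" using Lx_less_top_bounded[OF ps bd] be by auto
 have V2: "Lx (1/2) (V t) < top" by (rule le_less_trans[OF V_L2]) auto
 show "integrable lborel (\<lambda>x. V t x * ps x)" by (rule integrable_mult_Lx[where p="1/2"]) (use V2 ps2 in auto)
 define P where "P = enn2real (Lx (1 - be) ps)"
 have P: "Lx (1 - be) ps = ennreal P" "0 \<le> P" using psbe by (auto simp: P_def)
 have Ube: "Lx be (U (t - s) ps) \<le> ennreal (Cdisp be * \<bar>t - s\<bar> powr (- delta CARD('n) be) * P)" if "t < s" for s
  using U_dispersive[OF ps _ be, of "t - s"] that C P by (simp add: ennreal_mult)
 have Fbe: "Lx (1 - be) (F s) < top" for s using F_le[of s] by (simp add: le_less_trans)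
 show int: "integrable lborel (\<lambda>x. F s x * U (t - s) ps x)" if "t < s" for s
  by (rule integrable_mult_Lx[where p="1 - be"]) (use be Fbe le_less_trans[OF Ube[OF that]] in auto)
 define w where "w s = Cdisp be * P * \<bar>t - s\<bar> powr (- delta CARD('n) be) * (ka * exp (- mu * s)) * indicator {t..} s" for s
 have w0: "0 \<le> w s" for s using C P ka by (simp add: w_def)
 have "(NN s. ennreal (w s)) = (NN s. ennreal (Cdisp be * P) * (ennreal (\<bar>t - s\<bar> powr (- delta CARD('n) be)) * (ennreal (ka * exp (- mu * s)) * indicator {t..} s)))"
  using C P ka by (intro nn_integral_cong) (simp add: w_def ennreal_mult indicator_def mult.assoc)
 also have "... = ennreal (Cdisp be * P) * (NN s. ennreal (\<bar>t - s\<bar> powr (- delta CARD('n) be)) * (ennreal (ka * exp (- mu * s)) * indicator {t..} s))"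
  by (rule nn_integral_cmult) measurable
 also have "... \<le> ennreal (Cdisp be * P) * ennreal (3 / (1 - delta CARD('n) be) * ka * mu powr (delta CARD('n) be - 1) * exp (- mu * t))"
  using ka by (intro mult_left_mono nn_integral_kernel_exp de_nonneg de1 mu) auto
 also have "... < \<infinity>" by (simp add: ennreal_mult_less_top)
 finally have wint: "integrable lborel w" using w0 by (intro integrableI_nonneg) (auto simp: w_def[abs_def])
 let ?g = "\<lambda>s. indicator {t<..} s * (LBINT x. F s x * U (t - s) ps x)"
 let ?h = "\<lambda>n s. \<integral>x. H n t s x * U (t - s) ps x \<partial>lborel"
 have meas_g: "?g \<in> borel_measurable lborel"
 proof -
  have "(\<lambda>(s, x). F s x * U (t - s) ps x) \<in> borel_measurable (lborel \<Otimes>\<^sub>M lborel)"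
   using meas unfolding split_beta' by measurable
  then have "(\<lambda>s. \<integral>x. F s x * U (t - s) ps x \<partial>lborel) \<in> borel_measurable lborel"
   by (rule lborel.borel_measurable_lebesgue_integral)
  then show ?thesis by measurable
 qed
 have meas_h: "?h n \<in> borel_measurable lborel" for n
 proof -
  have "(\<lambda>(s, x). H n t s x * U (t - s) ps x) \<in> borel_measurable (lborel \<Otimes>\<^sub>M lborel)"
   using measurable_H[of n t] unfolding split_beta' by measurable
  then show ?thesis by (rule lborel.borel_measurable_lebesgue_integral)
 qed
 have bd_h: "norm (?h n s) \<le> w s" for n s
 proof (cases "t < s")
  case True
  have "ennreal (cmod (?h n s)) \<le> Lx (1 - be) (H n t s) * Lx (1 - (1 - be)) (U (t - s) ps)"
   using be by (intro norm_integral_mult_le_Lx) auto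
  also have "... \<le> (ennreal (ka * exp (- mu * s)) * indicator {t..} s) * ennreal (Cdisp be * \<bar>t - s\<bar> powr (- delta CARD('n) be) * P)"
   using Ube[OF True] by (intro mult_mono H_le) auto
  also have "... = ennreal (w s)" using True ka C P by (simp add: w_def mult_ac flip: ennreal_mult)
  finally show ?thesis by (subst (asm) ennreal_le_iff[OF w0])
 next
  case False
  then show ?thesis using w0 by (simp add: H_zero')
 qed
 have lim_h: "(\<lambda>n. ?h n s) \<longlonglongrightarrow> ?g s" for s
 proof (cases "t < s")
  case True
  have Hbe: "Lx (1 - be) (H n t s) < top" for n using H_le[of n t s] True by (auto intro: le_less_trans)
  have intH: "integrable lborel (\<lambda>x. H n t s x * U (t - s) ps x)" for n
   by (rule integrable_mult_Lx[where p="1 - be"]) (use be Hbe le_less_trans[OF Ube[OF True]] in auto)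
  have le: "ennreal (cmod (?g s - ?h n s)) \<le> Lx (1 - be) (rest n t s) * Lx be (U (t - s) ps)" for n
  proof -
   have "?g s - ?h n s = (LBINT x. rest n t s x * U (t - s) ps x)"
    using True int[OF True] intH by (simp add: rest_def left_diff_distrib)
   then show ?thesis using norm_integral_mult_le_Lx[of "rest n t s" "U (t - s) ps" "1 - be"] be by simp
  qed
  have "(\<lambda>n. Lx (1 - be) (rest n t s) * Lx be (U (t - s) ps)) \<longlonglongrightarrow> 0 * Lx be (U (t - s) ps)"
   using Ube[OF True] by (intro tendsto_mult_ennreal rest_tendsto tendsto_const) (auto simp: top_unique)
  then have "(\<lambda>n. Lx (1 - be) (rest n t s) * Lx be (U (t - s) ps)) \<longlonglongrightarrow> 0" by simp
  with le have "(\<lambda>n. ?g s - ?h n s) \<longlonglongrightarrow> 0" by (rule ennreal_norm_squeeze)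
  then show ?thesis using tendsto_diff[OF tendsto_const[of "?g s"], of "\<lambda>n. ?g s - ?h n s" 0] by simp
 qed (simp add: H_zero')
 have lim: "(\<lambda>n. \<integral>s. ?h n s \<partial>lborel) \<longlonglongrightarrow> (LBINT s. ?g s)"
  by (rule integral_dominated_convergence[OF meas_g meas_h wint]) (use lim_h bd_h in auto)
 show "integrable lborel ?g"
  by (rule integrable_dominated_convergence[where s="\<lambda>n. ?h n", OF meas_g meas_h wint]) (use lim_h bd_h in auto)
 have "(\<lambda>n. \<integral>x. DuhN ka mu F n t x * ps x \<partial>lborel) \<longlonglongrightarrow> (LBINT x. V t x * ps x)"
 proof -
  have le: "ennreal (cmod ((LBINT x. DuhN ka mu F n t x * ps x) - (LBINT x. V t x * ps x)))
   \<le> Lx (1/2) (\<lambda>x. DuhN ka mu F n t x - V t x) * Lx (1/2) ps" for n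
  proof -
   have "Lx (1/2) (DuhN ka mu F n t) < top" by (rule le_less_trans[OF DuhN_L2]) simp
   then have "integrable lborel (\<lambda>x. DuhN ka mu F n t x * ps x)"
    by (intro integrable_mult_Lx[where p="1/2"]) (use ps2 in auto)
   then have "(LBINT x. DuhN ka mu F n t x * ps x) - (LBINT x. V t x * ps x) = (LBINT x. (DuhN ka mu F n t x - V t x) * ps x)"
    using \<open>integrable lborel (\<lambda>x. V t x * ps x)\<close> by (simp add: left_diff_distrib)
   then show ?thesis using norm_integral_mult_le_Lx[of "\<lambda>x. DuhN ka mu F n t x - V t x" ps "1/2"] by simp
  qed
  have "(\<lambda>n. Lx (1/2) (\<lambda>x. DuhN ka mu F n t x - V t x) * Lx (1/2) ps) \<longlonglongrightarrow> 0 * Lx (1/2) ps"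
   using ps2 by (intro tendsto_mult_ennreal V_limit tendsto_const) auto
  then have "(\<lambda>n. Lx (1/2) (\<lambda>x. DuhN ka mu F n t x - V t x) * Lx (1/2) ps) \<longlonglongrightarrow> 0" by simp
  with le have "(\<lambda>n. (LBINT x. DuhN ka mu F n t x * ps x) - (LBINT x. V t x * ps x)) \<longlonglongrightarrow> 0"
   by (rule ennreal_norm_squeeze)
  then show ?thesis by (simp only: LIM_zero_iff)
 qed
 then show "(LBINT x. V t x * ps x) = (LBINT s. ?g s)"
  unfolding DuhN_pairing[OF ps] using lim by (rule LIMSEQ_unique)
qed

end

section \<open>The Strichartz norm and its extreme pairs\<close>

lemma borel_measurable_Lx_0:
 fixes u :: "'a \<Rightarrow> 'n::finite wave"
 assumes u[measurable]: "(\<lambda>(s, x). u s x) \<in> borel_measurable (M \<Otimes>\<^sub>M borel)"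
 shows "(\<lambda>s. Lx 0 (u s)) \<in> borel_measurable M"
proof (rule borel_measurableI_le)
 fix y :: ennreal
 have [measurable]: "(\<lambda>x. ennreal (cmod (u s x))) \<in> borel_measurable lborel" if "s \<in> space M" for s
  using measurable_compose[OF measurable_Pair1'[OF that, of borel] u] by simp
 \<comment> \<open>An essential bound says that a superlevel set is null, and the measure of that
   set depends measurably on \<open>s\<close>.\<close>
 have "Lx 0 (u s) \<le> y \<longleftrightarrow> (NN x. (if y < ennreal (cmod (u s x)) then 1 else 0)) = 0" if s: "s \<in> space M" for s
 proof -
  note [measurable] = \<open>\<And>s. s \<in> space M \<Longrightarrow> _\<close>[OF s]
  have "Lx 0 (u s) \<le> y \<longleftrightarrow> (AE x in lborel. ennreal (cmod (u s x)) \<le> y)"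
  proof
   assume "Lx 0 (u s) \<le> y"
   then show "AE x in lborel. ennreal (cmod (u s x)) \<le> y"
    using esssup_AE[of "\<lambda>x. ennreal (cmod (u s x))" lborel]
    by (auto simp: Lx_def Lnorm_def elim!: eventually_mono)
  next
   assume "AE x in lborel. ennreal (cmod (u s x)) \<le> y"
   then have "esssup lborel (\<lambda>x. ennreal (cmod (u s x))) \<le> y" by (intro esssup_I) measurable
   then show "Lx 0 (u s) \<le> y" by (simp add: Lx_def Lnorm_def)
  qed
  also have "... \<longleftrightarrow> (NN x. (if y < ennreal (cmod (u s x)) then 1 else 0)) = 0"
   by (subst nn_integral_0_iff_AE) (auto simp: not_less)
  finally show ?thesis .
 qed
 then have "{s \<in> space M. Lx 0 (u s) \<le> y} = {s \<in> space M. (NN x. (if y < ennreal (cmod (u s x)) then 1 else 0)) = 0}"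
  by auto
 also have "... \<in> sets M" by measurable
 finally show "{s \<in> space M. Lx 0 (u s) \<le> y} \<in> sets M" .
qed

lemma Lx_interpolate_half:
 fixes f :: "'n::finite wave"
 assumes [measurable]: "f \<in> bm" and w: "0 < w" "w < 1" and b: "0 \<le> b"
 shows "Lx ((1 - w) * (1/2) + w * b) f \<le> enn_powr (Lx (1/2) f) (1 - w) * enn_powr (Lx b f) w"
proof (cases "b = 0")
 case True
 have "Lnorm lborel ((1 - w) * (1/2)) (\<lambda>x. ennreal (cmod (f x))) \<le> enn_powr (Lnorm lborel (1/2) (\<lambda>x. ennreal (cmod (f x)))) (1 - w) * enn_powr (Lx 0 f) w"
  by (rule Lnorm_interpolate_sup) (use w esssup_AE in \<open>auto simp: Lx_def Lnorm_def\<close>)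
 then show ?thesis using True by (simp add: Lx_def)
next
 case False
 then show ?thesis unfolding Lx_def using w b by (intro Lnorm_interpolate) auto
qed

text \<open>The reciprocal of the largest spatial exponent: infinite for \<open>d = 1\<close>, where
  \<open>bStr\<close> is 0, the prescribed number for \<open>d = 2\<close>, and the partner of
  \<open>q = 2\<close> for \<open>d \<ge> 3\<close>.\<close>

definition bend :: "nat \<Rightarrow> real \<Rightarrow> real" where
 "bend d bStr = (if d \<le> 2 then bStr else (real d - 2) / (2 * real d))"

definition aend :: "nat \<Rightarrow> real \<Rightarrow> real" where
 "aend d bStr = real d / 2 * (1/2 - bend d bStr)"

text \<open>The reciprocal admissible pairs lie on the segment from \<open>(0, 1/2)\<close> to the
  extreme pair; interpolation in space at each time, followed by the time norm, covers all of
  them.\<close>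

lemma strichartz_le:
 fixes u :: "'n::finite evol"
 assumes meas[measurable]: "jm u"
  and bStr: "0 \<le> bStr" "bStr < 1/2"
  and L2: "AE t in lborel. t0 \<le> t \<longrightarrow> Lx (1/2) (u t) \<le> Z"
  and ends: "Ltx (aend CARD('n) bStr) (bend CARD('n) bStr) t0 u \<le> Z"
 shows "strichartz bStr t0 u \<le> Z" unfolding strichartz_def
proof (rule SUP_least)
 fix ab assume "ab \<in> {(a, b). admissible CARD('n) a b \<and> bStr \<le> b}"
 then obtain a b where ab: "ab = (a, b)" "admissible CARD('n) a b" "bStr \<le> b" by auto
 let ?d = "real CARD('n)" and ?M = "restrict_space lborel {t0..} :: real measure"
 define as where "as = aend CARD('n) bStr"
 define bs where "bs = bend CARD('n) bStr"
 have d: "0 < ?d" by simp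
 have adm: "0 \<le> a" "a \<le> 1/2" "0 \<le> b" "b \<le> 1/2" "2 * a + ?d * b = ?d/2"
  using ab(2) by (auto simp: admissible_def)
 have bs: "0 \<le> bs" "bs < 1/2" "bs \<le> b"
 proof -
  show "0 \<le> bs" "bs < 1/2" using bStr d by (auto simp: bs_def bend_def field_simps)
  have "?d - 2 \<le> 2 * ?d * b" using adm by (simp add: field_simps)
  then show "bs \<le> b" using ab(3) d by (auto simp: bs_def bend_def field_simps)
 qed
 have as: "as = ?d/2 * (1/2 - bs)" by (simp add: as_def aend_def bs_def)
 have as0: "0 < as" unfolding as using bs d by (intro mult_pos_pos) auto
 define w where "w = (1/2 - b) / (1/2 - bs)"
 have w: "0 \<le> w" "w \<le> 1" using bs adm by (auto simp: w_def)
 have wb: "w * (1/2 - bs) = 1/2 - b" using bs by (simp add: w_def)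
 have b_eq: "b = (1 - w) * (1/2) + w * bs"
 proof -
  have "(1 - w) * (1/2) + w * bs = 1/2 - w * (1/2 - bs)" by (simp add: field_simps)
  then show ?thesis unfolding wb by simp
 qed
 have a_eq: "a = w * as"
 proof -
  have "w * as = ?d/2 * (w * (1/2 - bs))" by (simp add: as)
  also have "... = a" unfolding wb using adm(5) by (simp add: algebra_simps)
  finally show ?thesis ..
 qed
 have um[measurable]: "u t \<in> bm" for t using measurable_compose[OF measurable_Pair1'[of t borel] meas] by simp
 have L2': "AE t in ?M. Lx (1/2) (u t) \<le> Z" using L2 by (subst AE_restrict_space_iff) auto
 have mLx: "(\<lambda>t. Lx q (u t)) \<in> borel_measurable ?M" if "0 \<le> q" for q
  using that borel_measurable_Lx[OF meas, of q] borel_measurable_Lx_0[OF meas]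
  by (intro measurable_restrict_space1) (cases "q = 0"; simp)
 have "Ltx a b t0 u \<le> Z"
 proof (cases "w = 0 \<or> w = 1")
  case True
  then show ?thesis
  proof
   assume "w = 0"
   then have a0: "a = 0" and b2: "b = 1/2" using a_eq b_eq by auto
   show ?thesis unfolding a0 b2 using esssup_I[OF mLx[of "1/2"] L2'] by (simp add: Ltx_def Lnorm_def)
  next
   assume "w = 1"
   then have "a = as" "b = bs" using a_eq b_eq by auto
   then show ?thesis using ends by (simp add: as_def bs_def)
  qed
 next
  case False
  then have w': "0 < w" "w < 1" using w by auto
  have "Ltx a b t0 u \<le> Lnorm ?M a (\<lambda>t. enn_powr Z (1 - w) * enn_powr (Lx bs (u t)) w)" unfolding Ltx_def
  proof (rule Lnorm_mono_AE)
   show "0 < a" using a_eq w' as0 by simp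
   show "AE t in ?M. Lx b (u t) \<le> enn_powr Z (1 - w) * enn_powr (Lx bs (u t)) w" using L2'
   proof eventually_elim
    case (elim t)
    have "Lx b (u t) \<le> enn_powr (Lx (1/2) (u t)) (1 - w) * enn_powr (Lx bs (u t)) w"
     unfolding b_eq by (rule Lx_interpolate_half) (use w' bs in auto)
    also have "... \<le> enn_powr Z (1 - w) * enn_powr (Lx bs (u t)) w"
     using w' elim by (intro mult_right_mono enn_powr_mono) auto
    finally show ?case .
   qed
  qed
  also have "... = enn_powr Z (1 - w) * Lnorm ?M a (\<lambda>t. enn_powr (Lx bs (u t)) w)"
   using a_eq w' as0 mLx[OF bs(1)] by (intro Lnorm_cmult) auto
  also have "Lnorm ?M a (\<lambda>t. enn_powr (Lx bs (u t)) w) = enn_powr (Ltx as bs t0 u) w"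
   using a_eq w' as0 by (subst Lnorm_enn_powr) (auto simp: Ltx_def)
  also have "enn_powr Z (1 - w) * ... \<le> enn_powr Z (1 - w) * enn_powr Z w"
   using ends w' unfolding as_def[symmetric] bs_def[symmetric] by (intro mult_left_mono enn_powr_mono) auto
  also have "... = Z" by (simp add: enn_powr_add)
  finally show ?thesis .
 qed
 then show "Ltx (fst ab) (snd ab) t0 u \<le> Z" by (simp add: ab)
qed

text \<open>The pair \<open>(0, 1/2)\<close> carries an essential supremum in time, whence only
  almost every time.\<close>

lemma strichartz_ge_L2:
 fixes u :: "'n::finite evol"
 assumes "bStr \<le> 1/2"
 shows "AE t in lborel. t0 \<le> t \<longrightarrow> Lx (1/2) (u t) \<le> strichartz bStr t0 u"
proof -
 let ?M = "restrict_space lborel {t0..} :: real measure"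
 have "Ltx 0 (1/2) t0 u \<le> strichartz bStr t0 u"
  unfolding strichartz_def using assms by (intro SUP_upper2[of "(0, 1/2)"]) (auto simp: admissible_def)
 moreover have "AE t in ?M. Lx (1/2) (u t) \<le> Ltx 0 (1/2) t0 u"
  unfolding Ltx_def Lnorm_def by (simp add: esssup_AE)
 ultimately have "AE t in ?M. Lx (1/2) (u t) \<le> strichartz bStr t0 u" by (auto elim: eventually_mono)
 then show ?thesis by (subst (asm) AE_restrict_space_iff) auto
qed

text \<open>For \<open>d \<ge> 2\<close> the extreme pair has a finite spatial exponent and is
  reached directly; for \<open>d = 1\<close> it is reached by Fatou from the pairs
  \<open>(1/4, b n)\<close> with \<open>b n\<close> tending to 0.\<close>

lemma endpoint_bound:
 assumes be: "0 < be" "be < 1/2" and de1: "delta CARD('n::finite) be < 1"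
  and bStr: "if CARD('n) = 2 then 0 < bStr \<and> bStr < be else bStr = 0"
 shows "\<exists>C>0. \<exists>et>0. \<forall>(F :: 'n evol) ka mu t0. duhamel F be ka mu \<longrightarrow>
  Ltx (aend CARD('n) bStr) (bend CARD('n) bStr) t0 (duhamel.V F ka mu) \<le> ennreal (C * ka * mu powr (- et) * exp (- mu * t0))"
proof (cases "CARD('n) = 1")
 case True
 define th1 where "th1 = (1 - 2 * be) / 2"
 define th2 where "th2 = 1 - be"
 have th: "0 < th1" "th1 < 1 - 2 * be" "1 - 2 * be < th2" "th2 < 1" "th1 < 1" "0 < th2" "th1 \<le> th2"
  using be by (auto simp: th1_def th2_def)
 define et where "et = th1/16"
 have et: "0 < et" "et \<le> 1" using th by (auto simp: et_def)
 from strichartz_DuhN[OF be et th(1-4), where 'n='n] obtain C where C: "0 < C"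
  and le: "\<And>a b (F :: 'n evol) ka mu t0 n.
   admissible_split CARD('n) et th1 a b \<Longrightarrow> admissible_split CARD('n) et th2 a b \<Longrightarrow> a \<le> 1 \<Longrightarrow> b \<le> 1 \<Longrightarrow> duhamel F be ka mu \<Longrightarrow>
   Ltx a b t0 (DuhN ka mu F n) \<le> ennreal (C * ka * mu powr (- et) * exp (- mu * t0))"
  unfolding duhamel_def by blast
 \<comment> \<open>The restriction from \<open>th2\<close> is the stronger one, so these pairs are
   reached with both parameters.\<close>
 define b where "b n = (1 - th2) / 8 / real (Suc n)" for n
 have b: "0 < b n" "b n \<le> (1 - th2) / 8" for n
  using th divide_left_mono[of 1 "real (Suc n)" "(1 - th2) / 8"] by (auto simp: b_def)
 have b1: "b n \<le> (1 - th1) / 8" for n using b(2)[of n] th by simp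
 have b_lim: "b \<longlonglongrightarrow> 0"
 proof -
  have "(\<lambda>n. (1 - th2) / 8 * inverse (real (Suc n))) \<longlonglongrightarrow> (1 - th2) / 8 * 0"
   by (intro tendsto_mult tendsto_const LIMSEQ_inverse_real_of_nat)
  then show ?thesis unfolding b_def[abs_def] by (simp only: divide_inverse mult_zero_right)
 qed
 have "Ltx (aend CARD('n) bStr) (bend CARD('n) bStr) t0 (duhamel.V F ka mu) \<le> ennreal (C * ka * mu powr (- et) * exp (- mu * t0))"
  if D: "duhamel F be ka mu" for F :: "'n evol" and ka mu t0
 proof -
  note V_Ltx_le = duhamel.V_Ltx_le[OF D] and measurable_V = duhamel.measurable_V[OF D]
   and [measurable] = duhamel.measurable_V1[OF D]
  let ?V = "duhamel.V F ka mu"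
  let ?B = "ennreal (C * ka * mu powr (- et) * exp (- mu * t0))"
  have ends: "aend CARD('n) bStr = 1/4" "bend CARD('n) bStr = 0" using True bStr by (auto simp: aend_def bend_def)
  have 1: "Ltx (1/4) (b n) t0 ?V \<le> ?B" for n
  proof (rule V_Ltx_le[OF _ b(1) le[OF _ _ _ _ D]])
   show "admissible_split CARD('n) et th1 (1/4) (b n)"
    unfolding True et_def by (rule admissible_split_1) (use th b b1 in auto)
   show "admissible_split CARD('n) et th2 (1/4) (b n)"
    unfolding True et_def by (rule admissible_split_mono[OF admissible_split_1[where th=th2]]) (use th b in auto)
   show "b n \<le> 1" using b(2)[of n] th by simp
  qed auto
  have "Ltx (1/4) 0 t0 ?V \<le> liminf (\<lambda>n. Ltx (1/4) (b n) t0 ?V)" unfolding Ltx_def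
  proof (rule Lnorm_Fatou)
   show "AE t in restrict_space lborel {t0..}. Lx 0 (?V t) \<le> liminf (\<lambda>n. Lx (b n) (?V t))"
    by (intro AE_I2 Lx_0_le_liminf b(1) b_lim) measurable
   show "(\<lambda>t. Lx (b n) (?V t)) \<in> borel_measurable (restrict_space lborel {t0..})" for n
    using borel_measurable_Lx[OF measurable_V b(1)] by (intro measurable_restrict_space1) simp
  qed simp
  also have "... \<le> liminf (\<lambda>n. ?B)" by (intro Liminf_mono always_eventually allI 1)
  finally show ?thesis by (simp add: Liminf_const ends)
 qed
 with C et(1) show ?thesis by blast
next
 case False
 let ?d = "real CARD('n)"
 define a where "a = aend CARD('n) bStr"
 define b where "b = bend CARD('n) bStr"
 have d2: "2 \<le> CARD('n)" using False zero_less_card_finite[where 'a='n] by linarith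
 then have d: "2 \<le> ?d" by simp
 define th1 where "th1 = (1 - 2 * be) / 2"
 \<comment> \<open>\<open>th2\<close> must exceed \<open>1 - 2 * be\<close> and stay below
   \<open>1 - 2 * b\<close>. The room is \<open>b < be\<close>, which is \<open>delta < 1\<close>
   for \<open>d \<ge> 3\<close> and the condition on \<open>bStr\<close> for
   \<open>d = 2\<close>.\<close>
 define th2 where "th2 = ((1 - 2 * be) + (1 - 2 * b)) / 2"
 have b: "0 < b" "b < be" using bStr d2 de1 be by (auto simp: b_def bend_def delta_def field_simps split: if_splits)
 have th: "0 < th1" "th1 < 1 - 2 * be" "1 - 2 * be < th2" "th2 < 1" "th1 < 1 - 2 * b" "th2 < 1 - 2 * b" "0 < th2"
  using be b by (auto simp: th1_def th2_def)
 have a_eq: "a = ?d/4 - ?d * b/2" by (simp add: a_def aend_def b_def algebra_simps)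
 have ab: "(CARD('n) = 2 \<and> a = 1/2 - b) \<or> (3 \<le> CARD('n) \<and> a = 1/2 \<and> ?d * (1 - 2 * b) = 2)"
 proof (cases "CARD('n) = 2")
  case True then show ?thesis by (simp add: a_eq)
 next
  case False
  then have "b = (?d - 2) / (2 * ?d)" "3 \<le> CARD('n)" using d2 by (auto simp: b_def bend_def)
  then show ?thesis using d by (simp add: a_eq field_simps)
 qed
 have a: "0 < a" "a \<le> 1/2" using ab b be by auto
 have split: "\<exists>et>0. admissible_split CARD('n) et th a b" if th: "0 < th" "th < 1 - 2 * b" for th
 proof (rule admissible_split_scaling[OF b(1) th(2,1) a_eq a])
  have "?d * th < ?d * (1 - 2 * b)" using th d by (intro mult_strict_left_mono) auto
  then have "3 \<le> CARD('n) \<and> a = 1/2 \<and> ?d * (1 - 2 * b) = 2 \<Longrightarrow> ?d * th/4 < 1 - a" by linarith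
  moreover have "CARD('n) = 2 \<and> a = 1/2 - b \<Longrightarrow> ?d * th/4 < 1 - a" using th b by simp
  ultimately show "?d * th/4 < 1 - a" using ab by blast
  \<comment> \<open>The inequality is strict for different reasons: for \<open>d = 2\<close> because
    \<open>a < 1/2\<close>, for \<open>d \<ge> 3\<close>, where \<open>a = 1/2\<close>, because
    \<open>th * (d - 2)\<close> is positive.\<close>
  have "0 \<le> th * (?d - 2)" "CARD('n) \<noteq> 2 \<Longrightarrow> 0 < th * (?d - 2)" using th d d2 by auto
  then show "2 * a < 1 + th * (?d - 2) / 2" using ab b by auto
 qed
 obtain et1 where et1: "0 < et1" "admissible_split CARD('n) et1 th1 a b" using split[OF th(1,5)] by auto
 obtain et2 where et2: "0 < et2" "admissible_split CARD('n) et2 th2 a b" using split[OF th(7,6)] by auto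
 note et12 = et1 et2
 define et where "et = min 1 (min et1 et2)"
 have et: "0 < et" "et \<le> 1" using et12 by (auto simp: et_def)
 have ok: "admissible_split CARD('n) et th1 a b" "admissible_split CARD('n) et th2 a b"
  using et12 et by (auto intro: admissible_split_mono simp: et_def)
 from strichartz_DuhN[OF be et th(1-4), where 'n='n] obtain C where C: "0 < C"
  and le': "\<And>a b (F :: 'n evol) ka mu t0 n.
   admissible_split CARD('n) et th1 a b \<Longrightarrow> admissible_split CARD('n) et th2 a b \<Longrightarrow> a \<le> 1 \<Longrightarrow> b \<le> 1 \<Longrightarrow> duhamel F be ka mu \<Longrightarrow>
   Ltx a b t0 (DuhN ka mu F n) \<le> ennreal (C * ka * mu powr (- et) * exp (- mu * t0))"
  unfolding duhamel_def by blast
 have ab1: "a \<le> 1" "b \<le> 1" using a b be by auto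
 note le = le'[OF ok ab1]
 show ?thesis unfolding a_def[symmetric] b_def[symmetric] using duhamel.V_Ltx_le[OF _ a(1) b(1) le] C et(1) by blast
qed

section \<open>Test functions and the mild formulation\<close>

lemma has_derivative_zero_quadratic:
 fixes f :: "real \<Rightarrow> real"
 assumes f0: "f y = 0" and le: "\<And>z. \<bar>f z\<bar> \<le> C * (z - y)\<^sup>2" and C: "0 \<le> C"
 shows "(f has_real_derivative 0) (at y)" unfolding has_field_derivative_iff
proof (rule Lim_null_comparison)
 show "\<forall>\<^sub>F z in at y. norm ((f z - f y) / (z - y)) \<le> C * \<bar>z - y\<bar>"
 proof (rule eventually_at_topological[THEN iffD2], intro exI[of _ UNIV] conjI ballI impI)
  fix z assume "z \<noteq> y"
  then show "norm ((f z - f y) / (z - y)) \<le> C * \<bar>z - y\<bar>"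
   using le[of z] by (simp add: f0 divide_le_eq power2_eq_square abs_mult_self_eq mult.assoc)
 qed auto
 have "((\<lambda>z. C * \<bar>z - y\<bar>) \<longlongrightarrow> C * \<bar>y - y\<bar>) (at y)" by (intro tendsto_intros)
 then show "((\<lambda>z. C * \<bar>z - y\<bar>) \<longlongrightarrow> 0) (at y)" by simp
qed

text \<open>With \<open>q = (y - a) * (b - y)\<close>, the functions
  \<open>P / q ^ m * exp (- 1 / (c * q))\<close> on the interval, zero outside, form a class closed
  under differentiation; the pair of \<open>P\<close> and \<open>m\<close> encodes a member.\<close>

definition bump :: "real \<Rightarrow> real \<Rightarrow> real \<Rightarrow> real poly \<times> nat \<Rightarrow> real \<Rightarrow> real" where
 "bump c a b Rm y = (if a < y \<and> y < b
   then poly (fst Rm) y / ((y - a) * (b - y)) ^ snd Rm * exp (- 1 / (c * ((y - a) * (b - y)))) else 0)"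

text \<open>\<open>Q\<close> and \<open>Q'\<close> are \<open>q\<close> and its derivative as
  polynomials; the new numerator is that of the derivative over the denominator
  \<open>q ^ (m + 2)\<close>.\<close>

definition next_bump :: "real \<Rightarrow> real \<Rightarrow> real \<Rightarrow> real poly \<times> nat \<Rightarrow> real poly \<times> nat" where
 "next_bump c a b Rm = (let R = fst Rm; m = snd Rm; Q = [:- a * b, a + b, -1:]; Q' = [:a + b, -2:] in
   (pderiv R * Q * Q - smult (real m) (R * Q' * Q) + smult (1/c) (R * Q'), m + 2))"

lemma power_le_exp: "0 \<le> x \<Longrightarrow> 0 < k \<Longrightarrow> x ^ k \<le> real k ^ k * exp x"
proof -
 assume x: "0 \<le> x" and k: "0 < k"
 have "(x / real k) ^ k \<le> exp (x / real k) ^ k" using x exp_gt_self[of "x / real k"] by (intro power_mono) auto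
 also have "... = exp x" using k by (simp flip: exp_of_nat_mult)
 finally show ?thesis using k by (simp add: power_divide divide_le_eq mult.commute)
qed

lemma bump_has_derivative:
 assumes c: "0 < c"
 shows "(bump c a b Rm has_real_derivative bump c a b (next_bump c a b Rm) y) (at y)"
proof (cases "a < y \<and> y < b")
 case True
 define R m where "R = fst Rm" and "m = snd Rm"
 define q where "q = (y - a) * (b - y)"
 have q: "0 < q" using True by (simp add: q_def)
 define Qp Qp' where "Qp = [:- a * b, a + b, -1:]" and "Qp' = [:a + b, -2:]"
 have Q: "poly Qp y = q" "poly Qp' y = (b - y) - (y - a)" by (simp_all add: q_def Qp_def Qp'_def algebra_simps)
 have nb: "next_bump c a b Rm = (pderiv R * Qp * Qp - smult (real m) (R * Qp' * Qp) + smult (1/c) (R * Qp'), m + 2)"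
  by (simp add: next_bump_def Let_def R_def m_def Qp_def Qp'_def)
 let ?f = "\<lambda>y. poly R y * inverse (((y - a) * (b - y)) ^ m) * exp (- inverse (c * ((y - a) * (b - y))))"
 define q' where "q' = (b - y) - (y - a)"
 have dq: "((\<lambda>y. (y - a) * (b - y)) has_real_derivative q') (at y)"
  by (auto intro!: derivative_eq_intros simp: q'_def)
 have d1: "((\<lambda>y. inverse (((y - a) * (b - y)) ^ m)) has_real_derivative - (inverse (q ^ m) * (real m * q ^ (m - Suc 0) * q') * inverse (q ^ m))) (at y)"
  by (rule DERIV_cong[OF DERIV_inverse'[OF DERIV_power[OF dq]]]) (use q in \<open>auto simp: q_def\<close>)
 have d2: "((\<lambda>y. exp (- inverse (c * ((y - a) * (b - y))))) has_real_derivative exp (- inverse (c * q)) * (inverse (c * q) * (c * q') * inverse (c * q))) (at y)"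
  by (rule DERIV_cong[OF DERIV_chain2[OF DERIV_exp DERIV_minus[OF DERIV_inverse'[OF DERIV_cmult[OF dq]]]]]) (use q c in \<open>auto simp: q_def\<close>)
 have "(?f has_real_derivative
   (poly (pderiv R) y * inverse (q ^ m) + - (inverse (q ^ m) * (real m * q ^ (m - Suc 0) * q') * inverse (q ^ m)) * poly R y) * exp (- inverse (c * q))
    + exp (- inverse (c * q)) * (inverse (c * q) * (c * q') * inverse (c * q)) * (poly R y * inverse (q ^ m))) (at y)"
  by (rule DERIV_cong[OF DERIV_mult[OF DERIV_mult[OF poly_DERIV d1] d2]]) (simp add: q_def)
 moreover have "(poly (pderiv R) y * inverse (q ^ m) + - (inverse (q ^ m) * (real m * q ^ (m - Suc 0) * q') * inverse (q ^ m)) * poly R y) * exp (- inverse (c * q))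
    + exp (- inverse (c * q)) * (inverse (c * q) * (c * q') * inverse (c * q)) * (poly R y * inverse (q ^ m))
   = bump c a b (next_bump c a b Rm) y"
 proof -
  have e: "inverse (q ^ m) * (real m * q ^ (m - Suc 0) * q') * inverse (q ^ m) = real m * q' / q ^ Suc m"
   using q by (cases m) (auto simp: field_simps)
  have "bump c a b (next_bump c a b Rm) y
   = (poly (pderiv R) y * q * q - real m * (poly R y * q' * q) + (1/c) * (poly R y * q')) / (q ^ m * (q * q)) * exp (- inverse (c * q))"
   unfolding bump_def nb q_def[symmetric] using True by (simp add: Q q'_def divide_inverse mult.assoc)
  also have "... = (poly (pderiv R) y * inverse (q ^ m) + - (real m * q' / q ^ Suc m) * poly R y) * exp (- inverse (c * q))
    + exp (- inverse (c * q)) * (inverse (c * q) * (c * q') * inverse (c * q)) * (poly R y * inverse (q ^ m))"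
   using q c by (simp add: field_simps)
  finally show ?thesis unfolding e by simp
 qed
 ultimately have "(?f has_real_derivative bump c a b (next_bump c a b Rm) y) (at y)" by simp
 moreover have "\<forall>\<^sub>F z in nhds y. bump c a b Rm z = ?f z"
 proof -
  have "\<forall>\<^sub>F z in nhds y. z \<in> {a<..<b}" using True by (intro eventually_nhds_in_open) auto
  then show ?thesis by eventually_elim (simp add: bump_def R_def m_def divide_inverse)
 qed
 ultimately show ?thesis by (simp add: DERIV_cong_ev)
next
 case False
 define R m where "R = fst Rm" and "m = snd Rm"
 obtain D where D: "0 \<le> D" "\<And>z. z \<in> {a..b} \<Longrightarrow> \<bar>poly R z\<bar> \<le> D"
 proof -
  have "bounded (poly R ` {a..b})" by (intro compact_imp_bounded compact_continuous_image continuous_intros) auto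
  then obtain D where D: "\<forall>z\<in>{a..b}. \<bar>poly R z\<bar> \<le> D" by (auto simp: bounded_real)
  show ?thesis by (rule that[of "max 0 D"]) (use D in force)+
 qed
 \<comment> \<open>Two powers of \<open>q\<close> more than the denominator holds: the exponential
   absorbs \<open>q ^ m\<close> and leaves the square of \<open>q\<close>, hence a quadratic zero at
   every point outside the open interval.\<close>
 define k where "k = m + 2"
 define C where "C = D * (real k ^ k * c ^ k) * (b - a)\<^sup>2"
 have zero: "bump c a b S y = 0" for S using False by (auto simp: bump_def)
 have "(bump c a b Rm has_real_derivative 0) (at y)"
 proof (rule has_derivative_zero_quadratic[where C=C])
  show "0 \<le> C" using D c by (simp add: C_def)
  fix z
  show "\<bar>bump c a b Rm z\<bar> \<le> C * (z - y)\<^sup>2"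
  proof (cases "a < z \<and> z < b")
   case True
   define q where "q = (z - a) * (b - z)"
   have q: "0 < q" using True by (simp add: q_def)
   have q_le: "q \<le> \<bar>z - y\<bar> * (b - a)"
   proof (cases "y \<le> a")
    case True
    then show ?thesis using \<open>a < z \<and> z < b\<close> by (auto simp: q_def intro!: mult_mono)
   next
    case False
    then have "q \<le> (b - a) * \<bar>z - y\<bar>" using \<open>a < z \<and> z < b\<close> \<open>\<not> (a < y \<and> y < b)\<close> by (auto simp: q_def intro!: mult_mono)
    then show ?thesis by (simp add: mult.commute)
   qed
   have "exp (- (1 / (c * q))) \<le> real k ^ k * (c * q) ^ k"
   proof -
    have "(1 / (c * q)) ^ k \<le> real k ^ k * exp (1 / (c * q))" using q c by (intro power_le_exp) (auto simp: k_def)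
    then show ?thesis using q c by (simp add: exp_minus power_divide field_simps)
   qed
   then have "\<bar>bump c a b Rm z\<bar> \<le> D / q ^ m * (real k ^ k * (c * q) ^ k)"
    using True q D(2)[of z] D(1) unfolding bump_def q_def[symmetric] R_def[symmetric] m_def[symmetric]
    by (auto simp: abs_mult intro!: mult_mono divide_right_mono)
   also have "... = D * (real k ^ k * c ^ k) * q\<^sup>2"
    using q by (simp add: k_def power_mult_distrib power_add field_simps power2_eq_square)
   also have "... \<le> D * (real k ^ k * c ^ k) * (\<bar>z - y\<bar> * (b - a))\<^sup>2"
    using q q_le D c by (intro mult_left_mono power_mono) auto
   also have "... = C * (z - y)\<^sup>2" by (simp add: C_def power_mult_distrib)
   finally show ?thesis .
  next
   case False
   then show ?thesis using \<open>0 \<le> C\<close> by (auto simp: bump_def)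
  qed
 qed (rule zero)
 then show ?thesis by (simp add: zero)
qed

text \<open>\<open>k i\<close> counts the derivatives taken in coordinate \<open>i\<close>. With no
  derivative, the functions tend to the indicator of the box as \<open>c\<close> grows.\<close>

definition box_bump :: "real \<Rightarrow> real^'n::finite \<Rightarrow> real^'n \<Rightarrow> ('n \<Rightarrow> nat) \<Rightarrow> real^'n \<Rightarrow> real" where
 "box_bump c A B k x = (\<Prod>i\<in>UNIV. bump c (A $ i) (B $ i) ((next_bump c (A $ i) (B $ i) ^^ k i) (1, 0)) (x $ i))"

lemma box_bump_has_derivative:
 assumes c: "0 < c"
 shows "(box_bump c A B k has_derivative (\<lambda>y. \<Sum>i\<in>UNIV. box_bump c A B (k(i := Suc (k i))) x * y $ i)) (at x)"
proof -
 let ?f = "\<lambda>i k x. bump c (A $ i) (B $ i) ((next_bump c (A $ i) (B $ i) ^^ k) (1, 0)) x"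
 have d1: "((\<lambda>x. ?f i (k i) (x $ i)) has_derivative (\<lambda>y. ?f i (Suc (k i)) (x $ i) * y $ i)) (at x)" for i
 proof -
  have "(?f i (k i) has_derivative (\<lambda>h. ?f i (Suc (k i)) (x $ i) * h)) (at (x $ i))"
   using bump_has_derivative[OF c] by (simp add: has_field_derivative_def mult_commute_abs)
  from has_derivative_compose[OF bounded_linear.has_derivative[OF bounded_linear_vec_nth has_derivative_ident, of i "at x"] this]
  show ?thesis by simp
 qed
 have "(box_bump c A B k has_derivative (\<lambda>y. \<Sum>i\<in>UNIV. (?f i (Suc (k i)) (x $ i) * y $ i) * (\<Prod>j\<in>UNIV - {i}. ?f j (k j) (x $ j)))) (at x)"
  unfolding box_bump_def[abs_def] using d1 by (intro has_derivative_prod) auto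
 moreover have "(?f i (Suc (k i)) (x $ i) * y $ i) * (\<Prod>j\<in>UNIV - {i}. ?f j (k j) (x $ j)) = box_bump c A B (k(i := Suc (k i))) x * y $ i" for i y
 proof -
  have "box_bump c A B (k(i := Suc (k i))) x = ?f i (Suc (k i)) (x $ i) * (\<Prod>j\<in>UNIV - {i}. ?f j ((k(i := Suc (k i))) j) (x $ j))"
   unfolding box_bump_def by (subst prod.remove[of _ i]) auto
  also have "(\<Prod>j\<in>UNIV - {i}. ?f j ((k(i := Suc (k i))) j) (x $ j)) = (\<Prod>j\<in>UNIV - {i}. ?f j (k j) (x $ j))"
   by (intro prod.cong) auto
  finally have e: "box_bump c A B (k(i := Suc (k i))) x = ?f i (Suc (k i)) (x $ i) * (\<Prod>j\<in>UNIV - {i}. ?f j (k j) (x $ j))" .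
  show ?thesis unfolding e by (simp only: mult_ac)
 qed
 ultimately show ?thesis by (simp only:)
qed

lemma smooth_box_bump:
 assumes c: "0 < c" shows "smooth_fun (box_bump c A B k)"
proof -
 have ex: "\<exists>k'. pds is (box_bump c A B k) = box_bump c A B k'" for "is"
 proof (induction "is")
  case (Cons i "is")
  then obtain k' where k': "pds is (box_bump c A B k) = box_bump c A B k'" by blast
  have "pd i (box_bump c A B k') x = box_bump c A B (k'(i := Suc (k' i))) x" for x
   unfolding pd_def frechet_derivative_at[OF box_bump_has_derivative[OF c], symmetric]
   by (simp add: axis_def if_distrib cong: if_cong)
  then have "pds (i # is) (box_bump c A B k) = box_bump c A B (k'(i := Suc (k' i)))" by (simp add: k' fun_eq_iff)
  then show ?case by blast
 qed auto
 show ?thesis unfolding smooth_fun_def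
 proof (intro allI)
  fix "is" x
  obtain k' where "pds is (box_bump c A B k) = box_bump c A B k'" using ex by blast
  then show "pds is (box_bump c A B k) differentiable (at x)"
   using box_bump_has_derivative[OF c, of A B k' x] by (auto simp: differentiable_def)
 qed
qed

lemma box_bump_0: "box_bump c A B (\<lambda>_. 0) x =
 (if x \<in> box A B then exp (\<Sum>i\<in>UNIV. - 1 / (c * ((x $ i - A $ i) * (B $ i - x $ i)))) else 0)"
proof (cases "x \<in> box A B")
 case True
 then show ?thesis by (simp add: box_bump_def bump_def mem_box_cart exp_sum)
next
 case False
 then obtain i where "\<not> (A $ i < x $ i \<and> x $ i < B $ i)" by (auto simp: mem_box_cart)
 then show ?thesis using False by (auto simp: box_bump_def bump_def intro!: prod_zero bexI[of _ i])
qed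

lemma test_fun_box_bump: "0 < c \<Longrightarrow> test_fun (box_bump c A B (\<lambda>_. 0))" unfolding test_fun_def
 by (auto simp: smooth_box_bump box_bump_0 intro!: bounded_subset[OF bounded_box[of A B]])

lemma box_bump_tendsto: "(\<lambda>n. box_bump (real (Suc n)) A B (\<lambda>_. 0) x) \<longlonglongrightarrow> indicator (box A B) x"
proof (cases "x \<in> box A B")
 case True
 let ?S = "\<Sum>i\<in>UNIV. - 1 / ((x $ i - A $ i) * (B $ i - x $ i))"
 have "(\<Sum>i\<in>UNIV. - 1 / (c * ((x $ i - A $ i) * (B $ i - x $ i)))) = inverse c * ?S" for c
  by (simp add: sum_distrib_left divide_inverse)
 moreover have "(\<lambda>n. exp (inverse (real (Suc n)) * ?S)) \<longlonglongrightarrow> exp (0 * ?S)"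
  by (intro tendsto_exp tendsto_mult tendsto_const LIMSEQ_inverse_real_of_nat)
 ultimately show ?thesis using True by (simp add: box_bump_0)
qed (simp add: box_bump_0)

lemma box_bump_le: "0 < c \<Longrightarrow> \<bar>box_bump c A B (\<lambda>_. 0) x\<bar> \<le> indicator (box A B) x"
proof (cases "x \<in> box A B")
 case True
 assume c: "0 < c"
 have "- 1 / (c * ((x $ i - A $ i) * (B $ i - x $ i))) \<le> 0" for i
 proof -
  have "0 \<le> c * ((x $ i - A $ i) * (B $ i - x $ i))"
   using True c by (intro mult_nonneg_nonneg) (auto simp: mem_box_cart intro: less_imp_le)
  then show ?thesis by (simp add: divide_nonpos_nonneg)
 qed
 then have "(\<Sum>i\<in>UNIV. - 1 / (c * ((x $ i - A $ i) * (B $ i - x $ i)))) \<le> 0" by (intro sum_nonpos)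
 then show ?thesis using True by (simp add: box_bump_0)
qed (simp add: box_bump_0)

lemma test_fun_props:
 fixes ps :: "real^'n::finite \<Rightarrow> real"
 assumes "test_fun ps"
 shows "integrable lborel ps" "\<exists>B. \<forall>x. \<bar>ps x\<bar> \<le> B"
proof -
 have "pds [] ps differentiable (at x)" for x using assms unfolding test_fun_def smooth_fun_def by blast
 then have cont: "continuous_on S ps" for S
  by (auto intro: continuous_at_imp_continuous_on differentiable_imp_continuous_within)
 from assms obtain r where r: "{x. ps x \<noteq> 0} \<subseteq> cball 0 r"
  unfolding test_fun_def bounded_iff by (auto simp: subset_iff)
 have "(\<lambda>x. indicator (cball 0 r) x *\<^sub>R ps x) = ps" using r by (auto simp: fun_eq_iff indicator_def)
 then show "integrable lborel ps" using borel_integrable_compact[OF compact_cball cont, of 0 r] by simp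
 have "bounded (ps ` cball 0 r)" by (intro compact_imp_bounded compact_continuous_image cont compact_cball)
 then obtain B where B: "\<forall>x\<in>cball 0 r. \<bar>ps x\<bar> \<le> B" unfolding bounded_real by auto
 have "\<bar>ps x\<bar> \<le> max 0 B" for x using bspec[OF B, of x] r by (cases "ps x = 0") auto
 then show "\<exists>B. \<forall>x. \<bar>ps x\<bar> \<le> B" by blast
qed

lemma integrable_indicator_box_Lx:
 fixes h :: "'n::finite wave"
 assumes [measurable]: "h \<in> bm" and h: "Lx p h < top" and p: "0 < p" "p < 1"
 shows "integrable lborel (\<lambda>x. h x * indicator (box A B) x)"
proof (rule integrable_mult_Lx[where p=p])
 have "Lx (1 - p) (indicator (box A B) :: 'n wave) < top"
 proof (rule Lx_less_top_bounded[where B=1])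
  have "integrable lborel (\<lambda>x. complex_of_real (indicator (box A B) x))"
   by (intro integrable_of_real integrable_real_indicator) (use emeasure_lborel_box_finite[of A B] in \<open>auto simp: less_top\<close>)
  then show "integrable lborel (indicator (box A B) :: 'n wave)"
   by (rule back_subst[of "integrable lborel"]) (auto simp: indicator_def)
 qed (use p in \<open>auto simp: indicator_def\<close>)
 then show "Lx (1 - p) (indicator (box A B) :: 'n wave) < top" .
qed (use h p in auto)

text \<open>Bumps converge to indicators of open boxes, boxes form an intersection-stable generator
  of the Borel sets, and a function whose integrals over all Borel sets vanish is zero almost
  everywhere. Integrability is local, so the argument runs inside one box and space is exhausted at
  the end.\<close>

lemma test_fun_separates:
 fixes h :: "'n::finite wave"
 assumes m[measurable]: "h \<in> bm" and loc: "\<And>A B. integrable lborel (\<lambda>x. h x * indicator (box A B) x)"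
  and zero: "\<And>ps. test_fun ps \<Longrightarrow> (LBINT x. h x * of_real (ps x)) = 0"
 shows "AE x in lborel. h x = 0"
proof -
 have box0: "(LBINT x. h x * indicator (box A B) x) = 0" for A B
 proof -
  let ?ps = "\<lambda>n. box_bump (real (Suc n)) A B (\<lambda>_. 0)"
  have [measurable]: "?ps n \<in> borel_measurable lborel" for n
   using test_fun_props(1)[OF test_fun_box_bump[of "real (Suc n)" A B]] by auto
  have "(\<lambda>n. \<integral>x. h x * of_real (?ps n x) \<partial>lborel) \<longlonglongrightarrow> (LBINT x. h x * indicator (box A B) x)"
  proof (rule integral_dominated_convergence)
   show "integrable lborel (\<lambda>x. cmod (h x * indicator (box A B) x))" by (intro integrable_norm loc)
   show "AE x in lborel. (\<lambda>n. h x * of_real (?ps n x)) \<longlonglongrightarrow> h x * indicator (box A B) x"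
   proof (rule AE_I2)
    fix x
    have "(\<lambda>n. h x * of_real (?ps n x)) \<longlonglongrightarrow> h x * of_real (indicator (box A B) x)"
     by (intro tendsto_mult tendsto_const tendsto_of_real box_bump_tendsto)
    then show "(\<lambda>n. h x * of_real (?ps n x)) \<longlonglongrightarrow> h x * indicator (box A B) x"
     by (auto simp: indicator_def split: if_splits)
   qed
   show "AE x in lborel. norm (h x * of_real (?ps n x)) \<le> cmod (h x * indicator (box A B) x)" for n
   proof (rule AE_I2)
    fix x
    show "norm (h x * of_real (?ps n x)) \<le> cmod (h x * indicator (box A B) x)"
     using box_bump_le[of "real (Suc n)" A B x] by (auto simp: norm_mult indicator_def mult_left_le split: if_splits)
   qed
  qed measurable
  moreover have "(LBINT x. h x * of_real (?ps n x)) = 0" for n by (rule zero[OF test_fun_box_bump]) simp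
  ultimately show ?thesis by (simp add: LIMSEQ_const_iff)
 qed
 have box_AE: "AE x in lborel. h x * indicator (box A B) x = 0" for A B
 proof (rule sigma_finite_measure.density_zero[OF sigma_finite_lborel])
  let ?h = "\<lambda>x. h x * indicator (box A B) x"
  let ?G = "range (\<lambda>(a, b). box a b :: (real^'n) set)"
  show int: "integrable lborel ?h" by (rule loc)
  have sets: "X \<in> sigma_sets UNIV ?G \<longleftrightarrow> X \<in> sets borel" for X by (simp add: borel_eq_box)
  fix E :: "(real^'n) set" assume "E \<in> sets lborel"
  then have E: "E \<in> sigma_sets UNIV ?G" by (simp add: sets)
  have G: "Int_stable ?G" "?G \<subseteq> Pow UNIV" by (auto simp: Int_stable_def box_Int_box)
  from G E show "set_lebesgue_integral lborel E ?h = 0"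
  proof (induction rule: sigma_sets_induct_disjoint)
   case (basic X)
   then obtain a b where X: "X = box a b" by auto
   have "X \<inter> box A B \<in> ?G" unfolding X by (auto simp: box_Int_box)
   then obtain a' b' where ab: "X \<inter> box A B = box a' b'" by auto
   have "indicator X x *\<^sub>R (h x * indicator (box A B) x) = h x * indicator (box a' b') x" for x
    unfolding ab[symmetric] by (auto simp: indicator_def)
   then show ?case by (simp add: set_lebesgue_integral_def box0)
  next
   case (compl X)
   have "indicator (UNIV - X) x *\<^sub>R ?h x = ?h x - indicator X x *\<^sub>R ?h x" for x
    by (auto simp: indicator_def)
   moreover have "integrable lborel (\<lambda>x. indicator X x *\<^sub>R ?h x)"
    using compl(1) by (intro integrable_mult_indicator int) (simp add: sets)
   ultimately show ?case using compl(2) int by (simp add: set_lebesgue_integral_def box0)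
  next
   case (union X)
   have X: "X i \<in> sets borel" for i using union(2) sets by blast
   then have U: "(\<Union>i. X i) \<in> sets borel" by blast
   have "set_integrable lborel (\<Union>i. X i) ?h"
    unfolding set_integrable_def using U int by (intro integrable_mult_indicator) auto
   then have "set_lebesgue_integral lborel (\<Union>i. X i) ?h = (\<Sum>i. set_lebesgue_integral lborel (X i) ?h)"
    by (rule lebesgue_integral_countable_add[rotated 2]) (use union(1) X in \<open>auto simp: disjoint_family_on_def\<close>)
   then show ?case by (simp only: union(3) suminf_zero)
  qed (simp add: set_lebesgue_integral_def)
 qed
 have "AE x in lborel. \<forall>n::nat. h x * indicator (box (- (real n *\<^sub>R One)) (real n *\<^sub>R One)) x = 0"
  unfolding AE_all_countable using box_AE by blast
 then show ?thesis
 proof eventually_elim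
  case (elim x)
  have "x \<in> (\<Union>n::nat. box (- (real n *\<^sub>R One)) (real n *\<^sub>R One))"
   unfolding UN_box_eq_UNIV by simp
  then obtain n :: nat where "x \<in> box (- (real n *\<^sub>R One)) (real n *\<^sub>R One)" by blast
  then show ?case using elim[rule_format, of n] by simp
 qed
qed

text \<open>The weak formulation of \<open>h = - \<i> \<integral>\<^sub>t\<^sup>\<infinity> e\<^sup>i\<^sup>(\<^sup>t\<^sup>-\<^sup>s\<^sup>)\<^sup>\<Delta> F(s) ds\<close> used in \<open>nls_solution\<close>.\<close>

definition mild :: "('n::finite evol) \<Rightarrow> ('n wave) \<Rightarrow> real \<Rightarrow> bool" where
 "mild F h t \<longleftrightarrow> (\<forall>ps. test_fun ps \<longrightarrow>
   integrable lborel (\<lambda>x. h x * of_real (ps x)) \<and>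
   (AE s in lborel. s \<ge> t \<longrightarrow> integrable lborel (\<lambda>x. F s x * cnj (schr (s - t) ps x))) \<and>
   (\<forall>T\<ge>t. set_integrable lborel {t..T} (\<lambda>s. \<integral>x. F s x * cnj (schr (s - t) ps x) \<partial>lborel)) \<and>
   ((\<lambda>T. - \<i> * (\<integral>s\<in>{t..T}. (LBINT x. F s x * cnj (schr (s - t) ps x)) \<partial>lborel))
     \<longlongrightarrow> (LBINT x. h x * of_real (ps x))) at_top)"

lemma nls_solution_iff_mild:
 "nls_solution g R u \<longleftrightarrow> (\<lambda>(t, x). u t x) \<in> borel_measurable (lborel \<Otimes>\<^sub>M lborel) \<and>
  (\<forall>t\<ge>0. mild (forcing g R (\<lambda>t x. u t x - train R t x)) (\<lambda>x. u t x - train R t x) t)"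
 by (simp add: nls_solution_def mild_def Let_def)

text \<open>The weak formulation is linear in the forcing and fixes \<open>h\<close> up to null
  sets. It identifies the Duhamel term of a difference with the difference of the Duhamel terms, and
  with \<open>h\<close> and \<open>D\<close> zero it compares two solutions of the same
  equation.\<close>

lemma mild_diff_unique:
 fixes h h1 h2 :: "'n::finite wave"
 assumes 1: "mild F1 h1 t" and 2: "mild F2 h2 t" and 3: "mild D h t"
  and D: "AE s in lborel. s \<ge> t \<longrightarrow> (AE x in lborel. D s x = F1 s x - F2 s x)"
  and [measurable]: "h \<in> bm" "h1 \<in> bm" "h2 \<in> bm"
  and loc: "\<And>A B. integrable lborel (\<lambda>x. h x * indicator (box A B) x)" "\<And>A B. integrable lborel (\<lambda>x. h1 x * indicator (box A B) x)"
   "\<And>A B. integrable lborel (\<lambda>x. h2 x * indicator (box A B) x)"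
 shows "AE x in lborel. h x = h1 x - h2 x"
proof -
 have loc': "integrable lborel (\<lambda>x. (h x - (h1 x - h2 x)) * indicator (box A B) x)" for A B
  using loc[of A B] by (simp add: left_diff_distrib)
 have "AE x in lborel. h x - (h1 x - h2 x) = 0"
 proof (rule test_fun_separates[OF _ loc'])
  fix ps :: "real^'n \<Rightarrow> real" assume ps: "test_fun ps"
  define J where "J F s = (LBINT x. F s x * cnj (schr (s - t) ps x))" for F s
  let ?I = "\<lambda>F T. \<integral>s\<in>{t..T}. J F s \<partial>lborel" and ?p = "\<lambda>h. LBINT x. h x * of_real (ps x)"
  note 1 = 1[unfolded mild_def, rule_format, OF ps, folded J_def] and 2 = 2[unfolded mild_def, rule_format, OF ps, folded J_def]
   and 3 = 3[unfolded mild_def, rule_format, OF ps, folded J_def]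
  have ae: "AE s in lborel. s \<ge> t \<longrightarrow> J D s = J F1 s - J F2 s"
   using D 1[THEN conjunct2, THEN conjunct1] 2[THEN conjunct2, THEN conjunct1] 3[THEN conjunct2, THEN conjunct1]
  proof eventually_elim
   case (elim s)
   show ?case
   proof
    assume s: "t \<le> s"
    have "J D s = (LBINT x. F1 s x * cnj (schr (s - t) ps x) - F2 s x * cnj (schr (s - t) ps x))" unfolding J_def
    proof (rule integral_cong_AE)
     show "AE x in lborel. D s x * cnj (schr (s - t) ps x) = F1 s x * cnj (schr (s - t) ps x) - F2 s x * cnj (schr (s - t) ps x)"
      using elim(1)[rule_format, OF s] by eventually_elim (simp add: left_diff_distrib)
    qed (use elim s in \<open>auto intro!: borel_measurable_diff dest!: borel_measurable_integrable\<close>)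
    also have "... = J F1 s - J F2 s" unfolding J_def using elim s by (intro Bochner_Integration.integral_diff) auto
    finally show "J D s = J F1 s - J F2 s" .
   qed
  qed
  have set: "?I D T = ?I F1 T - ?I F2 T" if T: "T \<ge> t" for T
  proof -
   have i: "set_integrable lborel {t..T} (J F1)" "set_integrable lborel {t..T} (J F2)" "set_integrable lborel {t..T} (J D)"
    using 1 2 3 T by auto
   have "?I D T = (\<integral>s\<in>{t..T}. J F1 s - J F2 s \<partial>lborel)"
    unfolding set_lebesgue_integral_def
   proof (rule integral_cong_AE)
    show "AE s in lborel. indicat_real {t..T} s *\<^sub>R J D s = indicat_real {t..T} s *\<^sub>R (J F1 s - J F2 s)"
     using ae by eventually_elim (auto simp: indicator_def)
    show "(\<lambda>s. indicat_real {t..T} s *\<^sub>R (J F1 s - J F2 s)) \<in> borel_measurable lborel"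
     using set_integral_diff(1)[OF i(1,2)] unfolding set_integrable_def by auto
   qed (use i(3) in \<open>auto simp: set_integrable_def\<close>)
   then show ?thesis using set_integral_diff(2)[OF i(1,2)] by simp
  qed
  have "((\<lambda>T. - \<i> * ?I F1 T - - \<i> * ?I F2 T)
   \<longlongrightarrow> ?p h1 - ?p h2) at_top"
   using 1 2 by (intro tendsto_diff) blast+
  moreover have "\<forall>\<^sub>F T in at_top. - \<i> * ?I F1 T - - \<i> * ?I F2 T = - \<i> * ?I D T"
   using eventually_ge_at_top[of t] by eventually_elim (simp add: set right_diff_distrib)
  ultimately have "((\<lambda>T. - \<i> * ?I D T)
   \<longlongrightarrow> ?p h1 - ?p h2) at_top"
   by (rule Lim_transform_eventually)
  moreover have "((\<lambda>T. - \<i> * ?I D T) \<longlongrightarrow> ?p h) at_top"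
   using 3 by blast
  ultimately have "?p h = ?p h1 - ?p h2"
   by (rule tendsto_unique[OF trivial_limit_at_top_linorder, rotated])
  then show "(LBINT x. (h x - (h1 x - h2 x)) * of_real (ps x)) = 0" using 1 2 3 by (simp add: left_diff_distrib)
 qed measurable
 then show ?thesis by eventually_elim simp
qed

lemma (in duhamel) mild_V: "mild F (\<lambda>x. - \<i> * V t x) t" unfolding mild_def
proof (intro allI impI)
 fix ps :: "real^'n \<Rightarrow> real" assume ps: "test_fun ps"
 define \<Psi> where "\<Psi> x = complex_of_real (ps x)" for x
 obtain B where B: "\<And>x. \<bar>ps x\<bar> \<le> B" using test_fun_props(2)[OF ps] by blast
 have \<Psi>: "integrable lborel \<Psi>" "\<And>x. cmod (\<Psi> x) \<le> B"
  using test_fun_props(1)[OF ps] B by (auto simp: \<Psi>_def[abs_def])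
 note V = V_pairing[OF \<Psi>, of t]
 define J where "J s = (LBINT x. F s x * cnj (schr (s - t) ps x))" for s
 define g where "g s = indicator {t<..} s * (LBINT x. F s x * U (t - s) \<Psi> x)" for s
 have schr: "cnj (schr (s - t) ps x) = U (t - s) \<Psi> x" if "t < s" for s x
  using that by (simp add: schr_eq_U cnj_U \<Psi>_def[abs_def])
 have Jg: "J s = g s" if "t < s" for s using that by (simp add: J_def g_def schr)
 have g: "integrable lborel g" unfolding g_def[abs_def] by (rule V(3))
 have g0: "g s = 0" if "s \<le> t" for s using that by (simp add: g_def)
 \<comment> \<open>At \<open>s = t\<close> the two formulations differ, since \<open>schr 0\<close>
   is the identity and \<open>U 0\<close> is zero; this single time is split off as a null
   set.\<close>
 have ind: "indicat_real {t..T} s *\<^sub>R J s = indicat_real {t..T} s *\<^sub>R g s + indicat_real {t..T} t *\<^sub>R (indicat_real {t} s *\<^sub>R J t)" for s T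
  using Jg[of s] g0[of s] by (cases "s = t") (auto simp: indicator_def)
 have it: "integrable lborel (\<lambda>s. indicat_real {t} s *\<^sub>R J t)" "(LBINT s. indicat_real {t} s *\<^sub>R J t) = 0"
  by (auto intro!: integrable_scaleR_left integrable_real_indicator)
 have ig: "integrable lborel (\<lambda>s. indicat_real {t..T} s *\<^sub>R g s)" for T
  by (intro integrable_mult_indicator g) auto
 have set: "set_integrable lborel {t..T} J" for T
  unfolding set_integrable_def ind by (intro Bochner_Integration.integrable_add ig integrable_scaleR_right it)
 have "(\<integral>s\<in>{t..T}. J s \<partial>lborel) = (LBINT s. indicat_real {..T} s *\<^sub>R g s)" for T
 proof -
  have "(\<integral>s\<in>{t..T}. J s \<partial>lborel) = (LBINT s. indicat_real {t..T} s *\<^sub>R g s)"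
   unfolding set_lebesgue_integral_def ind using it ig by (subst Bochner_Integration.integral_add) auto
  also have "(\<lambda>s. indicat_real {t..T} s *\<^sub>R g s) = (\<lambda>s. indicat_real {..T} s *\<^sub>R g s)"
  proof
   fix s show "indicat_real {t..T} s *\<^sub>R g s = indicat_real {..T} s *\<^sub>R g s"
    using g0[of s] by (cases "s < t") (auto simp: indicator_def)
  qed
  finally show ?thesis .
 qed
 then have "((\<lambda>T. \<integral>s\<in>{t..T}. J s \<partial>lborel) \<longlongrightarrow> (LBINT s. g s)) at_top"
  using tendsto_integral_at_top[OF _ g] by (simp only: sets_lborel)
 moreover have "(LBINT s. g s) = (LBINT x. V t x * \<Psi> x)" unfolding g_def by (rule V(4)[symmetric])
 ultimately have lim: "((\<lambda>T. - \<i> * (\<integral>s\<in>{t..T}. J s \<partial>lborel)) \<longlongrightarrow> - \<i> * (LBINT x. V t x * \<Psi> x)) at_top"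
  by (intro tendsto_mult tendsto_const) simp
 have "- \<i> * (LBINT x. V t x * \<Psi> x) = (LBINT x. - \<i> * V t x * of_real (ps x))"
  by (simp add: \<Psi>_def mult.assoc)
 moreover have "AE s in lborel. s \<ge> t \<longrightarrow> integrable lborel (\<lambda>x. F s x * cnj (schr (s - t) ps x))"
  using AE_lborel_singleton[of t] by eventually_elim (use V(2) in \<open>auto simp: schr\<close>)
 moreover have "integrable lborel (\<lambda>x. - \<i> * V t x * of_real (ps x))"
  using integrable_mult_right[OF V(1), of "- \<i>"] by (simp add: \<Psi>_def mult.assoc)
 ultimately show "integrable lborel (\<lambda>x. - \<i> * V t x * of_real (ps x)) \<and>
   (AE s in lborel. s \<ge> t \<longrightarrow> integrable lborel (\<lambda>x. F s x * cnj (schr (s - t) ps x))) \<and>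
   (\<forall>T\<ge>t. set_integrable lborel {t..T} (\<lambda>s. \<integral>x. F s x * cnj (schr (s - t) ps x) \<partial>lborel)) \<and>
   ((\<lambda>T. - \<i> * (\<integral>s\<in>{t..T}. (LBINT x. F s x * cnj (schr (s - t) ps x)) \<partial>lborel))
     \<longlongrightarrow> (LBINT x. - \<i> * V t x * of_real (ps x))) at_top"
  using set lim unfolding J_def[symmetric] by simp
qed

section \<open>Nonlinear estimates\<close>

text \<open>The L2 and \<open>L(r2)\<close> bounds gain \<open>mu powr (delta - 1)\<close>, the
  extreme pair gains \<open>mu powr (- et)\<close>; as \<open>mu \<ge> 1\<close>, the weaker gain
  serves for all.\<close>

lemma Duhamel_bounds:
 assumes be: "0 < be" "be < 1/2" and de1: "delta CARD('n::finite) be < 1"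
  and bStr: "if CARD('n) = 2 then 0 < bStr \<and> bStr < be else bStr = 0"
 shows "\<exists>C>0. \<exists>si>0. \<forall>(F :: 'n evol) ka mu t. duhamel F be ka mu \<longrightarrow>
  Lx (1/2) (duhamel.V F ka mu t) \<le> ennreal (C * ka * mu powr (- si) * exp (- mu * t)) \<and>
  Lx be (duhamel.V F ka mu t) \<le> ennreal (C * ka * mu powr (- si) * exp (- mu * t)) \<and>
  strichartz bStr t (duhamel.V F ka mu) \<le> ennreal (C * ka * mu powr (- si) * exp (- mu * t))"
proof -
 let ?de = "delta CARD('n) be"
 from endpoint_bound[OF be de1 bStr] obtain C0 et where C0: "0 < C0" "0 < et"
  and ends: "\<And>(F :: 'n evol) ka mu t0. duhamel F be ka mu \<Longrightarrow>
   Ltx (aend CARD('n) bStr) (bend CARD('n) bStr) t0 (duhamel.V F ka mu) \<le> ennreal (C0 * ka * mu powr (- et) * exp (- mu * t0))"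
  by blast
 define C1 where "C1 = sqrt (Cdisp be * 3 / (1 - ?de))"
 define C2 where "C2 = Cdisp be * 3 / (1 - ?de)"
 have C2: "0 < C2" using Cdisp_pos[OF be(2)] de1 by (simp add: C2_def)
 then have C1: "0 < C1" by (simp add: C1_def C2_def del: real_sqrt_divide)
 define si where "si = min et (1 - ?de)"
 define C where "C = C0 + C1 + C2"
 let ?B = "\<lambda>ka mu t. ennreal (C * ka * mu powr (- si) * exp (- mu * t))"
 have si: "0 < si" using C0 de1 by (simp add: si_def)
 have C: "0 < C" using C0 C1 C2 by (simp add: C_def)
 have "Lx (1/2) (duhamel.V F ka mu t) \<le> ?B ka mu t \<and>
  Lx be (duhamel.V F ka mu t) \<le> ?B ka mu t \<and>
  strichartz bStr t (duhamel.V F ka mu) \<le> ?B ka mu t"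
  if D: "duhamel F be ka mu" for F :: "'n evol" and ka mu t
 proof -
  have ka: "0 < ka" and mu: "1 \<le> mu" using D by (auto simp: duhamel_def)
  have le: "ennreal (c * ka * mu powr (- e) * exp (- mu * s)) \<le> ?B ka mu t"
   if "0 \<le> c" "c \<le> C" "si \<le> e" "t \<le> s" for c e s t
  proof (intro ennreal_leI mult_mono)
   show "mu powr (- e) \<le> mu powr (- si)" using mu that by (intro powr_mono) auto
   show "exp (- mu * s) \<le> exp (- mu * t)" using mu that by simp
  qed (use that ka in auto)
  have L2: "Lx (1/2) (duhamel.V F ka mu s) \<le> ?B ka mu t" if "t \<le> s" for s t
  proof -
   have "Lx (1/2) (duhamel.V F ka mu s) \<le> ennreal (C1 * ka * mu powr (- (1 - ?de)) * exp (- mu * s))"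
    using duhamel.V_L2[OF D, of s] by (simp add: C1_def)
   also have "... \<le> ?B ka mu t"
    using C0 C1 C2 that by (intro le) (auto simp: C_def si_def)
   finally show ?thesis .
  qed
  have "Lx be (duhamel.V F ka mu t) \<le> ennreal (C2 * ka * mu powr (- (1 - ?de)) * exp (- mu * t))"
   using duhamel.V_Lbe[OF D be(1), of t] by (simp add: C2_def)
  also have "... \<le> ?B ka mu t"
   using C0 C1 C2 by (intro le) (auto simp: C_def si_def)
  finally have Lbe: "Lx be (duhamel.V F ka mu t) \<le> ?B ka mu t" .
  have "strichartz bStr t (duhamel.V F ka mu) \<le> ?B ka mu t"
  proof (rule strichartz_le[OF duhamel.measurable_V[OF D]])
   show "0 \<le> bStr" "bStr < 1/2" using bStr be by (auto split: if_splits)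
   show "AE s in lborel. t \<le> s \<longrightarrow> Lx (1/2) (duhamel.V F ka mu s) \<le> ?B ka mu t"
    using L2 by simp
   show "Ltx (aend CARD('n) bStr) (bend CARD('n) bStr) t (duhamel.V F ka mu) \<le> ?B ka mu t"
    by (rule order_trans[OF ends[OF D] le]) (use C0 C1 C2 in \<open>auto simp: C_def si_def\<close>)
  qed
  with L2[of t t] Lbe show ?thesis by simp
 qed
 with C si show ?thesis by blast
qed

text \<open>The contraction norm at a single time: with \<open>be = 1/r2\<close> it controls every
  Lebesgue norm between L2 and \<open>L(r2)\<close>.\<close>

definition NL :: "real \<Rightarrow> ('n::finite wave) \<Rightarrow> ennreal" where
 "NL be h = max (Lx (1/2) h) (Lx be h)"

lemma Lx_le_NL:
 fixes h :: "'n::finite wave"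
 assumes [measurable]: "h \<in> bm" and be: "0 < be" "be < 1/2" and s: "be \<le> s" "s \<le> 1/2"
 shows "Lx s h \<le> NL be h"
proof (cases "s = be \<or> s = 1/2")
 case True
 then show ?thesis by (elim disjE; hypsubst; simp add: NL_def)
next
 case False
 define w where "w = (1/2 - s) / (1/2 - be)"
 have w: "0 < w" "w < 1" using False s be by (auto simp: w_def)
 have "w * (1/2 - be) = 1/2 - s" using be by (simp add: w_def)
 moreover have "(1 - w) * (1/2) + w * be = 1/2 - w * (1/2 - be)" by (simp add: field_simps)
 ultimately have s_eq: "s = (1 - w) * (1/2) + w * be" by simp
 have "Lx s h \<le> enn_powr (Lx (1/2) h) (1 - w) * enn_powr (Lx be h) w"
  unfolding s_eq by (rule Lx_interpolate_half) (use w be in auto)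
 also have "... \<le> enn_powr (NL be h) (1 - w) * enn_powr (NL be h) w"
  using w by (intro mult_mono enn_powr_mono) (auto simp: NL_def)
 also have "... = NL be h" by (simp add: enn_powr_add)
 finally show ?thesis .
qed

lemma Lx_mult_powr_le:
 fixes f g :: "'n::finite wave"
 assumes [measurable]: "f \<in> bm" "g \<in> bm" and p: "0 < p" "0 < al"
 shows "Lx ((1 + al) * p) (\<lambda>x. f x * of_real (cmod (g x) powr al)) \<le> Lx p f * enn_powr (Lx p g) al"
proof -
 have "Lx ((1 + al) * p) (\<lambda>x. f x * of_real (cmod (g x) powr al))
  = Lnorm lborel (p + al * p) (\<lambda>x. ennreal (cmod (f x)) * enn_powr (ennreal (cmod (g x))) al)"
  by (simp add: Lx_def norm_mult ennreal_mult enn_powr_ennreal distrib_right)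
 also have "... \<le> Lnorm lborel p (\<lambda>x. ennreal (cmod (f x))) * Lnorm lborel (al * p) (\<lambda>x. enn_powr (ennreal (cmod (g x))) al)"
  using p by (intro Lnorm_Hoelder) auto
 also have "... = Lx p f * enn_powr (Lx p g) al" using p by (subst Lnorm_enn_powr) (auto simp: Lx_def)
 finally show ?thesis .
qed

text \<open>Hoelder places each product in \<open>L(r2')\<close>. The factor \<open>G\<close> is
  paired with L2. Powers \<open>al1\<close> are taken in the exponent \<open>1/s\<close> with
  \<open>(1 + al1) * s = 1 - be\<close>, where the condition relating \<open>al1\<close> and
  \<open>al2\<close> gives \<open>s \<le> 1/2\<close>. Powers \<open>al2\<close> are taken in
  \<open>r2\<close> itself, since \<open>(1 + al2) * be = 1 - be\<close>.\<close>

lemma nonlinear_estimate: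
 fixes D h u u' :: "'n::finite wave" and G :: "real^'n \<Rightarrow> real"
 assumes [measurable]: "D \<in> bm" "h \<in> bm" "u \<in> bm" "u' \<in> bm" "G \<in> bm"
  and le: "\<And>x. cmod (D x) \<le> C * cmod (h x) * (\<bar>G x\<bar> + cmod (u x) powr al1 + cmod (u' x) powr al1 + cmod (u x) powr al2 + cmod (u' x) powr al2)"
  and al: "0 < al1" "al1 \<le> al2" "al2 / (2 + al2) \<le> al1" and be: "be = 1 / (2 + al2)" and C: "0 \<le> C"
  and G: "Lx (1/2 - be) (\<lambda>x. of_real (G x)) \<le> ennreal CG" "0 \<le> CG" and u: "NL be u \<le> 1" "NL be u' \<le> 1"
 shows "Lx (1 - be) D \<le> ennreal (C * (CG + 4)) * NL be h"
proof -
 have b: "0 < be" "be < 1/2" using al by (auto simp: be field_simps)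
 define s where "s = (1 - be) / (1 + al1)"
 have s: "be \<le> s" "s \<le> 1/2"
 proof -
  have "1 - be = (1 + al2) * be" using al by (simp add: be field_simps)
  moreover have "(1 + al1) * be \<le> (1 + al2) * be" using al b by (intro mult_right_mono) auto
  ultimately show "be \<le> s" using al by (simp add: s_def le_divide_eq mult.commute)
  have "al2 / (2 + al2) = 1 - 2 * be" using al by (simp add: be field_simps)
  then show "s \<le> 1/2" using al by (simp add: s_def divide_le_eq)
 qed
 have T0: "Lx (1 - be) (\<lambda>x. h x * of_real (G x)) \<le> ennreal CG * NL be h"
 proof -
  have "Lx (1 - be) (\<lambda>x. h x * of_real (G x)) = Lnorm lborel (1/2 + (1/2 - be)) (\<lambda>x. ennreal (cmod (h x)) * ennreal (cmod (of_real (G x))))"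
   by (simp add: Lx_def norm_mult ennreal_mult)
  also have "... \<le> Lx (1/2) h * Lx (1/2 - be) (\<lambda>x. of_real (G x))"
   unfolding Lx_def using b by (intro Lnorm_Hoelder) auto
  also have "... \<le> NL be h * ennreal CG" using G by (intro mult_mono) (auto simp: NL_def)
  finally show ?thesis by (simp add: mult.commute)
 qed
 have T1: "Lx (1 - be) (\<lambda>x. h x * of_real (cmod (w x) powr al1)) \<le> NL be h"
  if [measurable]: "w \<in> bm" and w: "NL be w \<le> 1" for w
 proof -
  have "(1 + al1) * s = 1 - be" using al by (simp add: s_def)
  then have "Lx (1 - be) (\<lambda>x. h x * of_real (cmod (w x) powr al1)) \<le> Lx s h * enn_powr (Lx s w) al1"
   using Lx_mult_powr_le[of h w s al1] s b al by simp
  also have "... \<le> NL be h * enn_powr 1 al1"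
   using s b al w Lx_le_NL[OF _ b s, of w] by (intro mult_mono enn_powr_mono Lx_le_NL) auto
  finally show ?thesis by simp
 qed
 have T2: "Lx (1 - be) (\<lambda>x. h x * of_real (cmod (w x) powr al2)) \<le> NL be h"
  if [measurable]: "w \<in> bm" and w: "NL be w \<le> 1" for w
 proof -
  have "(1 + al2) * be = 1 - be" using al by (simp add: be field_simps)
  then have "Lx (1 - be) (\<lambda>x. h x * of_real (cmod (w x) powr al2)) \<le> Lx be h * enn_powr (Lx be w) al2"
   using Lx_mult_powr_le[of h w be al2] b al by simp
  also have "... \<le> NL be h * enn_powr 1 al2" using al w by (intro mult_mono enn_powr_mono) (auto simp: NL_def)
  finally show ?thesis by simp
 qed
 define T :: "nat \<Rightarrow> real^'n \<Rightarrow> real" where "T i x = (if i = 0 then \<bar>G x\<bar> else if i = 1 then cmod (u x) powr al1 else if i = 2 then cmod (u' x) powr al1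
  else if i = 3 then cmod (u x) powr al2 else cmod (u' x) powr al2)" for i x
 have T: "0 \<le> T i x" for i x by (simp add: T_def)
 have [measurable]: "T i \<in> bm" for i unfolding T_def[abs_def] by measurable
 have sum5: "(\<Sum>i<5::nat. f i) = f 0 + f 1 + f 2 + f 3 + f 4" for f :: "nat \<Rightarrow> 'z::comm_monoid_add"
  by (simp add: eval_nat_numeral add.assoc)
 have "Lx (1 - be) D \<le> Lx (1 - be) (\<lambda>x. \<Sum>i<5. of_real (C * cmod (h x) * T i x))"
 proof (rule Lx_mono)
  fix x
  have "cmod (\<Sum>i<5. complex_of_real (C * cmod (h x) * T i x)) = (\<Sum>i<5. C * cmod (h x) * T i x)"
   unfolding of_real_sum[symmetric] norm_of_real using C T by (intro abs_of_nonneg sum_nonneg) auto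
  also have "... = C * cmod (h x) * (\<bar>G x\<bar> + cmod (u x) powr al1 + cmod (u' x) powr al1 + cmod (u x) powr al2 + cmod (u' x) powr al2)"
   unfolding sum5 by (simp add: T_def distrib_left)
  finally show "cmod (D x) \<le> cmod (\<Sum>i<5. complex_of_real (C * cmod (h x) * T i x))" using le[of x] by simp
 qed (use b in simp)
 also have "... \<le> (\<Sum>i<5. Lx (1 - be) (\<lambda>x. complex_of_real (C * cmod (h x) * T i x)))"
  using b by (intro Lx_sum_le) auto
 also have "... = (\<Sum>i<5. ennreal C * Lx (1 - be) (\<lambda>x. h x * of_real (T i x)))"
 proof (rule sum.cong[OF refl])
  fix i
  have "Lx (1 - be) (\<lambda>x. complex_of_real (C * cmod (h x) * T i x)) = Lx (1 - be) (\<lambda>x. of_real C * (h x * of_real (T i x)))"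
   using C T by (simp add: Lx_def norm_mult mult.assoc)
  also have "... = ennreal C * Lx (1 - be) (\<lambda>x. h x * of_real (T i x))" using b C by (subst Lx_cmult) auto
  finally show "Lx (1 - be) (\<lambda>x. complex_of_real (C * cmod (h x) * T i x)) = ..." .
 qed
 also have "... \<le> ennreal C * (ennreal CG * NL be h) + ennreal C * NL be h + ennreal C * NL be h + ennreal C * NL be h + ennreal C * NL be h"
 proof -
  have "Lx (1 - be) (\<lambda>x. h x * of_real \<bar>G x\<bar>) = Lx (1 - be) (\<lambda>x. h x * of_real (G x))"
   by (simp add: Lx_def norm_mult)
  then show ?thesis unfolding sum5 using T0 T1[of u] T1[of u'] T2[of u] T2[of u'] u
   by (intro add_mono mult_left_mono) (simp_all add: T_def)
 qed
 also have "... = (ennreal C * (ennreal CG + 4)) * NL be h"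
 proof -
  have "(4::ennreal) = 1 + 1 + 1 + 1" by simp
  then show ?thesis by (simp only: distrib_left distrib_right mult_1_right add.assoc mult.assoc)
 qed
 also have "ennreal C * (ennreal CG + 4) = ennreal (C * (CG + 4))"
  using ennreal_plus[of CG 4] ennreal_mult[of C "CG + 4"] C G by simp
 finally show ?thesis .
qed

text \<open>The derivative bound is integrated from 0: \<open>h\<close> is its primitive, and
  \<open>h - g\<close> and \<open>h + g\<close> are nondecreasing.\<close>

lemma F0_bound:
 assumes F0: "F0 d g al1 al2 C0" and s: "0 \<le> s"
 shows "\<bar>g s\<bar> \<le> 2 * C0/al1 * (s powr (al1/2) + s powr (al2/2))"
proof (cases "s = 0")
 case True
 then show ?thesis using F0 by (simp add: F0_def)
next
 case False
 have a: "0 < al1" "al1 \<le> al2" "0 < C0" and g0: "g 0 = 0" and gc: "continuous_on {0..} g"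
  and gd: "\<And>s. 0 < s \<Longrightarrow> g differentiable (at s)"
  and gb: "\<And>s. 0 < s \<Longrightarrow> \<bar>s * deriv g s\<bar> + \<bar>s\<^sup>2 * deriv (deriv g) s\<bar> \<le> C0 * (s powr (al1/2) + s powr (al2/2))"
  using F0 by (auto simp: F0_def)
 define h where "h s = 2 * C0 * (s powr (al1/2) / al1 + s powr (al2/2) / al2)" for s
 have hd: "(h has_real_derivative C0 * (s powr (al1/2) + s powr (al2/2)) / s) (at s)" if "0 < s" for s
 proof -
  have "(h has_real_derivative 2 * C0 * ((al1/2) * s powr (al1/2 - 1) / al1 + (al2/2) * s powr (al2/2 - 1) / al2)) (at s)"
   unfolding h_def[abs_def] using that a by (auto intro!: derivative_eq_intros)
  moreover have "2 * C0 * ((al1/2) * s powr (al1/2 - 1) / al1 + (al2/2) * s powr (al2/2 - 1) / al2) = C0 * (s powr (al1/2) + s powr (al2/2)) / s"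
  proof -
   have p: "s powr (al/2 - 1) = s powr (al/2) / s" for al using powr_diff[of s "al/2" 1] that by simp
   show ?thesis unfolding p using that a by (simp add: field_simps)
  qed
  ultimately show ?thesis by simp
 qed
 have hc: "continuous_on {0..s} h"
  unfolding h_def[abs_def] using a by (intro continuous_intros continuous_on_powr') auto
 have gc': "continuous_on {0..s} g" using gc by (rule continuous_on_subset) auto
 have gD: "(g has_real_derivative deriv g x) (at x)" if "0 < x" for x
  using gd[OF that] by (simp add: DERIV_deriv_iff_real_differentiable)
 have gb': "\<bar>deriv g x\<bar> \<le> C0 * (x powr (al1/2) + x powr (al2/2)) / x" if "0 < x" for x
 proof -
  have "\<bar>x * deriv g x\<bar> \<le> C0 * (x powr (al1/2) + x powr (al2/2))"
   by (rule order_trans[OF _ gb[OF that]]) simp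
  then show ?thesis using that by (simp add: abs_mult le_divide_eq mult.commute)
 qed
 have "h 0 - g 0 \<le> h s - g s"
 proof (rule DERIV_nonneg_imp_increasing_open[OF s _ continuous_on_diff[OF hc gc']])
  fix x assume "0 < x" "x < s"
  then show "\<exists>y. ((\<lambda>x. h x - g x) has_real_derivative y) (at x) \<and> 0 \<le> y"
   using DERIV_diff[OF hd gD, of x] gb'[of x] by (intro exI conjI) auto
 qed
 moreover have "h 0 + g 0 \<le> h s + g s"
 proof (rule DERIV_nonneg_imp_increasing_open[OF s _ continuous_on_add[OF hc gc']])
  fix x assume "0 < x" "x < s"
  then show "\<exists>y. ((\<lambda>x. h x + g x) has_real_derivative y) (at x) \<and> 0 \<le> y"
   using DERIV_add[OF hd gD, of x] gb'[of x] by (intro exI conjI) auto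
 qed
 ultimately have "\<bar>g s\<bar> \<le> h s" using g0 by (simp add: h_def)
 also have "... \<le> 2 * C0 * (s powr (al1/2) / al1 + s powr (al2/2) / al1)"
  unfolding h_def using a by (intro mult_left_mono add_left_mono divide_left_mono) auto
 finally show ?thesis using a by (simp add: field_simps)
qed

text \<open>For \<open>cmod z \<le> cmod z'\<close> the difference is a multiple of
  \<open>z' - z\<close> plus the increment of \<open>g\<close> times \<open>z\<close>. The mean
  value theorem along \<open>g (r^2)\<close> gives the derivative at some \<open>c\<close> above
  \<open>cmod z\<close>, and the factor \<open>z\<close> turns it into
  \<open>c^2 * deriv g (c^2)\<close>, which (F0) controls even where \<open>deriv g\<close> is
  singular at 0.\<close>

lemma nonlin_lipschitz:
 assumes F0: "F0 d g al1 al2 C0"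
 shows "\<exists>C>0. \<forall>z w. cmod (nonlin g (z + w) - nonlin g z)
  \<le> C * cmod w * (cmod z powr al1 + cmod w powr al1 + cmod z powr al2 + cmod w powr al2)"
proof -
 have a: "0 < al1" "al1 \<le> al2" "0 < C0" and gc: "continuous_on {0..} g"
  and gd: "\<And>s. 0 < s \<Longrightarrow> g differentiable (at s)"
  and gb: "\<And>s. 0 < s \<Longrightarrow> \<bar>s * deriv g s\<bar> + \<bar>s\<^sup>2 * deriv (deriv g) s\<bar> \<le> C0 * (s powr (al1/2) + s powr (al2/2))"
  using F0 by (auto simp: F0_def)
 define P where "P r = r powr al1 + r powr al2" for r
 define C1 where "C1 = 2 * C0/al1"
 have C1: "0 < C1" using a by (simp add: C1_def)
 have sq: "(r\<^sup>2) powr (al/2) = r powr al" if "0 \<le> r" for r al :: real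
  unfolding powr_sq[OF that, symmetric] powr_powr by simp
 have P0: "0 \<le> P r" for r by (simp add: P_def)
 have Pmono: "P r \<le> P r'" if "0 \<le> r" "r \<le> r'" for r r'
  unfolding P_def using that a by (intro add_mono powr_mono2) auto
 have g1: "\<bar>g (r\<^sup>2)\<bar> \<le> C1 * P r" if "0 \<le> r" for r
  using F0_bound[OF F0, of "r\<^sup>2"] that by (simp add: sq P_def C1_def)
 have gdiff: "b * \<bar>g (a\<^sup>2) - g (b\<^sup>2)\<bar> \<le> 2 * C0 * P a * (a - b)" if ab: "0 \<le> b" "b \<le> a" for a b
 proof (cases "b = 0 \<or> a = b")
  case True
  then show ?thesis using ab P0 \<open>0 < C0\<close> by auto
 next
  case False
  then have b: "0 < b" "b < a" using ab by auto
  have "((\<lambda>r. g (r\<^sup>2)) has_real_derivative deriv g (r\<^sup>2) * (2 * r)) (at r)" if "b \<le> r" for r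
  proof -
   have "(g has_real_derivative deriv g (r\<^sup>2)) (at (r\<^sup>2))"
    using gd[of "r\<^sup>2"] that b by (simp add: DERIV_deriv_iff_real_differentiable)
   moreover have "((\<lambda>r. r\<^sup>2) has_real_derivative 2 * r) (at r)"
    by (auto intro!: derivative_eq_intros)
   ultimately show ?thesis by (rule DERIV_chain2)
  qed
  from MVT2[OF b(2) this] obtain c where c: "b < c" "c < a" "g (a\<^sup>2) - g (b\<^sup>2) = (a - b) * (deriv g (c\<^sup>2) * (2 * c))"
   by auto
  have "c * \<bar>deriv g (c\<^sup>2) * (2 * c)\<bar> = 2 * \<bar>c\<^sup>2 * deriv g (c\<^sup>2)\<bar>"
   using b c by (simp add: abs_mult power2_eq_square)
  also have "... \<le> 2 * (C0 * P c)" using gb[of "c\<^sup>2"] b c by (simp add: sq P_def)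
  also have "... \<le> 2 * (C0 * P a)" using Pmono[of c a] b c \<open>0 < C0\<close> by simp
  finally have 1: "c * \<bar>deriv g (c\<^sup>2) * (2 * c)\<bar> \<le> 2 * (C0 * P a)" .
  have "b * \<bar>g (a\<^sup>2) - g (b\<^sup>2)\<bar> = (a - b) * (b * \<bar>deriv g (c\<^sup>2) * (2 * c)\<bar>)"
   unfolding c(3) using b by (simp add: abs_mult)
  also have "... \<le> (a - b) * (c * \<bar>deriv g (c\<^sup>2) * (2 * c)\<bar>)"
   using b c by (intro mult_left_mono mult_right_mono) auto
  also have "... \<le> (a - b) * (2 * (C0 * P a))" using b by (intro mult_left_mono 1) auto
  finally show ?thesis by (simp add: mult_ac)
 qed
 have main1: "cmod (nonlin g z' - nonlin g z) \<le> (C1 + 2 * C0) * cmod (z' - z) * P (max (cmod z') (cmod z))"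
  if True: "cmod z \<le> cmod z'" for z z'
 proof -
  have "nonlin g z' - nonlin g z = of_real (g ((cmod z')\<^sup>2)) * (z' - z) + of_real (g ((cmod z')\<^sup>2) - g ((cmod z)\<^sup>2)) * z"
   by (simp add: nonlin_def algebra_simps)
  then have "cmod (nonlin g z' - nonlin g z) \<le> \<bar>g ((cmod z')\<^sup>2)\<bar> * cmod (z' - z) + cmod z * \<bar>g ((cmod z')\<^sup>2) - g ((cmod z)\<^sup>2)\<bar>"
   by (smt (verit) norm_triangle_ineq norm_mult norm_of_real mult.commute)
  also have "... \<le> C1 * P (cmod z') * cmod (z' - z) + 2 * C0 * P (cmod z') * (cmod z' - cmod z)"
   using True by (intro add_mono mult_right_mono g1 gdiff) auto
  also have "... \<le> C1 * P (cmod z') * cmod (z' - z) + 2 * C0 * P (cmod z') * cmod (z' - z)"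
   using P0[of "cmod z'"] \<open>0 < C0\<close> norm_triangle_ineq2[of z' z] by (intro add_left_mono mult_left_mono) auto
  also have "... = (C1 + 2 * C0) * cmod (z' - z) * P (max (cmod z') (cmod z))"
   using True by (simp add: max_def algebra_simps)
  finally show ?thesis .
 qed
 have main: "cmod (nonlin g z' - nonlin g z) \<le> (C1 + 2 * C0) * cmod (z' - z) * P (max (cmod z') (cmod z))" for z z'
  using main1[of z z'] main1[of z' z] linear[of "cmod z" "cmod z'"]
  unfolding norm_minus_commute[of z z'] norm_minus_commute[of "nonlin g z" "nonlin g z'"] max.commute[of "cmod z" "cmod z'"] by blast
 have pw: "(max (cmod (z + w)) (cmod z)) powr al \<le> 2 powr al2 * (cmod z powr al + cmod w powr al)" if "0 < al" "al \<le> al2" for z w al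
 proof -
  have "max (cmod (z + w)) (cmod z) \<le> 2 * max (cmod z) (cmod w)"
   using norm_triangle_ineq[of z w] max.cobounded1[of "cmod z" "cmod w"] max.cobounded2[of "cmod w" "cmod z"] norm_ge_zero[of z]
   unfolding max.commute[of "cmod w"] max.bounded_iff by linarith
  then have "(max (cmod (z + w)) (cmod z)) powr al \<le> (2 * max (cmod z) (cmod w)) powr al"
   using that by (intro powr_mono2) (auto simp: le_max_iff_disj)
  also have "... = 2 powr al * (max (cmod z) (cmod w)) powr al" by (rule powr_mult)
  also have "... \<le> 2 powr al2 * (cmod z powr al + cmod w powr al)"
   using that by (intro mult_mono powr_mono) (auto simp: max_def)
  finally show ?thesis .
 qed
 show ?thesis
 proof (intro exI[of _ "(C1 + 2 * C0) * 2 powr al2"] conjI allI)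
  show "0 < (C1 + 2 * C0) * 2 powr al2" using C1 \<open>0 < C0\<close> by simp
  fix z w
  have "cmod (nonlin g (z + w) - nonlin g z) \<le> (C1 + 2 * C0) * cmod w * P (max (cmod (z + w)) (cmod z))"
   using main[of "z + w" z] by simp
  also have "... \<le> (C1 + 2 * C0) * cmod w * (2 powr al2 * (cmod z powr al1 + cmod w powr al1) + 2 powr al2 * (cmod z powr al2 + cmod w powr al2))"
   unfolding P_def using C1 a by (intro mult_left_mono add_mono pw) auto
  finally show "cmod (nonlin g (z + w) - nonlin g z)
   \<le> (C1 + 2 * C0) * 2 powr al2 * cmod w * (cmod z powr al1 + cmod w powr al1 + cmod z powr al2 + cmod w powr al2)"
   by (simp add: algebra_simps)
 qed
qed

lemma borel_measurable_nonlin [measurable]: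
 assumes F0: "F0 d g al1 al2 C0" and [measurable]: "u \<in> borel_measurable M"
 shows "(\<lambda>x. nonlin g (u x)) \<in> borel_measurable M"
proof -
 have gc: "continuous_on {0..} g" using F0 by (simp add: F0_def)
 have "continuous_on UNIV (\<lambda>z. nonlin g z)" unfolding nonlin_def
  by (intro continuous_intros continuous_on_compose2[OF gc]) auto
 then have "nonlin g \<in> bm" by (rule borel_measurable_continuous_onI)
 from measurable_compose[OF assms(2) this] show ?thesis .
qed

section \<open>The soliton train\<close>

text \<open>Space is covered by balls of radius \<open>(n + 1) / c\<close> around \<open>z\<close>;
  their volumes produce the power of \<open>c\<close> and leave a constant depending on the
  dimension only.\<close>

lemma nn_integral_exp_norm_le:
 "\<exists>C\<ge>0. \<forall>c (z :: real^'n::finite). 0 < c \<longrightarrow>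
  (NN x. ennreal (exp (- c * norm (x - z)))) \<le> ennreal (C * c powr (- real CARD('n)))"
proof -
 let ?d = "CARD('n)"
 define w where "w n = exp (- real n) * real (Suc n) ^ ?d" for n
 have sw: "summable w"
 proof (rule summable_comparison_test'[where N=0])
  have "summable (\<lambda>n. (2 ^ ?d * real ?d ^ ?d * exp (1/2)) * exp (- (1/2)) ^ n)"
   by (intro summable_mult summable_geometric) auto
  then show "summable (\<lambda>n. (2 ^ ?d * real ?d ^ ?d * exp (1/2)) * exp (- (1/2)) ^ n)" .
  fix n :: nat
  have "real (Suc n) ^ ?d = 2 ^ ?d * (real (Suc n) / 2) ^ ?d" by (simp add: power_divide)
  also have "... \<le> 2 ^ ?d * (real ?d ^ ?d * exp (real (Suc n) / 2))" by (intro mult_left_mono power_le_exp) auto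
  finally have "w n \<le> exp (- real n) * (2 ^ ?d * (real ?d ^ ?d * exp (real (Suc n) / 2)))"
   unfolding w_def by (intro mult_left_mono) auto
  also have "... = (2 ^ ?d * real ?d ^ ?d * exp (1/2)) * exp (- (1/2)) ^ n"
  proof -
   have "exp (- real n) * exp (real (Suc n) / 2) = exp (1/2) * exp (real n * (- (1/2)))"
    unfolding exp_add[symmetric] by (rule arg_cong[of _ _ exp]) (simp add: field_simps)
   then have "exp (- real n) * exp (real (Suc n) / 2) = exp (1/2) * exp (- (1/2)) ^ n"
    by (simp only: exp_of_nat_mult)
   from arg_cong[OF this, of "\<lambda>u. 2 ^ ?d * real ?d ^ ?d * u"] show ?thesis by (simp only: mult_ac)
  qed
  finally show "norm (w n) \<le> (2 ^ ?d * real ?d ^ ?d * exp (1/2)) * exp (- (1/2)) ^ n" by (simp add: w_def)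
 qed
 have w0: "0 \<le> w n" for n by (simp add: w_def)
 define C where "C = unit_ball_vol (real ?d) * suminf w"
 have C: "0 \<le> C" unfolding C_def using w0 sw by (intro mult_nonneg_nonneg suminf_nonneg) auto
 have "(NN x. ennreal (exp (- c * norm (x - z)))) \<le> ennreal (C * c powr (- real ?d))"
  if c: "0 < c" for c and z :: "real^'n"
 proof -
  have cball[measurable]: "cball z r \<in> sets borel" for r by (intro borel_closed closed_cball)
  have "(NN x. ennreal (exp (- c * norm (x - z))))
   \<le> (NN x. (\<Sum>n. ennreal (exp (- real n)) * indicator (cball z (real (Suc n) / c)) x))"
  proof (rule nn_integral_mono)
   fix x
   define n where "n = nat \<lfloor>c * norm (x - z)\<rfloor>"
   have n: "real n \<le> c * norm (x - z)" "c * norm (x - z) \<le> real (Suc n)"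
    using c by (auto simp: n_def) linarith
   have "x \<in> cball z (real (Suc n) / c)" using n c by (simp add: dist_norm norm_minus_commute field_simps)
   then have "ennreal (exp (- c * norm (x - z))) \<le> ennreal (exp (- real n)) * indicator (cball z (real (Suc n) / c)) x"
    using n by (auto intro!: ennreal_leI)
   also have "... = (\<Sum>n\<in>{n}. ennreal (exp (- real n)) * indicator (cball z (real (Suc n) / c)) x)"
    by (simp only: sum.insert_if sum.empty finite.emptyI empty_iff if_False add_0_right)
   also have "... \<le> (\<Sum>n. ennreal (exp (- real n)) * indicator (cball z (real (Suc n) / c)) x)"
    by (rule sum_le_suminf) auto
   finally show "ennreal (exp (- c * norm (x - z))) \<le> ..." .
  qed
  also have "(NN x. (\<Sum>n. ennreal (exp (- real n)) * indicator (cball z (real (Suc n) / c)) x))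
   = (\<Sum>n. ennreal (exp (- real n)) * emeasure lborel (cball z (real (Suc n) / c)))"
   by (subst nn_integral_suminf) (auto simp: nn_integral_cmult_indicator)
  also have "... = (\<Sum>n. ennreal (unit_ball_vol (real ?d) * c powr (- real ?d) * w n))"
  proof (intro suminf_cong)
   fix n
   have e: "exp (- real n) * (unit_ball_vol (real ?d) * (real (Suc n) / c) ^ ?d) = unit_ball_vol (real ?d) * c powr (- real ?d) * w n"
    using c by (simp add: w_def powr_minus powr_realpow divide_inverse power_mult_distrib power_inverse)
   have b: "emeasure lborel (cball z (real (Suc n) / c)) = ennreal (unit_ball_vol (real ?d) * (real (Suc n) / c) ^ ?d)"
    using emeasure_cball[of "real (Suc n) / c" z] c by simp
   show "ennreal (exp (- real n)) * emeasure lborel (cball z (real (Suc n) / c)) = ennreal (unit_ball_vol (real ?d) * c powr (- real ?d) * w n)"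
    unfolding b e[symmetric] using c by (intro ennreal_mult[symmetric]) auto
  qed
  also have "... = ennreal (\<Sum>n. unit_ball_vol (real ?d) * c powr (- real ?d) * w n)"
   using w0 sw by (intro suminf_ennreal2 summable_mult) auto
  also have "... = ennreal (C * c powr (- real ?d))" using sw by (subst suminf_mult) (auto simp: C_def mult_ac)
  finally show ?thesis .
 qed
 with C show ?thesis by blast
qed

lemma powr_add_le:
 fixes x y :: real
 assumes "0 \<le> x" "0 \<le> y" "0 \<le> al"
 shows "(x + y) powr al \<le> 2 powr al * (x powr al + y powr al)"
proof -
 have "(x + y) powr al \<le> (2 * max x y) powr al" using assms by (intro powr_mono2) auto
 also have "... = 2 powr al * (max x y) powr al" by (rule powr_mult)
 also have "... \<le> 2 powr al * (x powr al + y powr al)" by (intro mult_left_mono) (auto simp: max_def)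
 finally show ?thesis .
qed

locale soliton_train =
 fixes g :: "real \<Rightarrow> real" and al1 al2 C0 r0 a Da :: real and ph :: "nat \<Rightarrow> 'n::finite wave" and om :: "nat \<Rightarrow> real"
 assumes F0: "F0 CARD('n) g al1 al2 C0" and al_le: "al2 / (2 + al2) \<le> al1"
  and r0: "1 < r0" "real CARD('n) * al1/2 < r0" "1/2 \<le> al1/r0 + 1 / (2 + al2)" "1 < (al1 + 1) / r0 + 1 / (2 + al2)"
  and aD: "0 < a" "0 < Da" and om0: "\<And>j. 0 \<le> om j"
  and ph_diff: "\<And>j x. ph j differentiable (at x)"
  and ph_le: "\<And>j x. cmod (ph j x) \<le> Da * om j powr (1/al1) * exp (- a * sqrt (om j) * norm x)"
  and summ: "summable (\<lambda>j. om j powr (1/al1 - real CARD('n) / (2 * r0)))"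
begin

lemma al: "0 < al1" "al1 \<le> al2" using F0 by (auto simp: F0_def)

definition A :: "nat \<Rightarrow> real" where "A j = Da * om j powr (1/al1)"

text \<open>Half of the decay rate of the soliton. The soliton is bounded by \<open>A j\<close>
  times the square of this envelope: one factor is spent on smallness, the other on summation in
  \<open>G\<close>.\<close>

definition e :: "(nat \<Rightarrow> real^'n) \<Rightarrow> nat \<Rightarrow> real \<Rightarrow> real^'n \<Rightarrow> real" where
 "e v j t x = exp (- (a/2) * sqrt (om j) * norm (x - t *\<^sub>R v j))"

definition G :: "(nat \<Rightarrow> real^'n) \<Rightarrow> real \<Rightarrow> real^'n \<Rightarrow> real" where
 "G v t x = (\<Sum>j. A j * e v j t x)"

definition Ainf :: real where "Ainf = suminf A"

definition R :: "(nat \<Rightarrow> real^'n) \<Rightarrow> (nat \<Rightarrow> real) \<Rightarrow> nat \<Rightarrow> 'n evol" where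
 "R v ga j = soliton (ph j) (om j) 0 (v j) (ga j)"

definition Hf :: "(nat \<Rightarrow> real^'n) \<Rightarrow> (nat \<Rightarrow> real) \<Rightarrow> 'n evol" where
 "Hf v ga t x = nonlin g (train (R v ga) t x) - (\<Sum>j. nonlin g (R v ga j t x))"

lemma A_nonneg: "0 \<le> A j" using aD by (simp add: A_def)

lemma e_bounds: "0 < e v j t x" "e v j t x \<le> 1" using aD om0[of j] by (auto simp: e_def)

lemma exponent_pos: "0 < 1/al1 - real CARD('n) / (2 * r0)" using r0 al by (simp add: field_simps)

text \<open>The power \<open>s\<close> summed in (T1) is positive and below \<open>1/al1\<close>.
  Its terms are bounded, hence so is the remaining power of \<open>om j\<close>, which can be taken
  out of the sum.\<close>

lemma A_summable: "summable A"
proof -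
 define s where "s = 1/al1 - real CARD('n) / (2 * r0)"
 have s: "0 < s" using exponent_pos by (simp add: s_def)
 have "Bseq (\<lambda>j. om j powr s)"
  using summable_LIMSEQ_zero[OF summ] unfolding s_def by (intro convergent_imp_Bseq) (auto simp: convergent_def)
 then obtain M where M: "0 < M" "\<And>j. norm (om j powr s) \<le> M" by (auto simp: Bseq_def)
 show ?thesis
 proof (rule summable_comparison_test'[where N=0])
  show "summable (\<lambda>j. Da * M powr (real CARD('n) / (2 * r0) / s) * om j powr s)"
   unfolding s_def by (intro summable_mult summ)
  fix j
  have "om j powr (1/al1) = om j powr s * om j powr (real CARD('n) / (2 * r0))" by (simp add: s_def flip: powr_add)
  also have "om j powr (real CARD('n) / (2 * r0)) = (om j powr s) powr (real CARD('n) / (2 * r0) / s)"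
   using s by (simp add: powr_powr)
  also have "om j powr s * ... \<le> om j powr s * M powr (real CARD('n) / (2 * r0) / s)"
   using M s r0 by (intro mult_left_mono powr_mono2) auto
  finally show "norm (A j) \<le> Da * M powr (real CARD('n) / (2 * r0) / s) * om j powr s"
   using aD by (simp add: A_def mult_ac)
 qed
qed

lemma Ae_summable: "summable (\<lambda>j. A j * e v j t x)"
 by (rule summable_comparison_test'[OF A_summable, where N=0])
   (use A_nonneg e_bounds in \<open>auto simp: abs_mult less_imp_le intro!: mult_left_le\<close>)

lemma Ae_le_G: "A j * e v j t x \<le> G v t x"
proof -
 have "(\<Sum>j\<in>{j}. A j * e v j t x) \<le> G v t x"
  unfolding G_def by (intro sum_le_suminf Ae_summable) (auto intro!: mult_nonneg_nonneg A_nonneg less_imp_le[OF e_bounds(1)])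
 then show ?thesis by simp
qed

lemma G_bounds: "0 \<le> G v t x" "G v t x \<le> Ainf"
proof -
 show "0 \<le> G v t x"
  unfolding G_def by (intro suminf_nonneg Ae_summable mult_nonneg_nonneg A_nonneg less_imp_le[OF e_bounds(1)])
 show "G v t x \<le> Ainf"
  unfolding G_def Ainf_def by (intro suminf_le Ae_summable A_summable mult_left_le e_bounds A_nonneg)
qed

lemma Ainf_nonneg: "0 \<le> Ainf" using G_bounds[of undefined undefined undefined] by simp

lemma R_le: "cmod (R v ga j t x) \<le> A j * e v j t x * e v j t x"
proof -
 have "cmod (R v ga j t x) = cmod (ph j (x - t *\<^sub>R v j))" by (simp add: R_def soliton_def norm_mult)
 also have "... \<le> A j * exp (- a * sqrt (om j) * norm (x - t *\<^sub>R v j))"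
  using ph_le[of j "x - t *\<^sub>R v j"] by (simp add: A_def)
 also have "exp (- a * sqrt (om j) * norm (x - t *\<^sub>R v j)) = e v j t x * e v j t x"
  by (simp add: e_def flip: exp_add)
 finally show ?thesis by simp
qed

lemma R_le': "cmod (R v ga j t x) \<le> A j * e v j t x"
 using R_le[of v ga j t x] mult_left_le[OF e_bounds(2)[of v j t x], of "A j * e v j t x"] A_nonneg[of j] e_bounds(1)[of v j t x] by simp

lemma R_summable: "summable (\<lambda>j. cmod (R v ga j t x))" "summable (\<lambda>j. R v ga j t x)"
proof -
 show "summable (\<lambda>j. cmod (R v ga j t x))"
  by (rule summable_comparison_test'[OF Ae_summable[of v t x], where N=0]) (use R_le' in auto)
 then show "summable (\<lambda>j. R v ga j t x)" by (rule summable_norm_cancel)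
qed

lemma train_le: "cmod (train (R v ga) t x) \<le> G v t x"
proof -
 have "cmod (train (R v ga) t x) \<le> (\<Sum>j. cmod (R v ga j t x))"
  unfolding train_def by (intro summable_norm R_summable)
 also have "... \<le> G v t x" unfolding G_def by (intro suminf_le R_le' R_summable Ae_summable)
 finally show ?thesis .
qed

lemma measurable_R [measurable]: "jm (R v ga j)"
proof -
 have "continuous_on UNIV (ph j)"
  using ph_diff[of j] by (intro continuous_at_imp_continuous_on ballI differentiable_imp_continuous_within)
 then have [measurable]: "ph j \<in> bm" by (rule borel_measurable_continuous_onI)
 show ?thesis unfolding R_def soliton_def by measurable
qed

lemma measurable_train [measurable]: "jm (train (R v ga))"
 unfolding train_def split_beta' using measurable_R[of v ga] unfolding split_beta' by measurable

lemma measurable_G [measurable]: "G v t \<in> bm" unfolding G_def[abs_def] e_def by measurable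

lemma measurable_Hf: "jm (Hf v ga)" unfolding Hf_def split_beta'
 by (intro borel_measurable_diff borel_measurable_suminf borel_measurable_nonlin[OF F0])
   (use measurable_R[of v ga] measurable_train[of v ga] in \<open>auto simp: split_beta'\<close>)

lemma forcing_eq: "forcing g (R v ga) et s x = nonlin g (train (R v ga) s x + et s x) - nonlin g (train (R v ga) s x) + Hf v ga s x"
 by (simp add: forcing_def Hf_def)

lemma measurable_forcing:
 assumes "jm et"
 shows "jm (forcing g (R v ga) et)" unfolding forcing_eq split_beta'
 by (intro borel_measurable_add borel_measurable_diff borel_measurable_nonlin[OF F0])
   (use assms measurable_train[of v ga] measurable_Hf[of v ga] in \<open>auto simp: split_beta'\<close>)

text \<open>The \<open>L(r0)\<close> norm of one envelope scales like
  \<open>om j powr (- d / (2 * r0))\<close>, so the amplitudes times these norms sum to a multiple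
  of the series in (T1).\<close>

lemma G_Lr0: "\<exists>B>0. \<forall>v t. Lnorm lborel (1/r0) (\<lambda>x. ennreal (G v t x)) \<le> ennreal B"
proof -
 let ?d = "real CARD('n)"
 obtain Cd where Cd: "0 \<le> Cd" and exp_int: "\<And>c (z :: real^'n). 0 < c \<Longrightarrow>
  (NN x. ennreal (exp (- c * norm (x - z)))) \<le> ennreal (Cd * c powr (- ?d))"
  using nn_integral_exp_norm_le[where 'n='n] by blast
 define K0 where "K0 = (Cd * (a/2 * r0) powr (- ?d)) powr (1/r0)"
 \<comment> \<open>The summand \<open>(1/2) ^ j\<close> makes \<open>B j\<close> positive also where
   \<open>om j = 0\<close>, as \<open>Lnorm_suminf_le\<close> asks.\<close>
 define B where "B j = Da * K0 * om j powr (1/al1 - ?d / (2 * r0)) + (1/2) ^ j" for j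
 have B0: "0 < B j" for j unfolding B_def using aD by (intro add_nonneg_pos) (auto simp: K0_def)
 have sB: "summable B" unfolding B_def[abs_def] by (intro summable_add summable_mult summ summable_geometric) auto
 have le: "Lnorm lborel (1/r0) (\<lambda>x. ennreal (A j * e v j t x)) \<le> ennreal (B j)" for v j t
 proof (cases "om j = 0")
  case True
  then have "A j = 0" by (simp add: A_def)
  then show ?thesis using r0 by simp
 next
  case False
  then have w: "0 < om j" using om0[of j] by simp
  define c where "c = a/2 * r0 * sqrt (om j)"
  have c: "0 < c" using w aD r0 by (simp add: c_def)
  have "(NN x. enn_powr (ennreal (e v j t x)) r0) = (NN x. ennreal (exp (- c * norm (x - t *\<^sub>R v j))))"
   by (intro nn_integral_cong) (simp add: enn_powr_ennreal e_def c_def exp_powr_real mult_ac)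
  also have "... \<le> ennreal (Cd * c powr (- ?d))" by (rule exp_int[OF c])
  finally have "Lnorm lborel (1/r0) (\<lambda>x. ennreal (e v j t x)) \<le> enn_powr (ennreal (Cd * c powr (- ?d))) (1/r0)"
   using r0 by (auto simp: Lnorm_pos intro!: enn_powr_mono)
  also have "... = ennreal ((Cd * c powr (- ?d)) powr (1/r0))" using Cd by (simp add: enn_powr_ennreal)
  also have "(Cd * c powr (- ?d)) powr (1/r0) = K0 * om j powr (- ?d / (2 * r0))"
  proof -
   have "c powr (- ?d) = (a/2 * r0) powr (- ?d) * om j powr (- ?d/2)"
   proof -
    have "sqrt (om j) = om j powr (1/2)" using w by (simp add: powr_half_sqrt)
    then show ?thesis by (simp only: c_def powr_mult powr_powr) simp
   qed
   then have "Cd * c powr (- ?d) = (Cd * (a/2 * r0) powr (- ?d)) * om j powr (- ?d/2)" by simp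
   then show ?thesis using r0 by (simp only: powr_mult K0_def powr_powr) (simp add: field_simps)
  qed
  finally have "ennreal (A j) * Lnorm lborel (1/r0) (\<lambda>x. ennreal (e v j t x)) \<le> ennreal (A j) * ennreal (K0 * om j powr (- ?d / (2 * r0)))"
   by (rule mult_left_mono) simp
  moreover have "Lnorm lborel (1/r0) (\<lambda>x. ennreal (A j * e v j t x)) = ennreal (A j) * Lnorm lborel (1/r0) (\<lambda>x. ennreal (e v j t x))"
  proof -
   have "(\<lambda>x. ennreal (A j * e v j t x)) = (\<lambda>x. ennreal (A j) * ennreal (e v j t x))"
    using A_nonneg e_bounds(1) by (simp add: ennreal_mult less_imp_le)
   moreover have "(\<lambda>x. ennreal (e v j t x)) \<in> borel_measurable lborel" unfolding e_def by measurable
   ultimately show ?thesis using r0 by (simp add: Lnorm_cmult)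
  qed
  moreover have "A j * (K0 * om j powr (- ?d / (2 * r0))) \<le> B j"
  proof -
   have "om j powr (1/al1) * om j powr (- ?d / (2 * r0)) = om j powr (1/al1 - ?d / (2 * r0))"
    by (simp flip: powr_add)
   then show ?thesis by (simp add: A_def B_def mult_ac)
  qed
  ultimately show ?thesis using A_nonneg[of j] by (auto simp flip: ennreal_mult' intro: order_trans ennreal_leI)
 qed
 have "Lnorm lborel (1/r0) (\<lambda>x. ennreal (G v t x)) \<le> ennreal (suminf B)" for v t
 proof -
  have "Lnorm lborel (1/r0) (\<lambda>x. ennreal (G v t x)) = Lnorm lborel (1/r0) (\<lambda>x. \<Sum>j. ennreal (A j * e v j t x))"
   unfolding G_def using A_nonneg e_bounds(1) by (subst suminf_ennreal2[OF _ Ae_summable]) (auto simp: less_imp_le)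
  also have "... \<le> (\<Sum>j. ennreal (B j))"
  proof (rule Lnorm_suminf_le)
   show "(\<lambda>x. ennreal (A j * e v j t x)) \<in> borel_measurable lborel" for j unfolding e_def by measurable
  qed (use r0 B0 le in \<open>auto simp: sigma_finite_lborel\<close>)
  also have "... = ennreal (suminf B)" using B0 sB by (intro suminf_ennreal2) (auto simp: less_imp_le)
  finally show ?thesis .
 qed
 moreover have "0 < suminf B" using B0 sB by (intro suminf_pos) auto
 ultimately show ?thesis by blast
qed

text \<open>\<open>G\<close> lies in \<open>L(r0)\<close> and is bounded, hence it lies in
  \<open>L(p)\<close> for every \<open>p \<ge> r0\<close>; here \<open>p = al / q\<close>.\<close>

lemma G_powr:
 assumes q: "0 < q" "q \<le> al/r0"
 shows "\<exists>B>0. \<forall>v t. Lx q (\<lambda>x. of_real (G v t x powr al)) \<le> ennreal B"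
proof -
 obtain B where B: "0 < B" and le: "\<And>v t. Lnorm lborel (1/r0) (\<lambda>x. ennreal (G v t x)) \<le> ennreal B"
  using G_Lr0 by blast
 have rq: "r0 \<le> al/q" using q r0 by (simp add: field_simps)
 define D where "D = ((Ainf + 1) powr (al/q - r0) * B powr r0) powr q"
 have "Lx q (\<lambda>x. of_real (G v t x powr al)) \<le> ennreal D" for v t
 proof -
  have "(NN x. ennreal (G v t x powr r0)) \<le> ennreal (B powr r0)"
   using le[of v t] r0 B by (simp add: Lnorm_le_iff enn_powr_ennreal G_bounds)
  then have "(NN x. ennreal ((Ainf + 1) powr (al/q - r0)) * ennreal (G v t x powr r0)) \<le> ennreal ((Ainf + 1) powr (al/q - r0)) * ennreal (B powr r0)"
   by (subst nn_integral_cmult) (auto intro: mult_left_mono)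
  moreover have "(NN x. enn_powr (ennreal (cmod (of_real (G v t x powr al)))) (1/q))
   \<le> (NN x. ennreal ((Ainf + 1) powr (al/q - r0)) * ennreal (G v t x powr r0))"
  proof (rule nn_integral_mono)
   fix x
   have "(G v t x powr al) powr (1/q) = G v t x powr (al/q - r0) * G v t x powr r0"
    by (simp add: powr_powr flip: powr_add)
   also have "... \<le> (Ainf + 1) powr (al/q - r0) * G v t x powr r0"
    using G_bounds[of v t x] rq by (intro mult_right_mono powr_mono2) auto
   finally show "enn_powr (ennreal (cmod (of_real (G v t x powr al)))) (1/q) \<le> ennreal ((Ainf + 1) powr (al/q - r0)) * ennreal (G v t x powr r0)"
    by (simp add: enn_powr_ennreal ennreal_leI flip: ennreal_mult)
  qed
  ultimately have "(NN x. enn_powr (ennreal (cmod (of_real (G v t x powr al)))) (1/q)) \<le> ennreal ((Ainf + 1) powr (al/q - r0) * B powr r0)"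
   by (simp add: ennreal_mult)
  then have "Lx q (\<lambda>x. of_real (G v t x powr al)) \<le> enn_powr (ennreal ((Ainf + 1) powr (al/q - r0) * B powr r0)) q"
   unfolding Lx_pos[OF q(1)] using q by (intro enn_powr_mono) auto
  then show ?thesis by (simp add: D_def enn_powr_ennreal)
 qed
 moreover have "0 < D" using B Ainf_nonneg by (simp add: D_def)
 ultimately show ?thesis by blast
qed

text \<open>The two centres are \<open>t * norm (v k - v j)\<close> apart. As \<open>vstar\<close>
  is an infimum over ordered pairs, the smaller of the two frequencies also satisfies its bound, and
  the product of the envelopes is at most \<open>exp (- (a/2) * V * t)\<close>; so they cannot both
  exceed the root of this. The index \<open>j0\<close> depends on \<open>t\<close> and
  \<open>x\<close>. Trivial pairs have envelope 1 but amplitude 0.\<close>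

lemma separation:
 assumes V: "ereal V \<le> vstar om v" and t: "0 \<le> t"
 shows "\<exists>j0. \<forall>j. j \<noteq> j0 \<longrightarrow> A j = 0 \<or> e v j t x \<le> exp (- (a/4) * V * t)"
proof -
 let ?ep = "exp (- (a/4) * V * t)"
 have prod: "e v j t x * e v k t x \<le> ?ep * ?ep" if jk: "j \<noteq> k" "om j \<noteq> 0" "om k \<noteq> 0" for j k
 proof -
  have vs: "V \<le> sqrt (om j) * norm (v k - v j)" if "j \<noteq> k" "om j \<noteq> 0" "om k \<noteq> 0" for j k
  proof -
   have "vstar om v \<le> ereal (sqrt (om (fst (j, k))) * norm (v (snd (j, k)) - v (fst (j, k))))"
    unfolding vstar_def using that by (intro INF_lower) auto
   from order_trans[OF V this] show ?thesis by simp
  qed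
  define m where "m = min (sqrt (om j)) (sqrt (om k))"
  have Vm: "V \<le> m * norm (v k - v j)"
   using vs[OF jk] vs[OF jk(1)[symmetric] jk(3,2)] by (auto simp: m_def min_def norm_minus_commute)
  have m0: "0 \<le> m" using om0 by (simp add: m_def)
  have "t * norm (v k - v j) = norm ((x - t *\<^sub>R v j) - (x - t *\<^sub>R v k))"
   using t by (simp add: algebra_simps flip: scaleR_diff_right)
  also have "... \<le> norm (x - t *\<^sub>R v j) + norm (x - t *\<^sub>R v k)" by (rule norm_triangle_ineq4)
  finally have tri: "t * norm (v k - v j) \<le> norm (x - t *\<^sub>R v j) + norm (x - t *\<^sub>R v k)" .
  have "V * t \<le> m * (t * norm (v k - v j))" using mult_right_mono[OF Vm t] by (simp add: mult_ac)
  also have "... \<le> m * (norm (x - t *\<^sub>R v j) + norm (x - t *\<^sub>R v k))" by (intro mult_left_mono tri m0)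
  also have "... \<le> sqrt (om j) * norm (x - t *\<^sub>R v j) + sqrt (om k) * norm (x - t *\<^sub>R v k)"
   unfolding distrib_left by (intro add_mono mult_right_mono) (auto simp: m_def)
  finally have "(a/2) * (V * t) \<le> (a/2) * (sqrt (om j) * norm (x - t *\<^sub>R v j) + sqrt (om k) * norm (x - t *\<^sub>R v k))"
   using aD by (intro mult_left_mono) auto
  then show ?thesis unfolding e_def exp_add[symmetric] by (simp add: algebra_simps)
 qed
 show ?thesis
 proof (cases "\<exists>j0. om j0 \<noteq> 0 \<and> ?ep < e v j0 t x")
  case True
  then obtain j0 where j0: "om j0 \<noteq> 0" "?ep < e v j0 t x" by blast
  have "A j = 0 \<or> e v j t x \<le> ?ep" if "j \<noteq> j0" for j
  proof (cases "om j = 0")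
   case True
   then show ?thesis by (simp add: A_def)
  next
   case False
   have "e v j t x * ?ep \<le> e v j t x * e v j0 t x"
    using j0 e_bounds(1)[of v j t x] by (intro mult_left_mono) auto
   also have "... \<le> ?ep * ?ep" by (rule prod[OF that False j0(1)])
   finally show ?thesis by simp
  qed
  then show ?thesis by blast
 next
  case False
  then have "A j = 0 \<or> e v j t x \<le> ?ep" for j by (cases "om j = 0") (auto simp: A_def not_less)
  then show ?thesis by blast
 qed
qed

section \<open>Norms of the interaction and of nonlinear differences\<close>

definition be :: real where "be = 1 / (2 + al2)"

lemma be: "0 < be" "be < 1/2" using al by (auto simp: be_def field_simps)

lemma G_mono_exponent:
 assumes "0 \<le> p" "p \<le> q"
 shows "G v t x powr q \<le> (Ainf + 1) powr (q - p) * G v t x powr p"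
proof -
 have "G v t x powr q = G v t x powr (q - p) * G v t x powr p" by (simp flip: powr_add)
 also have "... \<le> (Ainf + 1) powr (q - p) * G v t x powr p"
  using G_bounds[of v t x] assms by (intro mult_right_mono powr_mono2) auto
 finally show ?thesis .
qed

lemma nonlin_const: "\<exists>C>0. \<forall>z w. cmod (nonlin g (z + w) - nonlin g z)
  \<le> C * cmod w * (cmod z powr al1 + cmod w powr al1 + cmod z powr al2 + cmod w powr al2)"
 by (rule nonlin_lipschitz[OF F0])

text \<open>With the dominant soliton \<open>j0\<close> set apart and \<open>W'\<close> the sum of
  the others, \<open>Hf\<close> is the increment of the nonlinearity from \<open>R j0\<close> to
  \<open>R j0 + W'\<close> minus the remaining terms \<open>nonlin g (R j)\<close>; each part
  carries a factor \<open>ep\<close>. Powers \<open>al2\<close> are reduced to \<open>al1\<close>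
  because \<open>G\<close> is bounded, which is the role of \<open>M\<close>.\<close>

lemma Hf_pointwise:
 "\<exists>C>0. \<forall>v ga V t x. ereal V \<le> vstar om v \<longrightarrow> 0 \<le> V \<longrightarrow> 0 \<le> t \<longrightarrow>
  cmod (Hf v ga t x) \<le> C * exp (- (a/4) * V * t) * G v t x powr (1 + al1)"
proof -
 obtain C where C: "0 < C" and lip: "\<And>z w. cmod (nonlin g (z + w) - nonlin g z)
  \<le> C * cmod w * (cmod z powr al1 + cmod w powr al1 + cmod z powr al2 + cmod w powr al2)"
  using nonlin_const by blast
 define M where "M = 1 + (Ainf + 1) powr (al2 - al1)"
 have M: "1 \<le> M" by (simp add: M_def)
 have nl0: "nonlin g 0 = 0" by (simp add: nonlin_def)
 have powG: "r powr al1 + r powr al2 \<le> M * G v t x powr al1" if "0 \<le> r" "r \<le> G v t x" for r v t x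
 proof -
  have "r powr al1 + r powr al2 \<le> G v t x powr al1 + G v t x powr al2"
   using that al by (intro add_mono powr_mono2) auto
  also have "... \<le> M * G v t x powr al1"
   using G_mono_exponent[of al1 al2 v t x] al by (simp add: M_def distrib_right)
  finally show ?thesis .
 qed
 have "cmod (Hf v ga t x) \<le> (3 * C * M) * exp (- (a/4) * V * t) * G v t x powr (1 + al1)"
  if V: "ereal V \<le> vstar om v" "0 \<le> V" "0 \<le> t" for v ga V t x
 proof -
  define ep where "ep = exp (- (a/4) * V * t)"
  have ep: "0 < ep" "ep \<le> 1" using V aD by (auto simp: ep_def)
  obtain j0 where j0: "\<And>j. j \<noteq> j0 \<Longrightarrow> A j = 0 \<or> e v j t x \<le> ep"
   using separation[OF V(1,3)] unfolding ep_def by blast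
  let ?R = "\<lambda>j. R v ga j t x" and ?G = "G v t x"
  have RG: "cmod (?R j) \<le> ?G" for j using R_le'[of v ga j t x] Ae_le_G[of j v t x] by simp
  have small: "cmod (?R j) \<le> ep * (A j * e v j t x)" if "j \<noteq> j0" for j
  proof -
   have "A j * e v j t x * e v j t x \<le> ep * (A j * e v j t x)"
    using j0[OF that] mult_left_mono[of "e v j t x" ep "A j * e v j t x"] A_nonneg[of j] e_bounds(1)[of v j t x]
    by (auto simp: mult_ac)
   with R_le[of v ga j t x] show ?thesis by simp
  qed
  define W' where "W' = (\<Sum>j. if j = j0 then 0 else ?R j)"
  have split0: "(\<lambda>j. if j = j0 then f j else 0) sums f j0" for f :: "nat \<Rightarrow> complex"
   using sums_single[of j0 f] by (simp add: eq_commute)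
  have sumW': "summable (\<lambda>j. if j = j0 then 0 else ?R j)"
   using summable_diff[OF R_summable(2)[of v ga t x] sums_summable[OF split0[of ?R]]] by (rule back_subst[of summable]) auto
  have train_eq: "train (R v ga) t x = ?R j0 + W'"
  proof -
   have "(\<Sum>j. ?R j) = (\<Sum>j. (if j = j0 then ?R j else 0) + (if j = j0 then 0 else ?R j))"
    by (intro suminf_cong) auto
   also have "... = ?R j0 + W'"
    unfolding W'_def using suminf_add[OF sums_summable[OF split0[of ?R]] sumW'] sums_unique[OF split0[of ?R]] by simp
   finally show ?thesis by (simp add: train_def)
  qed
  have se: "summable (\<lambda>j. ep * (A j * e v j t x))" by (intro summable_mult Ae_summable)
  have W'_le: "cmod W' \<le> ep * ?G"
  proof -
   have le: "norm (if j = j0 then 0 else ?R j) \<le> ep * (A j * e v j t x)" for j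
    using small[of j] ep A_nonneg[of j] e_bounds(1)[of v j t x] by auto
   have "cmod W' \<le> (\<Sum>j. ep * (A j * e v j t x))" unfolding W'_def by (rule norm_suminf_le[OF le se])
   also have "... = ep * ?G" unfolding G_def by (rule suminf_mult[OF Ae_summable])
   finally show ?thesis .
  qed
  then have W'G: "cmod W' \<le> ?G" using mult_left_le_one_le[of ?G ep] ep G_bounds[of v t x] by simp
  have nlR: "cmod (nonlin g (?R j)) \<le> C * M * ?G powr al1 * cmod (?R j)" for j
  proof -
   have "cmod (nonlin g (?R j)) \<le> C * cmod (?R j) * (cmod (?R j) powr al1 + cmod (?R j) powr al2)"
    using lip[of 0 "?R j"] by (simp add: nl0)
   also have "... \<le> C * cmod (?R j) * (M * ?G powr al1)"
    using C powG[OF norm_ge_zero RG] by (intro mult_left_mono) auto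
   finally show ?thesis by (simp add: mult_ac)
  qed
  have sumN: "summable (\<lambda>j. nonlin g (?R j))"
  proof (rule summable_comparison_test'[where N=0])
   show "summable (\<lambda>j. C * M * ?G powr al1 * cmod (?R j))" by (intro summable_mult R_summable)
  qed (use nlR in auto)
  define S' where "S' = (\<Sum>j. if j = j0 then 0 else nonlin g (?R j))"
  have S_eq: "(\<Sum>j. nonlin g (?R j)) = nonlin g (?R j0) + S'"
  proof -
   have s': "summable (\<lambda>j. if j = j0 then 0 else nonlin g (?R j))"
    using summable_diff[OF sumN sums_summable[OF split0[of "\<lambda>j. nonlin g (?R j)"]]] by (rule back_subst[of summable]) auto
   have "(\<Sum>j. nonlin g (?R j)) = (\<Sum>j. (if j = j0 then nonlin g (?R j) else 0) + (if j = j0 then 0 else nonlin g (?R j)))"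
    by (intro suminf_cong) auto
   also have "... = nonlin g (?R j0) + S'"
    unfolding S'_def using suminf_add[OF sums_summable[OF split0[of "\<lambda>j. nonlin g (?R j)"]] s'] sums_unique[OF split0[of "\<lambda>j. nonlin g (?R j)"]] by simp
   finally show ?thesis .
  qed
  have S'_le: "cmod S' \<le> C * M * ?G powr al1 * (ep * ?G)"
  proof -
   have le: "norm (if j = j0 then 0 else nonlin g (?R j)) \<le> C * M * ?G powr al1 * (ep * (A j * e v j t x))" for j
   proof (cases "j = j0")
    case True
    then show ?thesis using C M ep A_nonneg[of j] e_bounds(1)[of v j t x] by simp
   next
    case False
    have "C * M * ?G powr al1 * cmod (?R j) \<le> C * M * ?G powr al1 * (ep * (A j * e v j t x))"
     using C M by (intro mult_left_mono small[OF False]) auto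
    with nlR[of j] False show ?thesis by simp
   qed
   have "cmod S' \<le> (\<Sum>j. C * M * ?G powr al1 * (ep * (A j * e v j t x)))"
    unfolding S'_def by (rule norm_suminf_le[OF le summable_mult[OF se]])
   also have "... = C * M * ?G powr al1 * (ep * ?G)" unfolding G_def by (simp add: suminf_mult se Ae_summable)
   finally show ?thesis .
  qed
  have "Hf v ga t x = (nonlin g (?R j0 + W') - nonlin g (?R j0)) - S'" by (simp add: Hf_def train_eq S_eq)
  then have "cmod (Hf v ga t x) \<le> cmod (nonlin g (?R j0 + W') - nonlin g (?R j0)) + cmod S'"
   by (simp add: norm_triangle_ineq4)
  also have "... \<le> C * cmod W' * (cmod (?R j0) powr al1 + cmod W' powr al1 + cmod (?R j0) powr al2 + cmod W' powr al2) + C * M * ?G powr al1 * (ep * ?G)"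
   by (intro add_mono lip S'_le)
  also have "... \<le> C * (ep * ?G) * (M * ?G powr al1 + M * ?G powr al1) + C * M * ?G powr al1 * (ep * ?G)"
  proof (intro add_right_mono mult_mono)
   show "cmod (?R j0) powr al1 + cmod W' powr al1 + cmod (?R j0) powr al2 + cmod W' powr al2 \<le> M * ?G powr al1 + M * ?G powr al1"
    using powG[OF norm_ge_zero RG[of j0]] powG[OF norm_ge_zero W'G] by simp
  qed (use C ep W'_le G_bounds[of v t x] in auto)
  also have "... = 3 * C * M * ep * (?G * ?G powr al1)" by (simp add: algebra_simps)
  also have "?G * ?G powr al1 = ?G powr (1 + al1)" using G_bounds[of v t x] by (simp add: powr_add)
  finally show ?thesis by (simp add: ep_def)
 qed
 moreover have "0 < 3 * C * M" using C M by simp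
 ultimately show ?thesis by blast
qed

text \<open>The condition \<open>1 < (al1 + 1) / r0 + 1 / (2 + al2)\<close> is what puts the power
  \<open>1 + al1\<close> of \<open>G\<close> in \<open>L(r2')\<close>.\<close>

lemma Hf_norm:
 "\<exists>C>0. \<forall>v ga V t. ereal V \<le> vstar om v \<longrightarrow> 0 \<le> V \<longrightarrow> 0 \<le> t \<longrightarrow>
  Lx (1 - be) (Hf v ga t) \<le> ennreal (C * exp (- (a/4) * V * t))"
proof -
 obtain C where C: "0 < C" and H: "\<And>v ga V t x. ereal V \<le> vstar om v \<Longrightarrow> 0 \<le> V \<Longrightarrow> 0 \<le> t \<Longrightarrow>
  cmod (Hf v ga t x) \<le> C * exp (- (a/4) * V * t) * G v t x powr (1 + al1)" using Hf_pointwise by blast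
 have "0 < 1 - be" "1 - be \<le> (1 + al1) / r0" using be r0(4) unfolding be_def add.commute[of 1 al1] by linarith+
 from G_powr[OF this] obtain B where B: "0 < B" and Gp: "\<And>v t. Lx (1 - be) (\<lambda>x. of_real (G v t x powr (1 + al1))) \<le> ennreal B"
  by blast
 have "Lx (1 - be) (Hf v ga t) \<le> ennreal (C * B * exp (- (a/4) * V * t))"
  if V: "ereal V \<le> vstar om v" "0 \<le> V" "0 \<le> t" for v ga V t
 proof -
  let ?c = "C * exp (- (a/4) * V * t)"
  have "Lx (1 - be) (Hf v ga t) \<le> Lx (1 - be) (\<lambda>x. of_real ?c * of_real (G v t x powr (1 + al1)))"
   using be H[OF V] C by (intro Lx_mono) (auto simp: norm_mult)
  also have "... = ennreal ?c * Lx (1 - be) (\<lambda>x. of_real (G v t x powr (1 + al1)))"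
   using be C by (subst Lx_cmult) (auto simp: norm_mult)
  also have "... \<le> ennreal ?c * ennreal B" by (intro mult_left_mono Gp) auto
  also have "... = ennreal (C * B * exp (- (a/4) * V * t))" using C B by (simp add: mult_ac flip: ennreal_mult)
  finally show ?thesis .
 qed
 moreover have "0 < C * B" using C B by simp
 ultimately show ?thesis by blast
qed

text \<open>The interaction cancels in the difference. The train enters through
  \<open>G powr al1\<close>, which multiplies L2 into \<open>L(r2')\<close> because
  \<open>1/2 \<le> al1 / r0 + 1 / (2 + al2)\<close>; the power \<open>al2\<close> of
  \<open>G\<close> is absorbed by its boundedness.\<close>

lemma forcing_diff_norm:
 "\<exists>C>0. \<forall>v ga et et' s. et s \<in> bm \<longrightarrow> et' s \<in> bm \<longrightarrow> NL be (et s) \<le> 1 \<longrightarrow> NL be (et' s) \<le> 1 \<longrightarrow>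
  Lx (1 - be) (\<lambda>x. forcing g (R v ga) et s x - forcing g (R v ga) et' s x) \<le> ennreal C * NL be (\<lambda>x. et s x - et' s x)"
proof -
 obtain C where C: "0 < C" and lip: "\<And>z w. cmod (nonlin g (z + w) - nonlin g z)
  \<le> C * cmod w * (cmod z powr al1 + cmod w powr al1 + cmod z powr al2 + cmod w powr al2)"
  using nonlin_const by blast
 have "0 < 1/2 - be" "1/2 - be \<le> al1/r0" using be r0(3) unfolding be_def by linarith+
 from G_powr[OF this] obtain B where B: "0 < B" and Gp: "\<And>v t. Lx (1/2 - be) (\<lambda>x. of_real (G v t x powr al1)) \<le> ennreal B"
  by blast
 define L where "L = 2 powr al1 + 2 powr al2"
 define M where "M = 1 + (Ainf + 1) powr (al2 - al1)"
 have M: "1 \<le> M" by (simp add: M_def)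
 have L: "1 \<le> L" using ge_one_powr_ge_zero[of 2 al1] al by (simp add: L_def add_increasing2)
 define C' where "C' = C * (2 * L) * M"
 have C': "0 < C'" using C L M by (simp add: C'_def)
 have "Lx (1 - be) (\<lambda>x. forcing g (R v ga) et s x - forcing g (R v ga) et' s x) \<le> ennreal (C' * (B + 4)) * NL be (\<lambda>x. et s x - et' s x)"
  if m[measurable]: "et s \<in> bm" "et' s \<in> bm" and N: "NL be (et s) \<le> 1" "NL be (et' s) \<le> 1"
  for v ga et et' s
 proof -
  let ?W = "train (R v ga) s" and ?G = "G v s"
  have tm[measurable]: "?W \<in> bm"
   using measurable_compose[OF measurable_Pair1'[of s borel] measurable_train[of v ga]] by simp
  have eq: "(\<lambda>x. forcing g (R v ga) et s x - forcing g (R v ga) et' s x) = (\<lambda>x. nonlin g (?W x + et s x) - nonlin g (?W x + et' s x))"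
   by (simp add: forcing_eq)
  show ?thesis unfolding eq
  proof (rule nonlinear_estimate[where G="\<lambda>x. ?G x powr al1" and u="et s" and u'="et' s", OF _ _ _ _ _ _ al al_le be_def _ Gp _ N])
   show "(\<lambda>x. nonlin g (?W x + et s x) - nonlin g (?W x + et' s x)) \<in> bm"
    by (intro borel_measurable_diff borel_measurable_nonlin[OF F0]) measurable
   fix x
   let ?w = "et s x - et' s x" and ?z = "?W x + et' s x" and ?g = "?G x powr al1"
   let ?T = "\<bar>?g\<bar> + cmod (et s x) powr al1 + cmod (et' s x) powr al1 + cmod (et s x) powr al2 + cmod (et' s x) powr al2"
   have z: "cmod ?z powr p \<le> L * (?G x powr p + cmod (et' s x) powr p)" if p: "p = al1 \<or> p = al2" for p
   proof -
    have "cmod ?z \<le> ?G x + cmod (et' s x)"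
     using norm_triangle_ineq[of "?W x" "et' s x"] train_le[of v ga s x] by simp
    then have "cmod ?z powr p \<le> (?G x + cmod (et' s x)) powr p" using p al by (intro powr_mono2) auto
    also have "... \<le> 2 powr p * (?G x powr p + cmod (et' s x) powr p)"
     using p al G_bounds[of v s x] by (intro powr_add_le) auto
    also have "... \<le> L * (?G x powr p + cmod (et' s x) powr p)"
     using p by (intro mult_right_mono) (auto simp: L_def)
    finally show ?thesis .
   qed
   have w: "cmod ?w powr p \<le> L * (cmod (et s x) powr p + cmod (et' s x) powr p)" if p: "p = al1 \<or> p = al2" for p
   proof -
    have "cmod ?w powr p \<le> (cmod (et s x) + cmod (et' s x)) powr p" using p al by (intro powr_mono2 norm_triangle_ineq4) auto
    also have "... \<le> 2 powr p * (cmod (et s x) powr p + cmod (et' s x) powr p)"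
     using p al by (intro powr_add_le) auto
    also have "... \<le> L * (cmod (et s x) powr p + cmod (et' s x) powr p)"
     using p by (intro mult_right_mono) (auto simp: L_def)
    finally show ?thesis .
   qed
   have "cmod (nonlin g (?W x + et s x) - nonlin g (?W x + et' s x)) \<le> C * cmod ?w * (cmod ?z powr al1 + cmod ?w powr al1 + cmod ?z powr al2 + cmod ?w powr al2)"
    using lip[of ?z ?w] by simp
   also have "... \<le> C * cmod ?w * (L * (?g + cmod (et' s x) powr al1) + L * (cmod (et s x) powr al1 + cmod (et' s x) powr al1)
     + L * (?G x powr al2 + cmod (et' s x) powr al2) + L * (cmod (et s x) powr al2 + cmod (et' s x) powr al2))"
    using C by (intro mult_left_mono add_mono z w) auto
   also have "... \<le> C * cmod ?w * ((2 * L) * (M * ?T))"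
   proof (intro mult_left_mono)
    let ?p1 = "cmod (et s x) powr al1" and ?p1' = "cmod (et' s x) powr al1" and ?p2 = "cmod (et s x) powr al2" and ?p2' = "cmod (et' s x) powr al2"
    have "?G x powr al2 \<le> (M - 1) * ?g" using G_mono_exponent[of al1 al2 v s x] al by (simp add: M_def)
    then have "?g + ?G x powr al2 \<le> M * ?g" by (simp add: algebra_simps)
    moreover have "1 * (?p1 + ?p1' + ?p2 + ?p2') \<le> M * (?p1 + ?p1' + ?p2 + ?p2')" using M by (intro mult_right_mono) auto
    ultimately have "?g + ?G x powr al2 + (?p1 + ?p1' + ?p2 + ?p2') \<le> M * ?T" by (simp add: algebra_simps)
    moreover have "0 \<le> ?g" "0 \<le> ?G x powr al2" "0 \<le> ?p1" "0 \<le> ?p2" by auto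
    ultimately have "(?g + ?p1') + (?p1 + ?p1') + (?G x powr al2 + ?p2') + (?p2 + ?p2') \<le> 2 * (M * ?T)" by linarith
    then have "L * ((?g + ?p1') + (?p1 + ?p1') + (?G x powr al2 + ?p2') + (?p2 + ?p2')) \<le> L * (2 * (M * ?T))"
     using L by (intro mult_left_mono) auto
    then show "L * (?g + ?p1') + L * (?p1 + ?p1') + L * (?G x powr al2 + ?p2') + L * (?p2 + ?p2') \<le> (2 * L) * (M * ?T)"
     by (simp only: distrib_left mult_ac)
   qed (use C in auto)
   also have "... = C' * cmod ?w * ?T" by (simp add: C'_def)
   finally show "cmod (nonlin g (?W x + et s x) - nonlin g (?W x + et' s x)) \<le> C' * cmod ?w * ?T" .
  qed (use C' B in auto)
 qed
 moreover have "0 < C' * (B + 4)" using C' B by simp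
 ultimately show ?thesis by blast
qed

end

text \<open>Representatives may change: the forcing on a null set of times, the value on a null set
  in space. Measurability of the new pairing does not follow from equality almost everywhere and is
  obtained from \<open>U\<close>.\<close>

lemma mild_cong_AE:
 fixes F F' :: "'n::finite evol"
 assumes 1: "mild F h t" and eq: "AE s in lborel. t \<le> s \<longrightarrow> F s = F' s"
  and meas: "jm F'"
  and h: "AE x in lborel. h x = h' x" and [measurable]: "h \<in> bm" "h' \<in> bm"
 shows "mild F' h' t" unfolding mild_def
proof (intro allI impI)
 fix ps :: "real^'n \<Rightarrow> real" assume ps: "test_fun ps"
 have [measurable]: "ps \<in> bm" using test_fun_props(1)[OF ps] by auto
 define J where "J F s = (LBINT x. F s x * cnj (schr (s - t) ps x))" for F s
 let ?I = "\<lambda>F T. \<integral>s\<in>{t..T}. J F s \<partial>lborel" and ?p = "\<lambda>h. LBINT x. h x * of_real (ps x)"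
 note 1 = 1[unfolded mild_def, rule_format, OF ps, folded J_def]
 have Jm: "J F' \<in> borel_measurable lborel"
 proof -
  have "(\<lambda>(s, x). F' s x * cnj (if s - t = 0 then of_real (ps x) else U (s - t) (\<lambda>y. of_real (ps y)) x)) \<in> borel_measurable (lborel \<Otimes>\<^sub>M lborel)"
   using meas unfolding split_beta' by measurable
  moreover have "schr (s - t) ps x = (if s - t = 0 then of_real (ps x) else U (s - t) (\<lambda>y. of_real (ps y)) x)" for s x
   by (simp add: schr_eq_U) (simp add: schr_def)
  ultimately have "(\<lambda>(s, x). F' s x * cnj (schr (s - t) ps x)) \<in> borel_measurable (lborel \<Otimes>\<^sub>M lborel)" by simp
  then show ?thesis unfolding J_def by (rule lborel.borel_measurable_lebesgue_integral)
 qed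
 have eqJ: "AE s in lborel. indicat_real {t..T} s *\<^sub>R J F s = indicat_real {t..T} s *\<^sub>R J F' s" for T
  using eq by eventually_elim (auto simp: indicator_def J_def)
 have m1: "(\<lambda>s. indicat_real {t..T} s *\<^sub>R J F' s) \<in> borel_measurable lborel" for T
  using Jm by measurable
 have set: "set_integrable lborel {t..T} (J F')" "?I F' T = ?I F T" if T: "t \<le> T" for T
 proof -
  have i: "integrable lborel (\<lambda>s. indicat_real {t..T} s *\<^sub>R J F s)" using 1 T by (auto simp: set_integrable_def)
  show "set_integrable lborel {t..T} (J F')"
   unfolding set_integrable_def by (rule integrable_cong_AE_imp[OF i m1 eqJ])
  show "?I F' T = ?I F T"
   unfolding set_lebesgue_integral_def by (rule integral_cong_AE[OF borel_measurable_integrable[OF i] m1 eqJ, symmetric])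
 qed
 have hh: "AE x in lborel. h x * of_real (ps x) = h' x * of_real (ps x)" using h by eventually_elim simp
 have ih: "integrable lborel (\<lambda>x. h' x * of_real (ps x))"
  by (rule integrable_cong_AE_imp[of _ "\<lambda>x. h x * of_real (ps x)"]) (use 1 hh in auto)
 have eh: "?p h' = ?p h"
  by (rule integral_cong_AE[symmetric]) (use hh in auto)
 have "((\<lambda>T. - \<i> * ?I F' T) \<longlongrightarrow> ?p h) at_top"
 proof (rule Lim_transform_eventually)
  show "((\<lambda>T. - \<i> * ?I F T) \<longlongrightarrow> ?p h) at_top" using 1 by blast
  show "\<forall>\<^sub>F T in at_top. - \<i> * ?I F T = - \<i> * ?I F' T"
   using eventually_ge_at_top[of t] by eventually_elim (simp add: set)
 qed
 moreover have "AE s in lborel. t \<le> s \<longrightarrow> integrable lborel (\<lambda>x. F' s x * cnj (schr (s - t) ps x))"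
  using eq 1[THEN conjunct2, THEN conjunct1] by eventually_elim auto
 ultimately show "integrable lborel (\<lambda>x. h' x * of_real (ps x)) \<and>
   (AE s in lborel. s \<ge> t \<longrightarrow> integrable lborel (\<lambda>x. F' s x * cnj (schr (s - t) ps x))) \<and>
   (\<forall>T\<ge>t. set_integrable lborel {t..T} (\<lambda>s. \<integral>x. F' s x * cnj (schr (s - t) ps x) \<partial>lborel)) \<and>
   ((\<lambda>T. - \<i> * (\<integral>s\<in>{t..T}. (LBINT x. F' s x * cnj (schr (s - t) ps x)) \<partial>lborel))
     \<longlongrightarrow> ?p h') at_top"
  using set(1) ih unfolding J_def[symmetric] eh by blast
qed

section \<open>Existence and uniqueness\<close>

lemma NL_le_iff: "NL be h \<le> c \<longleftrightarrow> Lx (1/2) h \<le> c \<and> Lx be h \<le> c"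
 by (simp add: NL_def)

lemma NL_cong_AE: "0 < be \<Longrightarrow> AE x in lborel. f x = h x \<Longrightarrow> NL be f = NL be h"
 unfolding NL_def using Lx_cong_AE[of "1/2" f h] Lx_cong_AE[of be f h] by simp

lemma Lx_mult_ii [simp]: "Lx p (\<lambda>x. \<i> * f x) = Lx p f" by (simp add: Lx_def norm_mult)

lemma NL_triangle:
 fixes f g h :: "'n::finite wave"
 assumes [measurable]: "f \<in> bm" "g \<in> bm" "h \<in> bm"
  and be: "0 < be" "be \<le> 1"
 shows "NL be (\<lambda>x. f x - h x) \<le> NL be (\<lambda>x. f x - g x) + NL be (\<lambda>x. g x - h x)"
proof -
 have "Lx p (\<lambda>x. f x - h x) \<le> NL be (\<lambda>x. f x - g x) + NL be (\<lambda>x. g x - h x)" if "p = 1/2 \<or> p = be" for p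
 proof -
  have "Lx p (\<lambda>x. f x - h x) \<le> Lx p (\<lambda>x. f x - g x) + Lx p (\<lambda>x. g x - h x)"
   by (rule Lx_diff_triangle) (use that be in auto)
  also have "... \<le> NL be (\<lambda>x. f x - g x) + NL be (\<lambda>x. g x - h x)"
   using that by (elim disjE; hypsubst; intro add_mono; simp add: NL_def)
  finally show ?thesis .
 qed
 then show ?thesis by (simp add: NL_le_iff)
qed

lemma measurable_section:
 assumes "jm u"
 shows "u t \<in> bm" using measurable_compose[OF measurable_Pair1'[of t borel] assms] by simp

lemma measurable_NL:
 fixes u :: "'n::finite evol"
 assumes "jm u" "0 < be"
 shows "(\<lambda>t. NL be (u t)) \<in> bm"
 unfolding NL_def using borel_measurable_Lx[OF assms(1)] assms(2) by (intro borel_measurable_max) auto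

lemma strichartz_cong:
 fixes u u' :: "'n::finite evol"
 assumes m: "jm u" "jm u'"
  and eq: "\<And>s. t \<le> s \<Longrightarrow> AE x in lborel. u s x = u' s x"
 shows "strichartz bStr t u = strichartz bStr t u'"
proof -
 let ?M = "restrict_space lborel {t..} :: real measure"
 have mLx: "(\<lambda>s. Lx q (w s)) \<in> borel_measurable ?M"
  if "0 \<le> q" "jm w" for q and w :: "'n evol"
  using that borel_measurable_Lx[of w borel q] borel_measurable_Lx_0[of w borel]
  by (intro measurable_restrict_space1) (cases "q = 0"; simp)
 have Lx_eq: "Lx b (u s) = Lx b (u' s)" if "0 \<le> b" "t \<le> s" for b s
 proof (cases "b = 0")
  case True
  note [measurable] = measurable_section[OF m(1), of s] measurable_section[OF m(2), of s]
  have "esssup lborel (\<lambda>x. ennreal (cmod (u s x))) = esssup lborel (\<lambda>x. ennreal (cmod (u' s x)))"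
   using eq[OF that(2)] by (intro esssup_AE_cong) (auto elim: eventually_mono)
  then show ?thesis using True by (simp add: Lx_def Lnorm_def)
 next
  case False
  then show ?thesis using eq[OF that(2)] that by (intro Lx_cong_AE) auto
 qed
 have "Ltx (fst ab) (snd ab) t u = Ltx (fst ab) (snd ab) t u'" if "ab \<in> {(a, b). admissible CARD('n) a b \<and> bStr \<le> b}" for ab
 proof -
  from that obtain a b where ab: "ab = (a, b)" "0 \<le> a" "0 \<le> b" by (auto simp: admissible_def)
  have ae: "AE s in ?M. Lx b (u s) = Lx b (u' s)" using Lx_eq[OF ab(3)] by (intro AE_I2) simp
  show ?thesis
  proof (cases "a = 0")
   case True
   have "esssup ?M (\<lambda>s. Lx b (u s)) = esssup ?M (\<lambda>s. Lx b (u' s))"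
    by (intro esssup_AE_cong mLx ab m ae)
   then show ?thesis using True ab by (simp add: Ltx_def Lnorm_def)
  next
   case False
   then show ?thesis using ab ae by (auto simp: Ltx_def intro: Lnorm_cong_AE)
  qed
 qed
 then show ?thesis unfolding strichartz_def by (intro SUP_cong) auto
qed

lemma measurable_lborel_pair:
 "u \<in> borel_measurable (lborel \<Otimes>\<^sub>M lborel) \<longleftrightarrow> u \<in> borel_measurable (borel \<Otimes>\<^sub>M borel)"
 using measurable_cong_sets[OF sets_pair_measure_cong[OF sets_lborel sets_lborel] refl] by blast

lemma nls_solution_measurable:
 "nls_solution g R u \<Longrightarrow> jm u" by (simp add: nls_solution_iff_mild measurable_lborel_pair)

lemma mild_zero: "mild (\<lambda>_ _. 0) (\<lambda>_. 0) t"
 by (simp add: mild_def set_integrable_def set_lebesgue_integral_def)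

context soliton_train
begin

text \<open>For \<open>d \<ge> 3\<close> this is the condition \<open>al2 < 4 / (d - 2)\<close>
  rewritten; in lower dimensions it holds for every positive \<open>al2\<close>.\<close>

lemma delta_less_1: "delta CARD('n) be < 1"
proof -
 have "(real CARD('n) - 2) * al2 < 4"
 proof (cases "3 \<le> CARD('n)")
  case True
  then have "al2 < 4 / (real CARD('n) - 2)" using F0 by (auto simp: F0_def alpha_max_ok_def)
  then show ?thesis using True by (simp add: less_divide_eq mult.commute)
 next
  case False
  then have "(real CARD('n) - 2) * al2 \<le> 0" using al by (intro mult_nonpos_nonneg) auto
  then show ?thesis by simp
 qed
 then show ?thesis using al by (simp add: delta_def be_def field_simps)
qed

lemma forcing_zero: "forcing g (R v ga) (\<lambda>_ _. 0) s x = Hf v ga s x" by (simp add: forcing_eq)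

text \<open>The bound of \<open>Hf_pointwise\<close> is available for arbitrarily large
  \<open>V\<close>, and at a fixed positive time it tends to 0.\<close>

lemma Hf_zero:
 assumes "vstar om v = \<infinity>" "0 < t" shows "Hf v ga t x = 0"
proof -
 obtain C where C: "0 < C" and H: "\<And>v ga V t x. ereal V \<le> vstar om v \<Longrightarrow> 0 \<le> V \<Longrightarrow> 0 \<le> t \<Longrightarrow>
  cmod (Hf v ga t x) \<le> C * exp (- (a/4) * V * t) * G v t x powr (1 + al1)" using Hf_pointwise by blast
 have "cmod (Hf v ga t x) \<le> C * exp (- (a/4) * t) ^ n * G v t x powr (1 + al1)" for n
  using H[of "real n" v t ga x] assms by (simp add: mult_ac flip: exp_of_nat_mult)
 moreover have "(\<lambda>n. C * exp (- (a/4) * t) ^ n * G v t x powr (1 + al1)) \<longlonglongrightarrow> C * 0 * G v t x powr (1 + al1)"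
  using assms aD by (intro tendsto_mult tendsto_const LIMSEQ_realpow_zero) auto
 ultimately have "cmod (Hf v ga t x) \<le> C * 0 * G v t x powr (1 + al1)" by (intro LIMSEQ_le_const) auto
 then show ?thesis by simp
qed

lemma loc_integrable:
 fixes h :: "'n wave"
 assumes "h \<in> bm" "Lx be h < top"
 shows "integrable lborel (\<lambda>x. h x * indicator (box P Q) x)"
 using assms be by (intro integrable_indicator_box_Lx[where p=be]) auto

lemma train_estimateD:
 assumes "train_estimate bStr (2 + al2) c vs (R v ga) u" "0 \<le> t"
 shows "Lx be (\<lambda>x. u t x - train (R v ga) t x) \<le> decay c vs t"
  and "strichartz bStr t (\<lambda>s x. u s x - train (R v ga) s x) \<le> decay c vs t"
proof -
 have "Lx be (\<lambda>x. u t x - train (R v ga) t x) + strichartz bStr t (\<lambda>s x. u s x - train (R v ga) s x) \<le> decay c vs t"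
  using assms by (simp add: train_estimate_def be_def)
 then show "Lx be (\<lambda>x. u t x - train (R v ga) t x) \<le> decay c vs t"
  "strichartz bStr t (\<lambda>s x. u s x - train (R v ga) s x) \<le> decay c vs t"
  by (auto elim: order_trans[rotated])
qed

text \<open>By the definition of \<open>decay\<close>, a solution agrees with the train at every
  positive time. At \<open>t = 0\<close> the estimate only gives the bound 1, but the mild formula
  determines the value there from the forcing at later times.\<close>

lemma infinite_speed:
 assumes vs: "vstar om v = \<infinity>"
 shows "\<exists>u. nls_solution g (R v ga) u \<and> train_estimate bStr (2 + al2) c (vstar om v) (R v ga) u"
  and "nls_solution g (R v ga) u \<Longrightarrow> train_estimate bStr (2 + al2) c (vstar om v) (R v ga) u \<Longrightarrow>
   nls_solution g (R v ga) u' \<Longrightarrow> train_estimate bStr (2 + al2) c (vstar om v) (R v ga) u' \<Longrightarrow>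
   0 \<le> t \<Longrightarrow> AE x in lborel. u t x = u' t x"
proof -
 let ?W = "train (R v ga)"
 have "nls_solution g (R v ga) ?W" unfolding nls_solution_iff_mild
 proof (intro conjI allI impI)
  show "(\<lambda>(t, x). ?W t x) \<in> borel_measurable (lborel \<Otimes>\<^sub>M lborel)" using measurable_train[of v ga] by simp
  fix t :: real assume t: "0 \<le> t"
  have "mild (forcing g (R v ga) (\<lambda>_ _. 0)) (\<lambda>_. 0) t"
  proof (rule mild_cong_AE[OF mild_zero])
   show "AE s in lborel. t \<le> s \<longrightarrow> (\<lambda>_. 0) = forcing g (R v ga) (\<lambda>_ _. 0) s"
    using AE_lborel_singleton[of 0]
    by eventually_elim (use t in \<open>auto simp: forcing_zero[abs_def] fun_eq_iff Hf_zero[OF vs] forcing_zero\<close>)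
  qed (auto intro!: measurable_forcing)
  then show "mild (forcing g (R v ga) (\<lambda>t x. ?W t x - ?W t x)) (\<lambda>x. ?W t x - ?W t x) t" by simp
 qed
 moreover have "train_estimate bStr (2 + al2) c (vstar om v) (R v ga) ?W"
 proof -
  have "Ltx a b t (\<lambda>_ (_::real^'n). 0) = 0" if "0 \<le> a" "0 \<le> b" for a b t
  proof -
   have z: "Lnorm M p (\<lambda>_. 0) = 0" if "0 \<le> p" for M :: "'z measure" and p
    using that esssup_I[of "\<lambda>_. 0::ennreal" M 0] by (cases "p = 0") (auto simp: Lnorm_def)
   show ?thesis using that by (simp add: Ltx_def Lx_def z)
  qed
  then have "strichartz bStr t (\<lambda>_ (_::real^'n). 0) = 0" for t
   unfolding strichartz_def by (auto simp: admissible_def bot_ennreal intro!: antisym SUP_least)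
  then show ?thesis using al by (simp add: train_estimate_def)
 qed
 ultimately show "\<exists>u. nls_solution g (R v ga) u \<and> train_estimate bStr (2 + al2) c (vstar om v) (R v ga) u" by blast
 have zero: "AE x in lborel. u t x = ?W t x"
  if u: "nls_solution g (R v ga) u" "train_estimate bStr (2 + al2) c (vstar om v) (R v ga) u" and t: "0 < t" for u t
 proof -
  have m: "jm u" using u(1) by (rule nls_solution_measurable)
  note [measurable] = measurable_section[OF m, of t] measurable_section[OF measurable_train, of v ga t]
  have "Lx be (\<lambda>x. u t x - ?W t x) = 0" using train_estimateD(1)[OF u(2), of t] t vs by (simp add: decay_def)
  then have "AE x in lborel. u t x - ?W t x = 0" using be by (subst (asm) Lx_zero_iff) auto
  then show ?thesis by eventually_elim simp
 qed
 assume u: "nls_solution g (R v ga) u" "train_estimate bStr (2 + al2) c (vstar om v) (R v ga) u"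
  "nls_solution g (R v ga) u'" "train_estimate bStr (2 + al2) c (vstar om v) (R v ga) u'" and t: "0 \<le> t"
 show "AE x in lborel. u t x = u' t x"
 proof (cases "t = 0")
  case False
  with t have "0 < t" by simp
  from zero[OF u(1,2) this] zero[OF u(3,4) this] show ?thesis by eventually_elim simp
 next
  case True
  have m: "jm u" "jm u'" using u(1,3) by (auto intro: nls_solution_measurable)
  note [measurable] = measurable_section[OF m(1), of t] measurable_section[OF m(2), of t] measurable_section[OF measurable_train, of v ga t]
  have fin: "Lx be (\<lambda>x. w t x - ?W t x) < top" if "train_estimate bStr (2 + al2) c (vstar om v) (R v ga) w" for w
   using train_estimateD(1)[OF that, of t] True vs by (auto simp: decay_def intro: le_less_trans)
  \<comment> \<open>Zero solves the equation with zero forcing, and the two forcings agree at almost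
    every time.\<close>
  have "AE x in lborel. 0 = (u t x - ?W t x) - (u' t x - ?W t x)"
  proof (rule mild_diff_unique[OF _ _ mild_zero])
   show "mild (forcing g (R v ga) (\<lambda>t x. u t x - ?W t x)) (\<lambda>x. u t x - ?W t x) t"
    "mild (forcing g (R v ga) (\<lambda>t x. u' t x - ?W t x)) (\<lambda>x. u' t x - ?W t x) t"
    using u t by (auto simp: nls_solution_iff_mild)
   show "AE s in lborel. t \<le> s \<longrightarrow> (AE x in lborel. 0 = forcing g (R v ga) (\<lambda>t x. u t x - ?W t x) s x - forcing g (R v ga) (\<lambda>t x. u' t x - ?W t x) s x)"
    using AE_lborel_singleton[of 0]
   proof eventually_elim
    case (elim s)
    show ?case
    proof
     assume "t \<le> s"
     with elim True have "0 < s" by simp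
     from zero[OF u(1,2) this] zero[OF u(3,4) this]
     show "AE x in lborel. 0 = forcing g (R v ga) (\<lambda>t x. u t x - ?W t x) s x - forcing g (R v ga) (\<lambda>t x. u' t x - ?W t x) s x"
      by eventually_elim (simp add: forcing_eq)
    qed
   qed
  qed (auto intro!: loc_integrable fin u)
  then show ?thesis by eventually_elim simp
 qed
qed

end

lemma NL_leD: "NL be h \<le> c \<Longrightarrow> b = 1/2 \<or> b = be \<Longrightarrow> Lx b h \<le> c"
 by (elim disjE; hypsubst; simp add: NL_le_iff)

lemma NL_le_zeroD: "NL be h \<le> 0 \<Longrightarrow> Lx (1/2) h = 0" using NL_leD[of be h 0 "1/2"] by simp

section \<open>The fixed point for finite separation\<close>

context soliton_train
begin

definition well_posed :: "real \<Rightarrow> (nat \<Rightarrow> real^'n) \<Rightarrow> (nat \<Rightarrow> real) \<Rightarrow> bool" where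
 "well_posed bStr v ga \<longleftrightarrow> (\<exists>u. nls_solution g (R v ga) u \<and> train_estimate bStr (2 + al2) (a/4) (vstar om v) (R v ga) u) \<and>
  (\<forall>u u'. nls_solution g (R v ga) u \<and> train_estimate bStr (2 + al2) (a/4) (vstar om v) (R v ga) u \<and>
   nls_solution g (R v ga) u' \<and> train_estimate bStr (2 + al2) (a/4) (vstar om v) (R v ga) u' \<longrightarrow>
   (\<forall>t\<ge>0. AE x in lborel. u t x = u' t x))"

text \<open>The weight decays at the rate \<open>mu = a/4 * V\<close> of the interaction, and the
  lower bound on the speed makes \<open>mu\<close> so large that the gain
  \<open>mu powr (- si)\<close> beats all constants.\<close>

lemma finite_speed:
 assumes bStr: "if CARD('n) = 2 then 0 < bStr \<and> bStr < be else bStr = 0"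
 shows "\<exists>vs. \<forall>v ga V. vstar om v = ereal V \<longrightarrow> vs \<le> V \<longrightarrow> well_posed bStr v ga"
proof -
 have bStr': "0 \<le> bStr" "bStr < 1/2" using bStr be by (auto split: if_splits)
 obtain CH where CH: "0 < CH" and H_le: "\<And>v ga V t. ereal V \<le> vstar om v \<Longrightarrow> 0 \<le> V \<Longrightarrow> 0 \<le> t \<Longrightarrow>
  Lx (1 - be) (Hf v ga t) \<le> ennreal (CH * exp (- (a/4) * V * t))" using Hf_norm by blast
 obtain CF where CF: "0 < CF" and F_diff: "\<And>v ga et et' s. et s \<in> bm \<Longrightarrow> et' s \<in> bm \<Longrightarrow>
  NL be (et s) \<le> 1 \<Longrightarrow> NL be (et' s) \<le> 1 \<Longrightarrow>
  Lx (1 - be) (\<lambda>x. forcing g (R v ga) et s x - forcing g (R v ga) et' s x) \<le> ennreal CF * NL be (\<lambda>x. et s x - et' s x)"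
  using forcing_diff_norm by blast
 obtain CD si where CD: "0 < CD" "0 < si" and V_le:
  "\<And>(F :: 'n evol) ka mu t. duhamel F be ka mu \<Longrightarrow>
  Lx (1/2) (duhamel.V F ka mu t) \<le> ennreal (CD * ka * mu powr (- si) * exp (- mu * t)) \<and>
  Lx be (duhamel.V F ka mu t) \<le> ennreal (CD * ka * mu powr (- si) * exp (- mu * t)) \<and>
  strichartz bStr t (duhamel.V F ka mu) \<le> ennreal (CD * ka * mu powr (- si) * exp (- mu * t))"
  using Duhamel_bounds[OF be delta_less_1 bStr] by blast
 \<comment> \<open>For an error of size \<open>E s\<close> the forcing is at most
   \<open>CH * E s\<close> from the interaction plus \<open>CF * E s\<close> from the
   nonlinearity.\<close>
 define ka where "ka = CH + CF"
 have ka: "0 < ka" "CF \<le> ka" using CH CF by (auto simp: ka_def)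
 \<comment> \<open>Chosen so that the Duhamel map has constant 1/4: two norms of size
   \<open>E t / 4\<close> fit into the required estimate, and differences shrink to at most a
   quarter because \<open>CF \<le> ka\<close>.\<close>
 define mu0 where "mu0 = max 1 ((4 * CD * ka) powr (1/si))"
 have small: "CD * ka * mu powr (- si) \<le> 1/4" if "mu0 \<le> mu" for mu
 proof -
  have "4 * CD * ka = ((4 * CD * ka) powr (1/si)) powr si" using CD ka by (simp add: powr_powr)
  also have "... \<le> mu powr si" using that CD by (intro powr_mono2) (auto simp: mu0_def)
  finally show ?thesis using that by (simp add: powr_minus divide_simps mu0_def)
 qed
 have "well_posed bStr v ga"
  if vs: "vstar om v = ereal V" and V: "4 * mu0/a \<le> V" for v ga V
 proof -
  define mu where "mu = a/4 * V"
  have mu0: "mu0 \<le> mu" using V aD by (simp add: mu_def field_simps)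
  have mu1: "1 \<le> mu" using mu0 by (simp add: mu0_def)
  have "V = 4 * mu/a" using aD by (simp add: mu_def)
  then have V0: "0 \<le> V" using mu1 aD by simp
  define E where "E t = exp (- mu * t)" for t
  have E0: "0 < E t" for t by (simp add: E_def)
  have E1: "E t \<le> 1" if "0 \<le> t" for t using that mu1 by (simp add: E_def)
  have decay: "decay (a/4) (vstar om v) t = ennreal (E t)" for t by (simp add: decay_def vs E_def mu_def)
  have HE: "Lx (1 - be) (Hf v ga t) \<le> ennreal (CH * E t)" if "0 \<le> t" for t
   using H_le[of V v t ga] vs V0 that by (simp add: E_def mu_def)
  let ?W = "train (R v ga)"
  define good where "good et \<longleftrightarrow> jm et \<and> (\<forall>t\<ge>0. NL be (et t) \<le> ennreal (E t))" for et :: "'n evol"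
  \<comment> \<open>\<open>good\<close> bounds nothing at negative times, while
    \<open>duhamel\<close> asks for a bound at all \<open>s\<close>; cutting the forcing off there
    leaves the equation for \<open>t \<ge> 0\<close> unchanged.\<close>
  define FF where "FF et s x = (if 0 \<le> s then forcing g (R v ga) et s x else 0)" for et s x
  define Ph where "Ph et t x = - (\<i> * duhamel.V (FF et) ka mu t x)" for et t x
  have sec: "et t \<in> bm" if "jm et" for et :: "'n evol" and t using that by (rule measurable_section)
  have good1: "NL be (et t) \<le> 1" if "good et" "0 \<le> t" for et t
  proof -
   have "NL be (et t) \<le> ennreal (E t)" using that by (simp add: good_def)
   also have "... \<le> 1" using E1[OF that(2)] by simp
   finally show ?thesis .
  qed
  have good_jm: "good et \<Longrightarrow> jm et" for et by (simp add: good_def)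
  have good0: "good (\<lambda>_ _. 0)" using be by (simp add: good_def NL_def)
  have jm_forcing: "jm (forcing g (R v ga) et)" if "jm et" for et :: "'n evol"
   using that by (rule measurable_forcing)
  have jm_FF: "jm (FF et)" if "jm et" for et :: "'n evol"
   using jm_forcing[OF that] unfolding FF_def split_beta' by measurable
  have D1: "duhamel (FF et) be ka mu" if et: "good et" for et unfolding duhamel_def
  proof (intro conjI allI jm_FF good_jm et ka(1) mu1 be delta_less_1)
   fix s
   show "Lx (1 - be) (FF et s) \<le> ennreal (ka * exp (- mu * s))"
   proof (cases "0 \<le> s")
    case True
    let ?f = "\<lambda>x. forcing g (R v ga) et s x - forcing g (R v ga) (\<lambda>_ _. 0) s x"
    note [measurable] = measurable_section[OF jm_forcing[OF good_jm[OF et]], of s] measurable_section[OF jm_forcing[OF good_jm[OF good0]], of s]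
     measurable_section[OF measurable_Hf, of v ga s]
    have "Lx (1 - be) (FF et s) = Lx (1 - be) (\<lambda>x. ?f x + Hf v ga s x)"
     using True by (simp add: FF_def[abs_def] forcing_zero)
    also have "... \<le> Lx (1 - be) ?f + Lx (1 - be) (Hf v ga s)" using be by (intro Lx_add_le) auto
    also have "... \<le> ennreal CF * NL be (\<lambda>x. et s x - 0) + ennreal (CH * E s)"
     by (rule add_mono[OF F_diff[of et s "\<lambda>_ _. 0"] HE[OF True]])
       (use True good1[OF et] good1[OF good0] sec[OF good_jm[OF et]] in auto)
    also have "... \<le> ennreal CF * ennreal (E s) + ennreal (CH * E s)"
     using et True by (intro add_right_mono mult_left_mono) (auto simp: good_def)
    also have "... = ennreal (ka * exp (- mu * s))"
     using CF CH E0[of s] by (simp add: ka_def E_def distrib_right add.commute flip: ennreal_mult ennreal_plus)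
    finally show ?thesis .
   next
    case False
    then show ?thesis using be by (simp add: FF_def[abs_def])
   qed
  qed
  have D2: "duhamel (\<lambda>s x. FF et s x - FF et' s x) be (CF * rh) mu"
   if et: "good et" "good et'" and rh: "0 < rh" and d: "\<And>s. 0 \<le> s \<Longrightarrow> NL be (\<lambda>x. et s x - et' s x) \<le> ennreal (rh * E s)" for et et' rh
   unfolding duhamel_def
  proof (intro conjI allI mu1 be delta_less_1)
   show "(\<lambda>(s, x). FF et s x - FF et' s x) \<in> borel_measurable (borel \<Otimes>\<^sub>M borel)"
    using jm_FF[OF good_jm[OF et(1)]] jm_FF[OF good_jm[OF et(2)]] unfolding split_beta' by measurable
   show "0 < CF * rh" using CF rh by simp
   fix s
   show "Lx (1 - be) (\<lambda>x. FF et s x - FF et' s x) \<le> ennreal (CF * rh * exp (- mu * s))"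
   proof (cases "0 \<le> s")
    case True
    have "Lx (1 - be) (\<lambda>x. FF et s x - FF et' s x) \<le> ennreal CF * NL be (\<lambda>x. et s x - et' s x)"
     using True F_diff[of et s et' v ga] by (simp add: FF_def sec good_jm good1 et)
    also have "... \<le> ennreal CF * ennreal (rh * E s)" by (intro mult_left_mono d True) auto
    also have "... = ennreal (CF * rh * exp (- mu * s))"
     using CF rh E0[of s] by (simp add: E_def mult.assoc flip: ennreal_mult)
    finally show ?thesis .
   next
    case False
    then show ?thesis using be by (simp add: FF_def)
   qed
  qed
  have V4: "NL be (duhamel.V F (ka') mu t) \<le> ennreal (ka'/ka * (E t / 4)) \<and> strichartz bStr t (duhamel.V F ka' mu) \<le> ennreal (ka'/ka * (E t / 4))"
   if D: "duhamel F be ka' mu" for F :: "'n evol" and ka' t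
  proof -
   have k': "0 < ka'" using D by (simp add: duhamel_def)
   have "CD * ka' * mu powr (- si) * exp (- mu * t) = ka'/ka * (CD * ka * mu powr (- si) * E t)"
    using ka by (simp add: E_def)
   also have "... \<le> ka'/ka * (1/4 * E t)"
    using k' ka E0[of t] by (intro mult_left_mono mult_right_mono small mu0) auto
   finally have "ennreal (CD * ka' * mu powr (- si) * exp (- mu * t)) \<le> ennreal (ka'/ka * (E t / 4))"
    by (intro ennreal_leI) simp
   then show ?thesis using V_le[OF D, of t] unfolding NL_le_iff by (meson order_trans)
  qed
  have jm_Ph: "jm (Ph et)" if "good et" for et
   using duhamel.measurable_V[OF D1[OF that]] unfolding Ph_def split_beta' by measurable
  have NLPh: "NL be (Ph et t) = NL be (duhamel.V (FF et) ka mu t)" for et t by (simp add: Ph_def[abs_def] NL_def)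
  have Ph4: "NL be (Ph et t) \<le> ennreal (E t / 4)" "strichartz bStr t (Ph et) \<le> ennreal (E t / 4)" if "good et" for et t
  proof -
   have "strichartz bStr t (Ph et) = strichartz bStr t (duhamel.V (FF et) ka mu)"
    by (simp add: strichartz_def Ltx_def Ph_def[abs_def])
   then show "NL be (Ph et t) \<le> ennreal (E t / 4)" "strichartz bStr t (Ph et) \<le> ennreal (E t / 4)"
    using V4[OF D1[OF that], of t] ka by (simp_all add: NLPh)
  qed
  have good_Ph: "good (Ph et)" if "good et" for et unfolding good_def
  proof (intro conjI allI impI jm_Ph that)
   fix t
   have "ennreal (E t / 4) \<le> ennreal (E t)" using E0[of t] by (intro ennreal_leI) simp
   then show "NL be (Ph et t) \<le> ennreal (E t)" using Ph4(1)[OF that, of t] by (rule order_trans[rotated])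
  qed
  have mild_Ph: "mild (FF et) (Ph et t) t" if "good et" for et t
   using duhamel.mild_V[OF D1[OF that], of t] by (simp add: Ph_def[abs_def])
  have locN: "integrable lborel (\<lambda>x. h x * indicator (box P Q) x)"
   if "h \<in> bm" "NL be h \<le> ennreal c" for h :: "'n wave" and c P Q
   using that by (intro loc_integrable) (auto simp: NL_le_iff intro: le_less_trans)
  have goodE: "NL be (et t) \<le> ennreal (E t)" if "good et" "0 \<le> t" for et t using that by (simp add: good_def)
  have contract: "NL be (\<lambda>x. Ph et t x - Ph et' t x) \<le> ennreal (rh/4 * E t)"
   if et: "good et" "good et'" and rh: "0 < rh" and d: "\<And>s. 0 \<le> s \<Longrightarrow> NL be (\<lambda>x. et s x - et' s x) \<le> ennreal (rh * E s)" and t: "0 \<le> t" for et et' rh t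
  proof -
   let ?D = "\<lambda>s x. FF et s x - FF et' s x"
   let ?h = "\<lambda>x. - \<i> * duhamel.V ?D (CF * rh) mu t x"
   have D: "duhamel ?D be (CF * rh) mu" by (rule D2[OF et rh]) (rule d)
   have m[measurable]: "?h \<in> bm" "Ph et t \<in> bm" "Ph et' t \<in> bm"
    using duhamel.measurable_V1[OF D] sec[OF jm_Ph[OF et(1)]] sec[OF jm_Ph[OF et(2)]] by measurable
   have Nh: "NL be ?h \<le> ennreal (CF * rh/ka * (E t / 4))" using V4[OF D, of t] by (simp add: NL_def)
   \<comment> \<open>The Duhamel term of the difference is a separate choice; the weak formulation
     identifies it with the difference of the two images.\<close>
   have "AE x in lborel. ?h x = Ph et t x - Ph et' t x"
    by (rule mild_diff_unique[OF mild_Ph[OF et(1)] mild_Ph[OF et(2)] duhamel.mild_V[OF D] _ m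
      locN[OF m(1) Nh] locN[OF m(2) goodE[OF good_Ph[OF et(1)] t]] locN[OF m(3) goodE[OF good_Ph[OF et(2)] t]]])
     (intro AE_I2 impI refl)
   then have "NL be (\<lambda>x. Ph et t x - Ph et' t x) = NL be ?h"
    using be by (intro NL_cong_AE) (auto elim: eventually_mono)
   also note Nh
   also have "ennreal (CF * rh/ka * (E t / 4)) \<le> ennreal (rh/4 * E t)"
   proof (rule ennreal_leI)
    have "CF/ka * (rh/4 * E t) \<le> 1 * (rh/4 * E t)" using ka rh E0[of t] by (intro mult_right_mono) auto
    then show "CF * rh/ka * (E t / 4) \<le> rh/4 * E t" by simp
   qed
   finally show ?thesis .
  qed
  have existence: "\<exists>u. nls_solution g (R v ga) u \<and> train_estimate bStr (2 + al2) (a/4) (vstar om v) (R v ga) u"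
  proof -
   \<comment> \<open>Picard iteration starting from the pure train, that is from error 0.\<close>
   define p where "p n = (Ph ^^ n) (\<lambda>_ _. 0)" for n
   have p0: "p 0 = (\<lambda>_ _. 0)" and pS: "p (Suc n) = Ph (p n)" for n by (simp_all add: p_def)
   have good_p: "good (p n)" for n by (induction n) (simp_all add: p0 pS good0 good_Ph)
   note pm[measurable] = sec[OF good_jm[OF good_p]]
   have step: "NL be (\<lambda>x. p (Suc n) t x - p n t x) \<le> ennreal ((1/2) ^ n * E t)" if "0 \<le> t" for n t
    using that
   proof (induction n arbitrary: t)
    case 0
    then show ?case using goodE[OF good_Ph[OF good0]] by (simp add: pS p0)
   next
    case (Suc n)
    have "NL be (\<lambda>x. p (Suc (Suc n)) t x - p (Suc n) t x) \<le> ennreal ((1/2) ^ n / 4 * E t)"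
     unfolding pS[of "Suc n"] unfolding pS[of n]
     by (rule contract[OF good_Ph[OF good_p] good_p _ _ Suc.prems]) (use Suc.IH in \<open>auto simp: pS\<close>)
    also have "... \<le> ennreal ((1/2) ^ Suc n * E t)" using E0[of t] by (intro ennreal_leI) simp
    finally show ?case .
   qed
   have tail: "NL be (\<lambda>x. p (n + k) t x - p n t x) \<le> ennreal (2 * (1/2) ^ n * E t)" if t: "0 \<le> t" for n k t
   proof -
    have "NL be (\<lambda>x. p (n + k) t x - p n t x) \<le> ennreal ((2 * (1/2) ^ n - 2 * (1/2) ^ (n + k)) * E t)"
    proof (induction k)
     case 0
     then show ?case using be by (simp add: NL_def)
    next
     case (Suc k)
     have "NL be (\<lambda>x. p (n + Suc k) t x - p n t x) \<le> NL be (\<lambda>x. p (Suc (n + k)) t x - p (n + k) t x) + NL be (\<lambda>x. p (n + k) t x - p n t x)"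
      using be NL_triangle[of "p (Suc (n + k)) t" "p (n + k) t" "p n t" be] by simp
     also have "... \<le> ennreal ((1/2) ^ (n + k) * E t) + ennreal ((2 * (1/2) ^ n - 2 * (1/2) ^ (n + k)) * E t)"
      by (intro add_mono step t Suc.IH)
     also have "... = ennreal ((2 * (1/2) ^ n - 2 * (1/2) ^ (n + Suc k)) * E t)"
     proof -
      have "(1/2::real) ^ (n + k) \<le> (1/2) ^ n" by (intro power_decreasing) auto
      then show ?thesis using E0[of t] by (subst ennreal_plus[symmetric]) (auto simp: algebra_simps)
     qed
     finally show ?case .
    qed
    also have "... \<le> ennreal (2 * (1/2) ^ n * E t)" using E0[of t] by (intro ennreal_leI mult_right_mono) auto
    finally show ?thesis .
   qed
   \<comment> \<open>Cut at negative times once more, so that the Cauchy property holds for every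
     real \<open>t\<close>, as \<open>L2_limit_measurable\<close> asks.\<close>
   define q where "q n t x = (if 0 \<le> t then p n t x else 0)" for n t x
   have jm_q: "jm (q n)" for n using good_jm[OF good_p[of n]] unfolding q_def split_beta' by measurable
   have tail_q: "NL be (\<lambda>x. q (n + k) t x - q n t x) \<le> ennreal (2 * (1/2) ^ n * E t)" for n k t
    using tail[of t n k] be by (cases "0 \<le> t") (simp_all add: q_def NL_def)
   have rate: "(\<lambda>n. ennreal (c * (1/2) ^ n)) \<longlonglongrightarrow> 0" for c
   proof -
    have "(\<lambda>n. ennreal (c * (1/2) ^ n)) \<longlonglongrightarrow> ennreal (c * 0)"
     by (intro tendsto_ennrealI tendsto_mult tendsto_const LIMSEQ_realpow_zero) auto
    then show ?thesis by simp
   qed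
   obtain et where etm: "jm et" and lim: "\<And>t. (\<lambda>n. Lx (1/2) (\<lambda>x. q n t x - et t x)) \<longlonglongrightarrow> 0"
   proof -
    have "\<exists>N. \<forall>m\<ge>N. \<forall>n\<ge>N. Lx (1/2) (\<lambda>x. q m t x - q n t x) \<le> ennreal ep" if ep: "0 < ep" for t ep
    proof -
     have "\<forall>\<^sub>F n in sequentially. ennreal (2 * E t * (1/2) ^ n) < ennreal ep"
      using rate[of "2 * E t"] ep by (intro order_tendstoD(2)) auto
     then obtain N where N: "\<And>n. N \<le> n \<Longrightarrow> ennreal (2 * E t * (1/2) ^ n) < ennreal ep"
      by (auto simp: eventually_sequentially)
     have 1: "Lx (1/2) (\<lambda>x. q m t x - q n t x) \<le> ennreal ep" if "N \<le> n" "n \<le> m" for m n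
     proof -
      have "Lx (1/2) (\<lambda>x. q m t x - q n t x) \<le> ennreal (2 * (1/2) ^ n * E t)"
       using tail_q[of n "m - n" t] that by (simp add: NL_le_iff)
      also have "... = ennreal (2 * E t * (1/2) ^ n)" by (simp add: mult_ac)
      also have "... \<le> ennreal ep" using N[OF that(1)] by simp
      finally show ?thesis .
     qed
     have "Lx (1/2) (\<lambda>x. q m t x - q n t x) \<le> ennreal ep" if "N \<le> n" "N \<le> m" for m n
      using 1[of n m] 1[of m n] that Lx_commute[of "1/2" "q m t" "q n t"] by (cases "n \<le> m") auto
     then show ?thesis by blast
    qed
    from L2_limit_measurable[of q, OF jm_q this] show ?thesis using that by blast
   qed
   note [measurable] = sec[OF etm] sec[OF jm_q]
   have et_lim: "NL be (\<lambda>x. p n t x - et t x) \<le> ennreal (2 * (1/2) ^ n * E t)" if t: "0 \<le> t" for n t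
   proof -
    \<comment> \<open>Written so that, with \<open>n\<close> fixed, \<open>q n - q (n + k)\<close>
      converges in L2 to \<open>q n - et\<close>; lower semicontinuity then carries the tail bound
      to the limit in both norms.\<close>
    have l: "(\<lambda>k. Lx (1/2) (\<lambda>x. (q n t x - q (n + k) t x) - (q n t x - et t x))) \<longlonglongrightarrow> 0"
    proof -
     have "(\<lambda>k. Lx (1/2) (\<lambda>x. q (k + n) t x - et t x)) \<longlonglongrightarrow> 0" by (rule LIMSEQ_ignore_initial_segment[OF lim])
     then have "(\<lambda>k. Lx (1/2) (\<lambda>x. et t x - q (k + n) t x)) \<longlonglongrightarrow> 0"
      by (simp only: Lx_commute[of "1/2" "et t"])
     then show ?thesis by (simp add: add.commute)
    qed
    have "Lx b (\<lambda>x. q n t x - et t x) \<le> ennreal (2 * (1/2) ^ n * E t)" if b: "b = 1/2 \<or> b = be" for b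
    proof -
     have "Lx b (\<lambda>x. q n t x - et t x) \<le> liminf (\<lambda>k. Lx b (\<lambda>x. q n t x - q (n + k) t x))"
      by (rule Lx_lower_semicontinuous[OF _ _ l]) (use b be in auto)
     also have "... \<le> liminf (\<lambda>k. ennreal (2 * (1/2) ^ n * E t))"
     proof (intro Liminf_mono always_eventually allI)
      fix k
      show "Lx b (\<lambda>x. q n t x - q (n + k) t x) \<le> ennreal (2 * (1/2) ^ n * E t)"
       using NL_leD[OF tail_q[of n k t] b] Lx_commute[of b "q n t" "q (n + k) t"] by simp
     qed
     finally show ?thesis by (simp add: Liminf_const)
    qed
    then show ?thesis using t by (simp add: NL_le_iff q_def)
   qed
   have good_et: "good et" unfolding good_def
   proof (intro conjI allI impI etm)
    fix t :: real assume t: "0 \<le> t"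
    have "Lx b (et t) \<le> ennreal (E t)" if b: "b = 1/2 \<or> b = be" for b
    proof -
     have "Lx b (et t) \<le> liminf (\<lambda>n. Lx b (q n t))"
      by (rule Lx_lower_semicontinuous[OF _ _ lim]) (use b be in auto)
     also have "... \<le> liminf (\<lambda>n. ennreal (E t))"
     proof (intro Liminf_mono always_eventually allI)
      fix n
      have "q n t = p n t" using t by (simp add: q_def fun_eq_iff)
      then show "Lx b (q n t) \<le> ennreal (E t)" using NL_leD[OF goodE[OF good_p t, of n] b] by simp
     qed
     finally show ?thesis by (simp add: Liminf_const)
    qed
    then show "NL be (et t) \<le> ennreal (E t)" by (simp add: NL_le_iff)
   qed
   \<comment> \<open>\<open>Ph et\<close> is compared with \<open>Ph (p n)\<close>, which is
     \<open>p (Suc n)\<close>: the first error is small by contraction, the second by convergence of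
     the iterates.\<close>
   have fixp: "AE x in lborel. Ph et t x = et t x" if t: "0 \<le> t" for t
   proof -
    note [measurable] = sec[OF jm_Ph[OF good_et]]
    have "NL be (\<lambda>x. Ph et t x - et t x) \<le> ennreal (4 * E t * (1/2) ^ n)" for n
    proof -
     have "NL be (\<lambda>x. Ph et t x - et t x) \<le> NL be (\<lambda>x. Ph et t x - Ph (p n) t x) + NL be (\<lambda>x. p (Suc n) t x - et t x)"
      using be pm[of "Suc n" t] NL_triangle[of "Ph et t" "Ph (p n) t" "et t" be] by (simp add: pS)
     also have "NL be (\<lambda>x. Ph et t x - Ph (p n) t x) \<le> ennreal (2 * (1/2) ^ n / 4 * E t)"
     proof (rule contract[OF good_et good_p _ _ t])
      fix s :: real assume "0 \<le> s"
      then show "NL be (\<lambda>x. et s x - p n s x) \<le> ennreal (2 * (1/2) ^ n * E s)"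
       using et_lim[of s n] Lx_commute[of "1/2" "et s" "p n s"] Lx_commute[of be "et s" "p n s"] by (simp add: NL_def)
     qed simp
     also have "NL be (\<lambda>x. p (Suc n) t x - et t x) \<le> ennreal (2 * (1/2) ^ Suc n * E t)" by (rule et_lim[OF t])
     also have "ennreal (2 * (1/2) ^ n / 4 * E t) + ennreal (2 * (1/2) ^ Suc n * E t) \<le> ennreal (4 * E t * (1/2) ^ n)"
      using E0[of t] by (subst ennreal_plus[symmetric]) (auto intro!: ennreal_leI)
     finally show ?thesis by (simp add: add_mono)
    qed
    then have "NL be (\<lambda>x. Ph et t x - et t x) \<le> 0"
     by (intro LIMSEQ_le_const[OF rate[of "4 * E t"]]) auto
    then have "Lx (1/2) (\<lambda>x. Ph et t x - et t x) = 0" by (rule NL_le_zeroD)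
    then have "AE x in lborel. Ph et t x - et t x = 0" by (subst (asm) Lx_zero_iff) auto
    then show ?thesis by eventually_elim simp
   qed
   define u where "u t x = ?W t x + et t x" for t x
   have uet: "(\<lambda>t x. u t x - ?W t x) = et" by (simp add: u_def fun_eq_iff)
   have "nls_solution g (R v ga) u" unfolding nls_solution_iff_mild measurable_lborel_pair
   proof (intro conjI allI impI)
    show "jm u" using etm measurable_train[of v ga] unfolding u_def split_beta' by measurable
    fix t :: real assume t: "0 \<le> t"
    have "mild (forcing g (R v ga) et) (et t) t"
     by (rule mild_cong_AE[OF mild_Ph[OF good_et] _ jm_forcing[OF etm] fixp[OF t]])
       (use t sec[OF jm_Ph[OF good_et]] sec[OF etm] in \<open>auto simp: FF_def fun_eq_iff\<close>)
    then show "mild (forcing g (R v ga) (\<lambda>t x. u t x - ?W t x)) (\<lambda>x. u t x - ?W t x) t"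
     unfolding uet by (simp add: u_def)
   qed
   moreover have "train_estimate bStr (2 + al2) (a/4) (vstar om v) (R v ga) u" unfolding train_estimate_def decay
   proof (intro allI impI)
    fix t :: real assume t: "0 \<le> t"
    have "Lx be (et t) = Lx be (Ph et t)" using fixp[OF t] be by (intro Lx_cong_AE) (auto elim: eventually_mono)
    also have "... \<le> ennreal (E t / 4)" using Ph4(1)[OF good_et, of t] by (simp add: NL_le_iff)
    finally have 1: "Lx be (et t) \<le> ennreal (E t / 4)" .
    have "strichartz bStr t et = strichartz bStr t (Ph et)"
    proof (rule strichartz_cong[OF etm jm_Ph[OF good_et]])
     fix s assume "t \<le> s"
     with t have "0 \<le> s" by simp
     from fixp[OF this] show "AE x in lborel. et s x = Ph et s x" by eventually_elim simp
    qed
    then have 2: "strichartz bStr t et \<le> ennreal (E t / 4)" using Ph4(2)[OF good_et, of t] by simp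
    have "Lx be (et t) + strichartz bStr t et \<le> ennreal (E t / 4) + ennreal (E t / 4)" by (intro add_mono 1 2)
    also have "... \<le> ennreal (E t)" using E0[of t] by (subst ennreal_plus[symmetric]) (auto intro!: ennreal_leI)
    finally show "Lx (1 / (2 + al2)) (\<lambda>x. u t x - ?W t x) + strichartz bStr t (\<lambda>s x. u s x - ?W s x) \<le> ennreal (E t)"
     unfolding uet by (simp add: u_def be_def)
   qed
   ultimately show ?thesis by blast
  qed
  \<comment> \<open>Every solution with the required estimate is a good fixed point, so that
    \<open>contract\<close> applies to it. The difficulty is the L2 part of \<open>NL\<close>, known
    at first only at almost every time.\<close>
  have sol: "good (\<lambda>t x. u t x - ?W t x) \<and> (\<forall>t\<ge>0. AE x in lborel. u t x - ?W t x = Ph (\<lambda>t x. u t x - ?W t x) t x)"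
   if u: "nls_solution g (R v ga) u" "train_estimate bStr (2 + al2) (a/4) (vstar om v) (R v ga) u" for u
  proof -
   define et where "et t x = u t x - ?W t x" for t x
   have etm: "jm et"
    using nls_solution_measurable[OF u(1)] measurable_train[of v ga] unfolding et_def split_beta' by measurable
   note [measurable] = sec[OF etm]
   have b: "Lx be (et t) \<le> ennreal (E t)" "strichartz bStr t et \<le> ennreal (E t)" if "0 \<le> t" for t
    using train_estimateD[OF u(2) that] by (simp_all add: decay et_def[abs_def])
   \<comment> \<open>The Strichartz norm from a starting time on bounds the L2 norm at almost every
     later time. Countably many rational starting times leave a single null set, and letting them
     approach \<open>s\<close> from below gives the bound \<open>E s\<close>.\<close>
   have "AE s in lborel. \<forall>m n :: nat. real m / real (Suc n) \<le> s \<longrightarrow> Lx (1/2) (et s) \<le> ennreal (E (real m / real (Suc n)))"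
    unfolding AE_all_countable
   proof (intro allI)
    fix m n :: nat
    let ?r = "real m / real (Suc n)"
    have "AE s in lborel. ?r \<le> s \<longrightarrow> Lx (1/2) (et s) \<le> strichartz bStr ?r et"
     by (rule strichartz_ge_L2) (use bStr' in simp)
    then show "AE s in lborel. ?r \<le> s \<longrightarrow> Lx (1/2) (et s) \<le> ennreal (E ?r)"
    proof eventually_elim
     case (elim s)
     have "strichartz bStr ?r et \<le> ennreal (E ?r)" by (rule b(2)) simp
     with elim show ?case by (blast intro: order_trans)
    qed
   qed
   then have ae: "AE s in lborel. 0 \<le> s \<longrightarrow> NL be (et s) \<le> ennreal (E s)"
   proof eventually_elim
    case (elim s)
    show ?case
    proof
     assume s: "0 \<le> s"
     define X where "X n = real (nat \<lfloor>s * real (Suc n)\<rfloor>) / real (Suc n)" for n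
     have X: "X n \<le> s" "s - inverse (real (Suc n)) \<le> X n" for n
     proof -
      have "real (nat \<lfloor>s * real (Suc n)\<rfloor>) = of_int \<lfloor>s * real (Suc n)\<rfloor>" using s by simp
      then have "real (nat \<lfloor>s * real (Suc n)\<rfloor>) \<le> s * real (Suc n)" "s * real (Suc n) - 1 \<le> real (nat \<lfloor>s * real (Suc n)\<rfloor>)"
       by linarith+
      moreover have "s - inverse (real (Suc n)) = (s * real (Suc n) - 1) / real (Suc n)"
       by (simp add: diff_divide_distrib inverse_eq_divide)
      ultimately show "X n \<le> s" "s - inverse (real (Suc n)) \<le> X n"
       unfolding X_def by (simp add: divide_le_eq, simp only: divide_right_mono of_nat_0_le_iff)
     qed
     have "(\<lambda>n. s - inverse (real (Suc n))) \<longlonglongrightarrow> s - 0"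
      by (intro tendsto_diff tendsto_const LIMSEQ_inverse_real_of_nat)
     then have "X \<longlonglongrightarrow> s"
      by (intro tendsto_sandwich[of "\<lambda>n. s - inverse (real (Suc n))" X sequentially "\<lambda>_. s" s] always_eventually allI X tendsto_const) simp
     then have "(\<lambda>n. ennreal (E (X n))) \<longlonglongrightarrow> ennreal (E s)"
      unfolding E_def by (intro tendsto_ennrealI tendsto_exp tendsto_mult tendsto_const)
     moreover have "Lx (1/2) (et s) \<le> ennreal (E (X n))" for n
      using elim[rule_format, of "nat \<lfloor>s * real (Suc n)\<rfloor>" n] X(1)[of n] unfolding X_def .
     ultimately have "Lx (1/2) (et s) \<le> ennreal (E s)" by (intro LIMSEQ_le_const) auto
     then show "NL be (et s) \<le> ennreal (E s)" using b(1)[OF s] by (simp add: NL_le_iff)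
    qed
   qed
   \<comment> \<open>At the exceptional times the error is replaced by 0. This makes it good and
     alters the forcing on a null set of times only, so \<open>et\<close> is still the Duhamel term
     of \<open>et'\<close>.\<close>
   define et' where "et' s x = (if NL be (et s) \<le> ennreal (E s) then et s x else 0)" for s x
   have et'm: "jm et'"
   proof -
    have [measurable]: "(\<lambda>s. NL be (et s)) \<in> bm" using measurable_NL[OF etm] be by simp
    have [measurable]: "E \<in> bm" unfolding E_def[abs_def] by measurable
    show ?thesis using etm unfolding et'_def split_beta' by measurable
   qed
   have et'_eq: "et' s = et s" if "NL be (et s) \<le> ennreal (E s)" for s
    using that by (intro ext) (simp only: et'_def if_True)
   have "NL be (et' s) \<le> ennreal (E s)" for s
   proof (cases "NL be (et s) \<le> ennreal (E s)")
    case True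
    then show ?thesis by (simp only: et'_eq)
   next
    case False
    then have "et' s = (\<lambda>_. 0)" by (intro ext) (simp only: et'_def if_False)
    then show ?thesis using be by (simp add: NL_def)
   qed
   then have good': "good et'" using et'm by (simp add: good_def)
   have fix': "AE x in lborel. et t x = Ph et' t x" if t: "0 \<le> t" for t
   proof -
    have 1: "mild (FF et') (et t) t"
    proof (rule mild_cong_AE[OF _ _ jm_FF[OF et'm]])
     show "mild (forcing g (R v ga) et) (et t) t"
      using u(1) t by (simp add: nls_solution_iff_mild et_def[abs_def])
     show "AE s in lborel. t \<le> s \<longrightarrow> forcing g (R v ga) et s = FF et' s"
      using ae by eventually_elim (use t in \<open>auto simp: FF_def et'_eq fun_eq_iff forcing_eq\<close>)
    qed auto
    have "AE x in lborel. 0 = et t x - Ph et' t x"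
    proof (rule mild_diff_unique[OF 1 mild_Ph[OF good'] mild_zero])
     show "integrable lborel (\<lambda>x. et t x * indicator (box P Q) x)" for P Q
      using b(1)[OF t] by (intro loc_integrable) (auto intro: le_less_trans)
     show "integrable lborel (\<lambda>x. Ph et' t x * indicator (box P Q) x)" for P Q
      by (rule locN[OF sec[OF jm_Ph[OF good']] Ph4(1)[OF good']])
    qed (use sec[OF jm_Ph[OF good']] in auto)
    then show ?thesis by eventually_elim simp
   qed
   \<comment> \<open>The identity with \<open>Ph et'\<close> holds at every
     \<open>t \<ge> 0\<close>, so the bound on \<open>Ph et'\<close> passes to \<open>et\<close> at
     every such time; hence no nonnegative time was exceptional.\<close>
   have N: "NL be (et t) \<le> ennreal (E t)" if t: "0 \<le> t" for t
   proof -
    have "NL be (et t) = NL be (Ph et' t)" using be fix'[OF t] by (intro NL_cong_AE) auto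
    then show ?thesis using goodE[OF good_Ph[OF good'] t] by simp
   qed
   have "FF et' = FF et" using N by (auto simp: FF_def et'_eq fun_eq_iff forcing_eq)
   then have Pheq: "Ph et' = Ph et" unfolding Ph_def by (rule arg_cong)
   have "et = (\<lambda>t x. u t x - ?W t x)" by (simp add: et_def fun_eq_iff)
   moreover have "good et" using N etm by (simp add: good_def)
   ultimately show ?thesis using fix'[unfolded Pheq] by simp
  qed
  have uniqueness: "AE x in lborel. u t x = u' t x"
   if u: "nls_solution g (R v ga) u" "train_estimate bStr (2 + al2) (a/4) (vstar om v) (R v ga) u"
    "nls_solution g (R v ga) u'" "train_estimate bStr (2 + al2) (a/4) (vstar om v) (R v ga) u'" and t: "0 \<le> t" for u u' t
  proof -
   define et where "et = (\<lambda>t x. u t x - ?W t x)"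
   define et' where "et' = (\<lambda>t x. u' t x - ?W t x)"
   have g: "good et" "good et'" and fx: "\<And>t. 0 \<le> t \<Longrightarrow> AE x in lborel. et t x = Ph et t x" "\<And>t. 0 \<le> t \<Longrightarrow> AE x in lborel. et' t x = Ph et' t x"
    using sol[OF u(1,2)] sol[OF u(3,4)] unfolding et_def et'_def by auto
   note [measurable] = sec[OF good_jm[OF g(1)]] sec[OF good_jm[OF g(2)]]
   \<comment> \<open>The difference of two fixed points is its own image under the contraction, so
     each repetition gains a further factor 1/4.\<close>
   have le: "NL be (\<lambda>x. et t x - et' t x) \<le> ennreal (2 * (1/4) ^ n * E t)" if "0 \<le> t" for t n
    using that
   proof (induction n arbitrary: t)
    case 0
    have "NL be (\<lambda>x. et t x - et' t x) \<le> NL be (\<lambda>x. et t x - 0) + NL be (\<lambda>x. 0 - et' t x)"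
     using be by (intro NL_triangle) auto
    also have "... = NL be (et t) + NL be (et' t)" by (simp add: NL_def)
    also have "... \<le> ennreal (E t) + ennreal (E t)" by (intro add_mono goodE g 0)
    also have "... = ennreal (2 * E t)" using E0[of t] by (simp flip: ennreal_plus)
    finally show ?case by simp
   next
    case (Suc n)
    have "NL be (\<lambda>x. et t x - et' t x) = NL be (\<lambda>x. Ph et t x - Ph et' t x)"
    proof (rule NL_cong_AE)
     show "AE x in lborel. et t x - et' t x = Ph et t x - Ph et' t x"
      using fx(1)[OF Suc.prems] fx(2)[OF Suc.prems] by eventually_elim simp
    qed (use be in simp)
    also have "... \<le> ennreal (2 * (1/4) ^ n / 4 * E t)" by (rule contract[OF g _ Suc.IH Suc.prems]) simp_all
    finally show ?case by simp
   qed
   have "(\<lambda>n. ennreal (2 * (1/4) ^ n * E t)) \<longlonglongrightarrow> ennreal (2 * 0 * E t)"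
    by (intro tendsto_ennrealI tendsto_mult tendsto_const LIMSEQ_realpow_zero) auto
   then have "NL be (\<lambda>x. et t x - et' t x) \<le> ennreal (2 * 0 * E t)"
    by (rule LIMSEQ_le_const) (use le t in auto)
   then have "Lx (1/2) (\<lambda>x. et t x - et' t x) = 0" by (intro NL_le_zeroD) simp
   then have "AE x in lborel. et t x - et' t x = 0" by (subst (asm) Lx_zero_iff) auto
   then show ?thesis by eventually_elim (simp add: et_def et'_def)
  qed
  show ?thesis unfolding well_posed_def using existence uniqueness by blast
 qed
 then show ?thesis by blast
qed

end

theorem theorem1p1:
  fixes g :: "real \<Rightarrow> real" and \<alpha>1 \<alpha>2 C0 r0 bStr :: real
    and \<phi> :: "nat \<Rightarrow> real^'n::finite \<Rightarrow> complex" and \<omega> :: "nat \<Rightarrow> real"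
  assumes F0: "F0 CARD('n) g \<alpha>1 \<alpha>2 C0"
    and alpha: "\<alpha>2 / (2 + \<alpha>2) \<le> \<alpha>1"
    and r0: "max 1 (real CARD('n) * \<alpha>1 / 2) < r0" "r0 < 2 + \<alpha>1"
      "1/2 \<le> \<alpha>1 / r0 + 1 / (2 + \<alpha>2)" "1 < (\<alpha>1 + 1) / r0 + 1 / (2 + \<alpha>2)"
    and Str: "if CARD('n) = 2 then 0 < bStr \<and> bStr < 1 / (\<alpha>2 + 2) else bStr = 0"
    and bs: "\<forall>j. bound_state g (\<phi> j) (\<omega> j) \<or> (\<phi> j = (\<lambda>_. 0) \<and> \<omega> j = 0)"
    and T1: "T1 \<alpha>1 r0 \<phi> \<omega>"
  shows "\<exists>c1 > 0. \<exists>v\<^sub>s.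
     \<forall>(v :: nat \<Rightarrow> real^'n) (\<gamma> :: nat \<Rightarrow> real).
       vstar \<omega> v \<ge> ereal v\<^sub>s \<longrightarrow>
       (let R = (\<lambda>j. soliton (\<phi> j) (\<omega> j) 0 (v j) (\<gamma> j)) in
        (\<exists>u. nls_solution g R u \<and> train_estimate bStr (2 + \<alpha>2) c1 (vstar \<omega> v) R u) \<and>
        (\<forall>u u'. nls_solution g R u \<and> train_estimate bStr (2 + \<alpha>2) c1 (vstar \<omega> v) R u \<and>
                nls_solution g R u' \<and> train_estimate bStr (2 + \<alpha>2) c1 (vstar \<omega> v) R u' \<longrightarrow>
                (\<forall>t\<ge>0. AE x in lborel. u t x = u' t x)))"
proof -
  from T1 obtain a Da where aD: "0 < a" "0 < Da" and diff: "\<And>j x. \<phi> j differentiable (at x)"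
    and dec: "\<And>j x. cmod (\<phi> j x) + \<omega> j powr (-1/2) * grad_norm (\<phi> j) x \<le> Da * \<omega> j powr (1/\<alpha>1) * exp (- a * sqrt (\<omega> j) * norm x)"
    and summ: "summable (\<lambda>j. \<omega> j powr (1/\<alpha>1 - real CARD('n) / (2 * r0)))"
    unfolding T1_def by blast
  interpret soliton_train g \<alpha>1 \<alpha>2 C0 r0 a Da \<phi> \<omega>
  proof unfold_locales
    show "0 \<le> \<omega> j" for j using bs unfolding bound_state_def by (metis less_imp_le order_refl)
    show "cmod (\<phi> j x) \<le> Da * \<omega> j powr (1/\<alpha>1) * exp (- a * sqrt (\<omega> j) * norm x)" for j x
    proof -
      have "0 \<le> \<omega> j powr (-1/2) * grad_norm (\<phi> j) x" by (simp add: grad_norm_def sum_nonneg)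
      then show ?thesis using dec[of j x] by linarith
    qed
  qed (use F0 alpha r0 aD diff summ in auto)
  have "if CARD('n) = 2 then 0 < bStr \<and> bStr < be else bStr = 0" using Str by (simp add: be_def add.commute)
  from finite_speed[OF this] obtain vs where fin: "\<And>v \<gamma> V. vstar \<omega> v = ereal V \<Longrightarrow> vs \<le> V \<Longrightarrow> well_posed bStr v \<gamma>" by blast
  have wp: "well_posed bStr v \<gamma>" if vs: "ereal vs \<le> vstar \<omega> v" for v \<gamma>
  proof (cases "vstar \<omega> v")
    case (real V)
    with vs show ?thesis by (intro fin) auto
  next
    \<comment> \<open>The infimum over no pairs: there is at most one genuine soliton.\<close>
    case PInf
    show ?thesis unfolding well_posed_def using infinite_speed[OF PInf] by blast
  qed (use vs in simp)
  have R_eq: "(\<lambda>j. soliton (\<phi> j) (\<omega> j) 0 (v j) (\<gamma> j)) = R v \<gamma>" for v \<gamma> by (simp add: R_def fun_eq_iff)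
  show ?thesis
  proof (rule exI[of _ "a / 4"], rule conjI, use aD in simp, rule exI[of _ vs], intro allI impI)
    fix v :: "nat \<Rightarrow> real^'n" and \<gamma> :: "nat \<Rightarrow> real"
    assume "ereal vs \<le> vstar \<omega> v"
    from wp[OF this, of \<gamma>] show "let R = (\<lambda>j. soliton (\<phi> j) (\<omega> j) 0 (v j) (\<gamma> j)) in
        (\<exists>u. nls_solution g R u \<and> train_estimate bStr (2 + \<alpha>2) (a / 4) (vstar \<omega> v) R u) \<and>
        (\<forall>u u'. nls_solution g R u \<and> train_estimate bStr (2 + \<alpha>2) (a / 4) (vstar \<omega> v) R u \<and>
                nls_solution g R u' \<and> train_estimate bStr (2 + \<alpha>2) (a / 4) (vstar \<omega> v) R u' \<longrightarrow>
                (\<forall>t\<ge>0. AE x in lborel. u t x = u' t x))" unfolding R_eq Let_def well_posed_def .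
  qed
qed

end
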